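(* Let $U,V$ be real Banach spaces and let $\mathfrak{F}\in\mathcal{C}^{\omega}(\mathbb{R}\times U,V)$ be an analytic map such that: (F1) $\mathfrak{F}(\lambda,0)=0$ for all $\lambda\in\mathbb{R}$; (F2) $D_u\mathfrak{F}(\lambda,u)\in\Phi_0(U,V)$ for all $(\lambda,u)\in\mathbb{R}\times U$; (F3) with $\mathfrak{L}(\lambda):=D_u\mathfrak{F}(\lambda,0)$, $0\in\Sigma(\mathfrak{L})$ is an isolated eigenvalue with $N[\mathfrak{L}(0)]=\mathrm{span}[\varphi_0]$ for some $\varphi_0\in U\setminus\{0\}$; (F4) $\mathfrak{F}$ is proper on closed and bounded subsets of $\mathbb{R}\times U$. Suppose that there exists an analytic injective curve $\gamma:(0,1)\to\mathbb{R}\times U$ such that $\gamma((0,1))\subset\mathfrak{F}^{-1}(0)\setminus\mathcal{T}$, $\lim_{t\downarrow0}\gamma(t)=(0,0)$, and $\gamma((0,1))\subset\mathcal{R}(\mathfrak{F})$. Then there exists a locally injective continuous path $\Gamma:[0,\infty)\to\mathbb{R}\times U$ with $\Gamma([0,\infty))\subset\mathfrak{F}^{-1}(0)$, for which there exists $0<\delta<1$ with $\Gamma(t)=\gamma(t)$ for all $t\in(0,\delta)$. Moreover, $\Gamma$ satisfies one of the following non-excluding alternatives: (a) $\lim_{t\uparrow\infty}\|\Gamma(t)\|_{\mathbb{R}\times U}=+\infty$. (b) $\Gamma$ is a closed loop, i.e. there exists $T>0$ such that $\Gamma(T)=(0,0)$. In particular, when the associated Weierstrass polynomial $p(\lambda,z)$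 is irreducible, every analytic curve of $\mathfrak{F}^{-1}(0)$ emanating from $(0,0)$ can be extended to a locally injective continuous path $\Gamma:[0,+\infty)\to\mathbb{R}\times U$ in $\mathfrak{F}^{-1}(0)$ satisfying one of these alternatives.
   Context: $\Phi_0(U,V)$: bounded linear Fredholm operators of index zero; $\Sigma(\mathfrak{L})=\{\lambda:\mathfrak{L}(\lambda)\notin GL(U,V)\}$. $\mathcal{T}=\{(\lambda,0):\lambda\in\mathbb{R}\}$. $\mathcal{R}(\mathfrak{F})$ is the set of regular points: $(\lambda,u)\in\mathfrak{F}^{-1}(0)$ with $D_u\mathfrak{F}(\lambda,u)\in GL(U,V)$. Weierstrass polynomial: choose $\varphi_0^*\in U^*$ with $\langle\varphi_0,\varphi_0^*\rangle=1$, $P(u)=\langle u,\varphi_0^*\rangle\varphi_0$, a continuous projection $Q$ of $V$ onto $R[\mathfrak{L}(0)]$, $Y=N[P]$, and a linear isomorphism $S:N[Q]\to\mathbb{R}$. By the implicit function theorem there is an analytic $\mathcal{Y}$, defined near $(0,0)$ in $\mathbb{R}\times N[\mathfrak{L}(0)]$ with values in $Y$, $\mathcal{Y}(0,0)=0$, solving $Q\mathfrak{F}(\lambda,x+\mathcal{Y}(\lambda,x))=0$. Put $\mathfrak{G}(\lambda,z):=S(I_V-Q)\mathfrak{F}(\lambda,z\varphi_0+\mathcal{Y}(\lambda,z\varphi_0))=zg(\lambda,z)$, with $g$ analytic and $\chi:=\mathrm{ord}_{\lambda=0}g(\lambda,0)\in[1,\infty)$. By the Weierstrass preparation theorem, on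 a neighbourhood $\mathscr{U}=\mathscr{U}_\lambda\times\mathscr{U}_z$ of $(0,0)$ in $\mathbb{R}^2$, $g=c\cdot p$ with $c$ analytic, $c(0,0)\neq0$, and $p(\lambda,z)=\lambda^\chi+c_{\chi-1}(z)\lambda^{\chi-1}+\cdots+c_0(z)$, $c_j$ analytic on $\mathscr{U}_z$, $c_j(0)=0$; $p$ is the Weierstrass polynomial. Irreducible means irreducible in $\mathcal{M}(\mathscr{U}_z)[\lambda]$, the polynomials in $\lambda$ with meromorphic coefficients in $z$. *)

theory Defs
  imports
    "HOL-Analysis.Analysis"
    "HOL-Algebra.UnivPoly"
    "HOL-Algebra.Divisibility"
begin

section \<open>Real analytic maps between normed spaces\<close>

text \<open>An \<open>n\<close>-linear map is a function on families \<open>v :: nat \<Rightarrow> 'a\<close> that only reads the entries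
  \<open>v 0, \<dots>, v (n - 1)\<close>; \<open>C\<close> is an upper bound of its norm.\<close>

definition sym_multilinear ::
    "nat \<Rightarrow> real \<Rightarrow> ((nat \<Rightarrow> 'a::real_normed_vector) \<Rightarrow> 'b::real_normed_vector) \<Rightarrow> bool" where
  "sym_multilinear n C m \<longleftrightarrow>
     (\<forall>v w. (\<forall>i<n. v i = w i) \<longrightarrow> m v = m w) \<and>
     (\<forall>v. \<forall>i<n. linear (\<lambda>x. m (v(i := x)))) \<and>
     (\<forall>v \<pi>. \<pi> permutes {..<n} \<longrightarrow> m (v \<circ> \<pi>) = m v) \<and>
     (\<forall>v. norm (m v) \<le> C * (\<Prod>i<n. norm (v i)))"

definition analytic_map_at ::
    "('a::real_normed_vector \<Rightarrow> 'b::real_normed_vector) \<Rightarrow> 'a \<Rightarrow> bool" where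
  "analytic_map_at f x \<longleftrightarrow>
     (\<exists>m C r. r > 0 \<and> (\<forall>n. sym_multilinear n (C n) (m n)) \<and>
        (\<exists>K. \<forall>n. C n * r ^ n \<le> K) \<and>
        (\<forall>h. norm h < r \<longrightarrow> (\<lambda>n. m n (\<lambda>_. h)) sums f (x + h)))"

definition analytic_map_on ::
    "('a::real_normed_vector \<Rightarrow> 'b::real_normed_vector) \<Rightarrow> 'a set \<Rightarrow> bool" where
  "analytic_map_on f A \<longleftrightarrow> (\<forall>x\<in>A. analytic_map_at f x)"


section \<open>Fredholm operators of index zero, spectrum\<close>

definition null_space :: "('a::real_vector \<Rightarrow> 'b::real_vector) \<Rightarrow> 'a set" where
  "null_space T = {x. T x = 0}"

text \<open>The dimension of the quotient by \<open>A\<close>: the least number of vectors that span the space modulo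
  \<open>A\<close>. Only meaningful if \<open>A\<close> has finite codimension.\<close>

definition codim :: "'a::real_vector set \<Rightarrow> nat" where
  "codim A = (LEAST n. \<exists>B. finite B \<and> card B = n \<and> span (A \<union> B) = UNIV)"

definition fredholm :: "('a::real_normed_vector \<Rightarrow> 'b::real_normed_vector) \<Rightarrow> bool" where
  "fredholm T \<longleftrightarrow> bounded_linear T \<and> (\<exists>B. finite B \<and> null_space T = span B) \<and>
     closed (range T) \<and> (\<exists>B. finite B \<and> span (range T \<union> B) = UNIV)"

definition fredholm_index :: "('a::real_normed_vector \<Rightarrow> 'b::real_normed_vector) \<Rightarrow> int" where
  "fredholm_index T = int (dim (null_space T)) - int (codim (range T))"

definition Phi0 :: "('a::real_normed_vector \<Rightarrow> 'b::real_normed_vector) set" where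
  "Phi0 = {T. fredholm T \<and> fredholm_index T = 0}"

definition GL :: "('a::real_normed_vector \<Rightarrow> 'b::real_normed_vector) set" where
  "GL = {T. bounded_linear T \<and> bij T \<and> bounded_linear (inv_into UNIV T)}"

definition spectrum_family ::
    "(real \<Rightarrow> 'a::real_normed_vector \<Rightarrow> 'b::real_normed_vector) \<Rightarrow> real set" where
  "spectrum_family L = {l. L l \<notin> GL}"


section \<open>The nonlinear problem\<close>

definition Du :: "(real \<times> 'u::real_normed_vector \<Rightarrow> 'v::real_normed_vector) \<Rightarrow>
    real \<Rightarrow> 'u \<Rightarrow> 'u \<Rightarrow> 'v" where
  "Du F l u = frechet_derivative (\<lambda>w. F (l, w)) (at u)"

definition linearization :: "(real \<times> 'u::real_normed_vector \<Rightarrow> 'v::real_normed_vector) \<Rightarrow>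
    real \<Rightarrow> 'u \<Rightarrow> 'v" where
  "linearization F l = Du F l 0"

definition zero_set :: "(real \<times> 'u \<Rightarrow> 'v::zero) \<Rightarrow> (real \<times> 'u) set" where
  "zero_set F = {x. F x = 0}"

definition trivial_line :: "(real \<times> 'u::zero) set" where
  "trivial_line = {(l, 0) |l. True}"

definition regular_points ::
    "(real \<times> 'u::real_normed_vector \<Rightarrow> 'v::real_normed_vector) \<Rightarrow> (real \<times> 'u) set" where
  "regular_points F = {(l, u). (l, u) \<in> zero_set F \<and> Du F l u \<in> GL}"

definition proper_on_closed_bounded :: "('a::metric_space \<Rightarrow> 'b::topological_space) \<Rightarrow> bool" where
  "proper_on_closed_bounded F \<longleftrightarrow>
     (\<forall>B K. closed B \<and> bounded B \<and> compact K \<longrightarrow> compact {x\<in>B. F x \<in> K})"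

definition locally_injective_on :: "('a::topological_space \<Rightarrow> 'b) \<Rightarrow> 'a set \<Rightarrow> bool" where
  "locally_injective_on f A \<longleftrightarrow> (\<forall>x\<in>A. \<exists>N. open N \<and> x \<in> N \<and> inj_on f (A \<inter> N))"

definition analytic_curve_from_origin ::
    "(real \<times> 'u::real_normed_vector \<Rightarrow> 'v::zero) \<Rightarrow> (real \<Rightarrow> real \<times> 'u) \<Rightarrow> bool" where
  "analytic_curve_from_origin F \<gamma> \<longleftrightarrow>
     analytic_map_on \<gamma> {0<..<1} \<and> inj_on \<gamma> {0<..<1} \<and>
     \<gamma> ` {0<..<1} \<subseteq> zero_set F \<and> (\<gamma> \<longlongrightarrow> (0, 0)) (at_right 0)"

definition global_extension :: "(real \<times> 'u::real_normed_vector \<Rightarrow> 'v::zero) \<Rightarrow>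
    (real \<Rightarrow> real \<times> 'u) \<Rightarrow> (real \<Rightarrow> real \<times> 'u) \<Rightarrow> bool" where
  "global_extension F \<gamma> \<Gamma> \<longleftrightarrow>
     continuous_on {0..} \<Gamma> \<and> locally_injective_on \<Gamma> {0..} \<and> \<Gamma> ` {0..} \<subseteq> zero_set F \<and>
     (\<exists>\<delta>. 0 < \<delta> \<and> \<delta> < 1 \<and> (\<forall>t\<in>{0<..<\<delta>}. \<Gamma> t = \<gamma> t)) \<and>
     (filterlim (\<lambda>t. norm (\<Gamma> t)) at_top at_top \<or> (\<exists>T>0. \<Gamma> T = (0, 0)))"


section \<open>Meromorphic functions of one real variable\<close>

definition real_meromorphic_on :: "(real \<Rightarrow> real) \<Rightarrow> real set \<Rightarrow> bool" where
  "real_meromorphic_on f J \<longleftrightarrow>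
     (\<forall>z\<in>J. \<exists>r>0. \<exists>a b. analytic_map_on a (ball z r) \<and> analytic_map_on b (ball z r) \<and>
        (\<forall>w\<in>ball z r - {z}. b w \<noteq> 0 \<and> f w = a w / b w))"

text \<open>Meromorphic functions on an open set \<open>J\<close> are identified when they agree off a discrete set. The
  normal form of a class is continuous where possible, and \<open>0\<close> at the poles and outside \<open>J\<close>.\<close>

definition mero_normal :: "real set \<Rightarrow> (real \<Rightarrow> real) \<Rightarrow> real \<Rightarrow> real" where
  "mero_normal J f z = (if z \<in> J \<and> (\<exists>l. (f \<longlongrightarrow> l) (at z)) then Lim (at z) f else 0)"

definition mero_ring :: "real set \<Rightarrow> (real \<Rightarrow> real) ring" where
  "mero_ring J =
     \<lparr> carrier = {f. real_meromorphic_on f J \<and> mero_normal J f = f},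
       mult = (\<lambda>f g. mero_normal J (\<lambda>z. f z * g z)),
       one = mero_normal J (\<lambda>z. 1),
       zero = (\<lambda>z. 0),
       add = (\<lambda>f g. mero_normal J (\<lambda>z. f z + g z)) \<rparr>"


section \<open>The Weierstrass polynomial\<close>

text \<open>The subspace \<open>N[L(0)] = span {\<phi>\<^sub>0}\<close> is given the coordinate \<open>z\<close> of \<open>x = z \<phi>\<^sub>0\<close>, and \<open>W\<close> is the
  domain of \<open>Y\<close> in the coordinates \<open>(\<lambda>, z)\<close>. Only the values of \<open>S\<close> on \<open>null_space Q\<close> matter, so that
  \<open>S\<close> can be taken linear on the whole space.\<close>

definition lyapunov_schmidt ::
    "(real \<times> 'u::real_normed_vector \<Rightarrow> 'v::real_normed_vector) \<Rightarrow> 'u \<Rightarrow>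
     ('u \<Rightarrow> real) \<Rightarrow> ('v \<Rightarrow> 'v) \<Rightarrow> ('v \<Rightarrow> real) \<Rightarrow> (real \<times> real) set \<Rightarrow> (real \<times> 'u \<Rightarrow> 'u) \<Rightarrow> bool" where
  "lyapunov_schmidt F \<phi>0 \<phi>s Q S W Y \<longleftrightarrow>
     bounded_linear \<phi>s \<and> \<phi>s \<phi>0 = 1 \<and>
     bounded_linear Q \<and> Q \<circ> Q = Q \<and> range Q = range (linearization F 0) \<and>
     linear S \<and> bij_betw S (null_space Q) UNIV \<and>
     open W \<and> (0, 0) \<in> W \<and>
     analytic_map_on (\<lambda>(l, z). Y (l, z *\<^sub>R \<phi>0)) W \<and>
     Y (0, 0) = 0 \<and>
     (\<forall>(l, z)\<in>W. Y (l, z *\<^sub>R \<phi>0) \<in> null_space (\<lambda>u. \<phi>s u *\<^sub>R \<phi>0) \<and>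
        Q (F (l, z *\<^sub>R \<phi>0 + Y (l, z *\<^sub>R \<phi>0))) = 0)"

definition reduced_map ::
    "(real \<times> 'u::real_normed_vector \<Rightarrow> 'v::real_normed_vector) \<Rightarrow> 'u \<Rightarrow>
     ('v \<Rightarrow> 'v) \<Rightarrow> ('v \<Rightarrow> real) \<Rightarrow> (real \<times> 'u \<Rightarrow> 'u) \<Rightarrow> real \<times> real \<Rightarrow> real" where
  "reduced_map F \<phi>0 Q S Y =
     (\<lambda>(l, z). let v = F (l, z *\<^sub>R \<phi>0 + Y (l, z *\<^sub>R \<phi>0)) in S (v - Q v))"

definition order_at_zero :: "(real \<Rightarrow> real) \<Rightarrow> nat \<Rightarrow> bool" where
  "order_at_zero f n \<longleftrightarrow> (\<forall>j<n. (deriv ^^ j) f 0 = 0) \<and> (deriv ^^ n) f 0 \<noteq> 0"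

text \<open>The Weierstrass polynomial is given by its degree \<open>d\<close> and its lower coefficients
  \<open>a 0, \<dots>, a (d - 1)\<close>, functions of \<open>z\<close>.\<close>

definition weierstrass_poly_fun :: "nat \<Rightarrow> (nat \<Rightarrow> real \<Rightarrow> real) \<Rightarrow> real \<Rightarrow> real \<Rightarrow> real" where
  "weierstrass_poly_fun d a l z = l ^ d + (\<Sum>j<d. a j z * l ^ j)"

definition weierstrass_polynomial ::
    "(real \<times> 'u::real_normed_vector \<Rightarrow> 'v::real_normed_vector) \<Rightarrow> 'u \<Rightarrow>
     real set \<Rightarrow> nat \<Rightarrow> (nat \<Rightarrow> real \<Rightarrow> real) \<Rightarrow> bool" where
  "weierstrass_polynomial F \<phi>0 Uz d a \<longleftrightarrow>
     (\<exists>\<phi>s Q S W Y g Ul c.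
        lyapunov_schmidt F \<phi>0 \<phi>s Q S W Y \<and>
        analytic_map_on g W \<and> (\<forall>(l, z)\<in>W. reduced_map F \<phi>0 Q S Y (l, z) = z * g (l, z)) \<and>
        order_at_zero (\<lambda>l. g (l, 0)) d \<and> d \<ge> 1 \<and>
        open Ul \<and> connected Ul \<and> 0 \<in> Ul \<and> open Uz \<and> connected Uz \<and> 0 \<in> Uz \<and> Ul \<times> Uz \<subseteq> W \<and>
        analytic_map_on c (Ul \<times> Uz) \<and> c (0, 0) \<noteq> 0 \<and>
        (\<forall>j<d. analytic_map_on (a j) Uz \<and> a j 0 = 0) \<and>
        (\<forall>l\<in>Ul. \<forall>z\<in>Uz. g (l, z) = c (l, z) * weierstrass_poly_fun d a l z))"

definition weierstrass_irreducible :: "real set \<Rightarrow> nat \<Rightarrow> (nat \<Rightarrow> real \<Rightarrow> real) \<Rightarrow> bool" where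
  "weierstrass_irreducible Uz d a \<longleftrightarrow>
     Divisibility.irreducible (UP (mero_ring Uz))
       (\<lambda>n. if n < d then mero_normal Uz (a n)
            else if n = d then \<one>\<^bsub>mero_ring Uz\<^esub> else \<zero>\<^bsub>mero_ring Uz\<^esub>)"

end

theory Submission
  imports Defs "HOL-Complex_Analysis.Complex_Analysis"
begin

text \<open>Every zero of \<open>F\<close> has a neighbourhood in which, by Lyapunov--Schmidt reduction, the zero set is
  homeomorphic to a real analytic set in some \<open>\<real>\<^sup>m\<close>: adding a finite rank operator to the Fredholm derivative
  makes it invertible, and the inverse function theorem is applied in the complexification, so that
  the reduced equations are holomorphic. A real analytic set has the following property at each of its
  points \<open>y\<close>: every point near \<open>y\<close> can be joined, inside the set and without meeting \<open>y\<close>, to an arc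
  that passes through \<open>y\<close> from one side to the other. It is proved by induction on the dimension,
  following the real roots of a discriminant along Puiseux parametrisations.

  In a set with this property whose bounded parts are compact, an arc never gets stuck: it can be
  prolonged past its end point unless the set contains a loop through which a locally injective closed
  path can be built. Prolonging greedily gives a path that leaves every bounded set, because at a finite
  limit point it could be prolonged by a definite amount. A second branch at the starting point is
  needed in order to turn around; here it is one half of the trivial line, and near the origin a curve
  of zeros either avoids that line or is contained in one half of it, because zeros near a point
  \<open>(\<lambda>, 0)\<close> with invertible linearization are trivial.\<close>

section \<open>Arcs through a point of a set\<close>

definition arc_through :: "'a::topological_space set \<Rightarrow> 'a \<Rightarrow> (real \<Rightarrow> 'a) \<Rightarrow> bool" where
  "arc_through Z y \<phi> \<longleftrightarrow> continuous_on {-1..1} \<phi> \<and> inj_on \<phi> {-1..1} \<and> \<phi> ` {-1..1} \<subseteq> Z \<and> \<phi> 0 = y"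

definition arc_linked_at :: "'a::topological_space set \<Rightarrow> 'a \<Rightarrow> bool" where
  "arc_linked_at Z y \<longleftrightarrow> (\<exists>N. open N \<and> y \<in> N \<and>
      (\<forall>x\<in>Z \<inter> N - {y}. \<exists>\<phi>. arc_through Z y \<phi> \<and> path_component (Z - {y}) x (\<phi> 1)))"

lemma arc_through_image:
  assumes \<phi>: "arc_through Z y \<phi>" and f: "continuous_on Z f" "inj_on f Z" "f ` Z \<subseteq> W"
  shows "arc_through W (f y) (f \<circ> \<phi>)"
proof -
  have sub: "\<phi> ` {-1..1} \<subseteq> Z" using \<phi> by (simp add: arc_through_def)
  have "continuous_on {-1..1} (f \<circ> \<phi>)" "inj_on (f \<circ> \<phi>) {-1..1}"
    using \<phi> continuous_on_subset[OF f(1) sub] inj_on_subset[OF f(2) sub]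
    unfolding arc_through_def by (blast intro: continuous_on_compose comp_inj_on)+
  moreover have "(f \<circ> \<phi>) ` {-1..1} \<subseteq> W" using sub f(3) by (fastforce simp: image_subset_iff)
  ultimately show ?thesis using \<phi> by (simp add: arc_through_def)
qed

lemma path_component_image:
  assumes "path_component S x y" "continuous_on S f" "f ` S \<subseteq> T"
  shows "path_component T (f x) (f y)"
proof -
  obtain g where g: "path g" "path_image g \<subseteq> S" "pathstart g = x" "pathfinish g = y"
    using assms(1) unfolding path_component_def by blast
  have "path (f \<circ> g)" by (rule path_continuous_image[OF g(1) continuous_on_subset[OF assms(2) g(2)]])
  moreover have "path_image (f \<circ> g) \<subseteq> T" using g(2) assms(3) by (auto simp: path_image_compose)
  moreover have "pathstart (f \<circ> g) = f x" "pathfinish (f \<circ> g) = f y"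
    using g(3,4) by (simp_all add: pathstart_compose pathfinish_compose)
  ultimately show ?thesis unfolding path_component_def by blast
qed

lemma arc_linked_at_image:
  assumes Z: "arc_linked_at Z y" and y: "y \<in> Z"
    and f: "continuous_on Z f" "inj_on f Z" "f ` Z \<subseteq> W"
    and nhd: "\<And>M. open M \<Longrightarrow> y \<in> M \<Longrightarrow> \<exists>N. open N \<and> f y \<in> N \<and> W \<inter> N \<subseteq> f ` (Z \<inter> M)"
  shows "arc_linked_at W (f y)"
proof -
  obtain M where M: "open M" "y \<in> M"
    and arcs: "\<forall>x\<in>Z \<inter> M - {y}. \<exists>\<phi>. arc_through Z y \<phi> \<and> path_component (Z - {y}) x (\<phi> 1)"
    using Z unfolding arc_linked_at_def by blast
  from nhd[OF M] obtain N where N: "open N" "f y \<in> N" "W \<inter> N \<subseteq> f ` (Z \<inter> M)" by blast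
  have "\<exists>\<phi>. arc_through W (f y) \<phi> \<and> path_component (W - {f y}) \<xi> (\<phi> 1)" if \<xi>: "\<xi> \<in> W \<inter> N - {f y}" for \<xi>
  proof -
    obtain x where x: "x \<in> Z \<inter> M - {y}" "\<xi> = f x" using N(3) \<xi> by blast
    from arcs x(1) obtain \<phi> where \<phi>: "arc_through Z y \<phi>" "path_component (Z - {y}) x (\<phi> 1)" by blast
    have "path_component (W - {f y}) (f x) (f (\<phi> 1))"
    proof (rule path_component_image[OF \<phi>(2)])
      show "continuous_on (Z - {y}) f" using f(1) by (rule continuous_on_subset) blast
      show "f ` (Z - {y}) \<subseteq> W - {f y}" using f(2,3) y by (auto simp: inj_on_eq_iff)
    qed
    then show ?thesis using arc_through_image[OF \<phi>(1) f] x(2) by (intro exI[of _ "f \<circ> \<phi>"]) simp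
  qed
  then show ?thesis unfolding arc_linked_at_def using N(1,2) by blast
qed

section \<open>Roots of holomorphic functions depending on a parameter\<close>

lemma continuous_on_contour_integral_circlepath:
  fixes F :: "'a::topological_space \<Rightarrow> complex \<Rightarrow> complex"
  assumes "continuous_on (T \<times> sphere c r) (\<lambda>(t,z). F t z)" "0 < r"
  shows "continuous_on T (\<lambda>t. contour_integral (circlepath c r) (F t))"
proof -
  have "continuous_on (T \<times> cbox 0 1)
      (\<lambda>(t,x). F t (circlepath c r x) * vector_derivative (circlepath c r) (at x))"
    unfolding split_beta vector_derivative_circlepath
    unfolding circlepath
    by (intro continuous_intros continuous_on_compose2[OF assms(1)[unfolded split_beta], of _ "\<lambda>x. (fst x, f (snd x))" for f, simplified])
      (use assms(2) in \<open>auto simp: dist_norm norm_mult\<close>)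
  from integral_continuous_on_param[OF this]
  show ?thesis by (simp add: contour_integral_integral)
qed

lemma holomorphic_on_compose2:
  assumes "g holomorphic_on T" "f holomorphic_on S" "f ` S \<subseteq> T"
  shows "(\<lambda>x. g (f x)) holomorphic_on S"
  using holomorphic_on_compose_gen[OF assms(2,1,3)] by (simp add: o_def)

lemma continuous_on_contour_integral_linepath:
  fixes F :: "complex \<Rightarrow> 'a::topological_space \<Rightarrow> complex"
  assumes cont: "continuous_on (T \<times> A) (\<lambda>(w,z). F w z)" and sub: "closed_segment p q \<subseteq> T"
  shows "continuous_on A (\<lambda>z. contour_integral (linepath p q) (\<lambda>w. F w z))"
proof -
  have "continuous_on (A \<times> {0..1}) (\<lambda>x. (linepath p q (snd x), fst x))"
    unfolding linepath_def by (intro continuous_intros)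
  moreover have "(\<lambda>x. (linepath p q (snd x), fst x)) ` (A \<times> {0..1}) \<subseteq> T \<times> A"
    using sub linepath_in_path by fastforce
  ultimately have "continuous_on (A \<times> {0..1}) (\<lambda>x. F (linepath p q (snd x)) (fst x))"
    using continuous_on_compose2[OF cont[unfolded split_beta], of _ "\<lambda>x. (linepath p q (snd x), fst x)"] by simp
  then have "continuous_on (A \<times> cbox 0 1) (\<lambda>(z,x). F (linepath p q x) z * (q - p))"
    by (auto simp: split_beta intro!: continuous_intros)
  from integral_continuous_on_param[OF this] show ?thesis
    by (simp add: contour_integral_integral)
qed

lemma holomorphic_on_contour_integral_circlepath:
  assumes cont: "continuous_on (T \<times> sphere c r) (\<lambda>(w,z). F w z)" and "0 < r" "open T"
    and hol: "\<And>z. z \<in> sphere c r \<Longrightarrow> (\<lambda>w. F w z) holomorphic_on T"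
  shows "(\<lambda>w. contour_integral (circlepath c r) (F w)) holomorphic_on T"
proof -
  let ?I = "\<lambda>w. contour_integral (circlepath c r) (F w)"
  let ?J = "\<lambda>p q z. contour_integral (linepath p q) (\<lambda>w. F w z)"
  have "continuous_on T ?I"
    by (rule continuous_on_contour_integral_circlepath[OF cont \<open>0 < r\<close>])
  then have "?I analytic_on T"
  proof (rule Morera_triangle[OF _ \<open>open T\<close>], intro impI)
    fix a b d assume triangle: "convex hull {a,b,d} \<subseteq> T"
    then have sides: "closed_segment a b \<subseteq> T" "closed_segment b d \<subseteq> T" "closed_segment d a \<subseteq> T"
      by (auto simp: segment_convex_hull dest!: subsetD elim!: subsetD[OF hull_mono, rotated])
    have swap: "contour_integral (linepath p q) ?I = contour_integral (circlepath c r) (?J p q)"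
      if "closed_segment p q \<subseteq> T" for p q
    proof (rule contour_integral_swap)
      show "continuous_on (path_image (linepath p q) \<times> path_image (circlepath c r)) (\<lambda>(y1, y2). F y1 y2)"
        using that \<open>0 < r\<close> by (intro continuous_on_subset[OF cont]) auto
    qed (auto simp: vector_derivative_circlepath intro!: continuous_intros)
    have integrable: "?J p q contour_integrable_on circlepath c r" if "closed_segment p q \<subseteq> T" for p q
      using continuous_on_contour_integral_linepath[OF cont that] \<open>0 < r\<close>
      by (intro contour_integrable_continuous_circlepath) auto
    have "contour_integral (linepath a b) ?I + contour_integral (linepath b d) ?I + contour_integral (linepath d a) ?I
      = contour_integral (circlepath c r) (\<lambda>z. ?J a b z + ?J b d z + ?J d a z)"
      by (simp add: swap sides integrable contour_integral_add contour_integrable_add)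
    also have "\<dots> = contour_integral (circlepath c r) (\<lambda>z. 0)"
    proof (rule contour_integral_eq)
      fix z assume "z \<in> path_image (circlepath c r)"
      then have "(\<lambda>w. F w z) holomorphic_on convex hull {a,b,d}"
        using hol[of z] triangle \<open>0 < r\<close> holomorphic_on_subset by auto
      from Cauchy_theorem_triangle[OF this] show "?J a b z + ?J b d z + ?J d a z = 0"
        using has_chain_integral_chain_integral3 by blast
    qed
    finally show "contour_integral (linepath a b) ?I + contour_integral (linepath b d) ?I + contour_integral (linepath d a) ?I = 0"
      by simp
  qed
  then show ?thesis by (rule analytic_imp_holomorphic)
qed

lemma nonvanishing_near:
  fixes f :: "'a::metric_space \<Rightarrow> 'b::topological_space \<Rightarrow> 'c::real_normed_vector"
  assumes cont: "continuous_on (T \<times> K) (\<lambda>(t,z). f t z)" and K: "compact K" and t0: "t0 \<in> T"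
    and nonzero: "\<And>z. z \<in> K \<Longrightarrow> f t0 z \<noteq> 0"
  obtains d where "0 < d" "\<And>t z. t \<in> T \<Longrightarrow> dist t t0 < d \<Longrightarrow> z \<in> K \<Longrightarrow> f t z \<noteq> 0"
proof -
  obtain W where W: "open W" "W \<inter> (T \<times> K) = (\<lambda>(t,z). f t z) -` (- {0}) \<inter> (T \<times> K)"
    using cont open_Compl[OF closed_singleton] unfolding continuous_on_open_invariant by meson
  have zero_iff: "(t,z) \<in> W \<longleftrightarrow> f t z \<noteq> 0" if "t \<in> T" "z \<in> K" for t z
  proof -
    have "(t,z) \<in> W \<longleftrightarrow> (t,z) \<in> W \<inter> (T \<times> K)" using that by simp
    then show ?thesis unfolding W(2) using that by simp
  qed
  have "{t0} \<times> K \<subseteq> W" using zero_iff[OF t0] nonzero by auto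
  from Elementary_Topology.tube_lemma[OF K W(1) this] obtain X where X: "t0 \<in> X" "open X" "X \<times> K \<subseteq> W" by blast
  then obtain d where "0 < d" "ball t0 d \<subseteq> X" by (auto simp: open_contains_ball)
  moreover have "f t z \<noteq> 0" if "t \<in> T" "t \<in> X" "z \<in> K" for t z
    using that X(3) zero_iff[of t z] by blast
  ultimately show ?thesis using that by (metis (no_types) dist_commute mem_ball subsetD)
qed

locale root_family =
  fixes T :: "'a::metric_space set" and f :: "'a \<Rightarrow> complex \<Rightarrow> complex" and \<rho> R :: real
  assumes \<rho>: "0 < \<rho>" "\<rho> < R"
    and cont: "continuous_on (T \<times> ball 0 R) (\<lambda>(t,z). f t z)"
    and hol: "\<And>t. t \<in> T \<Longrightarrow> f t holomorphic_on ball 0 R"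
    and root_free_circle: "\<And>t z. t \<in> T \<Longrightarrow> cmod z = \<rho> \<Longrightarrow> f t z \<noteq> 0"
begin

definition roots :: "'a \<Rightarrow> complex set" where "roots t = {z. cmod z < \<rho> \<and> f t z = 0}"

definition root_section :: "('a \<Rightarrow> complex) \<Rightarrow> bool" where
  "root_section g \<longleftrightarrow> continuous_on T g \<and> (\<forall>t\<in>T. g t \<in> roots t)"

definition power_sum :: "nat \<Rightarrow> 'a \<Rightarrow> complex" where
  "power_sum a t = (\<Sum>p\<in>roots t. of_int (zorder (f t) p) * p ^ a)"

lemma nonzero_value: "t \<in> T \<Longrightarrow> \<exists>w\<in>ball 0 R. f t w \<noteq> 0"
  using root_free_circle[of t "of_real \<rho>"] \<rho> by (intro bexI[of _ "of_real \<rho>"]) auto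

lemma finite_zeros: assumes "t \<in> T" "r < R" shows "finite {z\<in>cball 0 r. f t z = 0}"
proof (cases "f t constant_on ball 0 R")
  case True
  then have "{z\<in>cball 0 r. f t z = 0} = {}"
    using nonzero_value[OF assms(1)] assms(2) by (fastforce simp: constant_on_def)
  then show ?thesis by (metis finite.emptyI)
next
  case False
  then show ?thesis
    using assms by (intro holomorphic_compact_finite_zeros[OF hol]) auto
qed

lemma finite_roots: "t \<in> T \<Longrightarrow> finite (roots t)"
  using finite_zeros[of t \<rho>] \<rho> by (auto simp: roots_def intro: finite_subset[rotated])

lemma zorder_pos: "t \<in> T \<Longrightarrow> p \<in> roots t \<Longrightarrow> zorder (f t) p > 0"
  using zorder_exist_zero[OF hol _ _ _ nonzero_value, of t p] \<rho> by (auto simp: roots_def split: if_splits)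

lemma power_sum_contour_integral:
  assumes t: "t \<in> T"
  shows "contour_integral (circlepath 0 \<rho>) (\<lambda>z. deriv (f t) z * z ^ a / f t z) = 2 * pi * \<i> * power_sum a t"
proof -
  define r where "r = (\<rho> + R) / 2"
  have r: "\<rho> < r" "r < R" using \<rho> by (auto simp: r_def)
  let ?pz = "{w \<in> ball 0 r. f t w = 0 \<or> w \<in> {}}"
  have finite: "finite ?pz" using finite_zeros[OF t r(2)] by (rule finite_subset[rotated]) auto
  have "contour_integral (circlepath 0 \<rho>) (\<lambda>z. deriv (f t) z * z ^ a / f t z) =
      2 * pi * \<i> * (\<Sum>p\<in>?pz. winding_number (circlepath 0 \<rho>) p * p ^ a * of_int (zorder (f t) p))"
  proof (rule argument_principle)
    show "f t holomorphic_on ball 0 r - {}"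
      using hol[OF t] r by (auto intro: holomorphic_on_subset)
    show "path_image (circlepath 0 \<rho>) \<subseteq> ball 0 r - ?pz"
      using r \<rho> root_free_circle[OF t] by auto
    show "\<forall>z. z \<notin> ball 0 r \<longrightarrow> winding_number (circlepath 0 \<rho>) z = 0"
      using r \<rho> by (auto intro!: winding_number_zero_outside[of _ "cball 0 \<rho>"] simp: dist_norm)
  qed (use finite in \<open>auto intro!: holomorphic_intros\<close>)
  also have "(\<Sum>p\<in>?pz. winding_number (circlepath 0 \<rho>) p * p ^ a * of_int (zorder (f t) p)) =
      (\<Sum>p\<in>roots t. winding_number (circlepath 0 \<rho>) p * p ^ a * of_int (zorder (f t) p))"
  proof (rule sum.mono_neutral_right[OF finite])
    show "roots t \<subseteq> ?pz" using r by (auto simp: roots_def)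
    show "\<forall>p\<in>?pz - roots t. winding_number (circlepath 0 \<rho>) p * p ^ a * of_int (zorder (f t) p) = 0"
    proof
      fix p assume p: "p \<in> ?pz - roots t"
      then have "cmod p \<noteq> \<rho>" using root_free_circle[OF t] by auto
      then have "p \<notin> cball 0 \<rho>" using p by (auto simp: roots_def)
      then have "winding_number (circlepath 0 \<rho>) p = 0"
        using \<rho> by (intro winding_number_zero_outside[of _ "cball 0 \<rho>"]) auto
      then show "winding_number (circlepath 0 \<rho>) p * p ^ a * of_int (zorder (f t) p) = 0" by simp
    qed
  qed
  also have "\<dots> = power_sum a t"
    unfolding power_sum_def by (intro sum.cong) (auto simp: roots_def winding_number_circlepath)
  finally show ?thesis .
qed

lemma deriv_eq_contour_integral:
  assumes t: "t \<in> T" and "0 < r" "r < R" "cmod z < r"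
  shows "deriv (f t) z = contour_integral (circlepath 0 r) (\<lambda>u. f t u / (u - z)^2) / (2 * pi * \<i>)"
proof -
  have "continuous_on (cball 0 r) (f t)"
    using hol[OF t] assms by (intro holomorphic_on_imp_continuous_on) (auto intro: holomorphic_on_subset)
  moreover have "f t holomorphic_on ball 0 r"
    using hol[OF t] assms by (auto intro: holomorphic_on_subset)
  ultimately show ?thesis
    using Cauchy_has_contour_integral_higher_derivative_circlepath[of 0 r "f t" z 1] assms
    by (auto dest!: contour_integral_unique simp: numeral_2_eq_2)
qed

lemma continuous_on_deriv: "continuous_on (T \<times> cball 0 \<rho>) (\<lambda>(t,z). deriv (f t) z)"
proof -
  define r where "r = (\<rho> + R) / 2"
  have r: "\<rho> < r" "r < R" "0 < r" using \<rho> by (auto simp: r_def)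
  have "continuous_on (T \<times> cball 0 \<rho>) (\<lambda>x. contour_integral (circlepath 0 r) (\<lambda>u. f (fst x) u / (u - snd x)^2))"
  proof (rule continuous_on_contour_integral_circlepath)
    show "continuous_on ((T \<times> cball 0 \<rho>) \<times> sphere 0 r) (\<lambda>(x, u). f (fst x) u / (u - snd x)\<^sup>2)"
      unfolding split_beta
      by (intro continuous_intros continuous_on_compose2[OF cont[unfolded split_beta], of _ "\<lambda>x. (fst (fst x), snd x)", simplified])
        (use r in auto)
  qed (use r in auto)
  then have "continuous_on (T \<times> cball 0 \<rho>) (\<lambda>x. contour_integral (circlepath 0 r) (\<lambda>u. f (fst x) u / (u - snd x)^2) / (2 * pi * \<i>))"
    by (intro continuous_intros) auto
  then show ?thesis
    by (rule continuous_on_eq) (use r in \<open>auto simp: deriv_eq_contour_integral\<close>)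
qed

lemma continuous_on_power_sum: "continuous_on T (power_sum a)"
proof -
  have "continuous_on (T \<times> sphere 0 \<rho>) (\<lambda>(t,z). deriv (f t) z * z ^ a / f t z)"
    unfolding split_beta
    by (intro continuous_intros continuous_on_subset[OF continuous_on_deriv[unfolded split_beta]]
        continuous_on_subset[OF cont[unfolded split_beta]])
      (use root_free_circle \<rho> in auto)
  from continuous_on_contour_integral_circlepath[OF this \<rho>(1)]
  have "continuous_on T (\<lambda>t. contour_integral (circlepath 0 \<rho>) (\<lambda>z. deriv (f t) z * z ^ a / f t z) / (2 * pi * \<i>))"
    by (intro continuous_intros) auto
  then show ?thesis by (rule continuous_on_eq) (simp add: power_sum_contour_integral)
qed

lemma card_roots_le_power_sum: assumes "t \<in> T" shows "real (card (roots t)) \<le> Re (power_sum 0 t)"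
proof -
  have "real (card (roots t)) = (\<Sum>p\<in>roots t. 1)" by simp
  also have "\<dots> \<le> (\<Sum>p\<in>roots t. real_of_int (zorder (f t) p))"
    using zorder_pos[OF assms] by (intro sum_mono) force
  finally show ?thesis by (simp add: power_sum_def)
qed

lemma power_sum_holomorphic:
  fixes \<psi> :: "complex \<Rightarrow> 'a"
  assumes S: "open S" "\<psi> ` S \<subseteq> T" "continuous_on S \<psi>"
    and h: "\<And>z. z \<in> ball 0 R \<Longrightarrow> (\<lambda>w. f (\<psi> w) z) holomorphic_on S"
  shows "(\<lambda>w. power_sum a (\<psi> w)) holomorphic_on S"
proof -
  define r where "r = (\<rho> + R) / 2"
  have r: "\<rho> < r" "r < R" "0 < r" using \<rho> by (auto simp: r_def)
  have c: "continuous_on (S \<times> ball 0 R) (\<lambda>(w,z). f (\<psi> w) z)"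
    unfolding split_beta
    by (intro continuous_on_compose2[OF cont[unfolded split_beta], of _ "\<lambda>x. (\<psi> (fst x), snd x)", simplified]
          continuous_intros continuous_on_compose2[OF S(3)]) (use S in auto)
  have dh: "(\<lambda>w. deriv (f (\<psi> w)) z) holomorphic_on S" if "z \<in> cball 0 \<rho>" for z
  proof -
    have "(\<lambda>w. contour_integral (circlepath 0 r) (\<lambda>u. f (\<psi> w) u / (u - z)^2) / (2 * pi * \<i>)) holomorphic_on S"
    proof (intro holomorphic_intros holomorphic_on_contour_integral_circlepath)
      show "continuous_on (S \<times> sphere 0 r) (\<lambda>(w, u). f (\<psi> w) u / (u - z)\<^sup>2)"
        unfolding split_beta
        by (intro continuous_intros continuous_on_subset[OF c[unfolded split_beta]]) (use r that in auto)
    qed (use r S that h in \<open>auto intro!: holomorphic_intros\<close>)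
    then show ?thesis
      by (rule holomorphic_transform) (use that r S in \<open>auto simp: deriv_eq_contour_integral image_subset_iff\<close>)
  qed
  have "(\<lambda>w. contour_integral (circlepath 0 \<rho>) (\<lambda>z. deriv (f (\<psi> w)) z * z ^ a / f (\<psi> w) z)) holomorphic_on S"
  proof (rule holomorphic_on_contour_integral_circlepath)
    have "continuous_on (S \<times> cball 0 \<rho>) (\<lambda>x. deriv (f (\<psi> (fst x))) (snd x))"
      by (intro continuous_on_compose2[OF continuous_on_deriv[unfolded split_beta], of _ "\<lambda>x. (\<psi> (fst x), snd x)", simplified]
          continuous_intros continuous_on_compose2[OF S(3)]) (use S in auto)
    then show "continuous_on (S \<times> sphere 0 \<rho>) (\<lambda>(w, z). deriv (f (\<psi> w)) z * z ^ a / f (\<psi> w) z)"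
      unfolding split_beta
      by (intro continuous_intros continuous_on_subset[OF c[unfolded split_beta]])
        (use \<rho> root_free_circle S in \<open>auto elim: continuous_on_subset simp: image_subset_iff\<close>)
    show "(\<lambda>w. deriv (f (\<psi> w)) z * z ^ a / f (\<psi> w) z) holomorphic_on S" if "z \<in> sphere 0 \<rho>" for z
      using that \<rho> root_free_circle S(2) by (intro holomorphic_intros dh h) auto
  qed (use \<rho> S in auto)
  then have "(\<lambda>w. contour_integral (circlepath 0 \<rho>) (\<lambda>z. deriv (f (\<psi> w)) z * z ^ a / f (\<psi> w) z) / (2 * pi * \<i>)) holomorphic_on S"
    by (intro holomorphic_intros) auto
  then show ?thesis
    by (rule holomorphic_transform) (use S in \<open>auto simp: power_sum_contour_integral image_subset_iff\<close>)
qed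

lemma root_family_shift:
  assumes S: "S \<subseteq> T" and \<kappa>: "0 < \<kappa>" "cmod c + \<kappa> < R"
    and nonzero: "\<And>t z. t \<in> S \<Longrightarrow> dist c z = \<kappa> \<Longrightarrow> f t z \<noteq> 0"
  shows "root_family S (\<lambda>t z. f t (c + z)) \<kappa> (R - cmod c)"
proof
  have in_ball: "c + z \<in> ball 0 R" if "z \<in> ball 0 (R - cmod c)" for z
    using that norm_triangle_ineq[of c z] by auto
  show "0 < \<kappa>" "\<kappa> < R - cmod c" using \<kappa> by auto
  show "continuous_on (S \<times> ball 0 (R - cmod c)) (\<lambda>(t, z). f t (c + z))"
    unfolding split_beta
    by (intro continuous_on_compose2[OF cont[unfolded split_beta], of _ "\<lambda>x. (fst x, c + snd x)", simplified]
        continuous_intros) (use S in_ball in auto)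
  show "(\<lambda>z. f t (c + z)) holomorphic_on ball 0 (R - cmod c)" if "t \<in> S" for t
  proof -
    have "f t holomorphic_on ball 0 R" using hol that S by blast
    moreover have "(\<lambda>z. c + z) ` ball 0 (R - cmod c) \<subseteq> ball 0 R" using in_ball by blast
    moreover have "(\<lambda>z. c + z) holomorphic_on ball 0 (R - cmod c)" by (intro holomorphic_intros)
    ultimately show ?thesis using holomorphic_on_compose2 by blast
  qed
  show "f t (c + z) \<noteq> 0" if "t \<in> S" "cmod z = \<kappa>" for t z
    using nonzero[OF that(1), of "c + z"] that(2) by (simp add: dist_norm)
qed

lemma roots_near:
  assumes t0: "t0 \<in> T" and \<epsilon>: "0 < \<epsilon>"
  obtains d where "0 < d" "\<And>t u. t \<in> T \<Longrightarrow> dist t t0 < d \<Longrightarrow> u \<in> roots t \<Longrightarrow> \<exists>z\<in>roots t0. u \<in> ball z \<epsilon>"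
proof -
  let ?K = "cball 0 \<rho> - (\<Union>z\<in>roots t0. ball z \<epsilon>)"
  have "continuous_on (T \<times> ?K) (\<lambda>(t,z). f t z)"
    using \<rho> by (intro continuous_on_subset[OF cont]) auto
  moreover have "compact ?K" by (intro compact_diff compact_cball open_UN) auto
  moreover have "f t0 u \<noteq> 0" if "u \<in> ?K" for u
    using that root_free_circle[OF t0, of u] \<epsilon> by (force simp: roots_def)
  ultimately obtain d where "0 < d" "\<And>t u. t \<in> T \<Longrightarrow> dist t t0 < d \<Longrightarrow> u \<in> ?K \<Longrightarrow> f t u \<noteq> 0"
    using nonvanishing_near[OF _ _ t0, of ?K f] by blast
  then have "\<exists>z\<in>roots t0. u \<in> ball z \<epsilon>" if "t \<in> T" "dist t t0 < d" "u \<in> roots t" for t u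
    using that by (force simp: roots_def)
  then show ?thesis using that \<open>0 < d\<close> by blast
qed

lemma isolated_root_circle:
  assumes t0: "t0 \<in> T" and z0: "z0 \<in> roots t0" and \<epsilon>: "0 < \<epsilon>"
  obtains \<kappa> where "0 < \<kappa>" "\<kappa> < \<epsilon>" "cmod z0 + \<kappa> < \<rho>" "\<And>z. dist z0 z = \<kappa> \<Longrightarrow> f t0 z \<noteq> 0"
proof -
  let ?Z = "{z\<in>cball 0 \<rho>. f t0 z = 0}"
  have "finite ?Z" using finite_zeros[OF t0] \<rho> by auto
  then obtain \<kappa>0 where \<kappa>0: "\<kappa>0 > 0" "\<forall>z\<in>?Z. z \<noteq> z0 \<longrightarrow> \<kappa>0 \<le> dist z0 z"
    using finite_set_avoid by blast
  define \<kappa> where "\<kappa> = min (\<kappa>0/2) (min (\<epsilon>/2) ((\<rho> - cmod z0)/2))"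
  have "cmod z0 < \<rho>" using z0 by (simp add: roots_def)
  then have \<kappa>: "0 < \<kappa>" "\<kappa> < \<kappa>0" "\<kappa> < \<epsilon>" "cmod z0 + \<kappa> < \<rho>"
    using \<kappa>0(1) \<epsilon> by (auto simp: \<kappa>_def min_def field_simps)
  have "f t0 z \<noteq> 0" if z: "dist z0 z = \<kappa>" for z
  proof
    assume "f t0 z = 0"
    moreover have "cmod z \<le> \<rho>"
      using z \<kappa>(4) norm_triangle_ineq2[of z z0] by (simp add: dist_norm norm_minus_commute)
    ultimately have "\<kappa>0 \<le> dist z0 z" using \<kappa>0(2) z \<kappa>(1) by auto
    then show False using z \<kappa>(2) by simp
  qed
  then show ?thesis using that \<kappa> by blast
qed

lemma root_persists:
  assumes t0: "t0 \<in> T" and z0: "z0 \<in> roots t0" and \<epsilon>: "0 < \<epsilon>"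
  obtains d where "0 < d" "\<And>t. t \<in> T \<Longrightarrow> dist t t0 < d \<Longrightarrow> \<exists>u\<in>roots t. u \<in> ball z0 \<epsilon>"
proof -
  obtain \<kappa> where \<kappa>: "0 < \<kappa>" "\<kappa> < \<epsilon>" "cmod z0 + \<kappa> < \<rho>" and nz0: "\<And>z. dist z0 z = \<kappa> \<Longrightarrow> f t0 z \<noteq> 0"
    using isolated_root_circle[OF assms] by blast
  have circle: "sphere z0 \<kappa> \<subseteq> ball 0 R"
  proof
    fix z assume "z \<in> sphere z0 \<kappa>"
    then show "z \<in> ball 0 R"
      using \<kappa>(3) \<rho> norm_triangle_ineq2[of z z0] by (simp add: dist_norm norm_minus_commute)
  qed
  have "continuous_on (T \<times> sphere z0 \<kappa>) (\<lambda>(t,z). f t z)"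
    using circle by (intro continuous_on_subset[OF cont]) auto
  then obtain d1 where d1: "0 < d1" "\<And>t z. t \<in> T \<Longrightarrow> dist t t0 < d1 \<Longrightarrow> z \<in> sphere z0 \<kappa> \<Longrightarrow> f t z \<noteq> 0"
    using nonvanishing_near[OF _ compact_sphere t0, of z0 \<kappa> f] nz0 by auto
  define S where "S = {t\<in>T. dist t t0 < d1}"
  interpret local: root_family S "\<lambda>t z. f t (z0 + z)" \<kappa> "R - cmod z0"
    using d1(2) \<kappa> \<rho> by (intro root_family_shift) (auto simp: S_def)
  have t0S: "t0 \<in> S" using t0 d1(1) by (simp add: S_def)
  have "0 \<in> local.roots t0" using z0 \<kappa>(1) by (simp add: local.roots_def roots_def)
  then have "1 \<le> card (local.roots t0)" using local.finite_roots[OF t0S] by (simp add: Suc_le_eq card_gt_0_iff) blast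
  then have pos: "1 \<le> Re (local.power_sum 0 t0)" using local.card_roots_le_power_sum[OF t0S] by linarith
  obtain d2 where d2: "0 < d2" "\<And>t. t \<in> S \<Longrightarrow> dist t t0 < d2 \<Longrightarrow> dist (local.power_sum 0 t) (local.power_sum 0 t0) < 1"
    using local.continuous_on_power_sum[of 0] t0S unfolding continuous_on_iff by (metis zero_less_one)
  have "\<exists>u\<in>roots t. u \<in> ball z0 \<epsilon>" if t: "t \<in> T" "dist t t0 < min d1 d2" for t
  proof -
    have "t \<in> S" using t by (simp add: S_def)
    then have "cmod (local.power_sum 0 t - local.power_sum 0 t0) < 1" using d2(2) t by (simp add: dist_norm)
    then have "local.power_sum 0 t \<noteq> 0" using pos abs_Re_le_cmod[of "local.power_sum 0 t - local.power_sum 0 t0"] by auto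
    then have "local.roots t \<noteq> {}" by (auto simp: local.power_sum_def)
    then obtain u where u: "cmod u < \<kappa>" "f t (z0 + u) = 0" by (auto simp: local.roots_def)
    then have "z0 + u \<in> roots t" using \<kappa>(3) norm_triangle_ineq[of z0 u] by (simp add: roots_def)
    moreover have "z0 + u \<in> ball z0 \<epsilon>" using u \<kappa>(2) by (simp add: dist_norm)
    ultimately show ?thesis by blast
  qed
  then show ?thesis using that[of "min d1 d2"] d1(1) d2(1) by simp
qed

lemma unique_root_eq_power_sum_ratio:
  assumes "t \<in> T" "roots t = {z}" shows "power_sum 1 t / power_sum 0 t = z"
  using zorder_pos[OF assms(1), of z] by (simp add: power_sum_def assms(2))

end

lemma root_family_compose:
  fixes u :: "'b::metric_space \<Rightarrow> 'a::metric_space"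
  assumes "root_family T f \<rho> R" "continuous_on S u" "u ` S \<subseteq> T"
  shows "root_family S (\<lambda>s. f (u s)) \<rho> R"
proof -
  interpret root_family T f \<rho> R by fact
  show ?thesis
  proof
    show "continuous_on (S \<times> ball 0 R) (\<lambda>(t, z). f (u t) z)"
      unfolding split_beta
      by (intro continuous_on_compose2[OF cont[unfolded split_beta], of _ "\<lambda>x. (u (fst x), snd x)", simplified]
          continuous_intros continuous_on_compose2[OF assms(2)]) (use assms(3) in auto)
  qed (use \<rho> hol root_free_circle assms(3) in auto)
qed

subsection \<open>Generalised discriminants\<close>

definition polynomial_in :: "nat \<Rightarrow> ((nat \<Rightarrow> complex) \<Rightarrow> complex) \<Rightarrow> bool" where
  "polynomial_in k q \<longleftrightarrow> (\<exists>L. \<forall>\<tau>. q \<tau> = (\<Sum>(c,\<alpha>)\<leftarrow>L. c * (\<Prod>i<k. \<tau> i ^ \<alpha> i)))"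

lemma polynomial_in_const: "polynomial_in k (\<lambda>_. c)"
  unfolding polynomial_in_def by (rule exI[of _ "[(c, \<lambda>_. 0)]"]) simp

lemma polynomial_in_coord: assumes "i < k" shows "polynomial_in k (\<lambda>\<tau>. \<tau> i)"
proof -
  have "(\<Prod>j<k. \<tau> j ^ (if j = i then 1 else 0)) = \<tau> i" for \<tau> :: "nat \<Rightarrow> complex"
    using assms by (subst prod.mono_neutral_right[of _ "{i}"]) auto
  then show ?thesis
    unfolding polynomial_in_def by (intro exI[of _ "[(1, \<lambda>j. if j = i then 1 else 0)]"]) simp
qed

lemma polynomial_in_add: assumes "polynomial_in k p" "polynomial_in k q" shows "polynomial_in k (\<lambda>\<tau>. p \<tau> + q \<tau>)"
proof -
  from assms obtain L M where "\<forall>\<tau>. p \<tau> = (\<Sum>(c,\<alpha>)\<leftarrow>L. c * (\<Prod>i<k. \<tau> i ^ \<alpha> i))"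
    "\<forall>\<tau>. q \<tau> = (\<Sum>(c,\<alpha>)\<leftarrow>M. c * (\<Prod>i<k. \<tau> i ^ \<alpha> i))" unfolding polynomial_in_def by auto
  then show ?thesis unfolding polynomial_in_def by (intro exI[of _ "L @ M"]) simp
qed

lemma polynomial_in_mult_monom:
  assumes "polynomial_in k q" shows "polynomial_in k (\<lambda>\<tau>. c * (\<Prod>i<k. \<tau> i ^ \<alpha> i) * q \<tau>)"
proof -
  from assms obtain M where M: "\<forall>\<tau>. q \<tau> = (\<Sum>(c,\<alpha>)\<leftarrow>M. c * (\<Prod>i<k. \<tau> i ^ \<alpha> i))"
    unfolding polynomial_in_def by auto
  have "c * (\<Prod>i<k. \<tau> i ^ \<alpha> i) * (\<Sum>(c,\<alpha>)\<leftarrow>M. c * (\<Prod>i<k. \<tau> i ^ \<alpha> i)) =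
      (\<Sum>(c,\<alpha>)\<leftarrow>map (\<lambda>(d,\<beta>). (c * d, \<lambda>i. \<alpha> i + \<beta> i)) M. c * (\<Prod>i<k. \<tau> i ^ \<alpha> i))" for \<tau> :: "nat \<Rightarrow> complex"
    by (induction M) (auto simp: algebra_simps power_add prod.distrib)
  then show ?thesis using M unfolding polynomial_in_def
    by (intro exI[of _ "map (\<lambda>(d,\<beta>). (c * d, \<lambda>i. \<alpha> i + \<beta> i)) M"]) (simp only: simp_thms)
qed

lemma polynomial_in_mult: assumes "polynomial_in k p" "polynomial_in k q" shows "polynomial_in k (\<lambda>\<tau>. p \<tau> * q \<tau>)"
proof -
  from assms obtain L where L: "\<forall>\<tau>. p \<tau> = (\<Sum>(c,\<alpha>)\<leftarrow>L. c * (\<Prod>i<k. \<tau> i ^ \<alpha> i))"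
    unfolding polynomial_in_def by auto
  have "polynomial_in k (\<lambda>\<tau>. (\<Sum>(c,\<alpha>)\<leftarrow>L. c * (\<Prod>i<k. \<tau> i ^ \<alpha> i)) * q \<tau>)"
  proof (induction L)
    case Nil then show ?case using polynomial_in_const[of k 0] by simp
  next
    case (Cons x L)
    obtain c \<alpha> where x: "x = (c,\<alpha>)" by (cases x)
    show ?case
      using polynomial_in_add[OF polynomial_in_mult_monom[OF assms(2), of c \<alpha>] Cons.IH]
      by (simp add: x algebra_simps)
  qed
  then show ?thesis using L by simp
qed

lemma polynomial_in_prod:
  assumes "finite I" "\<And>i. i \<in> I \<Longrightarrow> polynomial_in k (q i)" shows "polynomial_in k (\<lambda>\<tau>. \<Prod>i\<in>I. q i \<tau>)"
  using assms by (induction I rule: finite_induct) (auto simp: polynomial_in_const intro!: polynomial_in_mult)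
definition diff_prod :: "nat \<Rightarrow> (nat \<Rightarrow> complex) \<Rightarrow> complex" where
  "diff_prod k \<tau> = (\<Prod>i<k. \<Prod>j\<in>{..<k}-{i}. \<tau> i - \<tau> j)"

lemma polynomial_in_diff_prod: "polynomial_in k (diff_prod k)"
  unfolding diff_prod_def[abs_def]
proof (intro polynomial_in_prod)
  fix i j assume "i \<in> {..<k}" "j \<in> {..<k} - {i}"
  then have "polynomial_in k (\<lambda>\<tau>. \<tau> i + (-1) * \<tau> j)"
    by (intro polynomial_in_add polynomial_in_mult polynomial_in_const polynomial_in_coord) auto
  then show "polynomial_in k (\<lambda>\<tau>. \<tau> i - \<tau> j)" by simp
qed auto

lemma diff_prod_eq_0:
  assumes "\<not> inj_on \<tau> {..<k}" shows "diff_prod k \<tau> = 0"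
proof -
  obtain i j where "i < k" "j < k" "i \<noteq> j" "\<tau> i = \<tau> j" using assms by (auto simp: inj_on_def)
  then have "(\<Prod>j\<in>{..<k}-{i}. \<tau> i - \<tau> j) = 0" by (intro prod_zero bexI[of _ j]) auto
  with \<open>i < k\<close> show ?thesis unfolding diff_prod_def
    by - (rule prod_zero[OF finite_lessThan], rule bexI[of _ i], simp_all only: lessThan_iff)
qed

lemma diff_prod_bij_betw:
  assumes bij: "bij_betw \<tau> {..<k} A"
  shows "diff_prod k \<tau> = (\<Prod>a\<in>A. \<Prod>b\<in>A-{a}. a - b)"
proof -
  have "(\<Prod>j\<in>{..<k}-{i}. \<tau> i - \<tau> j) = (\<Prod>b\<in>A-{\<tau> i}. \<tau> i - b)" if "i < k" for i
  proof -
    have "bij_betw \<tau> ({..<k} - {i}) (A - {\<tau> i})"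
      using that bij_betwE[OF bij] by (intro bij_betw_DiffI[OF bij]) (auto simp: bij_betw_def)
    from prod.reindex_bij_betw[OF this, of "\<lambda>b. \<tau> i - b"] show ?thesis .
  qed
  then have "diff_prod k \<tau> = (\<Prod>i<k. \<Prod>b\<in>A-{\<tau> i}. \<tau> i - b)" by (simp add: diff_prod_def)
  also have "\<dots> = (\<Prod>a\<in>A. \<Prod>b\<in>A-{a}. a - b)"
    by (rule prod.reindex_bij_betw[OF bij])
  finally show ?thesis .
qed

context root_family
begin

text \<open>For \<open>k\<close> the number of distinct roots this is, up to a nonzero factor, the discriminant of the
  square-free part of \<open>f t\<close>; for larger \<open>k\<close> it vanishes. Being a polynomial in the power sums, it
  depends holomorphically on the parameter, although the number of roots may jump.\<close>

definition discriminant :: "nat \<Rightarrow> 'a \<Rightarrow> complex" where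
  "discriminant k t = (\<Sum>\<tau>\<in>{..<k} \<rightarrow>\<^sub>E roots t. (\<Prod>i<k. of_int (zorder (f t) (\<tau> i))) * diff_prod k \<tau>)"

lemma discriminant_eq_power_sums:
  "\<exists>L. \<forall>t\<in>T. discriminant k t = (\<Sum>(c,\<alpha>)\<leftarrow>L. c * (\<Prod>i<k. power_sum (\<alpha> i) t))"
proof -
  obtain L where L: "\<And>\<tau>. diff_prod k \<tau> = (\<Sum>(c,\<alpha>)\<leftarrow>L. c * (\<Prod>i<k. \<tau> i ^ \<alpha> i))"
    using polynomial_in_diff_prod[of k] unfolding polynomial_in_def by blast
  have "discriminant k t = (\<Sum>(c,\<alpha>)\<leftarrow>L. c * (\<Prod>i<k. power_sum (\<alpha> i) t))" if t: "t \<in> T" for t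
  proof -
    let ?P = "{..<k} \<rightarrow>\<^sub>E roots t" and ?m = "\<lambda>p. complex_of_int (zorder (f t) p)"
    have "discriminant k t = (\<Sum>\<tau>\<in>?P. \<Sum>(c,\<alpha>)\<leftarrow>L. c * (\<Prod>i<k. ?m (\<tau> i) * \<tau> i ^ \<alpha> i))"
      unfolding discriminant_def L
      by (intro sum.cong refl, induction L) (auto simp: algebra_simps prod.distrib)
    also have "\<dots> = (\<Sum>(c,\<alpha>)\<leftarrow>L. \<Sum>\<tau>\<in>?P. c * (\<Prod>i<k. ?m (\<tau> i) * \<tau> i ^ \<alpha> i))"
      by (induction L) (auto simp: sum.distrib)
    also have "\<dots> = (\<Sum>(c,\<alpha>)\<leftarrow>L. c * (\<Prod>i<k. power_sum (\<alpha> i) t))"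
      unfolding power_sum_def using finite_roots[OF t]
      by (intro arg_cong[where f = sum_list] map_cong refl) (auto simp: prod_sum_PiE sum_distrib_left)
    finally show ?thesis .
  qed
  then show ?thesis by blast
qed

lemma discriminant_eq_0:
  assumes t: "t \<in> T" and few: "card (roots t) < k" shows "discriminant k t = 0"
  unfolding discriminant_def
proof (rule sum.neutral, intro ballI)
  fix \<tau> assume \<tau>: "\<tau> \<in> {..<k} \<rightarrow>\<^sub>E roots t"
  have "\<not> inj_on \<tau> {..<k}"
    using card_inj_on_le[of \<tau> "{..<k}" "roots t"] \<tau> finite_roots[OF t] few by auto
  then show "(\<Prod>i<k. of_int (zorder (f t) (\<tau> i))) * diff_prod k \<tau> = 0" by (simp add: diff_prod_eq_0)
qed

lemma discriminant_card_roots: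
  assumes t: "t \<in> T" shows "discriminant (card (roots t)) t \<noteq> 0"
proof -
  let ?R = "roots t" and ?e = "card (roots t)"
  let ?P = "{..<?e} \<rightarrow>\<^sub>E ?R"
  define W :: complex where "W = (\<Prod>a\<in>?R. of_int (zorder (f t) a)) * (\<Prod>a\<in>?R. \<Prod>b\<in>?R-{a}. a - b)"
  have finite: "finite ?R" by (rule finite_roots[OF t])
  then have finP: "finite ?P" by (intro finite_PiE) auto
  let ?I = "{\<tau> \<in> ?P. inj_on \<tau> {..<?e}}"
  have bij: "bij_betw \<tau> {..<?e} ?R" if "\<tau> \<in> ?I" for \<tau>
    using that finite card_subset_eq[of ?R "\<tau> ` {..<?e}"] by (auto simp: bij_betw_def card_image)
  have "discriminant ?e t = (\<Sum>\<tau>\<in>?I. (\<Prod>i<?e. of_int (zorder (f t) (\<tau> i))) * diff_prod ?e \<tau>)"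
    unfolding discriminant_def
    by (rule sum.mono_neutral_right[OF finP]) (auto simp: diff_prod_eq_0)
  also have "\<dots> = (\<Sum>\<tau>\<in>?I. W)"
  proof (rule sum.cong[OF refl])
    fix \<tau> assume "\<tau> \<in> ?I"
    note bij = bij[OF this]
    show "(\<Prod>i<?e. of_int (zorder (f t) (\<tau> i))) * diff_prod ?e \<tau> = W"
      unfolding W_def diff_prod_bij_betw[OF bij]
      using prod.reindex_bij_betw[OF bij, of "\<lambda>a. of_int (zorder (f t) a) :: complex"] by simp
  qed
  finally have rescaled: "discriminant ?e t = of_nat (card ?I) * W" by simp
  obtain h where h: "bij_betw h {..<?e} ?R"
    using ex_bij_betw_nat_finite[OF finite] by (auto simp: atLeast0LessThan)
  then have "restrict h {..<?e} \<in> ?I"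
    using bij_betwE[OF h] bij_betw_imp_inj_on[OF h] by (simp add: restrict_PiE_iff inj_on_restrict_eq)
  then have "?I \<noteq> {}" by blast
  moreover have "finite ?I" by (rule finite_subset[OF _ finP]) blast
  ultimately have "card ?I \<noteq> 0" by (simp only: card_0_eq not_False_eq_True)
  moreover have "W \<noteq> 0" unfolding W_def using finite zorder_pos[OF t] by fastforce
  ultimately show ?thesis using rescaled by simp
qed

lemma card_roots_eqI:
  assumes "t \<in> T" "\<And>k. e < k \<Longrightarrow> discriminant k t = 0" "discriminant e t \<noteq> 0"
  shows "card (roots t) = e"
  using discriminant_card_roots[OF assms(1)] discriminant_eq_0[OF assms(1)] assms(2,3) by (metis linorder_neqE_nat)

end

subsection \<open>Continuous sections of the roots\<close>

locale root_family_const = root_family T f \<rho> R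
  for T :: "'a::real_normed_vector set" and f \<rho> R +
  fixes e :: nat
  assumes card_roots: "\<And>t. t \<in> T \<Longrightarrow> card (roots t) = e"

lemma root_family_const_compose:
  assumes "root_family T f \<rho> R" "continuous_on S u" "u ` S \<subseteq> T"
    and "\<And>s. s \<in> S \<Longrightarrow> card {z. cmod z < \<rho> \<and> f (u s) z = 0} = e"
  shows "root_family_const S (\<lambda>s. f (u s)) \<rho> R e"
proof -
  interpret root_family S "\<lambda>s. f (u s)" \<rho> R using root_family_compose[OF assms(1-3)] .
  show ?thesis by unfold_locales (use assms(4) in \<open>simp add: roots_def\<close>)
qed

context root_family_const
begin

definition separates :: "real \<Rightarrow> 'a \<Rightarrow> bool" where
  "separates \<kappa> t \<longleftrightarrow> 0 < \<kappa> \<and> (\<forall>z\<in>roots t. \<forall>z'\<in>roots t. z \<noteq> z' \<longrightarrow> 2 * \<kappa> < dist z z')"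

lemma separatesD:
  assumes "separates \<kappa> t" "z \<in> roots t" "z' \<in> roots t" "u \<in> ball z \<kappa>" "u \<in> ball z' \<kappa>"
  shows "z = z'"
proof (rule ccontr)
  assume "z \<noteq> z'"
  then have "2 * \<kappa> < dist z z'" using assms by (simp add: separates_def)
  moreover have "dist z z' \<le> dist z u + dist z' u" by (metis dist_commute dist_triangle)
  ultimately show False using assms(4,5) by simp
qed

lemma separating_radius:
  assumes t: "t \<in> T" and \<epsilon>: "0 < \<epsilon>"
  obtains \<kappa> where "separates \<kappa> t" "\<kappa> < \<epsilon>"
proof -
  let ?D = "(\<lambda>(z,z'). dist z z') ` (roots t \<times> roots t - Id)"
  have finite: "finite (insert \<epsilon> ?D)" using finite_roots[OF t] by auto
  define \<kappa> where "\<kappa> = Min (insert \<epsilon> ?D) / 3"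
  have "0 < \<kappa>" unfolding \<kappa>_def using \<epsilon> finite by (subst zero_less_divide_iff, subst Min_gr_iff) auto
  moreover have "3 * \<kappa> \<le> dist z z'" if "z \<in> roots t" "z' \<in> roots t" "z \<noteq> z'" for z z'
    unfolding \<kappa>_def using that by (simp, intro Min_le[OF finite]) force
  moreover have "3 * \<kappa> \<le> \<epsilon>" unfolding \<kappa>_def using finite by simp
  ultimately have "separates \<kappa> t" "\<kappa> < \<epsilon>" by (force simp: separates_def)+
  then show ?thesis using that by blast
qed

lemma roots_cluster:
  assumes t0: "t0 \<in> T" and \<kappa>: "0 < \<kappa>"
  obtains d where "0 < d"
    "\<And>t u. t \<in> T \<Longrightarrow> dist t t0 < d \<Longrightarrow> u \<in> roots t \<Longrightarrow> \<exists>z\<in>roots t0. u \<in> ball z \<kappa>"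
    "\<And>t z. t \<in> T \<Longrightarrow> dist t t0 < d \<Longrightarrow> z \<in> roots t0 \<Longrightarrow> \<exists>u\<in>roots t. u \<in> ball z \<kappa>"
proof -
  obtain d1 where d1: "0 < d1" "\<And>t u. t \<in> T \<Longrightarrow> dist t t0 < d1 \<Longrightarrow> u \<in> roots t \<Longrightarrow> \<exists>z\<in>roots t0. u \<in> ball z \<kappa>"
    using roots_near[OF t0 \<kappa>] by blast
  have "\<exists>d>0. \<forall>t\<in>T. dist t t0 < d \<longrightarrow> (\<exists>u\<in>roots t. u \<in> ball z \<kappa>)" if "z \<in> roots t0" for z
    using root_persists[OF t0 that \<kappa>] by metis
  then obtain D where D: "\<And>z. z \<in> roots t0 \<Longrightarrow> 0 < D z"
    "\<And>z t. z \<in> roots t0 \<Longrightarrow> t \<in> T \<Longrightarrow> dist t t0 < D z \<Longrightarrow> \<exists>u\<in>roots t. u \<in> ball z \<kappa>" by metis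
  define d where "d = Min (insert d1 (D ` roots t0))"
  have d: "0 < d" "d \<le> d1" "\<And>z. z \<in> roots t0 \<Longrightarrow> d \<le> D z"
    using finite_roots[OF t0] d1(1) D(1) by (auto simp: d_def)
  show ?thesis
  proof (rule that[OF d(1)])
    show "\<exists>z\<in>roots t0. u \<in> ball z \<kappa>" if "t \<in> T" "dist t t0 < d" "u \<in> roots t" for t u
      using d1(2)[OF that(1) _ that(3)] that(2) d(2) by simp
    show "\<exists>u\<in>roots t. u \<in> ball z \<kappa>" if "t \<in> T" "dist t t0 < d" "z \<in> roots t0" for t z
      using D(2)[OF that(3,1)] that(2) d(3)[OF that(3)] by simp
  qed
qed

text \<open>Each root disc contains at least one root for nearby parameters, and there are exactly as many
  roots as discs; hence exactly one.\<close>

lemma unique_root_nearby: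
  assumes t0: "t0 \<in> T" and sep: "separates \<kappa> t0"
  obtains d where "0 < d"
    "\<And>t u. t \<in> T \<Longrightarrow> dist t t0 < d \<Longrightarrow> u \<in> roots t \<Longrightarrow> \<exists>z\<in>roots t0. u \<in> ball z \<kappa>"
    "\<And>t z. t \<in> T \<Longrightarrow> dist t t0 < d \<Longrightarrow> z \<in> roots t0 \<Longrightarrow> \<exists>!u. u \<in> roots t \<and> u \<in> ball z \<kappa>"
proof -
  have \<kappa>: "0 < \<kappa>" using sep by (simp add: separates_def)
  obtain d where d: "0 < d"
    "\<And>t u. t \<in> T \<Longrightarrow> dist t t0 < d \<Longrightarrow> u \<in> roots t \<Longrightarrow> \<exists>z\<in>roots t0. u \<in> ball z \<kappa>"
    "\<And>t z. t \<in> T \<Longrightarrow> dist t t0 < d \<Longrightarrow> z \<in> roots t0 \<Longrightarrow> \<exists>u\<in>roots t. u \<in> ball z \<kappa>"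
    by (rule roots_cluster[OF t0 \<kappa>]) (rule that)
  have "\<exists>!u. u \<in> roots t \<and> u \<in> ball z \<kappa>" if t: "t \<in> T" "dist t t0 < d" and z: "z \<in> roots t0" for t z
  proof -
    obtain r where r: "\<And>z. z \<in> roots t0 \<Longrightarrow> r z \<in> roots t \<and> r z \<in> ball z \<kappa>" using d(3)[OF t] by metis
    have "inj_on r (roots t0)" using r separatesD[OF sep] by (metis inj_onI)
    then have onto: "r ` roots t0 = roots t"
      using r finite_roots[OF t(1)] card_roots[OF t(1)] card_roots[OF t0]
      by (intro card_subset_eq) (auto simp: card_image)
    show ?thesis
    proof (rule ex1I[of _ "r z"])
      fix u assume u: "u \<in> roots t \<and> u \<in> ball z \<kappa>"
      then obtain z' where z': "z' \<in> roots t0" "u = r z'" using onto by blast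
      then have "z' = z" using r[OF z'(1)] u z separatesD[OF sep] by blast
      then show "u = r z" using z' by simp
    qed (use r z in blast)
  qed
  then show ?thesis using that d(1,2) by blast
qed

definition nearby_root :: "real \<Rightarrow> complex \<Rightarrow> 'a \<Rightarrow> complex" where
  "nearby_root \<kappa> z t = (THE u. u \<in> roots t \<and> u \<in> ball z \<kappa>)"

lemma nearby_root:
  assumes "\<exists>!u. u \<in> roots t \<and> u \<in> ball z \<kappa>"
  shows "nearby_root \<kappa> z t \<in> roots t" "nearby_root \<kappa> z t \<in> ball z \<kappa>"
    and "\<And>u. u \<in> roots t \<Longrightarrow> u \<in> ball z \<kappa> \<Longrightarrow> u = nearby_root \<kappa> z t"
  using theI'[OF assms] assms unfolding nearby_root_def by blast+

lemma continuous_on_nearby_root: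
  assumes V: "V \<subseteq> T" and uniq: "\<And>t. t \<in> V \<Longrightarrow> \<exists>!u. u \<in> roots t \<and> u \<in> ball z \<kappa>"
  shows "continuous_on V (nearby_root \<kappa> z)"
  unfolding continuous_on_iff
proof (intro ballI allI impI)
  fix t1 and \<epsilon> :: real assume t1: "t1 \<in> V" and \<epsilon>: "0 < \<epsilon>"
  let ?r = "nearby_root \<kappa> z"
  define \<eta> where "\<eta> = min \<epsilon> (\<kappa> - dist z (?r t1))"
  have \<eta>: "0 < \<eta>" using nearby_root(2)[OF uniq[OF t1]] \<epsilon> by (auto simp: \<eta>_def)
  obtain d where d: "0 < d" "\<And>t. t \<in> T \<Longrightarrow> dist t t1 < d \<Longrightarrow> \<exists>u\<in>roots t. u \<in> ball (?r t1) \<eta>"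
    using root_persists[OF _ nearby_root(1)[OF uniq[OF t1]] \<eta>] t1 V by blast
  have "dist (?r t) (?r t1) < \<epsilon>" if t: "t \<in> V" "dist t t1 < d" for t
  proof -
    obtain u where u: "u \<in> roots t" "dist (?r t1) u < \<eta>" using d(2)[of t] t V by auto
    have "dist z u \<le> dist z (?r t1) + dist (?r t1) u" by (rule dist_triangle)
    then have "u \<in> ball z \<kappa>" using u(2) by (simp add: \<eta>_def)
    then have "u = ?r t" using nearby_root(3)[OF uniq[OF t(1)] u(1)] by blast
    then show ?thesis using u(2) by (simp add: \<eta>_def dist_commute)
  qed
  then show "\<exists>d>0. \<forall>t\<in>V. dist t t1 < d \<longrightarrow> dist (?r t) (?r t1) < \<epsilon>" using d(1) by blast
qed

definition total :: "('a \<times> complex) set" where "total = {(t,z). t \<in> T \<and> z \<in> roots t}"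

definition sheet :: "'a set \<Rightarrow> real \<Rightarrow> complex \<Rightarrow> ('a \<times> complex) set" where
  "sheet V \<kappa> z = {(t,u). t \<in> V \<and> u \<in> roots t \<and> u \<in> ball z \<kappa>}"

lemma homeomorphism_sheet:
  assumes V: "V \<subseteq> T" and uniq: "\<And>t. t \<in> V \<Longrightarrow> \<exists>!u. u \<in> roots t \<and> u \<in> ball z \<kappa>"
  shows "homeomorphism (sheet V \<kappa> z) V fst (\<lambda>t. (t, nearby_root \<kappa> z t))"
proof (rule homeomorphismI)
  show "continuous_on V (\<lambda>t. (t, nearby_root \<kappa> z t))"
    by (intro continuous_intros continuous_on_nearby_root assms)
  show "(\<lambda>t. (t, nearby_root \<kappa> z t)) ` V \<subseteq> sheet V \<kappa> z"
    using nearby_root(1,2)[OF uniq] by (force simp: sheet_def)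
  show "(fst x, nearby_root \<kappa> z (fst x)) = x" if "x \<in> sheet V \<kappa> z" for x
    using that nearby_root(3)[OF uniq] by (force simp: sheet_def)
qed (auto simp: sheet_def intro!: continuous_intros)

lemma evenly_covered:
  assumes t0: "t0 \<in> T"
  shows "\<exists>V. t0 \<in> V \<and> openin (top_of_set T) V \<and>
      (\<exists>v. \<Union> v = total \<inter> fst -` V \<and> (\<forall>u\<in>v. openin (top_of_set total) u) \<and> pairwise disjnt v \<and>
          (\<forall>u\<in>v. \<exists>q. homeomorphism u V fst q))"
proof -
  obtain \<kappa> where sep: "separates \<kappa> t0" using separating_radius[OF t0 zero_less_one] .
  obtain d where d: "0 < d"
    "\<And>t u. t \<in> T \<Longrightarrow> dist t t0 < d \<Longrightarrow> u \<in> roots t \<Longrightarrow> \<exists>z\<in>roots t0. u \<in> ball z \<kappa>"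
    "\<And>t z. t \<in> T \<Longrightarrow> dist t t0 < d \<Longrightarrow> z \<in> roots t0 \<Longrightarrow> \<exists>!u. u \<in> roots t \<and> u \<in> ball z \<kappa>"
    by (rule unique_root_nearby[OF t0 sep]) (rule that)
  define V where "V = T \<inter> ball t0 d"
  have V: "t \<in> V \<longleftrightarrow> t \<in> T \<and> dist t t0 < d" for t by (auto simp: V_def dist_commute)
  show ?thesis
  proof (intro exI[of _ V] conjI exI[of _ "sheet V \<kappa> ` roots t0"] ballI)
    show "t0 \<in> V" using t0 d(1) by (simp add: V)
    show "openin (top_of_set T) V" unfolding V_def by (intro openin_open_Int) auto
    show "\<Union> (sheet V \<kappa> ` roots t0) = total \<inter> fst -` V"
      using d(2) by (auto simp: sheet_def total_def V)
    show "pairwise disjnt (sheet V \<kappa> ` roots t0)"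
      using separatesD[OF sep] by (fastforce simp: pairwise_def disjnt_iff sheet_def)
    fix s assume "s \<in> sheet V \<kappa> ` roots t0"
    then obtain z where z: "z \<in> roots t0" "s = sheet V \<kappa> z" by auto
    have "s = total \<inter> (ball t0 d \<times> ball z \<kappa>)"
      by (auto simp: z sheet_def total_def V_def)
    then show "openin (top_of_set total) s"
      by (metis openin_open_Int open_Times open_ball)
    show "\<exists>q. homeomorphism s V fst q"
      unfolding z(2) using homeomorphism_sheet[of V z \<kappa>] d(3) z(1) V by blast
  qed
qed

lemma covering_space_total:
  assumes "0 < e" shows "covering_space total fst T"
  unfolding covering_space_def
proof (intro conjI ballI)
  have "\<exists>z. z \<in> roots t" if "t \<in> T" for t
    using card_roots[OF that] assms by (metis card.empty ex_in_conv less_numeral_extra(3))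
  then show "fst ` total = T" by (auto simp: total_def image_iff)
qed (auto intro: continuous_intros evenly_covered)

lemma roots_pos: "t \<in> T \<Longrightarrow> z \<in> roots t \<Longrightarrow> 0 < e"
  using card_roots finite_roots by (metis card_gt_0_iff empty_iff)

lemma section_exists:
  assumes "convex T" "t0 \<in> T" "z0 \<in> roots t0"
  obtains g where "root_section g" "g t0 = z0"
proof -
  obtain g where g: "continuous_on T g" "g \<in> T \<rightarrow> total" "g t0 = (t0,z0)" "\<And>y. y \<in> T \<Longrightarrow> fst (g y) = y"
  proof (rule covering_space_lift_strong[OF covering_space_total[OF roots_pos], of t0 z0 "(t0,z0)" t0 T "\<lambda>t. t"])
    show "simply_connected T" using assms(1) by (rule convex_imp_simply_connected)
    show "locally path_connected T" using assms(1) by (rule convex_imp_locally_path_connected)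
  qed (use assms in \<open>auto simp: total_def\<close>)
  have "continuous_on T (\<lambda>t. snd (g t))" using g(1) by (intro continuous_intros)
  moreover have "snd (g t) \<in> roots t" if "t \<in> T" for t
    using g(2,4) that by (auto simp: total_def Pi_iff split_beta)
  ultimately show ?thesis using that[of "\<lambda>t. snd (g t)"] g(3) by (simp add: root_section_def)
qed

lemma section_unique:
  assumes conn: "connected T" and g: "root_section g" and h: "root_section h"
    and a: "a \<in> T" "g a = h a" and t: "t \<in> T"
  shows "g t = h t"
proof -
  have "0 < e" using roots_pos[OF a(1)] g a(1) by (auto simp: root_section_def)
  then have "(t, g t) = (t, h t)"
    by (rule covering_space_lift_unique[OF covering_space_total, of "\<lambda>t. (t, g t)" a "\<lambda>t. (t, h t)" T "\<lambda>t. t"])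
      (use assms in \<open>auto simp: root_section_def total_def intro!: continuous_intros\<close>)
  then show ?thesis by simp
qed

text \<open>Isolating the root \<open>g t\<close> by a small circle, it is the quotient of the first two power sums.\<close>

lemma section_local_family:
  assumes g: "root_section g" and t0: "t0 \<in> T"
  obtains d \<kappa> where "0 < d" "0 < \<kappa>"
    "\<And>S. S \<subseteq> T \<inter> ball t0 d \<Longrightarrow> root_family S (\<lambda>t z. f t (g t0 + z)) \<kappa> (R - cmod (g t0))"
    "\<And>t z. t \<in> T \<inter> ball t0 d \<Longrightarrow> g t \<in> ball (g t0) \<kappa> \<Longrightarrow> cmod z < \<kappa> \<and> f t (g t0 + z) = 0 \<longleftrightarrow> z = g t - g t0"
proof -
  have g0: "g t0 \<in> roots t0" using g t0 by (simp add: root_section_def)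
  then have "0 < \<rho> - cmod (g t0)" by (simp add: roots_def)
  from separating_radius[OF t0 this] obtain \<kappa> where sep: "separates \<kappa> t0" and \<kappa>_lt: "\<kappa> < \<rho> - cmod (g t0)" .
  have \<kappa>: "0 < \<kappa>" "cmod (g t0) + \<kappa> < \<rho>" using sep \<kappa>_lt by (auto simp: separates_def)
  have inside: "cmod z < \<rho>" if "dist (g t0) z \<le> \<kappa>" for z
    using that \<kappa>(2) norm_triangle_ineq2[of z "g t0"] by (simp add: dist_norm norm_minus_commute)
  have "f t0 z \<noteq> 0" if "dist (g t0) z = \<kappa>" for z
    using that sep g0 inside[of z] \<kappa>(1) by (force simp: separates_def roots_def)
  moreover have "continuous_on (T \<times> sphere (g t0) \<kappa>) (\<lambda>(t,z). f t z)"
    using inside \<rho> by (intro continuous_on_subset[OF cont]) fastforce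
  ultimately obtain d1 where d1: "0 < d1" "\<And>t z. t \<in> T \<Longrightarrow> dist t t0 < d1 \<Longrightarrow> z \<in> sphere (g t0) \<kappa> \<Longrightarrow> f t z \<noteq> 0"
    using nonvanishing_near[OF _ compact_sphere t0, of "g t0" \<kappa> f] by auto
  obtain d2 where d2: "0 < d2" "\<And>t z. t \<in> T \<Longrightarrow> dist t t0 < d2 \<Longrightarrow> z \<in> roots t0 \<Longrightarrow> \<exists>!u. u \<in> roots t \<and> u \<in> ball z \<kappa>"
    by (rule unique_root_nearby[OF t0 sep]) (rule that)
  have family: "root_family S (\<lambda>t z. f t (g t0 + z)) \<kappa> (R - cmod (g t0))" if S: "S \<subseteq> T \<inter> ball t0 (min d1 d2)" for S
  proof (rule root_family_shift)
    show "f t z \<noteq> 0" if "t \<in> S" "dist (g t0) z = \<kappa>" for t z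
      using d1(2)[of t z] subsetD[OF S that(1)] that(2) by (auto simp: dist_commute)
  qed (use S \<kappa> \<rho> in auto)
  have root_iff: "cmod z < \<kappa> \<and> f t (g t0 + z) = 0 \<longleftrightarrow> z = g t - g t0"
    if t: "t \<in> T \<inter> ball t0 (min d1 d2)" and gt: "g t \<in> ball (g t0) \<kappa>" for t z
  proof -
    have "cmod z < \<kappa> \<and> f t (g t0 + z) = 0 \<longleftrightarrow> g t0 + z \<in> roots t \<and> g t0 + z \<in> ball (g t0) \<kappa>"
      using inside[of "g t0 + z"] by (auto simp: roots_def dist_norm)
    also have "\<dots> \<longleftrightarrow> g t0 + z = g t"
      using d2(2)[of t "g t0"] t gt g0 g by (auto simp: dist_commute root_section_def)
    finally show ?thesis by (auto simp: algebra_simps)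
  qed
  show ?thesis
    by (rule that[of "min d1 d2", OF _ \<kappa>(1) family root_iff]) (use d1(1) d2(1) in auto)
qed

end

lemma section_subfamily:
  assumes F: "root_family_const T f \<rho> R e" and G: "root_family_const T g \<rho> R e'"
    and sub: "\<And>t z. t \<in> T \<Longrightarrow> g t z = 0 \<Longrightarrow> f t z = 0" and "convex T"
    and y: "root_family.root_section T f \<rho> y"
    and a: "a \<in> T" "g a (y a) = 0" and t: "t \<in> T"
  shows "g t (y t) = 0"
proof -
  interpret F: root_family_const T f \<rho> R e by fact
  interpret G: root_family_const T g \<rho> R e' by fact
  have "y a \<in> G.roots a" using a y by (auto simp: G.roots_def F.root_section_def F.roots_def)
  from G.section_exists[OF \<open>convex T\<close> a(1) this] obtain k where k: "G.root_section k" "k a = y a" .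
  have "k t = y t"
    by (rule F.section_unique[OF convex_connected[OF \<open>convex T\<close>], of k y a t])
      (use k a t y sub in \<open>auto simp: G.roots_def F.roots_def G.root_section_def F.root_section_def\<close>)
  then show ?thesis using k(1) t by (auto simp: G.roots_def G.root_section_def)
qed

lemma section_holomorphic:
  assumes family: "root_family_const T f \<rho> R e" and T: "open T"
    and h: "\<And>z. z \<in> ball 0 R \<Longrightarrow> (\<lambda>w. f w z) holomorphic_on T"
    and g: "root_family.root_section T f \<rho> g"
  shows "g holomorphic_on T"
proof -
  interpret root_family_const T f \<rho> R e by fact
  have "\<exists>S. open S \<and> t0 \<in> S \<and> g holomorphic_on S" if t0: "t0 \<in> T" for t0
  proof -
    obtain d \<kappa> where d: "0 < d" "0 < \<kappa>"
      and local_family: "\<And>S. S \<subseteq> T \<inter> ball t0 d \<Longrightarrow> root_family S (\<lambda>t z. f t (g t0 + z)) \<kappa> (R - cmod (g t0))"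
      and root_iff: "\<And>t z. t \<in> T \<inter> ball t0 d \<Longrightarrow> g t \<in> ball (g t0) \<kappa> \<Longrightarrow> cmod z < \<kappa> \<and> f t (g t0 + z) = 0 \<longleftrightarrow> z = g t - g t0"
      using section_local_family[OF g t0] by blast
    define S where "S = (T \<inter> g -` ball (g t0) \<kappa>) \<inter> ball t0 d"
    have S: "open S" "t0 \<in> S" "S \<subseteq> T"
      using continuous_open_preimage[of T g "ball (g t0) \<kappa>"] g T t0 d by (auto simp: S_def root_section_def)
    interpret L: root_family S "\<lambda>t z. f t (g t0 + z)" \<kappa> "R - cmod (g t0)" by (rule local_family) (auto simp: S_def)
    have single: "L.roots t = {g t - g t0}" if "t \<in> S" for t
      using root_iff[of t] that by (auto simp: S_def L.roots_def)
    have hol_sum: "L.power_sum a holomorphic_on S" for a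
    proof (rule L.power_sum_holomorphic[of S "\<lambda>w. w" a])
      show "(\<lambda>w. f w (g t0 + z)) holomorphic_on S" if "z \<in> ball 0 (R - cmod (g t0))" for z
        using h[of "g t0 + z"] S(3) norm_triangle_ineq[of "g t0" z] that by (auto intro: holomorphic_on_subset)
    qed (use S in auto)
    have "L.power_sum 0 t \<noteq> 0" if "t \<in> S" for t
      using L.zorder_pos[OF that] single[OF that] by (simp add: L.power_sum_def)
    then have "(\<lambda>t. g t0 + L.power_sum 1 t / L.power_sum 0 t) holomorphic_on S"
      by (intro holomorphic_intros hol_sum)
    then have "g holomorphic_on S"
      by (rule holomorphic_transform) (simp add: L.unique_root_eq_power_sum_ratio[OF _ single] del: One_nat_def)
    then show ?thesis using S by blast
  qed
  then show ?thesis
    by (metis (no_types) field_differentiable_at_within holomorphic_onI holomorphic_on_imp_differentiable_at)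
qed

subsection \<open>Puiseux parametrisations\<close>

definition turn :: "nat \<Rightarrow> complex" where
  "turn n = of_nat n * (2 * of_real pi * \<i>)"

lemma turn_add: "turn (m + n) = turn m + turn n"
  by (simp add: turn_def algebra_simps)

lemma Re_turn [simp]: "Re (turn n) = 0"
  by (simp add: turn_def)

lemma exp_add_turn [simp]: "exp (w + turn n) = exp w"
  by (simp add: turn_def exp_add exp_of_nat_mult)

lemma turn_periodic:
  assumes periodic: "\<And>w. Re w < c \<Longrightarrow> h (w + turn 1) = h w"
    and w: "Re w' < c" "exp w = exp w'"
  shows "h w = h w'"
proof -
  have per_nat: "h (w + turn n) = h w" if "Re w < c" for w n
  proof (induction n)
    case (Suc n)
    then show ?case using periodic[of "w + turn n"] that by (simp add: turn_def algebra_simps)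
  qed (simp add: turn_def)
  obtain n :: int where n: "w = w' + of_int (2 * n) * pi * \<i>" using w(2) exp_eq by auto
  show ?thesis
  proof (cases "n \<ge> 0")
    case True
    then have "w = w' + turn (nat n)" by (simp add: n turn_def of_nat_nat)
    then show ?thesis using per_nat[OF w(1)] by simp
  next
    case False
    then have "w' = w + turn (nat (- n))" by (simp add: n turn_def of_nat_nat)
    moreover have "Re w < c" using w(1) n by simp
    ultimately show ?thesis using per_nat by metis
  qed
qed

lemma Re_Ln_less: "\<sigma> \<noteq> 0 \<Longrightarrow> cmod \<sigma> < exp c \<Longrightarrow> Re (Ln \<sigma>) < c"
  by (metis Re_Ln exp_gt_zero ln_exp ln_less_cancel_iff zero_less_norm_iff)

lemma descend_through_exp:
  assumes h: "h holomorphic_on {w. Re w < c}" and periodic: "\<And>w. Re w < c \<Longrightarrow> h (w + turn 1) = h w"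
  obtains Y where "Y holomorphic_on ball 0 (exp c) - {0}" "\<And>w. Re w < c \<Longrightarrow> Y (exp w) = h w"
proof -
  define Y where "Y \<sigma> = h (Ln \<sigma>)" for \<sigma>
  have Yexp: "Y (exp w) = h w" if "Re w < c" for w
    unfolding Y_def by (rule turn_periodic[where h = h and c = c]) (use periodic that in auto)
  define slit where "slit c' = {\<sigma> \<in> ball 0 (exp c). \<sigma> / c' \<notin> \<real>\<^sub>\<le>\<^sub>0}" for c' :: complex
  have "Y holomorphic_on slit c'" if c': "c' \<in> {1, -1}" for c'
  proof (rule holomorphic_transform[where f = "\<lambda>\<sigma>. h (Ln (\<sigma> / c') + Ln c')"])
    have log: "exp (Ln (\<sigma> / c') + Ln c') = \<sigma>" "Re (Ln (\<sigma> / c') + Ln c') < c" if "\<sigma> \<in> slit c'" for \<sigma>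
    proof -
      have "\<sigma> \<noteq> 0" using that by (auto simp: slit_def)
      then show "exp (Ln (\<sigma> / c') + Ln c') = \<sigma>" "Re (Ln (\<sigma> / c') + Ln c') < c"
        using that c' Re_Ln_less[of "\<sigma> / c'" c] by (auto simp: slit_def exp_add)
    qed
    show "(\<lambda>\<sigma>. h (Ln (\<sigma> / c') + Ln c')) holomorphic_on slit c'"
    proof (rule holomorphic_on_compose2[OF h])
      show "(\<lambda>\<sigma>. Ln (\<sigma> / c') + Ln c') holomorphic_on slit c'"
        using c' by (auto simp: slit_def intro!: holomorphic_intros)
    qed (use log(2) in blast)
    show "h (Ln (\<sigma> / c') + Ln c') = Y \<sigma>" if "\<sigma> \<in> slit c'" for \<sigma>
      using Yexp[OF log(2)[OF that]] log(1)[OF that] by simp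
  qed
  moreover have "open (slit c')" if "c' \<in> {1, -1}" for c'
  proof -
    have "slit c' = ball 0 (exp c) \<inter> (\<lambda>\<sigma>. \<sigma> / c') -` (- \<real>\<^sub>\<le>\<^sub>0)" by (auto simp: slit_def)
    moreover have "continuous_on (ball 0 (exp c)) (\<lambda>\<sigma>. \<sigma> / c')" using that by (auto intro!: continuous_intros)
    ultimately show ?thesis
      by (simp add: continuous_open_preimage closed_nonpos_Reals_complex open_Compl)
  qed
  ultimately have "Y holomorphic_on (\<Union>c'\<in>{1,-1}. slit c')"
    by (intro holomorphic_on_UN_open)
  moreover have "ball 0 (exp c) - {0} \<subseteq> (\<Union>c'\<in>{1,-1}. slit c')"
    by (auto simp: slit_def complex_nonpos_Reals_iff complex_eq_iff)
  ultimately have "Y holomorphic_on ball 0 (exp c) - {0}" by (rule holomorphic_on_subset)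
  then show ?thesis using that Yexp by blast
qed

locale punctured_family = root_family "ball 0 s1" G \<rho> R
  for s1 :: real and G :: "complex \<Rightarrow> complex \<Rightarrow> complex" and \<rho> R +
  fixes e :: nat
  assumes s1: "0 < s1"
    and card_punctured: "\<And>s. s \<in> ball 0 s1 - {0} \<Longrightarrow> card (roots s) = e"
    and roots_0: "roots 0 \<subseteq> {0}"
    and holomorphic_parameter: "\<And>z. z \<in> ball 0 R \<Longrightarrow> (\<lambda>s. G s z) holomorphic_on ball 0 s1"
begin

abbreviation log_domain :: "complex set" where "log_domain \<equiv> {w. Re w < ln s1}"

lemma exp_log_domain: "w \<in> log_domain \<Longrightarrow> exp w \<in> ball 0 s1 - {0}"
  using s1 by simp (metis exp_less_mono exp_ln)

sublocale log: root_family_const log_domain "\<lambda>w. G (exp w)" \<rho> R e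
  by (rule root_family_const_compose[OF root_family_axioms])
    (use exp_log_domain card_punctured in \<open>auto simp: roots_def intro!: continuous_intros\<close>)

lemma log_roots [simp]: "log.roots w = roots (exp w)"
  by (simp add: log.roots_def roots_def)

lemma log_section_turn: "log.root_section g \<Longrightarrow> log.root_section (\<lambda>w. g (w + turn n))"
  by (auto simp: log.root_section_def intro!: continuous_intros elim!: continuous_on_compose2)
    (metis Re_turn add.right_neutral exp_add_turn plus_complex.sel(1))

lemma log_section_holomorphic:
  assumes "log.root_section g" shows "g holomorphic_on log_domain"
proof (rule section_holomorphic[OF log.root_family_const_axioms open_halfspace_Re_lt _ assms])
  show "(\<lambda>w. G (exp w) z) holomorphic_on log_domain" if "z \<in> ball 0 R" for z
    by (rule holomorphic_on_compose2[OF holomorphic_parameter[OF that] holomorphic_on_exp])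
      (use exp_log_domain in blast)
qed

lemma log_section_period:
  assumes g: "log.root_section g"
  obtains N where "0 < N" "\<And>w. w \<in> log_domain \<Longrightarrow> g (w + turn N) = g w"
    "\<And>M w. 0 < M \<Longrightarrow> M < N \<Longrightarrow> w \<in> log_domain \<Longrightarrow> g (w + turn M) \<noteq> g w"
proof -
  have conn: "connected log_domain" by (intro convex_connected convex_halfspace_Re_lt)
  define w0 :: complex where "w0 = of_real (ln s1 - 1)"
  have w0: "w0 \<in> log_domain" by (simp add: w0_def)
  have everywhere: "g (w + turn j) = g (w + turn k)"
    if "w' \<in> log_domain" "g (w' + turn j) = g (w' + turn k)" "w \<in> log_domain" for j k w w'
    using log.section_unique[OF conn log_section_turn[OF g] log_section_turn[OF g] that(1,2,3)] .
  define P where "P n \<longleftrightarrow> 0 < n \<and> (\<exists>w\<in>log_domain. g (w + turn n) = g w)" for n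
  have "\<not> inj_on (\<lambda>j. g (w0 + turn j)) {..e}"
  proof
    assume inj: "inj_on (\<lambda>j. g (w0 + turn j)) {..e}"
    have "card {..e} \<le> card (log.roots w0)"
      by (rule card_inj_on_le[OF inj _ log.finite_roots[OF w0]])
        (use log_section_turn[OF g] w0 in \<open>auto simp: log.root_section_def\<close>)
    then show False using log.card_roots[OF w0] by simp
  qed
  then obtain j k where jk: "j < k" "g (w0 + turn j) = g (w0 + turn k)"
    by (metis (mono_tags, lifting) inj_onI linorder_neqE_nat)
  then have "turn k = turn j + turn (k - j)" by (simp flip: turn_add)
  then have "g (w0 + turn j + turn (k - j)) = g (w0 + turn j)" using jk(2) by (simp add: add.assoc)
  then have "P (k - j)" using jk(1) w0 unfolding P_def by (intro conjI bexI[of _ "w0 + turn j"]) auto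
  then have "P (LEAST n. P n)" by (rule LeastI)
  then have "0 < (LEAST n. P n)" "g (w + turn (LEAST n. P n)) = g w" if "w \<in> log_domain" for w
    using everywhere[of _ "LEAST n. P n" 0 w] that by (auto simp: P_def turn_def)
  moreover have "g (w + turn M) \<noteq> g w" if "0 < M" "M < (LEAST n. P n)" "w \<in> log_domain" for M w
    using not_less_Least[OF that(2)] that(1,3) by (auto simp: P_def)
  ultimately show ?thesis using that w0 by metis
qed

definition puiseux :: "nat \<Rightarrow> (complex \<Rightarrow> complex) \<Rightarrow> bool" where
  "puiseux N Y \<longleftrightarrow> 0 < N \<and> Y holomorphic_on ball 0 (root N s1) \<and> Y 0 = 0 \<and>
      (\<forall>\<sigma>\<in>ball 0 (root N s1) - {0}. Y \<sigma> \<in> roots (\<sigma> ^ N) \<and> (even N \<longrightarrow> Y (- \<sigma>) \<noteq> Y \<sigma>))"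

lemma tendsto_roots_0:
  assumes N: "0 < N" and Y: "\<And>\<sigma>. \<sigma> \<in> ball 0 (root N s1) - {0} \<Longrightarrow> Y \<sigma> \<in> roots (\<sigma> ^ N)"
  shows "(Y \<longlongrightarrow> 0) (at 0)"
proof (rule tendstoI)
  fix \<epsilon> :: real assume "0 < \<epsilon>"
  then obtain d where d: "0 < d" "\<And>s u. s \<in> ball 0 s1 \<Longrightarrow> dist s 0 < d \<Longrightarrow> u \<in> roots s \<Longrightarrow> \<exists>z\<in>roots 0. u \<in> ball z \<epsilon>"
    using s1 by (rule_tac roots_near[of 0]) auto
  have small: "dist (Y \<sigma>) 0 < \<epsilon>" if "\<sigma> \<noteq> 0" "dist \<sigma> 0 < root N (min d s1)" for \<sigma>
  proof -
    have "cmod \<sigma> ^ N < root N (min d s1) ^ N" using that N by (intro power_strict_mono) auto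
    then have "cmod (\<sigma> ^ N) < min d s1" using N d(1) s1 by (simp add: norm_power)
    moreover have "root N (min d s1) \<le> root N s1" using N by simp
    ultimately show ?thesis using d(2)[of "\<sigma> ^ N" "Y \<sigma>"] Y[of \<sigma>] that roots_0 by auto
  qed
  show "\<forall>\<^sub>F \<sigma> in at 0. dist (Y \<sigma>) 0 < \<epsilon>"
    unfolding eventually_at using small N d(1) s1 by (intro exI[of _ "root N (min d s1)"]) auto
qed

lemma puiseux_of_section:
  assumes g: "log.root_section g"
  obtains N Y where "puiseux N Y" "\<And>w. Re w < ln s1 / N \<Longrightarrow> Y (exp w) = g (of_nat N * w)"
proof -
  obtain N where N: "0 < N" and periodic: "\<And>w. w \<in> log_domain \<Longrightarrow> g (w + turn N) = g w"
    and minimal: "\<And>M w. 0 < M \<Longrightarrow> M < N \<Longrightarrow> w \<in> log_domain \<Longrightarrow> g (w + turn M) \<noteq> g w"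
    by (rule log_section_period[OF g]) (rule that)
  let ?c = "ln s1 / N" and ?h = "\<lambda>w. g (of_nat N * w)"
  have dom: "of_nat N * w \<in> log_domain" if "Re w < ?c" for w using that N by (simp add: field_simps)
  have r: "exp ?c = root N s1" using N s1 by (metis exp_ln ln_root real_root_gt_zero)
  have hol_h: "?h holomorphic_on {w. Re w < ?c}"
    by (rule holomorphic_on_compose2[OF log_section_holomorphic[OF g]]) (use dom in \<open>auto intro!: holomorphic_intros\<close>)
  have per_h: "?h (w + turn 1) = ?h w" if "Re w < ?c" for w
    using periodic[OF dom[OF that]] by (simp add: turn_def algebra_simps)
  obtain Y where Y: "Y holomorphic_on ball 0 (root N s1) - {0}" "\<And>w. Re w < ?c \<Longrightarrow> Y (exp w) = ?h w"
    by (rule descend_through_exp[OF hol_h per_h, unfolded r]) (assumption, rule that)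
  define Z where "Z = Y(0 := 0)"
  have Zexp: "Z (exp w) = ?h w" if "Re w < ?c" for w using Y(2)[OF that] by (simp add: Z_def)
  have log: "Re (Ln \<sigma>) < ?c" "exp (Ln \<sigma>) = \<sigma>" if "\<sigma> \<in> ball 0 (root N s1) - {0}" for \<sigma>
    using that Re_Ln_less[of \<sigma> ?c] unfolding r by auto
  have Zroots: "Z \<sigma> \<in> roots (\<sigma> ^ N)" if \<sigma>: "\<sigma> \<in> ball 0 (root N s1) - {0}" for \<sigma>
  proof -
    have "?h (Ln \<sigma>) \<in> log.roots (of_nat N * Ln \<sigma>)"
      using g dom[OF log(1)[OF \<sigma>]] unfolding log.root_section_def by blast
    moreover have "exp (of_nat N * Ln \<sigma>) = \<sigma> ^ N" unfolding exp_of_nat_mult log(2)[OF \<sigma>] ..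
    ultimately show ?thesis using Zexp[OF log(1)[OF \<sigma>]] log(2)[OF \<sigma>] by simp
  qed
  have "Z holomorphic_on ball 0 (root N s1)"
  proof (rule no_isolated_singularity'[of "{0}"])
    have "Z 0 = 0" by (simp add: Z_def)
    then show "(Z \<longlongrightarrow> Z z) (at z within ball 0 (root N s1))" if "z \<in> {0}" for z
      using tendsto_roots_0[OF N Zroots] that by (auto intro: tendsto_within_subset)
    show "Z holomorphic_on ball 0 (root N s1) - {0}" by (rule holomorphic_transform[OF Y(1)]) (simp add: Z_def)
  qed auto
  moreover have "Z (- \<sigma>) \<noteq> Z \<sigma>" if \<sigma>: "\<sigma> \<in> ball 0 (root N s1) - {0}" and "even N" for \<sigma>
  proof -
    obtain M where M: "N = 2 * M" using \<open>even N\<close> by (auto elim: evenE)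
    have "Z (- \<sigma>) = Z (exp (Ln \<sigma> + \<i> * pi))" using \<sigma> by (simp add: exp_add)
    also have "\<dots> = ?h (Ln \<sigma> + \<i> * pi)" using log(1)[OF \<sigma>] by (intro Zexp) simp
    also have "of_nat N * (Ln \<sigma> + \<i> * pi) = of_nat N * Ln \<sigma> + turn M" by (simp add: M turn_def algebra_simps)
    finally show ?thesis using minimal[of M] M N Zexp[OF log(1)[OF \<sigma>]] dom[OF log(1)[OF \<sigma>]] log(2)[OF \<sigma>] by simp
  qed
  ultimately have "puiseux N Z" using N Zroots by (auto simp: puiseux_def Z_def)
  then show ?thesis using that Zexp by blast
qed

theorem puiseux_root:
  assumes s0: "0 < s0" "s0 < s1" and z0: "z0 \<in> roots (of_real s0)"
  obtains N Y where "puiseux N Y" "Y (of_real (root N s0)) = z0"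
proof -
  have exp_ln_of_real: "exp (of_real (ln x)) = complex_of_real x" if "0 < x" for x
    using that by (metis exp_ln exp_of_real)
  have "of_real (ln s0) \<in> log_domain" "z0 \<in> log.roots (of_real (ln s0))"
    using s0 z0 s1 by (auto simp: exp_ln_of_real)
  then obtain g where g: "log.root_section g" "g (of_real (ln s0)) = z0"
    using log.section_exists[OF convex_halfspace_Re_lt] by blast
  obtain N Y where Y: "puiseux N Y" "\<And>w. Re w < ln s1 / N \<Longrightarrow> Y (exp w) = g (of_nat N * w)"
    by (rule puiseux_of_section[OF g(1)]) (rule that)
  have N: "0 < N" using Y(1) by (simp add: puiseux_def)
  then have "ln s0 / N < ln s1 / N" using s0 s1 by (simp add: divide_strict_right_mono)
  moreover have "exp (of_real (ln s0 / N)) = complex_of_real (root N s0)"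
    using s0 N by (metis exp_ln_of_real ln_root real_root_gt_zero)
  ultimately have "Y (of_real (root N s0)) = z0" using Y(2)[of "of_real (ln s0 / N)"] g(2) N by simp
  then show ?thesis using that Y(1) by blast
qed

end

subsection \<open>Germs of real analytic functions\<close>

lemma analytic_continuation_reals:
  assumes f: "f holomorphic_on ball 0 r" and zero: "\<And>x::real. 0 < x \<Longrightarrow> x < r \<Longrightarrow> f (of_real x) = 0"
    and z: "z \<in> ball 0 r"
  shows "f z = 0"
proof -
  have r: "0 < r" using z by (metis ball_eq_empty empty_iff not_le)
  show ?thesis
  proof (rule analytic_continuation[OF f open_ball connected_ball, of "of_real ` {0<..<r}" "of_real (r/2)"])
    show "complex_of_real (r / 2) islimpt of_real ` {0<..<r}"
    proof (rule islimpt_isCont_image)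
      show "r / 2 islimpt {0<..<r}" using r by (intro interior_limit_point) simp
      show "\<forall>\<^sub>F y in at (r / 2). complex_of_real y \<noteq> complex_of_real (r / 2)"
        unfolding of_real_eq_iff by (simp add: eventually_at_filter)
    qed auto
  qed (use r z zero in auto)
qed

definition real_germ :: "real \<Rightarrow> (complex \<Rightarrow> complex) \<Rightarrow> bool" where
  "real_germ r Y \<longleftrightarrow> 0 < r \<and> Y holomorphic_on ball 0 r \<and> Y 0 = 0 \<and> (\<forall>s\<in>ball 0 r. Y (cnj s) = cnj (Y s))"

lemma real_germD:
  assumes "real_germ r Y"
  shows "0 < r" "Y holomorphic_on ball 0 r" "Y 0 = 0" "\<And>s. s \<in> ball 0 r \<Longrightarrow> Y (cnj s) = cnj (Y s)"
  using assms by (simp_all add: real_germ_def)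

lemma real_germI:
  assumes r: "0 < r" and Y: "Y holomorphic_on ball 0 r" "Y 0 = 0"
    and real: "\<And>x::real. 0 < x \<Longrightarrow> x < r \<Longrightarrow> Y (of_real x) \<in> \<real>"
  shows "real_germ r Y"
proof -
  have "(cnj \<circ> Y \<circ> cnj) holomorphic_on ball 0 r"
    by (rule holomorphic_on_compose_cnj_cnj) (auto intro!: holomorphic_on_subset[OF Y(1)])
  then have "(\<lambda>w. Y w - cnj (Y (cnj w))) holomorphic_on ball 0 r"
    by (intro holomorphic_intros Y) (simp add: o_def)
  then have "Y w - cnj (Y (cnj w)) = 0" if "w \<in> ball 0 r" for w
    by (rule analytic_continuation_reals[OF _ _ that]) (use real in \<open>simp add: Reals_cnj_iff\<close>)
  from this[of "cnj s" for s] show ?thesis using r Y by (simp add: real_germ_def)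
qed

lemma real_germ_of_real:
  assumes "real_germ r Y" "\<bar>x\<bar> < r" shows "Y (of_real x) = of_real (Re (Y (of_real x)))"
  using real_germD(4)[OF assms(1), of "of_real x"] assms(2) by (simp add: complex_eq_iff)

lemma real_germ_subset: "real_germ r Y \<Longrightarrow> 0 < r' \<Longrightarrow> r' \<le> r \<Longrightarrow> real_germ r' Y"
  by (auto simp: real_germ_def elim: holomorphic_on_subset)

lemma real_germ_add: "real_germ r Y \<Longrightarrow> real_germ r Z \<Longrightarrow> real_germ r (\<lambda>s. Y s + Z s)"
  and real_germ_diff: "real_germ r Y \<Longrightarrow> real_germ r Z \<Longrightarrow> real_germ r (\<lambda>s. Y s - Z s)"
  and real_germ_scale: "real_germ r Y \<Longrightarrow> real_germ r (\<lambda>s. of_real c * Y s)"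
  and real_germ_monomial: "0 < r \<Longrightarrow> 0 < n \<Longrightarrow> real_germ r (\<lambda>s. s ^ n)"
  by (auto simp: real_germ_def intro!: holomorphic_intros)

lemma real_germ_power:
  assumes Y: "real_germ r Y" and n: "0 < n" and r': "0 < r'" "r' ^ n \<le> r"
  shows "real_germ r' (\<lambda>s. Y (s ^ n))"
proof -
  have pow: "s ^ n \<in> ball 0 r" if "s \<in> ball 0 r'" for s :: complex
    using power_strict_mono[of "cmod s" r' n] that n r'(2) by (simp add: norm_power)
  have "(\<lambda>s. Y (s ^ n)) holomorphic_on ball 0 r'"
    by (rule holomorphic_on_compose2[OF real_germD(2)[OF Y]]) (use pow in \<open>auto intro!: holomorphic_intros\<close>)
  then show ?thesis
    using real_germD(3,4)[OF Y] pow n r'(1) by (simp add: real_germ_def zero_power flip: complex_cnj_power)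
qed

lemma real_germ_small:
  assumes Y: "real_germ r Y" and b: "0 < b"
  obtains r' where "0 < r'" "r' \<le> r" "\<And>s. s \<in> ball 0 r' \<Longrightarrow> cmod (Y s) < b"
proof -
  note germ = real_germD[OF Y]
  have "isCont Y 0" using holomorphic_on_imp_continuous_on[OF germ(2)] germ(1)
    by (intro continuous_on_interior[of "ball 0 r"]) auto
  then obtain d where "0 < d" "\<And>w. dist w 0 < d \<Longrightarrow> dist (Y w) (Y 0) < b"
    unfolding continuous_at_eps_delta using b by metis
  then show ?thesis using germ(1,3) by (intro that[of "min d r"]) auto
qed

lemma holomorphic_lower_bound:
  assumes d: "d holomorphic_on ball 0 r" and w: "w \<in> ball 0 r" "d w \<noteq> 0"
  obtains c n r' where "0 < c" "0 < r'" "r' \<le> r" "\<And>s. s \<in> ball 0 r' \<Longrightarrow> c * cmod s ^ n \<le> cmod (d s)"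
proof -
  define n where "n = nat (zorder d 0)"
  define g where "g = zor_poly d 0"
  have r: "0 < r" using w(1) by (metis ball_eq_empty empty_iff not_le)
  then have "0 \<in> ball (0::complex) r" by simp
  from conjunct2[OF zorder_exist_zero[OF d open_ball connected_ball this bexI[of _ w]]] w
  obtain q where q: "0 < q" "cball 0 q \<subseteq> ball (0::complex) r" "g holomorphic_on cball 0 q"
      "\<forall>s\<in>cball 0 q. d s = g s * s ^ n \<and> g s \<noteq> 0"
    unfolding n_def[symmetric] g_def[symmetric] diff_zero by auto
  have "continuous_on (cball 0 q) (\<lambda>s. cmod (g s))"
    by (intro continuous_on_norm holomorphic_on_imp_continuous_on q)
  then obtain s0 where s0: "s0 \<in> cball 0 q" "\<forall>s\<in>cball 0 q. cmod (g s0) \<le> cmod (g s)"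
    using continuous_attains_inf[OF compact_cball] q(1) by (metis ball_eq_empty cball_eq_empty not_less order.strict_implies_not_eq order_less_imp_le)
  have "complex_of_real q \<in> ball 0 r" using q(1,2) by (intro subsetD[OF q(2)]) auto
  then have "q \<le> r" using q(1) by simp
  moreover have "cmod (g s0) * cmod s ^ n \<le> cmod (d s)" if "s \<in> ball 0 q" for s
    using s0 q(4) that by (auto simp: norm_mult norm_power intro!: mult_right_mono)
  ultimately show ?thesis using that[of "cmod (g s0)" q n] s0(1) q(1,4) by auto
qed

lemma add_odd_monomial_not_even:
  assumes W: "W holomorphic_on ball 0 r" and r: "0 < r" and M: "odd M"
  obtains \<theta> :: real and r' where "0 < \<theta>" "\<theta> \<le> 1" "0 < r'" "r' \<le> r"
    "\<And>s. s \<in> ball 0 r' - {0} \<Longrightarrow> W (- s) + of_real \<theta> * (- s) ^ M \<noteq> W s + of_real \<theta> * s ^ M"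
proof -
  define D where "D \<theta> s = (W (- s) + of_real \<theta> * (- s) ^ M) - (W s + of_real \<theta> * s ^ M)" for \<theta> :: real and s
  let ?w = "complex_of_real (r/2)"
  have w: "?w \<in> ball 0 r" using r by simp
  have "(\<lambda>s. W (- s)) holomorphic_on ball 0 r"
    by (rule holomorphic_on_compose2[OF W]) (auto intro!: holomorphic_intros)
  then have holD: "D \<theta> holomorphic_on ball 0 r" for \<theta>
    unfolding D_def by (intro holomorphic_intros W)
  have "D 1 ?w - D (1/2) ?w = - (?w ^ M)" using M by (simp add: D_def algebra_simps)
  then have "D 1 ?w \<noteq> 0 \<or> D (1/2) ?w \<noteq> 0" using r by force
  then obtain \<theta> where \<theta>: "\<theta> \<in> {1/2, 1::real}" "D \<theta> ?w \<noteq> 0" by blast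
  have "0 \<in> ball (0::complex) r" using r by simp
  from non_zero_neighbour_alt[OF holD open_ball connected_ball this w \<theta>(2)]
  obtain d where "0 < d" "\<And>s. s \<noteq> 0 \<Longrightarrow> dist s 0 < d \<Longrightarrow> D \<theta> s \<noteq> 0"
    unfolding eventually_at by blast
  then show ?thesis using r \<theta>(1) by (intro that[of \<theta> "min d r"]) (auto simp: D_def)
qed

lemma odd_monomial_less:
  fixes s :: real
  assumes "0 < \<theta>" "\<theta> \<le> 1" "0 < s" "s \<le> 1" "s < b"
  shows "\<theta> * s ^ (2 * n + 1) < b * s ^ n"
proof -
  have "\<theta> * s ^ (2 * n + 1) \<le> s * (s ^ n * s ^ n)"
    using assms(1-3) by (simp add: power_add mult_2 mult_left_le_one_le)
  also have "\<dots> \<le> s * (s ^ n * 1)" using assms(3,4) by (intro mult_left_mono power_le_one) auto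
  also have "\<dots> < b * s ^ n" using assms(3,5) by simp
  finally show ?thesis .
qed

text \<open>The mean of the two germs, perturbed by an odd monomial of an order so high that it stays
  between them; the monomial makes it take different values at opposite parameters.\<close>

lemma real_germ_between:
  assumes L: "real_germ r L" and U: "real_germ r U"
    and less: "\<And>s. 0 < s \<Longrightarrow> s < r \<Longrightarrow> Re (L (of_real s)) < Re (U (of_real s))"
  obtains Y r' where "r' \<le> r" "real_germ r' Y"
    "\<And>s. 0 < s \<Longrightarrow> s < r' \<Longrightarrow> Re (L (of_real s)) < Re (Y (of_real s)) \<and> Re (Y (of_real s)) < Re (U (of_real s))"
    "\<And>s. s \<in> ball 0 r' - {0} \<Longrightarrow> Y (- s) \<noteq> Y s"
proof -
  have r: "0 < r" by (rule real_germD(1)[OF L])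
  define d where "d s = U s - L s" for s
  have d: "real_germ r d" unfolding d_def by (rule real_germ_diff[OF U L])
  have w: "complex_of_real (r/2) \<in> ball 0 r" "d (of_real (r/2)) \<noteq> 0"
    using less[of "r/2"] r by (auto simp: d_def complex_eq_iff)
  obtain c n r1 where c: "0 < c" "0 < r1" "r1 \<le> r" "\<And>s. s \<in> ball 0 r1 \<Longrightarrow> c * cmod s ^ n \<le> cmod (d s)"
    by (rule holomorphic_lower_bound[OF real_germD(2)[OF d] w]) (rule that)
  define W where "W s = of_real (1/2) * (L s + U s)" for s
  define M where "M = 2 * n + 1"
  have W: "real_germ r W" unfolding W_def by (intro real_germ_scale real_germ_add L U)
  obtain \<theta> :: real and r2 where \<theta>: "0 < \<theta>" "\<theta> \<le> 1" "0 < r2" "r2 \<le> r"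
    "\<And>s. s \<in> ball 0 r2 - {0} \<Longrightarrow> W (- s) + of_real \<theta> * (- s) ^ M \<noteq> W s + of_real \<theta> * s ^ M"
    using add_odd_monomial_not_even[OF real_germD(2)[OF W] r, of M] by (auto simp: M_def)
  define r' where "r' = Min {r1, r2, 1, c/2}"
  have r': "0 < r'" "r' \<le> r1" "r' \<le> r2" "r' \<le> 1" "r' \<le> c/2" using c \<theta> by (auto simp: r'_def)
  have Y: "real_germ r' (\<lambda>s. W s + of_real \<theta> * s ^ M)"
    using r' \<theta>(4) by (intro real_germ_subset[OF real_germ_add[OF W real_germ_scale[OF real_germ_monomial]] r'(1)])
      (auto simp: M_def r)
  have small: "\<theta> * s ^ M < (Re (U (of_real s)) - Re (L (of_real s))) / 2" if s: "0 < s" "s < r'" for s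
  proof -
    have "\<theta> * s ^ M < (c/2) * s ^ n" unfolding M_def using \<theta>(1,2) s r'(4,5) by (intro odd_monomial_less) auto
    also have "\<dots> \<le> cmod (d (of_real s)) / 2" using c(4)[of "of_real s"] s r'(2) by simp
    also have "cmod (d (of_real s)) = \<bar>Re (d (of_real s))\<bar>"
      using real_germ_of_real[OF d, of s] s r' c by (metis abs_of_pos less_le_trans norm_of_real order.strict_trans)
    also have "\<dots> = Re (U (of_real s)) - Re (L (of_real s))" using less[of s] s r' c by (simp add: d_def)
    finally show ?thesis .
  qed
  have mean: "Re (W (of_real s) + of_real \<theta> * of_real s ^ M)
      = (Re (L (of_real s)) + Re (U (of_real s))) / 2 + \<theta> * s ^ M" for s :: real
    by (simp add: W_def)
  have between: "Re (L (of_real s)) < Re (W (of_real s) + of_real \<theta> * of_real s ^ M) \<and>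
      Re (W (of_real s) + of_real \<theta> * of_real s ^ M) < Re (U (of_real s))" if s: "0 < s" "s < r'" for s
  proof -
    have "0 < \<theta> * s ^ M" using \<theta>(1) s by simp
    moreover have "Re (L (of_real s)) < Re (U (of_real s))" using less[of s] s r' c by simp
    ultimately show ?thesis using small[OF s] mean[of s] by argo
  qed
  show ?thesis
    by (rule that[OF _ Y]) (use r' \<theta> c between in auto)
qed

subsection \<open>Real roots\<close>

lemma convex_combination_between:
  fixes a b \<theta> :: real
  assumes "0 < \<theta>" "\<theta> < 1" "a < b" shows "a < a + \<theta> * (b - a)" "a + \<theta> * (b - a) < b"
proof -
  have "\<theta> * (b - a) < 1 * (b - a)" using assms by (intro mult_strict_right_mono) auto
  then show "a + \<theta> * (b - a) < b" by simp
qed (use assms in simp)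

locale real_root_family = root_family_const T f \<rho> R e
  for T :: "real set" and f \<rho> R e +
  assumes convex: "convex T"
    and conj: "\<And>t z. t \<in> T \<Longrightarrow> cmod z < \<rho> \<Longrightarrow> f t (cnj z) = cnj (f t z)"
begin

definition real_root :: "(real \<Rightarrow> real) \<Rightarrow> bool" where
  "real_root g \<longleftrightarrow> continuous_on T g \<and> (\<forall>t\<in>T. \<bar>g t\<bar> < \<rho> \<and> f t (of_real (g t)) = 0)"

lemma real_root_imp_section: "real_root g \<Longrightarrow> root_section (\<lambda>t. of_real (g t))"
  by (auto simp: real_root_def root_section_def roots_def intro!: continuous_intros)

lemma real_root_exists:
  assumes t0: "t0 \<in> T" and y: "\<bar>y\<bar> < \<rho>" "f t0 (of_real y) = 0"
  obtains g where "real_root g" "g t0 = y"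
proof -
  have "complex_of_real y \<in> roots t0" using y by (simp add: roots_def)
  from section_exists[OF convex t0 this] obtain g where g: "root_section g" "g t0 = of_real y" .
  have "root_section (\<lambda>t. cnj (g t))"
    using g(1) conj by (auto simp: root_section_def roots_def intro!: continuous_intros)
  then have "cnj (g t) = g t" if "t \<in> T" for t
    by (rule section_unique[OF convex_connected[OF convex] _ g(1) t0 _ that]) (simp_all add: g(2))
  then have "g t = complex_of_real (Re (g t))" if "t \<in> T" for t
    using that by (metis Reals_cnj_iff of_real_Re)
  then have "cmod (g t) = \<bar>Re (g t)\<bar> \<and> f t (of_real (Re (g t))) = f t (g t)" if "t \<in> T" for t
    using that by (metis norm_of_real)
  then have "real_root (\<lambda>t. Re (g t))"
    using g(1) by (auto simp: real_root_def root_section_def roots_def intro!: continuous_intros)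
  then show ?thesis using that g(2) by simp
qed

lemma real_roots_ordered:
  assumes g: "real_root g" and h: "real_root h" and t0: "t0 \<in> T" "g t0 < h t0" and t: "t \<in> T"
  shows "g t < h t"
proof (rule ccontr)
  assume "\<not> g t < h t"
  have "connected ((\<lambda>t. h t - g t) ` T)"
    using convex_connected[OF convex] g h
    by (intro connected_continuous_image continuous_intros) (auto simp: real_root_def)
  moreover have "h t - g t \<in> (\<lambda>t. h t - g t) ` T" "h t0 - g t0 \<in> (\<lambda>t. h t - g t) ` T"
    using t t0 by auto
  ultimately have "0 \<in> (\<lambda>t. h t - g t) ` T"
    using \<open>\<not> g t < h t\<close> t0 connected_contains_Icc[of "(\<lambda>t. h t - g t) ` T" "h t - g t" "h t0 - g t0"]
    by (auto dest!: subsetD[of _ _ 0])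
  then obtain a where a: "a \<in> T" "complex_of_real (g a) = of_real (h a)" by auto
  have "complex_of_real (g t0) = of_real (h t0)"
    by (rule section_unique[OF convex_connected[OF convex] real_root_imp_section[OF g] real_root_imp_section[OF h] a t0(1)])
  then show False using t0 by simp
qed

definition lower_edge :: "(real \<Rightarrow> real) \<Rightarrow> bool" where
  "lower_edge lo \<longleftrightarrow> lo = (\<lambda>_. -\<rho>) \<or> real_root lo"

definition upper_edge :: "(real \<Rightarrow> real) \<Rightarrow> bool" where
  "upper_edge hi \<longleftrightarrow> hi = (\<lambda>_. \<rho>) \<or> real_root hi"

lemma lower_edge_bound: "lower_edge lo \<Longrightarrow> t \<in> T \<Longrightarrow> -\<rho> \<le> lo t"
  and upper_edge_bound: "upper_edge hi \<Longrightarrow> t \<in> T \<Longrightarrow> hi t \<le> \<rho>"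
  by (force simp: lower_edge_def upper_edge_def real_root_def abs_less_iff)+

lemma edge_continuous: "lower_edge g \<or> upper_edge g \<Longrightarrow> continuous_on T g"
  by (auto simp: lower_edge_def upper_edge_def real_root_def)

lemma edges_ordered:
  assumes lo: "lower_edge lo" and hi: "upper_edge hi" and t0: "t0 \<in> T" "lo t0 < hi t0" and t: "t \<in> T"
  shows "lo t < hi t"
proof -
  consider "real_root lo" "real_root hi" | "lo = (\<lambda>_. -\<rho>)" "hi = (\<lambda>_. \<rho>)"
    | "lo = (\<lambda>_. -\<rho>)" "real_root hi" | "real_root lo" "hi = (\<lambda>_. \<rho>)"
    using lo hi unfolding lower_edge_def upper_edge_def by blast
  then show ?thesis
  proof cases
    case 1 then show ?thesis using real_roots_ordered t0 t by blast
  qed (use t0 t \<rho> in \<open>auto simp: real_root_def abs_less_iff minus_less_iff\<close>)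
qed

definition gap :: "(real \<Rightarrow> real) \<Rightarrow> (real \<Rightarrow> real) \<Rightarrow> bool" where
  "gap lo hi \<longleftrightarrow> lower_edge lo \<and> upper_edge hi \<and>
      (\<forall>t\<in>T. lo t < hi t \<and> (\<forall>v. lo t < v \<longrightarrow> v < hi t \<longrightarrow> f t (of_real v) \<noteq> 0))"

lemma nearest_edges:
  assumes t0: "t0 \<in> T" and y: "\<bar>y\<bar> < \<rho>"
  obtains lo hi where "lower_edge lo" "lo t0 < y" "\<And>g. real_root g \<Longrightarrow> g t0 < y \<Longrightarrow> g t0 \<le> lo t0"
    "upper_edge hi" "y < hi t0" "\<And>g. real_root g \<Longrightarrow> y < g t0 \<Longrightarrow> hi t0 \<le> g t0"
proof -
  let ?A = "{v. \<bar>v\<bar> < \<rho> \<and> f t0 (of_real v) = 0}"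
  have "complex_of_real ` ?A \<subseteq> roots t0" by (auto simp: roots_def)
  then have "finite (complex_of_real ` ?A)" using finite_roots[OF t0] finite_subset by blast
  then have "finite ?A" by (rule finite_imageD) (auto simp: inj_on_def)
  then have finite: "finite {v\<in>?A. v < y}" "finite {v\<in>?A. y < v}" by (rule rev_finite_subset, blast)+
  have root_in: "g t0 \<in> ?A" if "real_root g" for g using that t0 by (auto simp: real_root_def)
  have "\<exists>lo. lower_edge lo \<and> lo t0 < y \<and> (\<forall>g. real_root g \<longrightarrow> g t0 < y \<longrightarrow> g t0 \<le> lo t0)"
  proof (cases "{v\<in>?A. v < y} = {}")
    case True
    then show ?thesis using y root_in by (intro exI[of _ "\<lambda>_. -\<rho>"]) (auto simp: lower_edge_def)
  next
    case False
    define a where "a = Max {v\<in>?A. v < y}"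
    have "a \<in> {v\<in>?A. v < y}" unfolding a_def by (rule Max_in[OF finite(1) False])
    moreover from this obtain lo where "real_root lo" "lo t0 = a" using real_root_exists[OF t0] by blast
    moreover have "g t0 \<le> a" if "real_root g" "g t0 < y" for g
      unfolding a_def using root_in[OF that(1)] that(2) by (intro Max_ge[OF finite(1)]) auto
    ultimately show ?thesis by (auto simp: lower_edge_def)
  qed
  moreover have "\<exists>hi. upper_edge hi \<and> y < hi t0 \<and> (\<forall>g. real_root g \<longrightarrow> y < g t0 \<longrightarrow> hi t0 \<le> g t0)"
  proof (cases "{v\<in>?A. y < v} = {}")
    case True
    then show ?thesis using y root_in by (intro exI[of _ "\<lambda>_. \<rho>"]) (auto simp: upper_edge_def)
  next
    case False
    define a where "a = Min {v\<in>?A. y < v}"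
    have "a \<in> {v\<in>?A. y < v}" unfolding a_def by (rule Min_in[OF finite(2) False])
    moreover from this obtain hi where "real_root hi" "hi t0 = a" using real_root_exists[OF t0] by blast
    moreover have "a \<le> g t0" if "real_root g" "y < g t0" for g
      unfolding a_def using root_in[OF that(1)] that(2) by (intro Min_le[OF finite(2)]) auto
    ultimately show ?thesis by (auto simp: upper_edge_def)
  qed
  ultimately show ?thesis using that by blast
qed

lemma gap_exists:
  assumes t0: "t0 \<in> T" and y: "\<bar>y\<bar> < \<rho>" "f t0 (of_real y) \<noteq> 0"
  obtains lo hi where "gap lo hi" "lo t0 < y" "y < hi t0"
proof -
  obtain lo hi where lo: "lower_edge lo" "lo t0 < y" "\<And>g. real_root g \<Longrightarrow> g t0 < y \<Longrightarrow> g t0 \<le> lo t0"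
    and hi: "upper_edge hi" "y < hi t0" "\<And>g. real_root g \<Longrightarrow> y < g t0 \<Longrightarrow> hi t0 \<le> g t0"
    by (rule nearest_edges[OF t0 y(1)]) (rule that)
  have "f t (of_real v) \<noteq> 0" if t: "t \<in> T" and v: "lo t < v" "v < hi t" for t v
  proof
    assume "f t (of_real v) = 0"
    moreover have "\<bar>v\<bar> < \<rho>" using v lower_edge_bound[OF lo(1) t] upper_edge_bound[OF hi(1) t] by auto
    ultimately obtain g where g: "real_root g" "g t = v" using real_root_exists[OF t] by blast
    then have "lo t0 < g t0" "g t0 < hi t0"
      using edges_ordered[OF lo(1) _ t _ t0, of g] edges_ordered[OF _ hi(1) t _ t0, of g] v
      by (simp_all add: lower_edge_def upper_edge_def)
    moreover have "g t0 \<noteq> y" using g(1) y(2) t0 by (auto simp: real_root_def)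
    ultimately show False using lo(3)[OF g(1)] hi(3)[OF g(1)] by linarith
  qed
  moreover have "lo t < hi t" if "t \<in> T" for t using edges_ordered[OF lo(1) hi(1) t0 _ that] lo(2) hi(2) by simp
  ultimately have "gap lo hi" using lo(1) hi(1) by (auto simp: gap_def)
  then show ?thesis using that lo(2) hi(2) by blast
qed

lemma path_connected_gap:
  assumes gap: "gap lo hi"
  shows "path_connected {(t,v). t \<in> T \<and> lo t < v \<and> v < hi t}"
proof -
  let ?h = "\<lambda>(t,\<theta>). (t, lo t + \<theta> * (hi t - lo t))"
  have pos: "0 < hi t - lo t" if "t \<in> T" for t using gap that by (simp add: gap_def)
  have "{(t,v). t \<in> T \<and> lo t < v \<and> v < hi t} = ?h ` (T \<times> {0<..<1})"
  proof safe
    fix t v assume t: "t \<in> T" and v: "lo t < v" "v < hi t"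
    show "(t,v) \<in> ?h ` (T \<times> {0<..<1})"
      using t v by (intro image_eqI[of _ _ "(t, (v - lo t) / (hi t - lo t))"]) auto
  next
    fix t and \<theta> :: real assume t: "t \<in> T" and \<theta>: "\<theta> \<in> {0<..<1}"
    show "lo t < lo t + \<theta> * (hi t - lo t)" "lo t + \<theta> * (hi t - lo t) < hi t"
      using convex_combination_between[of \<theta> "lo t" "hi t"] \<theta> pos[OF t] by simp_all
  qed
  moreover have "continuous_on (T \<times> {0<..<1}) ?h"
    using gap edge_continuous[of lo] edge_continuous[of hi]
    by (auto simp: split_beta gap_def intro!: continuous_intros elim!: continuous_on_compose2)
  moreover have "path_connected (T \<times> {0<..<1::real})"
    by (intro path_connected_Times convex_imp_path_connected convex convex_real_interval)
  ultimately show ?thesis by (simp add: path_connected_continuous_image)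
qed

end

locale real_product_family = real_root_family T f \<rho> R e
  for T :: "real set" and f \<rho> R e +
  fixes I :: "'k set" and F :: "'k \<Rightarrow> real \<Rightarrow> complex \<Rightarrow> complex" and e' :: "'k \<Rightarrow> nat"
  assumes finite_factors: "finite I" and product: "\<And>t z. f t z = (\<Prod>i\<in>I. F i t z)"
    and factor_family: "\<And>i. i \<in> I \<Longrightarrow> root_family_const T (F i) \<rho> R (e' i)"
begin

lemma factor_zero: "i \<in> I \<Longrightarrow> F i t z = 0 \<Longrightarrow> f t z = 0"
  unfolding product using finite_factors by (intro prod_zero bexI[of _ i])

lemma same_zeros_root:
  assumes g: "real_root g" and i: "i \<in> I" and t: "t \<in> T" "t' \<in> T"
  shows "F i t (of_real (g t)) = 0 \<longleftrightarrow> F i t' (of_real (g t')) = 0"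
  using section_subfamily[OF root_family_const_axioms factor_family[OF i] factor_zero[OF i] convex
      real_root_imp_section[OF g]] t by blast

lemma same_zeros_gap:
  assumes "gap lo hi" "i \<in> I" "t \<in> T" "lo t < v" "v < hi t" "t' \<in> T" "lo t' < v'" "v' < hi t'"
  shows "F i t (of_real v) = 0 \<longleftrightarrow> F i t' (of_real v') = 0"
  using assms factor_zero[OF assms(2)] unfolding gap_def by blast

lemma real_path_lift:
  assumes t0: "t0 \<in> T" and y: "\<bar>y\<bar> < \<rho>"
  obtains V :: "real \<Rightarrow> real" where "continuous_on T V" "V t0 = y" "\<And>t. t \<in> T \<Longrightarrow> \<bar>V t\<bar> < \<rho>"
    "\<And>i t. i \<in> I \<Longrightarrow> t \<in> T \<Longrightarrow> F i t (of_real (V t)) = 0 \<longleftrightarrow> F i t0 (of_real y) = 0"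
proof (cases "f t0 (of_real y) = 0")
  case True
  from real_root_exists[OF t0 y this] obtain g where g: "real_root g" "g t0 = y" .
  show ?thesis
    using that[of g] g same_zeros_root[OF g(1) _ _ t0] by (simp add: real_root_def)
next
  case False
  from gap_exists[OF t0 y this] obtain lo hi where lohi: "gap lo hi" "lo t0 < y" "y < hi t0" .
  then have edges: "lower_edge lo" "upper_edge hi" and pos: "\<And>t. t \<in> T \<Longrightarrow> 0 < hi t - lo t"
    by (auto simp: gap_def)
  define \<theta> where "\<theta> = (y - lo t0) / (hi t0 - lo t0)"
  define V where "V t = lo t + \<theta> * (hi t - lo t)" for t
  have \<theta>: "0 < \<theta>" "\<theta> < 1" "V t0 = y" using lohi(2,3) by (auto simp: \<theta>_def V_def field_simps)
  have inside: "lo t < V t" "V t < hi t" if "t \<in> T" for t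
    using convex_combination_between[OF \<theta>(1,2)] pos[OF that] by (simp_all add: V_def)
  show ?thesis
  proof (rule that[of V, OF _ \<theta>(3)])
    show "continuous_on T V"
      unfolding V_def using edges edge_continuous by (auto intro!: continuous_intros)
    show "\<bar>V t\<bar> < \<rho>" if "t \<in> T" for t
      using inside[OF that] lower_edge_bound[OF edges(1) that] upper_edge_bound[OF edges(2) that] by auto
    show "F i t (of_real (V t)) = 0 \<longleftrightarrow> F i t0 (of_real y) = 0" if "i \<in> I" "t \<in> T" for i t
      by (rule same_zeros_gap[OF lohi(1) that inside[OF that(2)] t0 lohi(2,3)])
  qed
qed

end

subsection \<open>Arcs of real points in the plane\<close>

locale plane_family = punctured_family s1 G \<rho> R e
  for s1 :: real and G :: "complex \<Rightarrow> complex \<Rightarrow> complex" and \<rho> R e +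
  fixes I :: "'k set" and F :: "'k \<Rightarrow> complex \<Rightarrow> complex \<Rightarrow> complex" and e' :: "'k \<Rightarrow> nat"
  assumes conj: "\<And>s z. s \<in> ball 0 s1 \<Longrightarrow> z \<in> ball 0 R \<Longrightarrow> G (cnj s) (cnj z) = cnj (G s z)"
    and finite_factors: "finite I" and product: "\<And>s z. G s z = (\<Prod>i\<in>I. F i s z)"
    and factor_family: "\<And>i. i \<in> I \<Longrightarrow> root_family (ball 0 s1) (F i) \<rho> R"
    and card_factor: "\<And>i s. i \<in> I \<Longrightarrow> s \<in> ball 0 s1 - {0} \<Longrightarrow> card {z. cmod z < \<rho> \<and> F i s z = 0} = e' i"
begin

sublocale real: real_product_family "{0<..<s1}" "\<lambda>s. G (of_real s)" \<rho> R e I "\<lambda>i s. F i (of_real s)" e'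
proof (intro real_product_family.intro real_root_family.intro real_root_family_axioms.intro real_product_family_axioms.intro)
  show "root_family_const {0<..<s1} (\<lambda>s. G (of_real s)) \<rho> R e"
    by (rule root_family_const_compose[OF root_family_axioms])
      (use card_punctured in \<open>auto simp: roots_def intro!: continuous_intros\<close>)
  show "root_family_const {0<..<s1} (\<lambda>s. F i (of_real s)) \<rho> R (e' i)" if "i \<in> I" for i
    by (rule root_family_const_compose[OF factor_family[OF that]])
      (use card_factor[OF that] in \<open>auto intro!: continuous_intros\<close>)
  show "G (of_real s) (cnj z) = cnj (G (of_real s) z)" if "s \<in> {0<..<s1}" "cmod z < \<rho>" for s z
    using conj[of "of_real s" z] that \<rho> by simp
qed (simp_all add: finite_factors product)

lemma power_in_range:
  assumes "0 < N" "\<sigma> \<in> {0<..<root N s1}" shows "\<sigma> ^ N \<in> {0<..<s1}"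
proof -
  have "\<sigma> ^ N < root N s1 ^ N" using assms by (intro power_strict_mono) auto
  then show ?thesis using assms s1 by simp
qed

lemma puiseux_real_root:
  assumes g: "real.real_root g"
  obtains N Y where "puiseux N Y" "real_germ (root N s1) Y"
    "\<And>\<sigma>. \<sigma> \<in> {0<..<root N s1} \<Longrightarrow> Y (of_real \<sigma>) = of_real (g (\<sigma> ^ N))"
proof -
  have "s1/2 \<in> {0<..<s1}" using s1 by simp
  then have "of_real (g (s1/2)) \<in> roots (of_real (s1/2))"
    using real.real_root_imp_section[OF g] unfolding real.root_section_def real.roots_def roots_def by blast
  from puiseux_root[OF _ _ this] s1 obtain N Y
    where Y: "puiseux N Y" "Y (of_real (root N (s1/2))) = of_real (g (s1/2))" by auto
  note Y_props = Y(1)[unfolded puiseux_def]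
  then have N: "0 < N" by blast
  interpret pow: root_family_const "{0<..<root N s1}" "\<lambda>\<sigma>. G (of_real (\<sigma> ^ N))" \<rho> R e
    by (rule root_family_const_compose[OF real.root_family_axioms])
      (use power_in_range[OF N] real.card_roots in \<open>auto simp: real.roots_def simp del: of_real_power intro!: continuous_intros\<close>)
  have "pow.root_section (\<lambda>\<sigma>. of_real (g (\<sigma> ^ N)))"
    using real.real_root_imp_section[OF g] power_in_range[OF N]
    by (auto simp: pow.root_section_def real.root_section_def real.roots_def pow.roots_def
        simp del: of_real_power intro!: continuous_intros elim!: continuous_on_compose2)
  moreover have "pow.root_section (\<lambda>\<sigma>. Y (of_real \<sigma>))"
    unfolding pow.root_section_def
  proof
    show "continuous_on {0<..<root N s1} (\<lambda>\<sigma>. Y (of_real \<sigma>))"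
    proof (rule continuous_on_compose2[of "ball 0 (root N s1)" Y])
      show "continuous_on (ball 0 (root N s1)) Y" using Y_props by (simp add: holomorphic_on_imp_continuous_on)
    qed (auto intro!: continuous_intros)
    have "Y (of_real \<sigma>) \<in> roots (of_real \<sigma> ^ N)" if "\<sigma> \<in> {0<..<root N s1}" for \<sigma>
      using Y_props that by auto
    then show "\<forall>\<sigma>\<in>{0<..<root N s1}. Y (of_real \<sigma>) \<in> pow.roots \<sigma>" unfolding pow.roots_def roots_def by simp
  qed
  moreover have "connected {0<..<root N s1}" by (intro convex_connected convex_real_interval)
  moreover have "root N (s1/2) \<in> {0<..<root N s1}" "Y (of_real (root N (s1/2))) = of_real (g (root N (s1/2) ^ N))"
    using Y(2) N s1 by simp_all
  ultimately have agree: "Y (of_real \<sigma>) = of_real (g (\<sigma> ^ N))" if "\<sigma> \<in> {0<..<root N s1}" for \<sigma>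
    using pow.section_unique that by blast
  then have "real_germ (root N s1) Y" using Y_props s1 N by (intro real_germI) auto
  then show ?thesis using that Y(1) agree by blast
qed

lemma puiseux_real_roots:
  assumes g: "real.real_root g" and h: "real.real_root h"
  obtains N Y Z where "0 < N" "real_germ (root N s1) Y" "real_germ (root N s1) Z"
    "\<And>\<sigma>. \<sigma> \<in> {0<..<root N s1} \<Longrightarrow> Y (of_real \<sigma>) = of_real (g (\<sigma> ^ N)) \<and> Z (of_real \<sigma>) = of_real (h (\<sigma> ^ N))"
proof -
  obtain M Y where Y: "puiseux M Y" "real_germ (root M s1) Y"
    "\<And>\<sigma>. \<sigma> \<in> {0<..<root M s1} \<Longrightarrow> Y (of_real \<sigma>) = of_real (g (\<sigma> ^ M))" using puiseux_real_root[OF g] by metis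
  obtain N Z where Z: "puiseux N Z" "real_germ (root N s1) Z"
    "\<And>\<sigma>. \<sigma> \<in> {0<..<root N s1} \<Longrightarrow> Z (of_real \<sigma>) = of_real (h (\<sigma> ^ N))" using puiseux_real_root[OF h] by metis
  have pos: "0 < M" "0 < N" using Y(1) Z(1) by (simp_all add: puiseux_def)
  let ?r = "root (M * N) s1"
  have r: "0 < ?r" "?r ^ N = root M s1" "?r ^ M = root N s1"
  proof -
    show "0 < ?r" using pos s1 by simp
    show "?r ^ N = root M s1" using real_root_mult_exp[of N M s1] pos s1 by (simp add: mult.commute)
    show "?r ^ M = root N s1" using real_root_mult_exp[of M N s1] pos s1 by simp
  qed
  have "real_germ ?r (\<lambda>s. Y (s ^ N))" "real_germ ?r (\<lambda>s. Z (s ^ M))"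
    using real_germ_power[OF Y(2) pos(2) r(1)] real_germ_power[OF Z(2) pos(1) r(1)] r by auto
  moreover have "Y (of_real \<sigma> ^ N) = of_real (g (\<sigma> ^ (M * N))) \<and> Z (of_real \<sigma> ^ M) = of_real (h (\<sigma> ^ (M * N)))"
    if \<sigma>: "\<sigma> \<in> {0<..<?r}" for \<sigma>
  proof -
    have "\<sigma> ^ N \<in> {0<..<root M s1}" "\<sigma> ^ M \<in> {0<..<root N s1}"
      using \<sigma> pos power_strict_mono[of \<sigma> ?r N] power_strict_mono[of \<sigma> ?r M] unfolding r by auto
    then show ?thesis using Y(3) Z(3) by (simp add: mult.commute flip: power_mult of_real_power)
  qed
  ultimately show ?thesis using that[of "M * N"] pos by simp
qed

lemma puiseux_real_root_margin:
  assumes g: "real.real_root g"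
  obtains N r Y where "0 < N" "r \<le> root N s1" "real_germ r Y"
    "\<And>\<sigma>. 0 < \<sigma> \<Longrightarrow> \<sigma> < r \<Longrightarrow> Re (Y (of_real \<sigma>)) = g (\<sigma> ^ N) \<and> \<bar>g (\<sigma> ^ N)\<bar> + \<sigma> \<le> \<rho>"
proof -
  obtain N Y where Y: "puiseux N Y" "real_germ (root N s1) Y"
    "\<And>\<sigma>. \<sigma> \<in> {0<..<root N s1} \<Longrightarrow> Y (of_real \<sigma>) = of_real (g (\<sigma> ^ N))" using puiseux_real_root[OF g] by metis
  obtain r where r: "0 < r" "r \<le> root N s1" "\<And>s. s \<in> ball 0 r \<Longrightarrow> cmod (Y s) < \<rho>/2"
    using real_germ_small[OF Y(2), of "\<rho>/2"] \<rho> by (metis half_gt_zero)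
  let ?r = "min r (\<rho>/2)"
  have "real_germ ?r Y" using r \<rho> by (intro real_germ_subset[OF Y(2)]) auto
  moreover have "Re (Y (of_real \<sigma>)) = g (\<sigma> ^ N) \<and> \<bar>g (\<sigma> ^ N)\<bar> + \<sigma> \<le> \<rho>" if "0 < \<sigma>" "\<sigma> < ?r" for \<sigma>
    using r(2) r(3)[of "of_real \<sigma>"] Y(3)[of \<sigma>] that by auto
  ultimately show ?thesis using that[of N ?r Y] Y(1) r(2) by (simp add: puiseux_def)
qed

lemma germs_along_gap:
  assumes gap: "real.gap lo hi"
  obtains N L U r where "0 < N" "r \<le> root N s1" "real_germ r L" "real_germ r U"
    "\<And>\<sigma>. 0 < \<sigma> \<Longrightarrow> \<sigma> < r \<Longrightarrow> lo (\<sigma> ^ N) \<le> Re (L (of_real \<sigma>)) \<and>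
        Re (L (of_real \<sigma>)) < Re (U (of_real \<sigma>)) \<and> Re (U (of_real \<sigma>)) \<le> hi (\<sigma> ^ N)"
proof -
  have id: "real_germ r (\<lambda>s. s)" if "0 < r" for r using real_germ_monomial[of r 1] that by simp
  consider (none) "lo = (\<lambda>_. -\<rho>)" "hi = (\<lambda>_. \<rho>)" | (lower) "real.real_root lo" "hi = (\<lambda>_. \<rho>)"
    | (upper) "lo = (\<lambda>_. -\<rho>)" "real.real_root hi" | (both) "real.real_root lo" "real.real_root hi"
    using gap by (auto simp: real.gap_def real.lower_edge_def real.upper_edge_def)
  then show ?thesis
  proof cases
    case none
    have "real_germ (min \<rho> s1) (\<lambda>s. s)" "real_germ (min \<rho> s1) (\<lambda>s. of_real (-1) * s)"
      using \<rho> s1 by (intro id real_germ_scale; simp)+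
    then show ?thesis using that[of 1 "min \<rho> s1" "\<lambda>s. of_real (-1) * s" "\<lambda>s. s"] none by simp
  next
    case lower
    obtain N r L where L: "0 < N" "r \<le> root N s1" "real_germ r L"
      "\<And>\<sigma>. 0 < \<sigma> \<Longrightarrow> \<sigma> < r \<Longrightarrow> Re (L (of_real \<sigma>)) = lo (\<sigma> ^ N) \<and> \<bar>lo (\<sigma> ^ N)\<bar> + \<sigma> \<le> \<rho>"
      by (rule puiseux_real_root_margin[OF lower(1)]) (rule that)
    show ?thesis
      by (rule that[OF L(1-3) real_germ_add[OF L(3) id[OF real_germD(1)[OF L(3)]]]])
        (use L(4) lower in fastforce)
  next
    case upper
    obtain N r U where U: "0 < N" "r \<le> root N s1" "real_germ r U"
      "\<And>\<sigma>. 0 < \<sigma> \<Longrightarrow> \<sigma> < r \<Longrightarrow> Re (U (of_real \<sigma>)) = hi (\<sigma> ^ N) \<and> \<bar>hi (\<sigma> ^ N)\<bar> + \<sigma> \<le> \<rho>"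
      by (rule puiseux_real_root_margin[OF upper(2)]) (rule that)
    show ?thesis
      by (rule that[OF U(1,2) real_germ_diff[OF U(3) id[OF real_germD(1)[OF U(3)]]] U(3)])
        (use U(4) upper in fastforce)
  next
    case both
    from puiseux_real_roots[OF this] obtain N L U where LU: "0 < N" "real_germ (root N s1) L" "real_germ (root N s1) U"
      "\<And>\<sigma>. \<sigma> \<in> {0<..<root N s1} \<Longrightarrow> L (of_real \<sigma>) = of_real (lo (\<sigma> ^ N)) \<and> U (of_real \<sigma>) = of_real (hi (\<sigma> ^ N))"
      by metis
    show ?thesis
      by (rule that[OF LU(1) order_refl LU(2,3)])
        (use LU(4) power_in_range[OF LU(1)] gap in \<open>simp add: real.gap_def\<close>)
  qed
qed

definition real_stratum :: "real \<Rightarrow> real \<Rightarrow> (real \<times> real) set" where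
  "real_stratum s0 y = {(s,v). s \<in> {0<..<s1} \<and> \<bar>v\<bar> < \<rho> \<and>
      (\<forall>i\<in>I. F i (of_real s) (of_real v) = 0 \<longleftrightarrow> F i (of_real s0) (of_real y) = 0)}"

definition arc_into_stratum :: "real \<Rightarrow> real \<Rightarrow> nat \<Rightarrow> real \<Rightarrow> (complex \<Rightarrow> complex) \<Rightarrow> bool" where
  "arc_into_stratum s0 y N r Y \<longleftrightarrow> 0 < N \<and> r \<le> root N s1 \<and> real_germ r Y \<and> (\<forall>\<sigma>\<in>ball 0 r. cmod (Y \<sigma>) < \<rho>) \<and>
      (even N \<longrightarrow> (\<forall>\<sigma>\<in>ball 0 r - {0}. Y (- \<sigma>) \<noteq> Y \<sigma>)) \<and>
      (\<forall>\<sigma>\<in>{0<..<r}. path_component (real_stratum s0 y) (s0, y) (\<sigma> ^ N, Re (Y (of_real \<sigma>))))"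

lemma arc_through_root:
  assumes s0: "s0 \<in> {0<..<s1}" and y: "\<bar>y\<bar> < \<rho>" and zero: "G (of_real s0) (of_real y) = 0"
  obtains N r Y where "arc_into_stratum s0 y N r Y"
proof -
  obtain g where g: "real.real_root g" "g s0 = y" by (rule real.real_root_exists[OF s0 y zero])
  obtain N Y where Y: "puiseux N Y" "real_germ (root N s1) Y"
    "\<And>\<sigma>. \<sigma> \<in> {0<..<root N s1} \<Longrightarrow> Y (of_real \<sigma>) = of_real (g (\<sigma> ^ N))" using puiseux_real_root[OF g(1)] by metis
  let ?graph = "(\<lambda>s. (s, g s)) ` {0<..<s1}"
  have "continuous_on {0<..<s1} (\<lambda>s. (s, g s))" using g(1) by (auto simp: real.real_root_def intro!: continuous_intros)
  then have "path_connected ?graph"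
    by (intro path_connected_continuous_image convex_imp_path_connected convex_real_interval)
  moreover have "?graph \<subseteq> real_stratum s0 y"
    using g real.same_zeros_root[OF g(1) _ _ s0] by (auto simp: real_stratum_def real.real_root_def)
  ultimately have "path_component (real_stratum s0 y) (s0, y) (s, g s)" if "s \<in> {0<..<s1}" for s
    using s0 g(2) that unfolding path_connected_component by (meson image_eqI path_component_of_subset)
  then have "arc_into_stratum s0 y N (root N s1) Y"
    using Y power_in_range[of N] \<rho> by (auto simp: arc_into_stratum_def puiseux_def roots_def)
  then show ?thesis using that by blast
qed

lemma arc_through_gap:
  assumes s0: "s0 \<in> {0<..<s1}" and y: "\<bar>y\<bar> < \<rho>" and nonzero: "G (of_real s0) (of_real y) \<noteq> 0"
  obtains N r Y where "arc_into_stratum s0 y N r Y"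
proof -
  obtain lo hi where gap: "real.gap lo hi" "lo s0 < y" "y < hi s0" by (rule real.gap_exists[OF s0 y nonzero])
  obtain N L U r0 where LU: "0 < N" "r0 \<le> root N s1" "real_germ r0 L" "real_germ r0 U"
    "\<And>\<sigma>. 0 < \<sigma> \<Longrightarrow> \<sigma> < r0 \<Longrightarrow> lo (\<sigma> ^ N) \<le> Re (L (of_real \<sigma>)) \<and>
        Re (L (of_real \<sigma>)) < Re (U (of_real \<sigma>)) \<and> Re (U (of_real \<sigma>)) \<le> hi (\<sigma> ^ N)"
    by (rule germs_along_gap[OF gap(1)]) (rule that)
  obtain Y r1 where Y: "r1 \<le> r0" "real_germ r1 Y" "\<And>s. s \<in> ball 0 r1 - {0} \<Longrightarrow> Y (- s) \<noteq> Y s"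
    and between: "\<And>s. 0 < s \<Longrightarrow> s < r1 \<Longrightarrow> Re (L (of_real s)) < Re (Y (of_real s)) \<and> Re (Y (of_real s)) < Re (U (of_real s))"
    using real_germ_between[OF LU(3,4)] LU(5) by (metis (no_types, lifting))
  obtain r where r: "0 < r" "r \<le> r1" "\<And>s. s \<in> ball 0 r \<Longrightarrow> cmod (Y s) < \<rho>"
    using real_germ_small[OF Y(2), of \<rho>] \<rho> by metis
  let ?gap = "{(s,v). s \<in> {0<..<s1} \<and> lo s < v \<and> v < hi s}"
  have "?gap \<subseteq> real_stratum s0 y"
    using real.same_zeros_gap[OF gap(1) _ _ _ _ s0 gap(2,3)] gap(1)
      real.lower_edge_bound[of lo] real.upper_edge_bound[of hi]
    by (fastforce simp: real_stratum_def real.gap_def abs_less_iff)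
  moreover have "path_component ?gap (s0, y) x" if "x \<in> ?gap" for x
    using real.path_connected_gap[OF gap(1)] that s0 gap(2,3) unfolding path_connected_component by blast
  ultimately have "path_component (real_stratum s0 y) (s0, y) x" if "x \<in> ?gap" for x
    using path_component_of_subset that by blast
  moreover have "(\<sigma> ^ N, Re (Y (of_real \<sigma>))) \<in> ?gap" if "\<sigma> \<in> {0<..<r}" for \<sigma>
    using power_in_range[OF LU(1), of \<sigma>] LU(2) LU(5)[of \<sigma>] between[of \<sigma>] that r Y(1) by force
  ultimately have "arc_into_stratum s0 y N r Y"
    using LU(1,2) Y r real_germ_subset[OF Y(2) r(1,2)] by (auto simp: arc_into_stratum_def)
  then show ?thesis using that by blast
qed

theorem arc_into_stratum_exists:
  assumes "s0 \<in> {0<..<s1}" "\<bar>y\<bar> < \<rho>"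
  obtains N r Y where "arc_into_stratum s0 y N r Y"
  using arc_through_root[OF assms] arc_through_gap[OF assms] by blast

end

subsection \<open>Holomorphic functions on polydiscs\<close>

definition polydisc :: "nat \<Rightarrow> real \<Rightarrow> (nat \<Rightarrow> complex) set" where
  "polydisc m r = {x. (\<forall>i<m. cmod (x i) < r) \<and> (\<forall>i\<ge>m. x i = 0)}"

definition real_point :: "(nat \<Rightarrow> complex) \<Rightarrow> bool" where "real_point x \<longleftrightarrow> (\<forall>i. x i \<in> \<real>)"

text \<open>Holomorphy along every holomorphic curve is all that is needed of holomorphy in several variables.\<close>

definition curve_holomorphic :: "nat \<Rightarrow> real \<Rightarrow> ((nat \<Rightarrow> complex) \<Rightarrow> complex) \<Rightarrow> bool" where
  "curve_holomorphic m r h \<longleftrightarrow> continuous_on (polydisc m r) h \<and>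
      (\<forall>S \<psi>. open S \<longrightarrow> (\<forall>i. (\<lambda>s. \<psi> s i) holomorphic_on S) \<longrightarrow> \<psi> ` S \<subseteq> polydisc m r \<longrightarrow> (\<lambda>s. h (\<psi> s)) holomorphic_on S)"

lemma curve_holomorphicI:
  assumes "continuous_on (polydisc m r) h"
    "\<And>S \<psi>. open S \<Longrightarrow> (\<And>i. (\<lambda>s. \<psi> s i) holomorphic_on S) \<Longrightarrow> \<psi> ` S \<subseteq> polydisc m r \<Longrightarrow> (\<lambda>s. h (\<psi> s)) holomorphic_on S"
  shows "curve_holomorphic m r h"
  unfolding curve_holomorphic_def by (intro conjI allI impI assms) auto

lemma curve_holomorphic_continuous: "curve_holomorphic m r h \<Longrightarrow> continuous_on (polydisc m r) h"
  by (simp add: curve_holomorphic_def)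

lemma curve_holomorphic_compose:
  "curve_holomorphic m r h \<Longrightarrow> open S \<Longrightarrow> (\<And>i. (\<lambda>s. \<psi> s i) holomorphic_on S) \<Longrightarrow> \<psi> ` S \<subseteq> polydisc m r \<Longrightarrow> (\<lambda>s. h (\<psi> s)) holomorphic_on S"
  by (simp add: curve_holomorphic_def)

lemma polydisc_mono: "r \<le> r' \<Longrightarrow> polydisc m r \<subseteq> polydisc m r'"
  by (force simp: polydisc_def)

lemma curve_holomorphic_subset: "curve_holomorphic m r h \<Longrightarrow> r' \<le> r \<Longrightarrow> curve_holomorphic m r' h"
proof (rule curve_holomorphicI)
  assume h: "curve_holomorphic m r h" "r' \<le> r"
  note sub = polydisc_mono[OF h(2), of m]
  show "continuous_on (polydisc m r') h" by (rule continuous_on_subset[OF curve_holomorphic_continuous[OF h(1)] sub])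
  fix S \<psi> assume \<psi>: "open S" "\<And>i. (\<lambda>s. \<psi> s i) holomorphic_on S" "\<psi> ` S \<subseteq> polydisc m r'"
  show "(\<lambda>s. h (\<psi> s)) holomorphic_on S"
    by (rule curve_holomorphic_compose[OF h(1) \<psi>(1,2) order_trans[OF \<psi>(3) sub]])
qed

lemma curve_holomorphic_const: "curve_holomorphic m r (\<lambda>_. c)"
  by (rule curve_holomorphicI) auto

lemma curve_holomorphic_coord: "curve_holomorphic m r (\<lambda>x. x i)"
  by (rule curve_holomorphicI) (simp_all add: continuous_on_subset[OF continuous_on_product_coordinates])

lemma curve_holomorphic_add: "curve_holomorphic m r h \<Longrightarrow> curve_holomorphic m r k \<Longrightarrow> curve_holomorphic m r (\<lambda>x. h x + k x)"
  unfolding curve_holomorphic_def by (simp add: continuous_intros holomorphic_intros)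

lemma curve_holomorphic_mult: "curve_holomorphic m r h \<Longrightarrow> curve_holomorphic m r k \<Longrightarrow> curve_holomorphic m r (\<lambda>x. h x * k x)"
  unfolding curve_holomorphic_def by (simp add: continuous_intros holomorphic_intros)

lemma curve_holomorphic_prod: "finite I \<Longrightarrow> (\<And>i. i \<in> I \<Longrightarrow> curve_holomorphic m r (h i)) \<Longrightarrow> curve_holomorphic m r (\<lambda>x. \<Prod>i\<in>I. h i x)"
  by (induction I rule: finite_induct) (auto intro: curve_holomorphic_const curve_holomorphic_mult)

lemma curve_holomorphic_cong: "curve_holomorphic m r h \<Longrightarrow> (\<And>x. x \<in> polydisc m r \<Longrightarrow> h x = k x) \<Longrightarrow> curve_holomorphic m r k"
proof (rule curve_holomorphicI)
  assume hk: "curve_holomorphic m r h" "\<And>x. x \<in> polydisc m r \<Longrightarrow> h x = k x"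
  show "continuous_on (polydisc m r) k" by (rule continuous_on_eq[OF curve_holomorphic_continuous[OF hk(1)] hk(2)])
  fix S \<psi> assume \<psi>: "open S" "\<And>i. (\<lambda>s. \<psi> s i) holomorphic_on S" "\<psi> ` S \<subseteq> polydisc m r"
  show "(\<lambda>s. k (\<psi> s)) holomorphic_on S"
    by (rule holomorphic_transform[OF curve_holomorphic_compose[OF hk(1) \<psi>]]) (use \<psi>(3) in \<open>intro hk(2), blast\<close>)
qed

lemma curve_holomorphic_cnj:
  assumes h: "curve_holomorphic m r h" shows "curve_holomorphic m r (\<lambda>x. cnj (h (\<lambda>i. cnj (x i))))"
proof (rule curve_holomorphicI)
  have "continuous_on (polydisc m r) (\<lambda>x i. cnj (x i))"
    by (intro continuous_on_coordinatewise_then_product continuous_on_cnj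
        continuous_on_subset[OF continuous_on_product_coordinates]) auto
  then show "continuous_on (polydisc m r) (\<lambda>x. cnj (h (\<lambda>i. cnj (x i))))"
    by (intro continuous_on_cnj continuous_on_compose2[OF curve_holomorphic_continuous[OF h]]) (auto simp: polydisc_def)
  fix S \<psi> assume \<psi>: "open S" "\<And>i. (\<lambda>s. \<psi> s i) holomorphic_on S" "\<psi> ` S \<subseteq> polydisc m r"
  have open_cnj: "open (cnj ` S)"
  proof -
    have "cnj ` S = cnj -` S" by (auto simp: image_iff) (metis complex_cnj_cnj)
    then show ?thesis using open_vimage[OF \<psi>(1), of cnj] by (simp add: continuous_on_cnj)
  qed
  have "(\<lambda>s. h (\<lambda>i. cnj (\<psi> (cnj s) i))) holomorphic_on cnj ` S"
  proof (rule curve_holomorphic_compose[OF h open_cnj])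
    show "(\<lambda>s. cnj (\<psi> (cnj s) i)) holomorphic_on cnj ` S" for i
      using holomorphic_on_compose_cnj_cnj[of "\<lambda>s. \<psi> s i" "cnj ` S"] \<psi> open_cnj by (simp add: o_def image_image)
    show "(\<lambda>s i. cnj (\<psi> (cnj s) i)) ` cnj ` S \<subseteq> polydisc m r"
      using \<psi>(3) by (auto simp: polydisc_def image_subset_iff)
  qed
  from holomorphic_on_compose_cnj_cnj[OF this \<psi>(1)]
  show "(\<lambda>s. cnj (h (\<lambda>i. cnj (\<psi> s i)))) holomorphic_on S" by (simp add: o_def)
qed

lemma polydisc_upd: "x \<in> polydisc m r \<Longrightarrow> cmod z < r \<Longrightarrow> x(m := z) \<in> polydisc (Suc m) r"
  by (auto simp: polydisc_def less_Suc_eq)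

lemma polydisc_restrict: "x \<in> polydisc (Suc m) r \<Longrightarrow> x(m := 0) \<in> polydisc m r"
  by (auto simp: polydisc_def)

lemma zero_in_polydisc: "0 < r \<Longrightarrow> (\<lambda>_. 0) \<in> polydisc m r"
  by (auto simp: polydisc_def)

lemma polydisc_subset_open:
  assumes "open X" "(\<lambda>_. 0) \<in> X" shows "\<exists>\<delta>>0. polydisc m \<delta> \<subseteq> X"
proof -
  have "openin (product_topology (\<lambda>_. euclidean) UNIV) X" using assms(1) by (simp add: open_fun_def)
  from product_topology_open_contains_basis[OF this assms(2)] obtain B where
    B: "(\<lambda>_. 0) \<in> PiE UNIV B" "\<And>i. open (B i)" "PiE UNIV B \<subseteq> X" by auto
  have "\<forall>i. \<exists>d>0. ball 0 d \<subseteq> B i" using B(1,2) by (auto simp: PiE_def Pi_def open_contains_ball)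
  then obtain d where d: "\<And>i. d i > 0" "\<And>i. ball 0 (d i) \<subseteq> B i" by metis
  define \<delta> where "\<delta> = Min (insert 1 (d ` {..<m}))"
  have \<delta>: "0 < \<delta>" "\<And>i. i < m \<Longrightarrow> \<delta> \<le> d i" using d(1) by (auto simp: \<delta>_def)
  have "x \<in> X" if x: "x \<in> polydisc m \<delta>" for x
  proof -
    have "x i \<in> B i" for i
    proof (cases "i < m")
      case True
      then have "x i \<in> ball 0 (d i)" using x \<delta>(2)[OF True] by (force simp: polydisc_def)
      then show ?thesis using d(2) by blast
    next
      case False
      then have "x i = 0" using x by (simp add: polydisc_def)
      then show ?thesis using B(1) by (auto simp: PiE_def Pi_def)
    qed
    then show ?thesis using B(3) by auto
  qed
  then show ?thesis using \<delta>(1) by blast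
qed

lemma continuous_on_upd: "continuous_on S f \<Longrightarrow> continuous_on S g \<Longrightarrow> continuous_on S (\<lambda>x. (f x)(m := g x :: complex))"
  for f :: "'a::topological_space \<Rightarrow> nat \<Rightarrow> complex"
proof (rule continuous_on_coordinatewise_then_product)
  fix i assume "continuous_on S f" "continuous_on S g"
  then show "continuous_on S (\<lambda>x. ((f x)(m := g x)) i)"
    by (cases "i = m") (auto intro: continuous_on_product_then_coordinatewise)
qed

lemma continuous_on_holomorphic_coords:
  "(\<And>i. (\<lambda>s. \<psi> s i) holomorphic_on S) \<Longrightarrow> continuous_on S (\<psi> :: complex \<Rightarrow> nat \<Rightarrow> complex)"
  by (intro continuous_on_coordinatewise_then_product holomorphic_on_imp_continuous_on)
locale polydisc_slice =
  fixes m :: nat and \<epsilon> \<rho> \<delta> :: real and k :: "(nat \<Rightarrow> complex) \<Rightarrow> complex"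
  assumes holomorphic: "curve_holomorphic (Suc m) \<epsilon> k" and radii: "0 < \<rho>" "\<rho> < \<epsilon>" "\<delta> \<le> \<epsilon>"
    and circle: "\<And>x z. x \<in> polydisc m \<delta> \<Longrightarrow> cmod z = \<rho> \<Longrightarrow> k (x(m := z)) \<noteq> 0"
begin

lemma slice_in: "x \<in> polydisc m \<delta> \<Longrightarrow> cmod z < \<epsilon> \<Longrightarrow> x(m := z) \<in> polydisc (Suc m) \<epsilon>"
  using polydisc_upd[of x m \<epsilon> z] polydisc_mono[OF radii(3), of m] by blast

lemma slice_curve:
  assumes "open S" "\<And>i. (\<lambda>s. \<psi> s i) holomorphic_on S" "\<psi> ` S \<subseteq> polydisc m \<delta>" "g holomorphic_on S"
    "\<And>s. s \<in> S \<Longrightarrow> cmod (g s) < \<epsilon>"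
  shows "(\<lambda>s. k ((\<psi> s)(m := g s))) holomorphic_on S"
proof (rule curve_holomorphic_compose[OF holomorphic assms(1)])
  show "(\<lambda>s. ((\<psi> s)(m := g s)) i) holomorphic_on S" for i
    using assms(2)[of i] assms(4) by (cases "i = m") auto
  show "(\<lambda>s. (\<psi> s)(m := g s)) ` S \<subseteq> polydisc (Suc m) \<epsilon>"
    using assms(3,5) slice_in by blast
qed

sublocale root_family "polydisc m \<delta>" "\<lambda>x z. k (x(m := z))" \<rho> \<epsilon>
proof
  show "continuous_on (polydisc m \<delta> \<times> ball 0 \<epsilon>) (\<lambda>(x, z). k (x(m := z)))"
    unfolding split_beta
  proof (rule continuous_on_compose2[OF curve_holomorphic_continuous[OF holomorphic]])
    show "continuous_on (polydisc m \<delta> \<times> ball 0 \<epsilon>) (\<lambda>x. (fst x)(m := snd x))"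
      by (intro continuous_on_upd continuous_intros)
    show "(\<lambda>x. (fst x)(m := snd x)) ` (polydisc m \<delta> \<times> ball 0 \<epsilon>) \<subseteq> polydisc (Suc m) \<epsilon>"
      using slice_in by auto
  qed
  show "(\<lambda>z. k (x(m := z))) holomorphic_on ball 0 \<epsilon>" if "x \<in> polydisc m \<delta>" for x
    by (rule slice_curve[of _ "\<lambda>_. x" "\<lambda>z. z"]) (use that in auto)
qed (use radii circle in auto)

lemma power_sum_curve_holomorphic: "curve_holomorphic m \<delta> (power_sum a)"
proof (rule curve_holomorphicI)
  show "continuous_on (polydisc m \<delta>) (power_sum a)" by (rule continuous_on_power_sum)
  fix S \<psi> assume \<psi>: "open S" "\<And>i. (\<lambda>s. \<psi> s i) holomorphic_on S" "\<psi> ` S \<subseteq> polydisc m \<delta>"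
  show "(\<lambda>s. power_sum a (\<psi> s)) holomorphic_on S"
  proof (rule power_sum_holomorphic[OF \<psi>(1,3) continuous_on_holomorphic_coords[OF \<psi>(2)]])
    show "(\<lambda>w. k ((\<psi> w)(m := z))) holomorphic_on S" if "z \<in> ball 0 \<epsilon>" for z
      by (rule slice_curve[OF \<psi>]) (use that in auto)
  qed
qed

lemma discriminant_curve_holomorphic: "curve_holomorphic m \<delta> (discriminant j)"
proof -
  obtain L where L: "\<And>x. x \<in> polydisc m \<delta> \<Longrightarrow> discriminant j x = (\<Sum>(c,\<alpha>)\<leftarrow>L. c * (\<Prod>i<j. power_sum (\<alpha> i) x))"
    using discriminant_eq_power_sums by blast
  have "curve_holomorphic m \<delta> (\<lambda>x. \<Sum>(c,\<alpha>)\<leftarrow>L. c * (\<Prod>i<j. power_sum (\<alpha> i) x))"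
  proof (induction L)
    case Nil
    show ?case unfolding list.map sum_list.Nil by (rule curve_holomorphic_const)
  next
    case (Cons a L)
    have "curve_holomorphic m \<delta> (\<lambda>x. fst a * (\<Prod>i<j. power_sum (snd a i) x))"
      by (intro curve_holomorphic_mult curve_holomorphic_const curve_holomorphic_prod power_sum_curve_holomorphic finite_lessThan)
    from curve_holomorphic_add[OF this Cons.IH] show ?case unfolding list.map sum_list.Cons split_beta .
  qed
  then show ?thesis by (rule curve_holomorphic_cong) (simp add: L)
qed

lemma card_roots_bounded:
  assumes "0 < \<delta>"
  obtains \<delta>' d where "0 < \<delta>'" "\<delta>' \<le> \<delta>" "\<And>x. x \<in> polydisc m \<delta>' \<Longrightarrow> card (roots x) \<le> d"
proof -
  have zero: "(\<lambda>_. 0) \<in> polydisc m \<delta>" using zero_in_polydisc[OF assms] .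
  then obtain e where e: "0 < e" "\<And>x. x \<in> polydisc m \<delta> \<Longrightarrow> dist x (\<lambda>_. 0) < e \<Longrightarrow> dist (power_sum 0 x) (power_sum 0 (\<lambda>_. 0)) < 1"
    using continuous_on_power_sum[of 0] unfolding continuous_on_iff by (metis zero_less_one)
  obtain \<delta>0 where \<delta>0: "0 < \<delta>0" "polydisc m \<delta>0 \<subseteq> ball (\<lambda>_. 0) e" using polydisc_subset_open[OF open_ball, of "\<lambda>_. 0" e] e(1) by auto
  define d where "d = nat \<lceil>Re (power_sum 0 (\<lambda>_. 0)) + 1\<rceil>"
  have "card (roots x) \<le> d" if "x \<in> polydisc m (min \<delta>0 \<delta>)" for x
  proof -
    have x: "x \<in> polydisc m \<delta>" "x \<in> ball (\<lambda>_. 0) e"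
      using that polydisc_mono[of "min \<delta>0 \<delta>" \<delta>0 m] polydisc_mono[of "min \<delta>0 \<delta>" \<delta> m] \<delta>0(2) by auto
    then have "cmod (power_sum 0 x - power_sum 0 (\<lambda>_. 0)) < 1" using e(2) by (simp add: dist_commute dist_norm)
    then have "Re (power_sum 0 x) < Re (power_sum 0 (\<lambda>_. 0)) + 1"
      using abs_Re_le_cmod[of "power_sum 0 x - power_sum 0 (\<lambda>_. 0)"] by simp
    then show ?thesis using card_roots_le_power_sum[OF x(1)] unfolding d_def by linarith
  qed
  then show ?thesis using that[of "min \<delta>0 \<delta>" d] \<delta>0(1) assms by simp
qed

lemma card_roots_eq:
  assumes x: "x \<in> polydisc m \<delta>" "x' \<in> polydisc m \<delta>" and bound: "card (roots x) \<le> d" "card (roots x') \<le> d"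
    and same: "\<And>j. j \<le> d \<Longrightarrow> discriminant j x = 0 \<longleftrightarrow> discriminant j x' = 0"
  shows "card (roots x) = card (roots x')"
proof (rule card_roots_eqI[OF x(1)])
  show "discriminant (card (roots x')) x \<noteq> 0" using discriminant_card_roots[OF x(2)] same bound(2) by blast
  show "discriminant j x = 0" if "card (roots x') < j" for j
  proof (cases "j \<le> d")
    case True then show ?thesis using same discriminant_eq_0[OF x(2) that] by simp
  next
    case False then show ?thesis using discriminant_eq_0[OF x(1), of j] bound(1) by simp
  qed
qed

lemma card_roots_punctured:
  assumes \<psi>: "\<And>i. (\<lambda>s. \<psi> s i) holomorphic_on ball 0 s0" "\<psi> ` ball 0 s0 \<subseteq> polydisc m \<delta>" and s0: "0 < s0"
    and card: "\<And>s. s \<in> {0<..<s0} \<Longrightarrow> card (roots (\<psi> (complex_of_real s))) = e"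
  obtains s1 where "0 < s1" "s1 \<le> s0" "\<And>s. s \<in> ball 0 s1 - {0} \<Longrightarrow> card (roots (\<psi> s)) = e"
proof -
  have hol: "(\<lambda>s. discriminant j (\<psi> s)) holomorphic_on ball 0 s0" for j
    by (rule curve_holomorphic_compose[OF discriminant_curve_holomorphic open_ball \<psi>])
  have dom: "\<psi> s \<in> polydisc m \<delta>" if "s \<in> ball 0 s0" for s using \<psi>(2) that by blast
  have zero: "discriminant j (\<psi> s) = 0" if "e < j" "s \<in> ball 0 s0" for j s
    using analytic_continuation_reals[OF hol _ that(2)] discriminant_eq_0[OF dom] card that(1) by simp
  have mid: "complex_of_real (s0/2) \<in> ball 0 s0" "0 \<in> ball (0::complex) s0" using s0 by auto
  have "discriminant e (\<psi> (of_real (s0/2))) \<noteq> 0"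
    using discriminant_card_roots[OF dom[OF mid(1)]] card[of "s0/2"] s0 by simp
  from non_zero_neighbour_alt[OF hol open_ball connected_ball mid(2,1) this]
  obtain d where d: "0 < d" "\<And>s. s \<noteq> 0 \<Longrightarrow> dist s 0 < d \<Longrightarrow> discriminant e (\<psi> s) \<noteq> 0"
    unfolding eventually_at by blast
  have "card (roots (\<psi> s)) = e" if "s \<in> ball 0 (min d s0) - {0}" for s
    by (rule card_roots_eqI[OF dom]) (use that d zero in auto)
  then show ?thesis using that[of "min d s0"] d(1) s0 by simp
qed

end

lemma polydisc_slice_exists:
  assumes k: "curve_holomorphic (Suc m) \<epsilon> k" and \<rho>: "0 < \<rho>" "\<rho> < \<epsilon>"
    and axis: "\<And>z. cmod z = \<rho> \<Longrightarrow> k ((\<lambda>_. 0)(m := z)) \<noteq> 0"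
  obtains \<delta> where "0 < \<delta>" "polydisc_slice m \<epsilon> \<rho> \<delta> k"
proof -
  have \<epsilon>: "0 < \<epsilon>" using \<rho> by simp
  have cont: "continuous_on (polydisc m \<epsilon> \<times> sphere 0 \<rho>) (\<lambda>(x,z). k (x(m := z)))"
    unfolding split_beta
  proof (rule continuous_on_compose2[OF curve_holomorphic_continuous[OF k]])
    show "continuous_on (polydisc m \<epsilon> \<times> sphere 0 \<rho>) (\<lambda>x. (fst x)(m := snd x))"
      by (intro continuous_on_upd continuous_intros)
    show "(\<lambda>x. (fst x)(m := snd x)) ` (polydisc m \<epsilon> \<times> sphere 0 \<rho>) \<subseteq> polydisc (Suc m) \<epsilon>"
      using polydisc_upd \<rho> by auto
  qed
  obtain d where d: "0 < d"
    "\<And>x z. x \<in> polydisc m \<epsilon> \<Longrightarrow> dist x (\<lambda>_. 0) < d \<Longrightarrow> z \<in> sphere 0 \<rho> \<Longrightarrow> k (x(m := z)) \<noteq> 0"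
    by (rule nonvanishing_near[OF cont compact_sphere zero_in_polydisc[OF \<epsilon>]]) (use axis in simp, rule that)
  obtain \<delta>0 where \<delta>0: "0 < \<delta>0" "polydisc m \<delta>0 \<subseteq> ball (\<lambda>_. 0) d" using polydisc_subset_open[OF open_ball, of "\<lambda>_. 0" d] d(1) by auto
  have "x \<in> polydisc m \<epsilon> \<and> dist x (\<lambda>_. 0) < d" if "x \<in> polydisc m (min \<delta>0 \<epsilon>)" for x
    using that polydisc_mono[of "min \<delta>0 \<epsilon>" \<delta>0 m] polydisc_mono[of "min \<delta>0 \<epsilon>" \<epsilon> m] \<delta>0(2) by (auto simp: dist_commute)
  then have "polydisc_slice m \<epsilon> \<rho> (min \<delta>0 \<epsilon>) k"
    using k \<rho> d(2) by unfold_locales auto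
  then show ?thesis using that[of "min \<delta>0 \<epsilon>"] \<delta>0(1) \<epsilon> by simp
qed

lemma polydisc_slice_subset: "polydisc_slice m \<epsilon> \<rho> \<delta> k \<Longrightarrow> \<delta>' \<le> \<delta> \<Longrightarrow> polydisc_slice m \<epsilon> \<rho> \<delta>' k"
  using polydisc_mono[of \<delta>' \<delta> m] by (auto simp: polydisc_slice_def)

lemma common_radius:
  fixes P :: "'a \<Rightarrow> real \<Rightarrow> bool"
  assumes "finite A" "\<And>a. a \<in> A \<Longrightarrow> \<exists>d>0. P a d" "\<And>a d d'. P a d \<Longrightarrow> 0 < d' \<Longrightarrow> d' \<le> d \<Longrightarrow> P a d'" and "0 < c"
  shows "\<exists>d>0. d \<le> c \<and> (\<forall>a\<in>A. P a d)"
  using assms(1,2)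
proof (induction A rule: finite_induct)
  case empty then show ?case using \<open>0 < c\<close> by auto
next
  case (insert a A)
  then obtain d where d: "d > 0" "d \<le> c" "\<forall>a\<in>A. P a d" by auto
  obtain d' where d': "d' > 0" "P a d'" using insert.prems by auto
  show ?case using d d' assms(3) by (intro exI[of _ "min d d'"]) (auto simp: min_def)
qed

subsection \<open>Strata and arcs\<close>

definition stratum :: "nat \<Rightarrow> ((nat \<Rightarrow> complex) \<Rightarrow> complex) set \<Rightarrow> real \<Rightarrow> (nat \<Rightarrow> complex) \<Rightarrow> (nat \<Rightarrow> complex) set" where
  "stratum m H \<epsilon> x = {y \<in> polydisc m \<epsilon>. real_point y \<and> (\<forall>h\<in>H. h y = 0 \<longleftrightarrow> h x = 0)}"

text \<open>The parameter of an arc ranges over a complex disc, but only its real points are of interest. The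
  constant arc is admitted, since the origin itself may be a stratum.\<close>

definition real_arc :: "nat \<Rightarrow> real \<Rightarrow> real \<Rightarrow> (complex \<Rightarrow> nat \<Rightarrow> complex) \<Rightarrow> bool" where
  "real_arc m \<epsilon> s0 \<psi> \<longleftrightarrow> 0 < s0 \<and> (\<forall>i. (\<lambda>s. \<psi> s i) holomorphic_on ball 0 s0) \<and>
      \<psi> ` ball 0 s0 \<subseteq> polydisc m \<epsilon> \<and> \<psi> 0 = (\<lambda>_. 0) \<and> (\<forall>s\<in>ball 0 s0. \<forall>i. \<psi> (cnj s) i = cnj (\<psi> s i)) \<and>
      (inj_on (\<lambda>s. \<psi> (complex_of_real s)) {-s0<..<s0} \<or> (\<forall>s\<in>ball 0 s0. \<psi> s = (\<lambda>_. 0)))"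

definition arc_reachable :: "nat \<Rightarrow> ((nat \<Rightarrow> complex) \<Rightarrow> complex) set \<Rightarrow> real \<Rightarrow> (nat \<Rightarrow> complex) \<Rightarrow> bool" where
  "arc_reachable m H \<epsilon> x \<longleftrightarrow> (\<exists>\<psi> s0. real_arc m \<epsilon> s0 \<psi> \<and>
      (\<forall>s\<in>{0<..<s0}. path_component (stratum m H \<epsilon> x) x (\<psi> (of_real s))))"

definition curve_selection :: "nat \<Rightarrow> bool" where
  "curve_selection m \<longleftrightarrow> (\<forall>H r. finite H \<longrightarrow> 0 < r \<longrightarrow> (\<forall>h\<in>H. curve_holomorphic m r h) \<longrightarrow>
      (\<exists>\<delta>>0. \<delta> \<le> r \<and> (\<forall>x\<in>polydisc m \<delta>. real_point x \<longrightarrow> arc_reachable m H r x)))"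

lemma real_arcD:
  assumes "real_arc m \<epsilon> s0 \<psi>"
  shows "0 < s0" "\<And>i. (\<lambda>s. \<psi> s i) holomorphic_on ball 0 s0" "\<And>s. s \<in> ball 0 s0 \<Longrightarrow> \<psi> s \<in> polydisc m \<epsilon>" "\<psi> 0 = (\<lambda>_. 0)"
    "\<And>s i. s \<in> ball 0 s0 \<Longrightarrow> \<psi> (cnj s) i = cnj (\<psi> s i)"
  using assms by (auto simp: real_arc_def)

lemma real_arc_continuous: "real_arc m \<epsilon> s0 \<psi> \<Longrightarrow> continuous_on (ball 0 s0) \<psi>"
  by (rule continuous_on_holomorphic_coords) (rule real_arcD)

lemma real_arc_real_point: "real_arc m \<epsilon> s0 \<psi> \<Longrightarrow> \<bar>s\<bar> < s0 \<Longrightarrow> real_point (\<psi> (of_real s))"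
  using real_arcD(5)[of m \<epsilon> s0 \<psi> "of_real s"] by (auto simp: real_point_def Reals_cnj_iff)

lemma real_arc_subset:
  assumes "real_arc m \<epsilon> s0 \<psi>" "0 < s1" "s1 \<le> s0" shows "real_arc m \<epsilon> s1 \<psi>"
proof -
  have sub: "ball 0 s1 \<subseteq> ball (0::complex) s0" "{-s1<..<s1} \<subseteq> {-s0<..<s0}" using assms(3) by auto
  show ?thesis
    using assms(1,2) sub(1) holomorphic_on_subset[OF _ sub(1)] inj_on_subset[OF _ sub(2)] unfolding real_arc_def by blast
qed

lemma real_arc_mono: "real_arc m \<epsilon> s0 \<psi> \<Longrightarrow> \<epsilon> \<le> r \<Longrightarrow> real_arc m r s0 \<psi>"
  using polydisc_mono[of \<epsilon> r m] unfolding real_arc_def by blast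

lemma real_arc_lift:
  assumes \<psi>: "real_arc m \<epsilon> s0 \<psi>" and inj: "inj_on (\<lambda>s. \<psi> (complex_of_real s)) {-s0<..<s0}" and "\<epsilon> \<le> \<epsilon>'"
    and Y: "real_germ r Y" "\<And>\<sigma>. \<sigma> \<in> ball 0 r \<Longrightarrow> cmod (Y \<sigma>) < \<epsilon>'"
    and N: "0 < N" "r \<le> root N s0" "even N \<Longrightarrow> \<forall>\<sigma>\<in>ball 0 r - {0}. Y (- \<sigma>) \<noteq> Y \<sigma>"
  shows "real_arc (Suc m) \<epsilon>' r (\<lambda>\<sigma>. (\<psi> (\<sigma> ^ N))(m := Y \<sigma>))"
proof -
  have pow: "\<sigma> ^ N \<in> ball 0 s0" if "\<sigma> \<in> ball 0 r" for \<sigma> :: complex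
    using power_strict_mono[of "cmod \<sigma>" "root N s0" N] that N(1,2) real_arcD(1)[OF \<psi>] by (simp add: norm_power)
  have "(\<lambda>\<sigma>. ((\<psi> (\<sigma> ^ N))(m := Y \<sigma>)) i) holomorphic_on ball 0 r" for i
  proof (cases "i = m")
    case False
    have "(\<lambda>\<sigma>. \<psi> (\<sigma> ^ N) i) holomorphic_on ball 0 r"
      by (rule holomorphic_on_compose2[OF real_arcD(2)[OF \<psi>]]) (use pow in \<open>auto intro!: holomorphic_intros\<close>)
    then show ?thesis using False by simp
  qed (use real_germD(2)[OF Y(1)] in simp)
  moreover have "(\<psi> (\<sigma> ^ N))(m := Y \<sigma>) \<in> polydisc (Suc m) \<epsilon>'" if "\<sigma> \<in> ball 0 r" for \<sigma>
    using polydisc_upd[of "\<psi> (\<sigma> ^ N)" m \<epsilon>'] polydisc_mono[OF \<open>\<epsilon> \<le> \<epsilon>'\<close>, of m] real_arcD(3)[OF \<psi> pow[OF that]] Y(2)[OF that] by blast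
  moreover have "inj_on (\<lambda>s. (\<psi> (complex_of_real s ^ N))(m := Y (of_real s))) {-r<..<r}"
  proof (rule inj_onI)
    fix a b assume ab: "a \<in> {-r<..<r}" "b \<in> {-r<..<r}"
      and same: "(\<psi> (complex_of_real a ^ N))(m := Y (of_real a)) = (\<psi> (of_real b ^ N))(m := Y (of_real b))"
    have less: "\<bar>a\<bar> < r" "\<bar>b\<bar> < r" using ab by auto
    then have "complex_of_real (a ^ N) \<in> ball 0 s0" "complex_of_real (b ^ N) \<in> ball 0 s0"
      using pow[of "of_real a"] pow[of "of_real b"] by simp_all
    note in_disc = real_arcD(3)[OF \<psi> this(1)] real_arcD(3)[OF \<psi> this(2)] this
    have "\<psi> (of_real (a ^ N)) i = \<psi> (of_real (b ^ N)) i" for i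
      using fun_cong[OF same, of i] in_disc(1,2) by (cases "i = m") (auto simp: polydisc_def)
    then have "\<psi> (of_real (a ^ N)) = \<psi> (of_real (b ^ N))" by blast
    moreover have "\<bar>a ^ N\<bar> < s0" "\<bar>b ^ N\<bar> < s0" using in_disc(3,4) by (simp_all del: of_real_power)
    ultimately have "a ^ N = b ^ N" using inj_onD[OF inj, of "a ^ N" "b ^ N"] by (simp add: abs_less_iff)
    then have "\<bar>a\<bar> = \<bar>b\<bar>" using N(1) by (metis abs_ge_zero power_abs power_eq_imp_eq_base)
    then consider "a = b" | "a = - b" "b \<noteq> 0" by linarith
    then show "a = b"
    proof cases
      case 2
      show ?thesis
      proof (cases "even N")
        case True
        then have "Y (- of_real b) \<noteq> Y (of_real b)" using bspec[OF N(3), of "of_real b"] less 2 by simp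
        then show ?thesis using fun_cong[OF same, of m] 2 by simp
      qed (use 2 \<open>a ^ N = b ^ N\<close> in simp)
    qed
  qed
  ultimately show ?thesis
    using real_germD[OF Y(1)] real_arcD(4,5)[OF \<psi>] pow N(1)
    by (auto simp: real_arc_def zero_power fun_eq_iff simp flip: complex_cnj_power)
qed

lemma arc_reachable_mono:
  assumes "arc_reachable m H \<epsilon> x" "\<epsilon> \<le> \<epsilon>'" "stratum m H \<epsilon> x \<subseteq> stratum m H' \<epsilon>' x"
  shows "arc_reachable m H' \<epsilon>' x"
  using assms real_arc_mono path_component_of_subset unfolding arc_reachable_def by metis

lemma arc_reachableI:
  assumes \<psi>: "real_arc m \<epsilon> s0 \<psi>" and in_stratum: "\<And>s. s \<in> {0<..<s0} \<Longrightarrow> \<psi> (of_real s) \<in> stratum m H \<epsilon> x"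
    and s: "s \<in> {0<..<s0}" "path_component (stratum m H \<epsilon> x) x (\<psi> (of_real s))"
  shows "arc_reachable m H \<epsilon> x"
proof -
  have "continuous_on {0<..<s0} (\<lambda>s. \<psi> (of_real s))"
    by (rule continuous_on_compose2[OF real_arc_continuous[OF \<psi>]]) (auto intro!: continuous_intros)
  moreover have "path_component {0<..<s0} s s'" if "s' \<in> {0<..<s0}" for s'
    using convex_imp_path_connected[OF convex_real_interval(8)[of 0 s0]] s(1) that unfolding path_connected_component by blast
  ultimately have "path_component (stratum m H \<epsilon> x) (\<psi> (of_real s)) (\<psi> (of_real s'))" if "s' \<in> {0<..<s0}" for s'
    using path_component_image[of "{0<..<s0}" s s' "\<lambda>s. \<psi> (of_real s)"] in_stratum that by blast
  then show ?thesis using \<psi> path_component_trans[OF s(2)] unfolding arc_reachable_def by blast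
qed

definition slice_count :: "nat \<Rightarrow> real \<Rightarrow> ((nat \<Rightarrow> complex) \<Rightarrow> complex) \<Rightarrow> (nat \<Rightarrow> complex) \<Rightarrow> nat" where
  "slice_count m \<rho> k x = card {z. cmod z < \<rho> \<and> k (x(m := z)) = 0}"

lemma (in polydisc_slice) slice_count_eq_card_roots: "slice_count m \<rho> k x = card (roots x)"
  by (simp add: slice_count_def roots_def)

definition slice_discriminant :: "nat \<Rightarrow> real \<Rightarrow> ((nat \<Rightarrow> complex) \<Rightarrow> complex) \<Rightarrow> nat \<Rightarrow> (nat \<Rightarrow> complex) \<Rightarrow> complex" where
  "slice_discriminant m \<rho> k = root_family.discriminant (\<lambda>x z. k (x(m := z))) \<rho>"

definition fun_prod :: "((nat \<Rightarrow> complex) \<Rightarrow> complex) set \<Rightarrow> (nat \<Rightarrow> complex) \<Rightarrow> complex" where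
  "fun_prod H x = (\<Prod>h\<in>H. h x)"

subsection \<open>Functions that are regular along the last coordinate axis\<close>

locale regular_family =
  fixes m :: nat and H :: "((nat \<Rightarrow> complex) \<Rightarrow> complex) set" and \<epsilon> \<rho> \<delta> :: real and d :: nat
  assumes finite: "finite H" and radius: "0 < \<delta>"
    and slices: "\<And>k. k \<in> insert (fun_prod H) H \<Longrightarrow> polydisc_slice m \<epsilon> \<rho> \<delta> k"
    and conj: "\<And>h x. h \<in> H \<Longrightarrow> x \<in> polydisc (Suc m) \<epsilon> \<Longrightarrow> h (\<lambda>i. cnj (x i)) = cnj (h x)"
    and axis: "\<And>h z. h \<in> H \<Longrightarrow> z \<noteq> 0 \<Longrightarrow> cmod z \<le> \<rho> \<Longrightarrow> h ((\<lambda>_. 0)(m := z)) \<noteq> 0"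
    and count: "\<And>k x. k \<in> insert (fun_prod H) H \<Longrightarrow> x \<in> polydisc m \<delta> \<Longrightarrow> slice_count m \<rho> k x \<le> d"
begin

abbreviation P where "P \<equiv> fun_prod H"

sublocale product: polydisc_slice m \<epsilon> \<rho> \<delta> P
  by (rule slices) simp

lemma P_eq_0_iff: "P x = 0 \<longleftrightarrow> (\<exists>h\<in>H. h x = 0)"
  unfolding fun_prod_def using finite by (rule prod_zero_iff)

lemma P_conj: "x \<in> polydisc (Suc m) \<epsilon> \<Longrightarrow> P (\<lambda>i. cnj (x i)) = cnj (P x)"
  by (simp add: fun_prod_def conj)

definition discriminants :: "((nat \<Rightarrow> complex) \<Rightarrow> complex) set" where
  "discriminants = (\<Union>k\<in>insert P H. slice_discriminant m \<rho> k ` {..d})"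

lemma discriminants_holomorphic: "finite discriminants" "h \<in> discriminants \<Longrightarrow> curve_holomorphic m \<delta> h"
  using finite polydisc_slice.discriminant_curve_holomorphic[OF slices]
  by (auto simp: discriminants_def slice_discriminant_def)

lemma slice_count_stratum:
  assumes k: "k \<in> insert P H" and x: "x \<in> polydisc m \<delta>" and w: "w \<in> stratum m discriminants \<delta> x"
  shows "slice_count m \<rho> k w = slice_count m \<rho> k x"
proof -
  interpret polydisc_slice m \<epsilon> \<rho> \<delta> k by (rule slices[OF k])
  have w': "w \<in> polydisc m \<delta>" using w by (simp add: stratum_def)
  have "slice_discriminant m \<rho> k j \<in> discriminants" if "j \<le> d" for j
    unfolding discriminants_def using k that by blast
  then have "discriminant j w = 0 \<longleftrightarrow> discriminant j x = 0" if "j \<le> d" for j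
    using w that unfolding stratum_def slice_discriminant_def by blast
  then show ?thesis
    using card_roots_eq[OF w' x, of d] count[OF k] x w' by (simp add: slice_count_eq_card_roots)
qed

lemma root_family_const_along:
  assumes k: "k \<in> insert P H" and x: "x \<in> polydisc m \<delta>"
    and u: "continuous_on T u" "u ` T \<subseteq> stratum m discriminants \<delta> x"
  shows "root_family_const T (\<lambda>t z. k ((u t)(m := z))) \<rho> \<epsilon> (slice_count m \<rho> k x)"
proof -
  interpret polydisc_slice m \<epsilon> \<rho> \<delta> k by (rule slices[OF k])
  show ?thesis
    by (rule root_family_const_compose[OF root_family_axioms u(1)])
      (use u(2) slice_count_stratum[OF k x] in \<open>auto simp: slice_count_def stratum_def\<close>)
qed

text \<open>Over a stratum of the discriminants the roots are continuous functions, so that paths can be lifted.\<close>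

lemma lift_path_component:
  assumes x: "x \<in> polydisc m \<delta>" and y: "\<bar>y\<bar> < \<rho>"
    and path: "path_component (stratum m discriminants \<delta> x) x w"
  obtains v where "\<bar>v\<bar> < \<rho>"
    "path_component (stratum (Suc m) H \<epsilon> (x(m := of_real y))) (x(m := of_real y)) (w(m := of_real v))"
proof -
  let ?S = "stratum m discriminants \<delta> x" and ?x = "x(m := complex_of_real y)"
  obtain q where "path q" "path_image q \<subseteq> ?S" "pathstart q = x" "pathfinish q = w"
    using path unfolding path_component_def by blast
  then have q: "continuous_on {0..1} q" "q ` {0..1} \<subseteq> ?S" "q 0 = x" "q 1 = w"
    by (simp_all only: path_def path_image_def pathstart_def pathfinish_def)
  have q_in: "q t \<in> polydisc m \<delta>" "real_point (q t)" if "t \<in> {0..1}" for t using subsetD[OF q(2) imageI[OF that]] by (simp_all add: stratum_def)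
  interpret real_product_family "{0..1}" "\<lambda>t z. P ((q t)(m := z))" \<rho> \<epsilon> "slice_count m \<rho> P x"
      H "\<lambda>h t z. h ((q t)(m := z))" "\<lambda>h. slice_count m \<rho> h x"
  proof (intro real_product_family.intro real_root_family.intro real_root_family_axioms.intro real_product_family_axioms.intro)
    show "P ((q t)(m := z)) = (\<Prod>h\<in>H. h ((q t)(m := z)))" for t z by (rule fun_prod_def)
    fix t :: real and z assume t: "t \<in> {0..1}" and z: "cmod z < \<rho>"
    have "(\<lambda>i. cnj (((q t)(m := z)) i)) = (q t)(m := cnj z)"
      using q_in(2)[OF t] by (auto simp: real_point_def Reals_cnj_iff)
    then show "P ((q t)(m := cnj z)) = cnj (P ((q t)(m := z)))"
      using P_conj[OF product.slice_in[OF q_in(1)[OF t]], of z] z product.radii by simp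
  qed (use root_family_const_along[OF _ x q(1,2)] finite in auto)
  obtain V :: "real \<Rightarrow> real" where V: "continuous_on {0..1} V" "V 0 = y" "\<And>t. t \<in> {0..1} \<Longrightarrow> \<bar>V t\<bar> < \<rho>"
    "\<And>h t. h \<in> H \<Longrightarrow> t \<in> {0..1} \<Longrightarrow> h ((q t)(m := of_real (V t))) = 0 \<longleftrightarrow> h ((q 0)(m := of_real y)) = 0"
    by (rule real_path_lift[OF _ y, of 0]) (auto intro: that)
  let ?p = "\<lambda>t. (q t)(m := complex_of_real (V t))"
  have "path ?p" unfolding path_def by (intro continuous_on_upd q(1) continuous_on_of_real V(1))
  moreover have "?p t \<in> stratum (Suc m) H \<epsilon> ?x" if t: "t \<in> {0..1}" for t
    using product.slice_in[OF q_in(1)[OF t], of "of_real (V t)"] q_in(2)[OF t] V(4)[OF _ t] V(3)[OF t] product.radii q(3)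
    by (auto simp: stratum_def real_point_def)
  ultimately have "path_component (stratum (Suc m) H \<epsilon> ?x) (?p 0) (?p 1)"
    unfolding path_component_def path_image_def pathstart_def pathfinish_def by (intro exI[of _ ?p]) auto
  then show ?thesis using that[of "V 1"] V(2,3) q(3,4) by simp
qed

lemma arc_reachable_axis:
  assumes y: "\<bar>y\<bar> < \<rho>" and path: "path_component (stratum (Suc m) H \<epsilon> x) x ((\<lambda>_. 0)(m := of_real y))"
  shows "arc_reachable (Suc m) H \<epsilon> x"
proof (cases "y = 0")
  case True
  have "(\<lambda>_. 0)(m := complex_of_real y) = (\<lambda>_. 0)" using True by auto
  moreover have "real_arc (Suc m) \<epsilon> 1 (\<lambda>_ _. 0)"
    using zero_in_polydisc[of \<epsilon> "Suc m"] product.radii by (auto simp: real_arc_def)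
  ultimately show ?thesis using path unfolding arc_reachable_def by force
next
  case False
  define c where "c = complex_of_real (sgn y)"
  have c: "cmod c = 1" "c \<noteq> 0" "cnj c = c" using False by (auto simp: c_def sgn_real_def)
  have end_point: "c * of_real \<bar>y\<bar> = of_real y" by (simp add: c_def sgn_mult_abs flip: of_real_mult)
  have "((\<lambda>_. 0)(m := complex_of_real y)) \<in> stratum (Suc m) H \<epsilon> x" using path path_component_mem(2) by blast
  then have nonzero: "h x \<noteq> 0" if "h \<in> H" for h using axis[OF that, of "of_real y"] y False that by (auto simp: stratum_def)
  have arc: "real_arc (Suc m) \<epsilon> \<rho> (\<lambda>s. (\<lambda>_. 0)(m := c * s))"
  proof -
    have "(\<lambda>s. ((\<lambda>_. 0)(m := c * s)) i) holomorphic_on ball 0 \<rho>" for i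
      by (cases "i = m") (auto intro!: holomorphic_intros)
    moreover have "inj_on (\<lambda>s. (\<lambda>_. 0::complex)(m := c * complex_of_real s)) {-\<rho><..<\<rho>}"
      using c(2) by (intro inj_onI) (auto dest!: fun_cong[of _ _ m])
    ultimately show ?thesis using product.radii c by (auto simp: real_arc_def polydisc_def norm_mult)
  qed
  have in_stratum: "(\<lambda>_. 0)(m := c * of_real s) \<in> stratum (Suc m) H \<epsilon> x" if "s \<in> {0<..<\<rho>}" for s
    using that c nonzero axis[of _ "c * of_real s"] product.radii
    by (auto simp: stratum_def polydisc_def real_point_def norm_mult c_def)
  have "path_component (stratum (Suc m) H \<epsilon> x) x ((\<lambda>_. 0)(m := c * of_real \<bar>y\<bar>))" using path by (simp only: end_point)
  from arc_reachableI[OF arc in_stratum _ this] show ?thesis using y False by simp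
qed

lemma slice_count_punctured:
  assumes x: "x \<in> polydisc m \<delta>" and \<psi>: "real_arc m \<delta> s0 \<psi>"
    and in_stratum: "\<And>s. s \<in> {0<..<s0} \<Longrightarrow> \<psi> (of_real s) \<in> stratum m discriminants \<delta> x"
  obtains s1 where "0 < s1" "s1 \<le> s0"
    "\<And>k s. k \<in> insert P H \<Longrightarrow> s \<in> ball 0 s1 - {0} \<Longrightarrow> slice_count m \<rho> k (\<psi> s) = slice_count m \<rho> k x"
proof -
  have "\<exists>s1>0. s1 \<le> s0 \<and> (\<forall>k\<in>insert P H. \<forall>s\<in>ball 0 s1 - {0}. slice_count m \<rho> k (\<psi> s) = slice_count m \<rho> k x)"
  proof (rule common_radius)
    fix k assume k: "k \<in> insert P H"
    interpret polydisc_slice m \<epsilon> \<rho> \<delta> k by (rule slices[OF k])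
    have "\<psi> ` ball 0 s0 \<subseteq> polydisc m \<delta>" using real_arcD(3)[OF \<psi>] by blast
    then obtain s1 where "0 < s1" "\<And>s. s \<in> ball 0 s1 - {0} \<Longrightarrow> card (roots (\<psi> s)) = slice_count m \<rho> k x"
      by (rule card_roots_punctured[OF real_arcD(2)[OF \<psi>] _ real_arcD(1)[OF \<psi>]])
        (use slice_count_stratum[OF k x in_stratum] in \<open>auto simp: slice_count_eq_card_roots\<close>)
    then show "\<exists>s1>0. \<forall>s\<in>ball 0 s1 - {0}. slice_count m \<rho> k (\<psi> s) = slice_count m \<rho> k x"
      unfolding slice_count_eq_card_roots by blast
  qed (use finite real_arcD(1)[OF \<psi>] in auto)
  then show ?thesis using that by blast
qed

lemma plane_family_along_arc:
  assumes \<psi>: "real_arc m \<delta> s1 \<psi>"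
    and counts: "\<And>k s. k \<in> insert P H \<Longrightarrow> s \<in> ball 0 s1 - {0} \<Longrightarrow> slice_count m \<rho> k (\<psi> s) = slice_count m \<rho> k x"
  shows "plane_family s1 (\<lambda>s z. P ((\<psi> s)(m := z))) \<rho> \<epsilon> (slice_count m \<rho> P x)
      H (\<lambda>h s z. h ((\<psi> s)(m := z))) (\<lambda>h. slice_count m \<rho> h x)"
proof -
  have sub: "\<psi> ` ball 0 s1 \<subseteq> polydisc m \<delta>" using real_arcD(3)[OF \<psi>] by blast
  have family: "root_family (ball 0 s1) (\<lambda>s z. k ((\<psi> s)(m := z))) \<rho> \<epsilon>" if "k \<in> insert P H" for k
  proof -
    interpret polydisc_slice m \<epsilon> \<rho> \<delta> k by (rule slices[OF that])
    show ?thesis by (rule root_family_compose[OF root_family_axioms real_arc_continuous[OF \<psi>] sub])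
  qed
  interpret root_family "ball 0 s1" "\<lambda>s z. P ((\<psi> s)(m := z))" \<rho> \<epsilon> by (rule family) simp
  show ?thesis
  proof (intro plane_family.intro punctured_family.intro punctured_family_axioms.intro plane_family_axioms.intro)
    show "P ((\<psi> s)(m := z)) = (\<Prod>h\<in>H. h ((\<psi> s)(m := z)))" for s z by (rule fun_prod_def)
    show "0 < s1" by (rule real_arcD(1)[OF \<psi>])
    show "card (roots s) = slice_count m \<rho> P x" if "s \<in> ball 0 s1 - {0}" for s
      using counts[OF _ that, of P] by (simp add: slice_count_def roots_def)
    show "roots 0 \<subseteq> {0}" using axis real_arcD(4)[OF \<psi>] by (force simp: roots_def P_eq_0_iff)
    show "(\<lambda>s. P ((\<psi> s)(m := z))) holomorphic_on ball 0 s1" if "z \<in> ball 0 \<epsilon>" for z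
      by (rule product.slice_curve[OF open_ball real_arcD(2)[OF \<psi>] sub]) (use that in auto)
    show "P ((\<psi> (cnj s))(m := cnj z)) = cnj (P ((\<psi> s)(m := z)))" if "s \<in> ball 0 s1" "z \<in> ball 0 \<epsilon>" for s z
    proof -
      have "(\<lambda>i. cnj (((\<psi> s)(m := z)) i)) = (\<psi> (cnj s))(m := cnj z)"
        using real_arcD(5)[OF \<psi> that(1)] by (auto simp: fun_eq_iff)
      then show ?thesis using P_conj[OF product.slice_in[OF real_arcD(3)[OF \<psi> that(1)]], of z] that(2) by simp
    qed
  qed (use family finite counts in \<open>auto simp: slice_count_def\<close>)
qed

lemma path_component_from_plane:
  fixes x :: "nat \<Rightarrow> complex"
  assumes \<psi>: "real_arc m \<delta> s1 \<psi>"
    and plane: "plane_family s1 (\<lambda>s z. P ((\<psi> s)(m := z))) \<rho> \<epsilon> e H (\<lambda>h s z. h ((\<psi> s)(m := z))) e'"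
    and start: "(\<psi> (of_real s0))(m := of_real v) \<in> stratum (Suc m) H \<epsilon> x"
    and path: "path_component (plane_family.real_stratum s1 \<rho> H (\<lambda>h s z. h ((\<psi> s)(m := z))) s0 v) (s0, v) (s, u)"
  shows "path_component (stratum (Suc m) H \<epsilon> x) ((\<psi> (of_real s0))(m := of_real v)) ((\<psi> (of_real s))(m := of_real u))"
proof -
  interpret plane_family s1 "\<lambda>s z. P ((\<psi> s)(m := z))" \<rho> \<epsilon> e H "\<lambda>h s z. h ((\<psi> s)(m := z))" e' by (rule plane)
  let ?f = "\<lambda>(s, v). (\<psi> (complex_of_real s))(m := complex_of_real v)"
  have "?f ` real_stratum s0 v \<subseteq> stratum (Suc m) H \<epsilon> x"
  proof clarify
    fix s u assume su: "(s,u) \<in> real_stratum s0 v"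
    then have "real_point (\<psi> (of_real s))" "\<psi> (of_real s) \<in> polydisc m \<delta>" "\<bar>u\<bar> < \<epsilon>"
      using real_arc_real_point[OF \<psi>, of s] real_arcD(3)[OF \<psi>, of "of_real s"] \<rho> by (auto simp: real_stratum_def)
    moreover from this have "(\<psi> (of_real s))(m := of_real u) \<in> polydisc (Suc m) \<epsilon>" by (intro product.slice_in) auto
    ultimately show "(\<psi> (of_real s))(m := of_real u) \<in> stratum (Suc m) H \<epsilon> x"
      using su start by (auto simp: stratum_def real_stratum_def real_point_def)
  qed
  moreover have "continuous_on (real_stratum s0 v) (\<lambda>x. \<psi> (of_real (fst x)))"
    by (rule continuous_on_compose2[OF real_arc_continuous[OF \<psi>]]) (auto simp: real_stratum_def intro!: continuous_intros)
  then have "continuous_on (real_stratum s0 v) ?f"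
    unfolding split_beta by (intro continuous_on_upd continuous_on_of_real continuous_on_snd continuous_on_id)
  ultimately show ?thesis using path_component_image[OF path, of ?f] by simp
qed

lemma arc_reachable_off_axis:
  assumes x: "x \<in> polydisc m \<delta>" and y: "\<bar>y\<bar> < \<rho>"
    and \<psi>: "real_arc m \<delta> s0 \<psi>" and inj: "inj_on (\<lambda>s. \<psi> (complex_of_real s)) {-s0<..<s0}"
    and path: "\<And>s. s \<in> {0<..<s0} \<Longrightarrow> path_component (stratum m discriminants \<delta> x) x (\<psi> (of_real s))"
  shows "arc_reachable (Suc m) H \<epsilon> (x(m := of_real y))"
proof -
  let ?x = "x(m := complex_of_real y)"
  let ?S = "stratum (Suc m) H \<epsilon> ?x"
  obtain s1 where r1: "0 < s1" "s1 \<le> s0"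
    "\<And>k s. k \<in> insert P H \<Longrightarrow> s \<in> ball 0 s1 - {0} \<Longrightarrow> slice_count m \<rho> k (\<psi> s) = slice_count m \<rho> k x"
    by (rule slice_count_punctured[OF x \<psi> path_component_mem(2)[OF path]]) (assumption, rule that)
  have \<psi>1: "real_arc m \<delta> s1 \<psi>" by (rule real_arc_subset[OF \<psi> r1(1,2)])
  note plane = plane_family_along_arc[OF \<psi>1 r1(3)]
  interpret plane_family s1 "\<lambda>s z. P ((\<psi> s)(m := z))" \<rho> \<epsilon> "slice_count m \<rho> P x"
      H "\<lambda>h s z. h ((\<psi> s)(m := z))" "\<lambda>h. slice_count m \<rho> h x" by (rule plane)
  have mid: "s1/2 \<in> {0<..<s1}" "s1/2 \<in> {0<..<s0}" using r1(1,2) by auto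
  obtain v where v: "\<bar>v\<bar> < \<rho>" "path_component ?S ?x ((\<psi> (of_real (s1/2)))(m := of_real v))"
    by (rule lift_path_component[OF x y path[OF mid(2)]])
  obtain N r Y where "arc_into_stratum (s1/2) v N r Y" by (rule arc_into_stratum_exists[OF mid(1) v(1)])
  then have N: "0 < N" "r \<le> root N s1" and Y: "real_germ r Y" "\<forall>\<sigma>\<in>ball 0 r. cmod (Y \<sigma>) < \<rho>"
      "even N \<longrightarrow> (\<forall>\<sigma>\<in>ball 0 r - {0}. Y (- \<sigma>) \<noteq> Y \<sigma>)"
    and into: "\<forall>\<sigma>\<in>{0<..<r}. path_component (real_stratum (s1/2) v) (s1/2, v) (\<sigma> ^ N, Re (Y (of_real \<sigma>)))"
    unfolding arc_into_stratum_def by blast+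
  have "real_arc (Suc m) \<epsilon> r (\<lambda>\<sigma>. (\<psi> (\<sigma> ^ N))(m := Y \<sigma>))"
  proof (rule real_arc_lift[OF \<psi>1])
    show "inj_on (\<lambda>s. \<psi> (complex_of_real s)) {-s1<..<s1}" by (rule inj_on_subset[OF inj]) (use r1(2) in auto)
    show "cmod (Y \<sigma>) < \<epsilon>" if "\<sigma> \<in> ball 0 r" for \<sigma> using bspec[OF Y(2) that] \<rho>(2) by simp
  qed (use N Y product.radii in auto)
  moreover have "path_component ?S ?x ((\<psi> (of_real \<sigma> ^ N))(m := Y (of_real \<sigma>)))" if \<sigma>: "\<sigma> \<in> {0<..<r}" for \<sigma>
  proof -
    have "path_component ?S ?x ((\<psi> (of_real (\<sigma> ^ N)))(m := of_real (Re (Y (of_real \<sigma>)))))"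
      using path_component_trans[OF v(2) path_component_from_plane[OF \<psi>1 plane path_component_mem(2)[OF v(2)] bspec[OF into \<sigma>]]] .
    then show ?thesis using real_germ_of_real[OF Y(1), of \<sigma>] \<sigma> by simp
  qed
  ultimately show ?thesis unfolding arc_reachable_def by blast
qed

lemma arc_reachable_lift:
  assumes x: "x \<in> polydisc m \<delta>" and y: "\<bar>y\<bar> < \<rho>" and reach: "arc_reachable m discriminants \<delta> x"
  shows "arc_reachable (Suc m) H \<epsilon> (x(m := of_real y))"
proof -
  obtain \<psi> s0 where \<psi>: "real_arc m \<delta> s0 \<psi>"
    and path: "\<And>s. s \<in> {0<..<s0} \<Longrightarrow> path_component (stratum m discriminants \<delta> x) x (\<psi> (of_real s))"
    using reach unfolding arc_reachable_def by blast
  consider "inj_on (\<lambda>s. \<psi> (complex_of_real s)) {-s0<..<s0}" | "\<forall>s\<in>ball 0 s0. \<psi> s = (\<lambda>_. 0)"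
    using \<psi> unfolding real_arc_def by blast
  then show ?thesis
  proof cases
    case 1
    then show ?thesis using arc_reachable_off_axis[OF x y \<psi> _ path] by blast
  next
    case 2
    have "s0/2 \<in> {0<..<s0}" using real_arcD(1)[OF \<psi>] by simp
    with path[OF this] 2 have "path_component (stratum m discriminants \<delta> x) x (\<lambda>_. 0)" by simp
    then show ?thesis using lift_path_component[OF x y] arc_reachable_axis by metis
  qed
qed

end

lemma regular_family_exists:
  assumes H: "finite H" "0 < \<epsilon>" "\<And>h. h \<in> H \<Longrightarrow> curve_holomorphic (Suc m) \<epsilon> h"
    and conj: "\<And>h x. h \<in> H \<Longrightarrow> x \<in> polydisc (Suc m) \<epsilon> \<Longrightarrow> h (\<lambda>i. cnj (x i)) = cnj (h x)"
    and regular: "\<And>h. h \<in> H \<Longrightarrow> \<exists>\<rho>>0. \<forall>z. z \<noteq> 0 \<longrightarrow> cmod z < \<rho> \<longrightarrow> h ((\<lambda>_. 0)(m := z)) \<noteq> 0"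
  obtains \<rho> \<delta> d where "regular_family m H \<epsilon> \<rho> \<delta> d"
proof -
  let ?K = "insert (fun_prod H) H"
  have finite: "finite ?K" using H(1) by simp
  have hol: "curve_holomorphic (Suc m) \<epsilon> k" if "k \<in> ?K" for k
    using that H curve_holomorphic_prod[of H "Suc m" \<epsilon> "\<lambda>h. h"] by (auto simp: fun_prod_def[abs_def])
  obtain \<rho>0 where \<rho>0: "0 < \<rho>0" "\<rho>0 \<le> \<epsilon>" "\<forall>h\<in>H. \<forall>z. z \<noteq> 0 \<longrightarrow> cmod z < \<rho>0 \<longrightarrow> h ((\<lambda>_. 0)(m := z)) \<noteq> 0"
    using common_radius[OF H(1), of "\<lambda>h \<rho>. \<forall>z. z \<noteq> 0 \<longrightarrow> cmod z < \<rho> \<longrightarrow> h ((\<lambda>_. 0)(m := z)) \<noteq> 0" \<epsilon>] regular H(2) by force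
  define \<rho> where "\<rho> = \<rho>0 / 2"
  have \<rho>: "0 < \<rho>" "\<rho> < \<epsilon>" "\<rho> < \<rho>0" using \<rho>0(1,2) by (auto simp: \<rho>_def)
  have axis: "h ((\<lambda>_. 0)(m := z)) \<noteq> 0" if "h \<in> H" "z \<noteq> 0" "cmod z \<le> \<rho>" for h z
    using \<rho>0(3) that \<rho>(3) by auto
  have "k ((\<lambda>_. 0)(m := z)) \<noteq> 0" if "k \<in> ?K" "cmod z = \<rho>" for k z
    using that axis[of _ z] \<rho>(1) H(1) by (auto simp: fun_prod_def)
  then have "\<exists>\<delta>>0. polydisc_slice m \<epsilon> \<rho> \<delta> k" if "k \<in> ?K" for k
    using polydisc_slice_exists[OF hol[OF that] \<rho>(1,2)] that by metis
  then obtain \<delta>1 where \<delta>1: "0 < \<delta>1" "\<forall>k\<in>?K. polydisc_slice m \<epsilon> \<rho> \<delta>1 k"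
    using common_radius[OF finite, of "\<lambda>k \<delta>. polydisc_slice m \<epsilon> \<rho> \<delta> k" \<epsilon>] polydisc_slice_subset H(2) by metis
  have "\<exists>\<delta>>0. \<exists>d. \<forall>x\<in>polydisc m \<delta>. slice_count m \<rho> k x \<le> d" if "k \<in> ?K" for k
    using polydisc_slice.card_roots_bounded[of m \<epsilon> \<rho> \<delta>1 k] polydisc_slice.slice_count_eq_card_roots[of m \<epsilon> \<rho> \<delta>1 k] \<delta>1 that
    by (metis (no_types, lifting))
  moreover have "\<exists>e. \<forall>x\<in>polydisc m \<delta>'. slice_count m \<rho> k x \<le> e"
    if "\<exists>e. \<forall>x\<in>polydisc m \<delta>. slice_count m \<rho> k x \<le> e" "\<delta>' \<le> \<delta>" for k \<delta> \<delta>'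
    using that(1) polydisc_mono[OF that(2), of m] by blast
  ultimately obtain \<delta> where \<delta>: "0 < \<delta>" "\<delta> \<le> \<delta>1" "\<forall>k\<in>?K. \<exists>d. \<forall>x\<in>polydisc m \<delta>. slice_count m \<rho> k x \<le> d"
    using common_radius[OF finite, of "\<lambda>k \<delta>. \<exists>d. \<forall>x\<in>polydisc m \<delta>. slice_count m \<rho> k x \<le> d" \<delta>1] \<delta>1(1) by metis
  then obtain d where d: "\<And>k x. k \<in> ?K \<Longrightarrow> x \<in> polydisc m \<delta> \<Longrightarrow> slice_count m \<rho> k x \<le> d k" by metis
  have counts: "slice_count m \<rho> k x \<le> Max (d ` ?K)" if "k \<in> ?K" "x \<in> polydisc m \<delta>" for k x
    using d[OF that] Max_ge[of "d ` ?K" "d k"] finite that(1) by (meson finite_imageI image_eqI le_trans)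
  have slices: "polydisc_slice m \<epsilon> \<rho> \<delta> k" if "k \<in> ?K" for k
    using polydisc_slice_subset[OF _ \<delta>(2)] \<delta>1(2) that by blast
  have "regular_family m H \<epsilon> \<rho> \<delta> (Max (d ` ?K))"
  proof (rule regular_family.intro[OF H(1) \<delta>(1) slices _ _ counts])
    show "h (\<lambda>i. cnj (x i)) = cnj (h x)" if "h \<in> H" "x \<in> polydisc (Suc m) \<epsilon>" for h x by (rule conj[OF that])
    show "h ((\<lambda>_. 0)(m := z)) \<noteq> 0" if "h \<in> H" "z \<noteq> 0" "cmod z \<le> \<rho>" for h z by (rule axis[OF that])
  qed
  then show ?thesis by (rule that)
qed

theorem curve_selection_regular:
  assumes IH: "curve_selection m" and H: "finite H" "0 < \<epsilon>" "\<And>h. h \<in> H \<Longrightarrow> curve_holomorphic (Suc m) \<epsilon> h"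
    and conj: "\<And>h x. h \<in> H \<Longrightarrow> x \<in> polydisc (Suc m) \<epsilon> \<Longrightarrow> h (\<lambda>i. cnj (x i)) = cnj (h x)"
    and regular: "\<And>h. h \<in> H \<Longrightarrow> \<exists>\<rho>>0. \<forall>z. z \<noteq> 0 \<longrightarrow> cmod z < \<rho> \<longrightarrow> h ((\<lambda>_. 0)(m := z)) \<noteq> 0"
  obtains \<delta> where "0 < \<delta>" "\<delta> \<le> \<epsilon>" "\<And>x. x \<in> polydisc (Suc m) \<delta> \<Longrightarrow> real_point x \<Longrightarrow> arc_reachable (Suc m) H \<epsilon> x"
proof -
  obtain \<rho> \<delta> d where "regular_family m H \<epsilon> \<rho> \<delta> d" using regular_family_exists[OF H conj regular] by blast
  then interpret regular_family m H \<epsilon> \<rho> \<delta> d .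
  obtain \<delta>' where \<delta>': "0 < \<delta>'" "\<delta>' \<le> \<delta>" "\<And>x. x \<in> polydisc m \<delta>' \<Longrightarrow> real_point x \<Longrightarrow> arc_reachable m discriminants \<delta> x"
    using IH discriminants_holomorphic radius unfolding curve_selection_def by metis
  have "arc_reachable (Suc m) H \<epsilon> x" if x: "x \<in> polydisc (Suc m) (min \<delta>' \<rho>)" and real: "real_point x" for x
  proof -
    have xm: "x m = of_real (Re (x m))" using real by (simp add: real_point_def of_real_Re)
    have "cmod (x m) < \<rho>" using x by (simp add: polydisc_def)
    then have "\<bar>Re (x m)\<bar> < \<rho>" using xm by (metis norm_of_real)
    moreover have "x(m := 0) \<in> polydisc m \<delta>'" "x(m := 0) \<in> polydisc m \<delta>"
      using polydisc_restrict[OF x] polydisc_mono[of "min \<delta>' \<rho>" \<delta>' m] polydisc_mono[OF \<delta>'(2), of m] by auto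
    moreover have "real_point (x(m := 0))" using real by (simp add: real_point_def)
    ultimately have "arc_reachable (Suc m) H \<epsilon> ((x(m := 0))(m := of_real (Re (x m))))"
      using arc_reachable_lift \<delta>'(3) by blast
    then show ?thesis using xm by (metis fun_upd_triv fun_upd_upd)
  qed
  then show ?thesis using that[of "min \<delta>' \<rho>"] \<delta>'(1,2) product.radii by simp
qed

subsection \<open>Curve selection\<close>

lemma curve_selection_0: "curve_selection 0"
proof -
  have "arc_reachable 0 H r x" if "x \<in> polydisc 0 r" "0 < r" for H r x
  proof -
    have x: "x = (\<lambda>_. 0)" using that(1) by (auto simp: polydisc_def)
    have "real_arc 0 r 1 (\<lambda>_. x)" using that by (auto simp: real_arc_def x)
    moreover have "x \<in> stratum 0 H r x" using that by (simp add: stratum_def real_point_def x)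
    ultimately show ?thesis using path_component_refl unfolding arc_reachable_def by blast
  qed
  then show ?thesis unfolding curve_selection_def by blast
qed

lemma polydisc_complex_line:
  assumes "x \<in> polydisc m r" "y \<in> polydisc m r"
  shows "\<exists>S. open S \<and> convex S \<and> 0 \<in> S \<and> 1 \<in> S \<and> (\<lambda>z i. x i + z * (y i - x i)) ` S \<subseteq> polydisc m r"
proof -
  let ?S = "\<Inter>i\<in>{..<m}. {z. x i + z * (y i - x i) \<in> ball 0 r}"
  have "{z. x i + z * (y i - x i) \<in> ball 0 r} = (\<lambda>z. x i + z * (y i - x i)) -` ball 0 r" for i by auto
  then have "open {z. x i + z * (y i - x i) \<in> ball 0 r}" for i
    using open_vimage[OF open_ball, of "\<lambda>z. x i + z * (y i - x i)" 0 r] by (simp add: continuous_intros)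
  then have "open ?S" by (intro open_INT) auto
  moreover have "convex ?S"
  proof (intro convex_INT)
    fix i
    show "convex {z. x i + z * (y i - x i) \<in> ball 0 r}"
    proof (rule convexI)
      fix a b :: complex and u v :: real
      assume a: "a \<in> {z. x i + z * (y i - x i) \<in> ball 0 r}" "b \<in> {z. x i + z * (y i - x i) \<in> ball 0 r}" and uv: "0 \<le> u" "0 \<le> v" "u + v = 1"
      have "u *\<^sub>R (x i + a * (y i - x i)) + v *\<^sub>R (x i + b * (y i - x i)) \<in> ball 0 r"
        using a uv by (intro convexD[OF convex_ball]) auto
      moreover have "u *\<^sub>R (x i + a * (y i - x i)) + v *\<^sub>R (x i + b * (y i - x i)) = (u + v) *\<^sub>R x i + (u *\<^sub>R a + v *\<^sub>R b) * (y i - x i)"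
        by (simp add: algebra_simps scaleR_conv_of_real)
      ultimately show "u *\<^sub>R a + v *\<^sub>R b \<in> {z. x i + z * (y i - x i) \<in> ball 0 r}" using uv by simp
    qed
  qed
  moreover have "0 \<in> ?S" "1 \<in> ?S" using assms by (auto simp: polydisc_def)
  moreover have "(\<lambda>z i. x i + z * (y i - x i)) ` ?S \<subseteq> polydisc m r"
    using assms by (auto simp: polydisc_def)
  ultimately show ?thesis by blast
qed

lemma generic_point:
  assumes "finite H" "0 < r" "\<And>h. h \<in> H \<Longrightarrow> curve_holomorphic m r h"
    "\<And>h. h \<in> H \<Longrightarrow> \<exists>x\<in>polydisc m r. real_point x \<and> h x \<noteq> 0"
  shows "\<exists>v\<in>polydisc m r. real_point v \<and> (\<forall>h\<in>H. h v \<noteq> 0)"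
  using assms(1,3,4)
proof (induction H rule: finite_induct)
  case empty
  show ?case using zero_in_polydisc[OF assms(2)] by (intro bexI[of _ "\<lambda>_. 0"]) (auto simp: real_point_def)
next
  case (insert h H)
  then obtain v where v: "v \<in> polydisc m r" "real_point v" "\<forall>h\<in>H. h v \<noteq> 0" by auto
  obtain w where w: "w \<in> polydisc m r" "real_point w" "h w \<noteq> 0" using insert.prems(2)[of h] by auto
  let ?l = "\<lambda>z i. v i + z * (w i - v i)"
  obtain S where S: "open S" "convex S" "0 \<in> S" "1 \<in> S" "?l ` S \<subseteq> polydisc m r"
    using polydisc_complex_line[OF v(1) w(1)] by blast
  have hol: "(\<lambda>z. k (?l z)) holomorphic_on S" if "k \<in> insert h H" for k
    by (rule curve_holomorphic_compose[OF insert.prems(1)[OF that] S(1) _ S(5)]) (intro holomorphic_intros)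
  have "eventually (\<lambda>z. h (?l z) \<noteq> 0 \<and> z \<in> S) (at 0)"
    by (rule non_zero_neighbour_alt[OF hol S(1) convex_connected[OF S(2)] S(3,4)]) (use w in auto)
  moreover have "eventually (\<lambda>z. \<forall>k\<in>H. k (?l z) \<noteq> 0) (at 0)"
  proof (rule eventually_ball_finite[OF insert.hyps(1)], intro ballI)
    fix k assume "k \<in> H"
    then have "isCont (\<lambda>z. k (?l z)) 0"
      using holomorphic_on_imp_continuous_on[OF hol[of k]] S(1,3) by (simp add: continuous_on_eq_continuous_at)
    then have "((\<lambda>z. k (?l z)) \<longlongrightarrow> k v) (at 0)" by (simp add: isCont_def)
    then show "eventually (\<lambda>z. k (?l z) \<noteq> 0) (at 0)"
      using tendsto_imp_eventually_ne v(3) \<open>k \<in> H\<close> by blast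
  qed
  ultimately have "eventually (\<lambda>z. h (?l z) \<noteq> 0 \<and> z \<in> S \<and> (\<forall>k\<in>H. k (?l z) \<noteq> 0)) (at 0)"
    by eventually_elim auto
  then obtain d where d: "d > 0" "\<And>z. z \<noteq> 0 \<Longrightarrow> dist z 0 < d \<Longrightarrow> h (?l z) \<noteq> 0 \<and> z \<in> S \<and> (\<forall>k\<in>H. k (?l z) \<noteq> 0)"
    unfolding eventually_at by blast
  let ?z = "complex_of_real (d/2)"
  have z: "h (?l ?z) \<noteq> 0" "?z \<in> S" "\<forall>k\<in>H. k (?l ?z) \<noteq> 0" using d(2)[of ?z] d(1) by auto
  have "real_point (?l ?z)" using v(2) w(2) by (auto simp: real_point_def intro!: Reals_add Reals_mult Reals_diff)
  then show ?case using z S(5) by (intro bexI[of _ "?l ?z"]) auto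
qed

lemma nonvanishing_on_line:
  assumes h: "curve_holomorphic m r h" and r: "0 < r" and v: "v \<in> polydisc m r" "h v \<noteq> 0"
  obtains d where "0 < d" "\<And>z. z \<noteq> 0 \<Longrightarrow> cmod z < d \<Longrightarrow> h (\<lambda>i. z * v i) \<noteq> 0"
proof -
  obtain S where S: "open S" "convex S" "0 \<in> S" "1 \<in> S" "(\<lambda>z i. 0 + z * (v i - 0)) ` S \<subseteq> polydisc m r"
    using polydisc_complex_line[OF zero_in_polydisc[OF r] v(1)] by blast
  have "(\<lambda>z. h (\<lambda>i. z * v i)) holomorphic_on S"
    by (rule curve_holomorphic_compose[OF h S(1)]) (use S(5) in \<open>auto intro!: holomorphic_intros\<close>)
  from non_zero_neighbour_alt[OF this S(1) convex_connected[OF S(2)] S(3,4)] v(2)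
  have "eventually (\<lambda>z. h (\<lambda>i. z * v i) \<noteq> 0 \<and> z \<in> S) (at 0)" by simp
  then show ?thesis using that unfolding eventually_at by (auto simp: dist_norm)
qed

locale real_shear =
  fixes m :: nat and c :: "nat \<Rightarrow> complex" and C :: real
  assumes real: "\<And>i. c i \<in> \<real>" and beyond: "\<And>i. m \<le> i \<Longrightarrow> c i = 0" and bound: "\<And>i. cmod (c i) \<le> C"
begin

definition shear :: "(nat \<Rightarrow> complex) \<Rightarrow> nat \<Rightarrow> complex" where "shear y i = y i + c i * y m"

definition unshear :: "(nat \<Rightarrow> complex) \<Rightarrow> nat \<Rightarrow> complex" where "unshear y i = y i - c i * y m"

lemma shear_unshear [simp]: "shear (unshear x) = x"
  and unshear_shear [simp]: "unshear (shear x) = x"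
  by (auto simp: shear_def unshear_def beyond)

lemma C_nonneg: "0 \<le> C"
  using bound[of m] norm_ge_zero[of "c m"] by linarith

lemma shear_polydisc: "y \<in> polydisc (Suc m) e \<Longrightarrow> shear y \<in> polydisc (Suc m) ((1 + C) * e)"
  and unshear_polydisc: "y \<in> polydisc (Suc m) e \<Longrightarrow> unshear y \<in> polydisc (Suc m) ((1 + C) * e)"
proof -
  assume y: "y \<in> polydisc (Suc m) e"
  have "cmod (y i + c i * y m) < (1 + C) * e \<and> cmod (y i - c i * y m) < (1 + C) * e" if "i < Suc m" for i
  proof -
    have "cmod (y m) < e" "cmod (y i) < e" using y that by (auto simp: polydisc_def)
    moreover from this have "cmod (c i * y m) \<le> C * e"
      unfolding norm_mult using bound[of i] C_nonneg by (intro mult_mono) auto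
    ultimately have "cmod (y i) + cmod (c i * y m) < (1 + C) * e" by (simp add: algebra_simps)
    then show ?thesis
      using norm_triangle_ineq[of "y i" "c i * y m"] norm_triangle_ineq4[of "y i" "c i * y m"] by linarith
  qed
  moreover have "y i = 0 \<and> c i = 0" if "Suc m \<le> i" for i using y beyond[of i] that by (auto simp: polydisc_def)
  ultimately show "shear y \<in> polydisc (Suc m) ((1 + C) * e)" "unshear y \<in> polydisc (Suc m) ((1 + C) * e)"
    by (simp_all add: polydisc_def shear_def unshear_def)
qed

lemma shear_real_point: "real_point y \<Longrightarrow> real_point (shear y)"
  and unshear_real_point: "real_point y \<Longrightarrow> real_point (unshear y)"
  using real by (auto simp: real_point_def shear_def unshear_def)

lemma shear_cnj: "shear (\<lambda>i. cnj (y i)) = (\<lambda>i. cnj (shear y i))"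
  using real by (auto simp: shear_def Reals_cnj_iff)

lemma continuous_on_shear: "continuous_on S f \<Longrightarrow> continuous_on S (\<lambda>x. shear (f x))"
  for f :: "'a::topological_space \<Rightarrow> nat \<Rightarrow> complex"
proof (rule continuous_on_coordinatewise_then_product)
  fix i assume "continuous_on S f"
  then have "continuous_on S (\<lambda>x. f x j)" for j by (rule continuous_on_product_then_coordinatewise)
  then show "continuous_on S (\<lambda>x. shear (f x) i)"
    unfolding shear_def by (intro continuous_on_add continuous_on_mult continuous_on_const)
qed

lemma curve_holomorphic_shear:
  assumes h: "curve_holomorphic (Suc m) ((1 + C) * e) h"
  shows "curve_holomorphic (Suc m) e (\<lambda>y. h (shear y))"
proof (rule curve_holomorphicI)
  show "continuous_on (polydisc (Suc m) e) (\<lambda>y. h (shear y))"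
    by (rule continuous_on_compose2[OF curve_holomorphic_continuous[OF h] continuous_on_shear[OF continuous_on_id]])
      (use shear_polydisc in blast)
  fix S \<psi> assume \<psi>: "open S" "\<And>i. (\<lambda>s. \<psi> s i) holomorphic_on S" "\<psi> ` S \<subseteq> polydisc (Suc m) e"
  show "(\<lambda>s. h (shear (\<psi> s))) holomorphic_on S"
  proof (rule curve_holomorphic_compose[OF h \<psi>(1)])
    show "(\<lambda>s. shear (\<psi> s) i) holomorphic_on S" for i unfolding shear_def by (intro holomorphic_intros \<psi>(2))
    show "(\<lambda>s. shear (\<psi> s)) ` S \<subseteq> polydisc (Suc m) ((1 + C) * e)" using \<psi>(3) shear_polydisc by blast
  qed
qed

lemma real_arc_shear:
  assumes \<psi>: "real_arc (Suc m) e s0 \<psi>"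
  shows "real_arc (Suc m) ((1 + C) * e) s0 (\<lambda>s. shear (\<psi> s))"
proof -
  have "(\<lambda>s. shear (\<psi> s) i) holomorphic_on ball 0 s0" for i
    unfolding shear_def by (intro holomorphic_intros real_arcD(2)[OF \<psi>])
  moreover have "inj_on (\<lambda>s. shear (\<psi> (complex_of_real s))) {-s0<..<s0}"
    if "inj_on (\<lambda>s. \<psi> (complex_of_real s)) {-s0<..<s0}"
    using that by (metis (mono_tags, lifting) inj_on_def unshear_shear)
  moreover have "shear (\<lambda>_. 0) = (\<lambda>_. 0)" by (auto simp: shear_def)
  moreover have "shear (\<psi> (cnj s)) i = cnj (shear (\<psi> s) i)" if "s \<in> ball 0 s0" for s i
    using real_arcD(5)[OF \<psi> that] real by (simp add: shear_def Reals_cnj_iff)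
  ultimately show ?thesis using \<psi> shear_polydisc by (auto simp: real_arc_def image_subset_iff)
qed

lemma arc_reachable_shear:
  assumes "arc_reachable (Suc m) ((\<lambda>h y. h (shear y)) ` H) e (unshear x)"
  shows "arc_reachable (Suc m) H ((1 + C) * e) x"
proof -
  let ?S = "stratum (Suc m) ((\<lambda>h y. h (shear y)) ` H) e (unshear x)"
  obtain \<psi> s0 where \<psi>: "real_arc (Suc m) e s0 \<psi>"
    and path: "\<And>s. s \<in> {0<..<s0} \<Longrightarrow> path_component ?S (unshear x) (\<psi> (of_real s))"
    using assms unfolding arc_reachable_def by blast
  have "shear ` ?S \<subseteq> stratum (Suc m) H ((1 + C) * e) x"
    using shear_polydisc shear_real_point by (auto simp: stratum_def)
  from path_component_image[OF path continuous_on_shear[OF continuous_on_id] this]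
  have "\<forall>s\<in>{0<..<s0}. path_component (stratum (Suc m) H ((1 + C) * e) x) x (shear (\<psi> (of_real s)))" by simp
  then show ?thesis using real_arc_shear[OF \<psi>] unfolding arc_reachable_def by blast
qed

end

lemma curve_selection_generic:
  assumes IH: "curve_selection m" and H: "finite H" "0 < r" "\<And>h. h \<in> H \<Longrightarrow> curve_holomorphic (Suc m) r h"
    and conj: "\<And>h x. h \<in> H \<Longrightarrow> h (\<lambda>i. cnj (x i)) = cnj (h x)"
    and nonzero: "\<And>h. h \<in> H \<Longrightarrow> \<exists>x\<in>polydisc (Suc m) r. real_point x \<and> h x \<noteq> 0"
  obtains \<delta> where "0 < \<delta>" "\<delta> \<le> r" "\<And>x. x \<in> polydisc (Suc m) \<delta> \<Longrightarrow> real_point x \<Longrightarrow> arc_reachable (Suc m) H r x"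
proof -
  have "\<exists>x\<in>polydisc (Suc m) r. real_point x \<and> x m \<noteq> 0"
    using H(2) by (intro bexI[of _ "(\<lambda>_. 0)(m := complex_of_real (r/2))"]) (auto simp: real_point_def polydisc_def)
  then have "\<exists>v\<in>polydisc (Suc m) r. real_point v \<and> (\<forall>h\<in>insert (\<lambda>x. x m) H. h v \<noteq> 0)"
    using H nonzero curve_holomorphic_coord by (intro generic_point) auto
  then obtain v where v: "v \<in> polydisc (Suc m) r" "real_point v" "\<And>h. h \<in> H \<Longrightarrow> h v \<noteq> 0" "v m \<noteq> 0" by auto
  define c where "c i = (if i < m then v i / v m else 0)" for i
  define C where "C = (\<Sum>i<m. cmod (c i))"
  interpret real_shear m c C
  proof
    show "cmod (c i) \<le> C" for i
      using member_le_sum[of i "{..<m}" "\<lambda>i. cmod (c i)"] by (cases "i < m") (auto simp: C_def c_def sum_nonneg)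
  qed (use v(2) in \<open>auto simp: c_def real_point_def\<close>)
  define \<epsilon> where "\<epsilon> = r / (1 + C)"
  have \<epsilon>: "0 < \<epsilon>" "(1 + C) * \<epsilon> = r" using H(2) C_nonneg by (auto simp: \<epsilon>_def)
  have axis_image: "shear ((\<lambda>_. 0)(m := z)) = (\<lambda>i. (z / v m) * v i)" for z
    using v(1,4) by (auto simp: shear_def c_def polydisc_def fun_eq_iff not_less le_less_Suc_eq)
  let ?H = "(\<lambda>h y. h (shear y)) ` H"
  have "\<exists>\<rho>>0. \<forall>z. z \<noteq> 0 \<longrightarrow> cmod z < \<rho> \<longrightarrow> h (shear ((\<lambda>_. 0)(m := z))) \<noteq> 0" if h: "h \<in> H" for h
  proof -
    obtain d where d: "0 < d" "\<And>z. z \<noteq> 0 \<Longrightarrow> cmod z < d \<Longrightarrow> h (\<lambda>i. z * v i) \<noteq> 0"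
      using nonvanishing_on_line[OF H(3)[OF h] H(2) v(1) v(3)[OF h]] by blast
    have "h (shear ((\<lambda>_. 0)(m := z))) \<noteq> 0" if "z \<noteq> 0" "cmod z < d * cmod (v m)" for z
      unfolding axis_image using d(2)[of "z / v m"] that v(4) by (simp add: norm_divide field_simps)
    then show ?thesis using d(1) v(4) by (intro exI[of _ "d * cmod (v m)"]) auto
  qed
  then have regular: "\<exists>\<rho>>0. \<forall>z. z \<noteq> 0 \<longrightarrow> cmod z < \<rho> \<longrightarrow> h ((\<lambda>_. 0)(m := z)) \<noteq> 0" if "h \<in> ?H" for h using that by blast
  obtain \<delta> where \<delta>: "0 < \<delta>" "\<delta> \<le> \<epsilon>" "\<And>x. x \<in> polydisc (Suc m) \<delta> \<Longrightarrow> real_point x \<Longrightarrow> arc_reachable (Suc m) ?H \<epsilon> x"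
  proof (rule curve_selection_regular[OF IH _ \<epsilon>(1) _ _ regular])
    show "curve_holomorphic (Suc m) \<epsilon> h" if "h \<in> ?H" for h using that curve_holomorphic_shear[of \<epsilon>] H(3) \<epsilon>(2) by auto
  qed (use H(1) conj shear_cnj in auto)
  have "1 * (\<delta> / (1 + C)) \<le> (1 + C) * (\<delta> / (1 + C))" "1 * \<epsilon> \<le> (1 + C) * \<epsilon>"
    using \<delta>(1) \<epsilon>(1) C_nonneg by (intro mult_right_mono; simp)+
  then have "\<delta> / (1 + C) \<le> r" using \<delta>(2) \<epsilon>(2) C_nonneg by simp
  moreover have "arc_reachable (Suc m) H r x" if "x \<in> polydisc (Suc m) (\<delta> / (1 + C))" "real_point x" for x
    using arc_reachable_shear[OF \<delta>(3)] unshear_polydisc[OF that(1)] unshear_real_point[OF that(2)] \<epsilon>(2) C_nonneg by simp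
  ultimately show ?thesis using that[of "\<delta> / (1 + C)"] \<delta>(1) C_nonneg by simp
qed

lemma curve_selection_conj_symmetric:
  assumes IH: "curve_selection m" and H: "finite H" "0 < r" "\<And>h. h \<in> H \<Longrightarrow> curve_holomorphic (Suc m) r h"
    and conj: "\<And>h x. h \<in> H \<Longrightarrow> h (\<lambda>i. cnj (x i)) = cnj (h x)"
  obtains \<delta> where "0 < \<delta>" "\<delta> \<le> r" "\<And>x. x \<in> polydisc (Suc m) \<delta> \<Longrightarrow> real_point x \<Longrightarrow> arc_reachable (Suc m) H r x"
proof -
  define Z where "Z = {h \<in> H. \<exists>\<rho>>0. \<forall>x\<in>polydisc (Suc m) \<rho>. real_point x \<longrightarrow> h x = 0}"
  have "\<exists>d>0. d \<le> r \<and> (\<forall>h\<in>Z. \<forall>x\<in>polydisc (Suc m) d. real_point x \<longrightarrow> h x = 0)"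
  proof (rule common_radius[OF _ _ _ H(2)])
    show "\<forall>x\<in>polydisc (Suc m) d'. real_point x \<longrightarrow> h x = 0"
      if "\<forall>x\<in>polydisc (Suc m) d. real_point x \<longrightarrow> h x = 0" "d' \<le> d" for h :: "(nat \<Rightarrow> complex) \<Rightarrow> complex" and d d'
      using that(1) polydisc_mono[OF that(2), of "Suc m"] by blast
  qed (use H(1) in \<open>auto simp: Z_def\<close>)
  then obtain r1 where r1: "0 < r1" "r1 \<le> r" "\<And>h x. h \<in> Z \<Longrightarrow> x \<in> polydisc (Suc m) r1 \<Longrightarrow> real_point x \<Longrightarrow> h x = 0" by blast
  obtain \<delta> where \<delta>: "0 < \<delta>" "\<delta> \<le> r1"
    "\<And>x. x \<in> polydisc (Suc m) \<delta> \<Longrightarrow> real_point x \<Longrightarrow> arc_reachable (Suc m) (H - Z) r1 x"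
  proof (rule curve_selection_generic[OF IH _ r1(1), of "H - Z"])
    show "curve_holomorphic (Suc m) r1 h" if "h \<in> H - Z" for h using H(3) that curve_holomorphic_subset r1(2) by blast
    show "\<exists>x\<in>polydisc (Suc m) r1. real_point x \<and> h x \<noteq> 0" if "h \<in> H - Z" for h using that r1(1) by (auto simp: Z_def)
  qed (use H(1) conj in auto)
  have "arc_reachable (Suc m) H r x" if x: "x \<in> polydisc (Suc m) \<delta>" "real_point x" for x
  proof (rule arc_reachable_mono[OF \<delta>(3)[OF x] r1(2)])
    have "x \<in> polydisc (Suc m) r1" using x(1) polydisc_mono[OF \<delta>(2), of "Suc m"] by blast
    then have "h y = 0 \<longleftrightarrow> h x = 0" if "h \<in> Z" "y \<in> polydisc (Suc m) r1" "real_point y" for h y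
      using r1(3) that x(2) by simp
    then show "stratum (Suc m) (H - Z) r1 x \<subseteq> stratum (Suc m) H r x"
      using polydisc_mono[OF r1(2), of "Suc m"] by (auto simp: stratum_def)
  qed
  then show ?thesis using that[of \<delta>] \<delta>(1,2) r1(2) by simp
qed

theorem curve_selection_step:
  assumes IH: "curve_selection m" shows "curve_selection (Suc m)"
  unfolding curve_selection_def
proof (intro allI impI)
  fix H :: "((nat \<Rightarrow> complex) \<Rightarrow> complex) set" and r :: real
  assume H: "finite H" "0 < r" "\<forall>h\<in>H. curve_holomorphic (Suc m) r h"
  define re where "re h x = (h x + cnj (h (\<lambda>i. cnj (x i)))) * (1/2)" for h :: "(nat \<Rightarrow> complex) \<Rightarrow> complex" and x
  define im where "im h x = (h x + (-1) * cnj (h (\<lambda>i. cnj (x i)))) * (1/(2*\<i>))" for h :: "(nat \<Rightarrow> complex) \<Rightarrow> complex" and x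
  let ?H = "re ` H \<union> im ` H"
  have re_im: "curve_holomorphic (Suc m) r (re h)" "curve_holomorphic (Suc m) r (im h)" if "h \<in> H" for h
    unfolding re_def[abs_def] im_def[abs_def] using H(3) that
    by (intro curve_holomorphic_mult curve_holomorphic_add curve_holomorphic_const curve_holomorphic_cnj; simp)+
  obtain \<delta> where \<delta>: "0 < \<delta>" "\<delta> \<le> r" "\<And>x. x \<in> polydisc (Suc m) \<delta> \<Longrightarrow> real_point x \<Longrightarrow> arc_reachable (Suc m) ?H r x"
  proof (rule curve_selection_conj_symmetric[OF IH _ H(2), of ?H])
    show "h (\<lambda>i. cnj (x i)) = cnj (h x)" if "h \<in> ?H" for h x
      using that by (auto simp: re_def im_def field_simps)
  qed (use H(1) re_im in auto)
  have zero_iff: "h x = 0 \<longleftrightarrow> re h x = 0 \<and> im h x = 0" if "real_point x" for h x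
  proof -
    have "(\<lambda>i. cnj (x i)) = x" using that by (auto simp: real_point_def Reals_cnj_iff)
    then have "re h x = of_real (Re (h x))" "im h x = of_real (Im (h x))"
      by (simp_all add: re_def im_def complex_eq_iff)
    then show ?thesis by (simp add: complex_eq_iff)
  qed
  have "arc_reachable (Suc m) H r x" if "x \<in> polydisc (Suc m) \<delta>" "real_point x" for x
  proof (rule arc_reachable_mono[OF \<delta>(3)[OF that] order_refl])
    have "h y = 0 \<longleftrightarrow> h x = 0" if "y \<in> stratum (Suc m) ?H r x" "h \<in> H" for h y
      using that zero_iff[of y h] zero_iff[OF \<open>real_point x\<close>, of h] by (auto simp: stratum_def)
    then show "stratum (Suc m) ?H r x \<subseteq> stratum (Suc m) H r x" unfolding stratum_def by blast
  qed
  then show "\<exists>\<delta>>0. \<delta> \<le> r \<and> (\<forall>x\<in>polydisc (Suc m) \<delta>. real_point x \<longrightarrow> arc_reachable (Suc m) H r x)" using \<delta>(1,2) by blast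
qed

theorem curve_selection: "curve_selection m"
  by (induction m) (simp_all add: curve_selection_0 curve_selection_step)

lemma arc_through_real_arc:
  assumes \<psi>: "real_arc m r s0 \<psi>" and inj: "inj_on (\<lambda>s. \<psi> (complex_of_real s)) {-s0<..<s0}"
    and Z: "\<And>s. \<bar>s\<bar> < s0 \<Longrightarrow> \<psi> (of_real s) \<in> Z"
  shows "arc_through Z (\<lambda>_. 0) (\<lambda>t. \<psi> (of_real (t * (s0/2))))"
proof -
  let ?\<phi> = "\<lambda>t. \<psi> (complex_of_real (t * (s0/2)))"
  note s0 = real_arcD(1)[OF \<psi>]
  have dom: "\<bar>t * (s0/2)\<bar> < s0" if "t \<in> {-1..1}" for t
  proof -
    have "\<bar>t\<bar> * (s0/2) \<le> 1 * (s0/2)" using that s0 by (intro mult_right_mono) auto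
    then show ?thesis using s0 by (simp add: abs_mult)
  qed
  have "continuous_on {-1..1} ?\<phi>"
    by (rule continuous_on_compose2[OF real_arc_continuous[OF \<psi>]])
      (use dom in \<open>auto simp del: of_real_mult of_real_divide intro!: continuous_intros\<close>)
  moreover have "inj_on ?\<phi> {-1..1}"
  proof (rule inj_onI)
    fix a b :: real assume ab: "a \<in> {-1..1}" "b \<in> {-1..1}" "?\<phi> a = ?\<phi> b"
    then have "a * (s0/2) = b * (s0/2)"
      using inj_onD[OF inj, of "a * (s0/2)" "b * (s0/2)"] dom
      by (simp only: abs_less_iff greaterThanLessThan_iff minus_less_iff)
    then show "a = b" using s0 by simp
  qed
  moreover have "?\<phi> ` {-1..1} \<subseteq> Z" using Z dom by blast
  ultimately show ?thesis using real_arcD(4)[OF \<psi>] by (simp add: arc_through_def)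
qed

text \<open>The arc is a real analytic curve through the origin, so it also runs in the zero set
  for negative parameters.\<close>

lemma arc_reachable_imp_arc_through:
  assumes H: "\<And>h. h \<in> H \<Longrightarrow> curve_holomorphic m r h"
  defines "Z \<equiv> {x \<in> polydisc m r. real_point x \<and> (\<forall>h\<in>H. h x = 0)}"
  assumes x: "x \<in> Z" "x \<noteq> (\<lambda>_. 0)" and reach: "arc_reachable m (H \<union> (\<lambda>i x. x i) ` {..<m}) r x"
  shows "\<exists>\<phi>. arc_through Z (\<lambda>_. 0) \<phi> \<and> path_component (Z - {\<lambda>_. 0}) x (\<phi> 1)"
proof -
  let ?S = "stratum m (H \<union> (\<lambda>i x. x i) ` {..<m}) r x"
  obtain \<psi> s0 where \<psi>: "real_arc m r s0 \<psi>" and path: "\<And>s. s \<in> {0<..<s0} \<Longrightarrow> path_component ?S x (\<psi> (of_real s))"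
    using reach unfolding arc_reachable_def by blast
  note s0 = real_arcD(1)[OF \<psi>]
  obtain i where i: "i < m" "x i \<noteq> 0" using x by (auto simp: Z_def polydisc_def fun_eq_iff not_less) (metis not_less)
  have S: "?S \<subseteq> Z - {\<lambda>_. 0}"
  proof
    fix y assume y: "y \<in> ?S"
    then have same: "\<forall>h\<in>H \<union> (\<lambda>i x. x i) ` {..<m}. h y = 0 \<longleftrightarrow> h x = 0" unfolding stratum_def mem_Collect_eq by (elim conjE)
    have "y i = 0 \<longleftrightarrow> x i = 0" using bspec[OF same, of "\<lambda>x. x i"] i(1) by blast
    then show "y \<in> Z - {\<lambda>_. 0}" using y x(1) i(2) by (auto simp: stratum_def Z_def)
  qed
  have \<psi>S: "\<psi> (of_real s) \<in> ?S" if "s \<in> {0<..<s0}" for s using path_component_mem(2)[OF path[OF that]] .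
  have inj: "inj_on (\<lambda>s. \<psi> (complex_of_real s)) {-s0<..<s0}"
  proof -
    have "complex_of_real (s0/2) \<in> ball 0 s0" "\<psi> (of_real (s0/2)) \<noteq> (\<lambda>_. 0)" using \<psi>S[of "s0/2"] S s0 by auto
    then show ?thesis using \<psi> unfolding real_arc_def by blast
  qed
  have zero: "h (\<psi> w) = 0" if h: "h \<in> H" and w: "w \<in> ball 0 s0" for h w
  proof (rule analytic_continuation_reals[OF _ _ w])
    show "(\<lambda>s. h (\<psi> s)) holomorphic_on ball 0 s0"
      using real_arcD(2,3)[OF \<psi>] by (intro curve_holomorphic_compose[OF H[OF h]]) auto
    show "h (\<psi> (of_real s)) = 0" if "0 < s" "s < s0" for s using \<psi>S[of s] S h that by (auto simp: Z_def)
  qed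
  have "\<psi> (of_real s) \<in> Z" if "\<bar>s\<bar> < s0" for s
    using real_arc_real_point[OF \<psi> that] real_arcD(3)[OF \<psi>, of "of_real s"] zero[of _ "of_real s"] that by (simp add: Z_def)
  then have "arc_through Z (\<lambda>_. 0) (\<lambda>t. \<psi> (of_real (t * (s0/2))))" by (rule arc_through_real_arc[OF \<psi> inj])
  moreover have "path_component (Z - {\<lambda>_. 0}) x (\<psi> (of_real (1 * (s0/2))))"
    using path_component_of_subset[OF S path[of "s0/2"]] s0 by simp
  ultimately show ?thesis by blast
qed

corollary arc_linked_at_real_zero_set:
  assumes H: "finite H" "0 < r" "\<And>h. h \<in> H \<Longrightarrow> curve_holomorphic m r h"
  shows "arc_linked_at {x \<in> polydisc m r. real_point x \<and> (\<forall>h\<in>H. h x = 0)} (\<lambda>_. 0)"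
proof -
  let ?H = "H \<union> (\<lambda>i x. x i) ` {..<m}"
  have "finite ?H" "\<forall>h\<in>?H. curve_holomorphic m r h" using H(1,3) curve_holomorphic_coord[of m r] by auto
  then obtain \<delta> where \<delta>: "0 < \<delta>" "\<And>x. x \<in> polydisc m \<delta> \<Longrightarrow> real_point x \<Longrightarrow> arc_reachable m ?H r x"
    using curve_selection[of m, unfolded curve_selection_def] H(2) by metis
  define N where "N = (\<Inter>i<m. {x :: nat \<Rightarrow> complex. cmod (x i) < \<delta>})"
  have "open {x :: nat \<Rightarrow> complex. cmod (x i) < \<delta>}" for i
    by (intro open_Collect_less continuous_intros continuous_on_product_coordinates)
  then have "open N" "(\<lambda>_. 0) \<in> N" using \<delta>(1) by (auto simp: N_def)
  moreover have "x \<in> polydisc m \<delta>" if "x \<in> polydisc m r" "x \<in> N" for x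
    using that by (auto simp: N_def polydisc_def)
  ultimately show ?thesis
    unfolding arc_linked_at_def using arc_reachable_imp_arc_through[OF H(3)] \<delta>(2) by (intro exI[of _ N]) auto
qed

section \<open>Extension of arcs\<close>

subsection \<open>Arcs and rays\<close>

lemma first_hitting_time:
  fixes f :: "real \<Rightarrow> 'a::t2_space"
  assumes "continuous_on {a..b} f" "closed K" "a \<le> b" "f b \<in> K"
  obtains t where "t \<in> {a..b}" "f t \<in> K" "\<And>s. s \<in> {a..<t} \<Longrightarrow> f s \<notin> K"
proof -
  let ?H = "{a..b} \<inter> f -` K"
  have "closed ?H" using assms by (intro continuous_closed_preimage) auto
  then have "compact ?H" using bounded_subset[OF bounded_closed_interval[of a b], of ?H] by (simp add: compact_eq_bounded_closed)
  moreover have "?H \<noteq> {}" using assms(3,4) by auto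
  ultimately obtain t where t: "t \<in> ?H" "\<forall>s\<in>?H. t \<le> s" using compact_attains_inf by blast
  have "f s \<notin> K" if "s \<in> {a..<t}" for s using bspec[OF t(2), of s] t(1) that by auto
  then show thesis using that t(1) by blast
qed

lemma arc_until_closed_set:
  fixes g :: "real \<Rightarrow> 'a::real_normed_vector"
  assumes g: "arc g" and K: "closed K" "pathfinish g \<in> K" "pathstart g \<notin> K"
  obtains h where "arc h" "pathstart h = pathstart g" "path_image h \<subseteq> path_image g" "path_image h \<inter> K = {pathfinish h}"
proof -
  have "continuous_on {0..1} g" "g 1 \<in> K" using g K(2) by (simp_all add: arc_def path_def pathfinish_def)
  from first_hitting_time[OF this(1) K(1) zero_le_one this(2)]
  obtain t where t: "t \<in> {0..1}" "g t \<in> K" "\<And>s. s \<in> {0..<t} \<Longrightarrow> g s \<notin> K" by blast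
  have "t \<noteq> 0" using t(2) K(3) by (auto simp: pathstart_def)
  then have t0: "0 < t" using t(1) by simp
  have image: "path_image (subpath 0 t g) = g ` {0..t}" using t0 by (simp add: path_image_subpath)
  show thesis
  proof (rule that)
    show "arc (subpath 0 t g)" using g t(1) t0 by (intro arc_subpath_arc) auto
    show "pathstart (subpath 0 t g) = pathstart g" by (simp add: pathstart_def subpath_def)
    show "path_image (subpath 0 t g) \<subseteq> path_image g" using t(1) by (intro path_image_subpath_subset) auto
    have "g s = g t" if "s \<in> {0..t}" "g s \<in> K" for s using t(3)[of s] that by (cases "s = t") auto
    then show "path_image (subpath 0 t g) \<inter> K = {pathfinish (subpath 0 t g)}"
      unfolding image using t(2) t0 by auto
  qed
qed

lemma arc_on_segment:
  fixes \<phi> :: "real \<Rightarrow> 'a::t2_space"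
  assumes "continuous_on (closed_segment p q) \<phi>" "inj_on \<phi> (closed_segment p q)" "p \<noteq> q"
  shows "arc (\<phi> \<circ> linepath p q)"
  using assms inj_on_subset[OF assms(2)] arc_linepath[OF assms(3)] unfolding arc_def
  by (auto intro: path_continuous_image comp_inj_on simp: path_image_def[symmetric])

lemma path_component_on_interval:
  fixes f :: "real \<Rightarrow> 'a::topological_space"
  assumes "continuous_on I f" "is_interval I" "s \<in> I" "t \<in> I" "f ` I \<subseteq> S"
  shows "path_component S (f s) (f t)"
proof -
  have "path_connected (f ` I)" using assms(1,2) is_interval_path_connected by (intro path_connected_continuous_image)
  then have "path_component (f ` I) (f s) (f t)" using assms(3,4) by (simp add: path_connected_component)
  then show ?thesis by (rule path_component_of_subset[OF assms(5)])
qed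

lemma arc_linked_at_path_component:
  assumes "arc_linked_at Z y" "y \<in> Z"
  obtains N where "open N" "y \<in> N" "\<And>x. x \<in> Z \<inter> N \<Longrightarrow> path_component Z x y"
proof -
  obtain N where N: "open N" "y \<in> N" "\<forall>x\<in>Z \<inter> N - {y}. \<exists>\<phi>. arc_through Z y \<phi> \<and> path_component (Z - {y}) x (\<phi> 1)"
    using assms(1) unfolding arc_linked_at_def by blast
  have "path_component Z x y" if x: "x \<in> Z \<inter> N" for x
  proof (cases "x = y")
    case False
    then obtain \<phi> where \<phi>: "arc_through Z y \<phi>" "path_component (Z - {y}) x (\<phi> 1)" using N(3) x by blast
    have "path_component Z x (\<phi> 1)" by (rule path_component_of_subset[OF _ \<phi>(2)]) blast
    moreover have "path_component Z (\<phi> 1) (\<phi> 0)"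
      using \<phi>(1) unfolding arc_through_def by (intro path_component_on_interval[of "{-1..1}"]) auto
    ultimately show ?thesis using path_component_trans \<phi>(1) unfolding arc_through_def by metis
  qed (use assms(2) path_component_refl in simp)
  then show thesis using that N(1,2) by blast
qed

lemma arc_between_branches:
  fixes f :: "real \<Rightarrow> 'a::{complete_space,real_normed_vector}"
  assumes f: "continuous_on {a..d} f" "inj_on f {a..d}" and b: "f b \<notin> S"
    and p: "p \<in> {a..<b}" and q: "q \<in> {b<..d}" and S: "path_component S (f q) (f p)"
  obtains t1 t2 \<sigma> where "t1 \<in> {b<..d}" "t2 \<in> {a..<b}" "arc \<sigma>" "pathstart \<sigma> = f t1" "pathfinish \<sigma> = f t2"
    "path_image \<sigma> \<subseteq> S" "path_image \<sigma> \<inter> f ` {a..d} \<subseteq> {f t1, f t2}"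
proof -
  have K: "closed (f ` {a..b})" "closed (f ` {b..d})"
    using p q by (auto intro!: compact_imp_closed compact_continuous_image continuous_on_subset[OF f(1)])
  have inj: "s = t" if "f s = f t" "s \<in> {a..d}" "t \<in> {a..d}" for s t using inj_onD[OF f(2) that] .
  obtain h where h: "path h" "path_image h \<subseteq> S" "pathstart h = f q" "pathfinish h = f p"
    using S unfolding path_component_def by blast
  have "f q \<noteq> f p" using inj[of q p] p q by auto
  then obtain \<zeta> where \<zeta>: "arc \<zeta>" "path_image \<zeta> \<subseteq> path_image h" "pathstart \<zeta> = f q" "pathfinish \<zeta> = f p"
    using path_contains_arc[OF h(1,3,4)] by blast
  have "f q \<notin> f ` {a..b}" using inj[of q] p q by force
  then obtain \<eta> where \<eta>: "arc \<eta>" "pathstart \<eta> = f q" "path_image \<eta> \<subseteq> path_image \<zeta>" "path_image \<eta> \<inter> f ` {a..b} = {pathfinish \<eta>}"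
    using arc_until_closed_set[OF \<zeta>(1) K(1)] \<zeta>(3,4) p by (metis atLeastAtMost_iff atLeastLessThan_iff imageI less_imp_le)
  then obtain t2 where t2: "t2 \<in> {a..b}" "pathfinish \<eta> = f t2" by blast
  have \<eta>S: "path_image \<eta> \<subseteq> S" using \<eta>(3) \<zeta>(2) h(2) by blast
  then have "t2 \<noteq> b" using b t2(2) pathfinish_in_path_image[of \<eta>] by auto
  then have t2b: "t2 \<in> {a..<b}" using t2(1) by auto
  have "f t2 \<notin> f ` {b..d}" using inj[of t2] t2b p q by force
  then obtain \<rho> where \<rho>: "arc \<rho>" "pathstart \<rho> = f t2" "path_image \<rho> \<subseteq> path_image \<eta>" "path_image \<rho> \<inter> f ` {b..d} = {pathfinish \<rho>}"
    using arc_until_closed_set[OF arc_reversepath[OF \<eta>(1)] K(2)] \<eta>(2) t2(2) q by auto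
  then obtain t1 where t1: "t1 \<in> {b..d}" "pathfinish \<rho> = f t1" by blast
  have "t1 \<noteq> b" using b t1(2) pathfinish_in_path_image[of \<rho>] \<rho>(3) \<eta>S by auto
  then have "t1 \<in> {b<..d}" using t1(1) by auto
  moreover have "{a..d} = {a..b} \<union> {b..d}" using p q by auto
  then have "path_image \<rho> \<inter> f ` {a..d} \<subseteq> {f t1, f t2}" using \<rho>(3,4) \<eta>(4) t1(2) t2(2) by (auto simp: image_Un)
  ultimately show thesis
    using that[OF _ t2b arc_reversepath[OF \<rho>(1)]] \<rho>(2,3) \<eta>S t1(2) by simp
qed

lemma simple_loop_through:
  fixes \<phi> :: "real \<Rightarrow> 'a::{complete_space,real_normed_vector}"
  assumes \<phi>: "continuous_on {a..d} \<phi>" "inj_on \<phi> {a..d}" "\<phi> ` {a..d} \<subseteq> S" and b: "a < b" "b < d"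
    and S: "path_component (S - {\<phi> b}) (\<phi> d) (\<phi> a)"
  obtains g where "simple_path g" "pathfinish g = pathstart g" "path_image g \<subseteq> S" "\<phi> b \<in> path_image g"
proof -
  obtain t1 t2 \<sigma> where \<sigma>: "t1 \<in> {b<..d}" "t2 \<in> {a..<b}" "arc \<sigma>" "pathstart \<sigma> = \<phi> t1" "pathfinish \<sigma> = \<phi> t2"
      "path_image \<sigma> \<subseteq> S - {\<phi> b}" "path_image \<sigma> \<inter> \<phi> ` {a..d} \<subseteq> {\<phi> t1, \<phi> t2}"
    by (rule arc_between_branches[OF \<phi>(1,2) _ _ _ S, of b]) (use b in auto)
  define k where "k = \<phi> \<circ> linepath t2 t1"
  have seg: "closed_segment t2 t1 = {t2..t1}" "{t2..t1} \<subseteq> {a..d}" using \<sigma>(1,2) by (auto simp: closed_segment_eq_real_ivl)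
  have k: "arc k" unfolding k_def
    using \<sigma>(1,2) continuous_on_subset[OF \<phi>(1) seg(2)] inj_on_subset[OF \<phi>(2) seg(2)] by (intro arc_on_segment) (auto simp: seg(1))
  have ends: "pathstart k = \<phi> t2" "pathfinish k = \<phi> t1" by (simp_all add: k_def pathstart_compose pathfinish_compose)
  have image: "path_image k = \<phi> ` {t2..t1}" by (simp add: k_def path_image_compose seg(1))
  have sub: "path_image k \<subseteq> \<phi> ` {a..d}" unfolding image using seg(2) by (rule image_mono)
  show thesis
  proof (rule that)
    show "simple_path (k +++ \<sigma>)" by (rule simple_path_join_loop[OF k \<sigma>(3)]) (use \<sigma> sub ends in auto)
    show "path_image (k +++ \<sigma>) \<subseteq> S" using path_image_join_subset[of k \<sigma>] sub \<phi>(3) \<sigma>(6) by blast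
    have "\<phi> b \<in> path_image k" unfolding image using \<sigma>(1,2) by auto
    then show "\<phi> b \<in> path_image (k +++ \<sigma>)" by (simp add: path_image_join ends \<sigma>(4))
  qed (simp add: \<sigma>(5) ends)
qed

lemma half_line_parametrisation:
  obtains q :: "real \<Rightarrow> real" where "continuous_on {0..<1} q" "inj_on q {0..<1}" "q ` {0..<1} = {a..}" "q 0 = a"
    "filterlim q at_top (at_left 1)"
proof
  define q where "q x = a + x / (1 - x)" for x
  show "continuous_on {0..<1} q" unfolding q_def by (intro continuous_intros) auto
  show "inj_on q {0..<1}" by (rule inj_onI) (auto simp: q_def frac_eq_eq algebra_simps)
  show "q 0 = a" by (simp add: q_def)
  show "q ` {0..<1} = {a..}"
  proof
    have "t = q ((t - a) / (1 + (t - a)))" "(t - a) / (1 + (t - a)) \<in> {0..<1}" if "a \<le> t" for t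
      using that by (auto simp: q_def field_simps)
    then show "{a..} \<subseteq> q ` {0..<1}" by blast
  qed (auto simp: q_def)
  have "filterlim (\<lambda>x::real. 1 - x) (at_right 0) (at_left 1)"
    by (auto simp: filterlim_at eventually_at_filter intro!: tendsto_eq_intros)
  then have "filterlim (\<lambda>x. (a - 1) + inverse (1 - x)) at_top (at_left (1::real))"
    by (intro filterlim_tendsto_add_at_top[OF tendsto_const] filterlim_compose[OF filterlim_inverse_at_top_right])
  then show "filterlim q at_top (at_left 1)"
    by (rule filterlim_cong[THEN iffD1, OF refl refl, rotated]) (auto simp: q_def eventually_at_filter field_simps)
qed

lemma arc_to_limit:
  fixes \<beta> :: "real \<Rightarrow> 'a::t2_space"
  assumes \<beta>: "continuous_on {a..} \<beta>" "inj_on \<beta> {a..}" "(\<beta> \<longlongrightarrow> y) at_top" "y \<notin> \<beta> ` {a..}"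
  obtains e where "arc e" "pathstart e = \<beta> a" "pathfinish e = y" "path_image e = insert y (\<beta> ` {a..})"
proof -
  obtain q :: "real \<Rightarrow> real" where q: "continuous_on {0..<1} q" "inj_on q {0..<1}" "q ` {0..<1} = {a..}" "q 0 = a"
    "filterlim q at_top (at_left 1)" by (rule half_line_parametrisation)
  have qa: "q x \<in> {a..}" if "x \<in> {0..<1}" for x using q(3) that by blast
  define e where "e x = (if x < 1 then \<beta> (q x) else y)" for x
  have "((\<lambda>x. \<beta> (q x)) \<longlongrightarrow> y) (at_left 1)" by (rule filterlim_compose[OF \<beta>(3) q(5)])
  then have "(e \<longlongrightarrow> y) (at_left 1)"
    by (rule Lim_transform_eventually) (simp add: e_def eventually_at_filter)
  then have "continuous (at 1 within {0..1}) e" by (simp add: continuous_within e_def at_within_Icc_at_left)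
  moreover have "continuous (at x within {0..1}) e" if x: "x \<in> {0..<1}" for x
  proof -
    have "continuous_on {0..<1} (\<lambda>x. \<beta> (q x))" using qa by (intro continuous_on_compose2[OF \<beta>(1) q(1)]) blast
    then have "continuous_on {0..<1} e" by (rule continuous_on_eq) (simp add: e_def)
    moreover have "at x within {0..1} = at x within {0..<1}" using x by (intro at_within_nhd[of x "{..<1}"]) auto
    ultimately show ?thesis using x by (simp add: continuous_on_eq_continuous_within continuous_within)
  qed
  ultimately have "continuous_on {0..1} e" 
    unfolding continuous_on_eq_continuous_within by (metis atLeastAtMost_iff atLeastLessThan_iff less_eq_real_def)
  moreover have "inj_on e {0..1}"
  proof (rule linorder_inj_onI)
    fix s t :: real assume st: "s < t" "s \<in> {0..1}" "t \<in> {0..1}"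
    then have s: "e s = \<beta> (q s)" "q s \<in> {a..}" using qa[of s] by (auto simp: e_def)
    show "e s \<noteq> e t"
    proof (cases "t < 1")
      case True
      then show ?thesis using s st qa[of t] inj_onD[OF \<beta>(2), of "q s" "q t"] inj_onD[OF q(2), of s t] by (auto simp: e_def)
    qed (use s \<beta>(4) in \<open>auto simp: e_def\<close>)
  qed auto
  ultimately have "arc e" by (simp add: arc_def path_def)
  moreover have "path_image e = insert y (\<beta> ` {a..})"
  proof -
    have "{0..1} = insert 1 {0..<1::real}" by auto
    moreover have "e ` {0..<1} = \<beta> ` q ` {0..<1}" unfolding image_image by (rule image_cong) (auto simp: e_def)
    ultimately show ?thesis by (simp add: path_image_def q(3)) (simp add: e_def)
  qed
  ultimately show thesis by (intro that[of e]) (simp_all add: e_def q(4) pathstart_def pathfinish_def)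
qed

subsection \<open>Locally injective rays\<close>

definition append_at :: "real \<Rightarrow> (real \<Rightarrow> 'a) \<Rightarrow> (real \<Rightarrow> 'a) \<Rightarrow> real \<Rightarrow> 'a" where
  "append_at c f g t = (if t \<le> c then f t else g (t - c))"

lemma append_at_left: "t \<le> c \<Longrightarrow> append_at c f g t = f t"
  by (simp add: append_at_def)

lemma append_at_right: "f c = g 0 \<Longrightarrow> c \<le> t \<Longrightarrow> append_at c f g t = g (t - c)"
  by (simp add: append_at_def)

lemma continuous_on_append_at:
  fixes f g :: "real \<Rightarrow> 'a::topological_space"
  assumes "continuous_on {0..c} f" "continuous_on T g" "closed T" "T \<subseteq> {0..}" "f c = g 0"
  shows "continuous_on ({0..c} \<union> (+) c ` T) (append_at c f g)"
proof (rule continuous_on_closed_Un)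
  show "continuous_on {0..c} (append_at c f g)" by (rule continuous_on_eq[OF assms(1)]) (simp add: append_at_left)
  have "continuous_on ((+) c ` T) (\<lambda>t. g (t - c))"
    by (rule continuous_on_compose2[OF assms(2)]) (auto intro!: continuous_intros)
  then show "continuous_on ((+) c ` T) (append_at c f g)"
    by (rule continuous_on_eq) (use assms(4) in \<open>auto simp: append_at_right[of f c g, OF assms(5)]\<close>)
qed (auto simp: closed_translation assms(3))

lemma inj_on_append_at:
  assumes f: "inj_on f {0..c}" and g: "inj_on g {0..d}" "f c = g 0" and disjoint: "f ` {0..c} \<inter> g ` {0..d} \<subseteq> {f c}"
  shows "inj_on (append_at c f g) {0..c+d}"
proof (rule linorder_inj_onI)
  fix s t assume st: "s < t" "s \<in> {0..c+d}" "t \<in> {0..c+d}"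
  consider "t \<le> c" | "s \<le> c" "c < t" | "c < s" by linarith
  then show "append_at c f g s \<noteq> append_at c f g t"
  proof cases
    case 2
    then have "f s \<in> f ` {0..c}" "g (t - c) \<in> g ` {0..d}" using st by auto
    moreover have "g (t - c) \<noteq> f c" using inj_onD[OF g(1), of "t - c" 0] g(2) 2 st by auto
    ultimately have "f s \<noteq> g (t - c)" using disjoint by (metis IntI singletonD subsetD)
    then show ?thesis using 2 by (simp add: append_at_def)
  qed (use st inj_onD[OF f, of s t] inj_onD[OF g(1), of "s - c" "t - c"] in \<open>auto simp: append_at_def\<close>)
qed auto

definition ray_in :: "'a::topological_space set \<Rightarrow> (real \<Rightarrow> 'a) \<Rightarrow> bool" where
  "ray_in A f \<longleftrightarrow> continuous_on {0..} f \<and> locally_injective_on f {0..} \<and> f ` {0..} \<subseteq> A"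

lemma ray_in_inj_on:
  assumes "continuous_on {0..} f" "inj_on f {0..}" "f ` {0..} \<subseteq> A"
  shows "ray_in A f"
  using assms unfolding ray_in_def locally_injective_on_def by (metis Int_UNIV_right UNIV_I open_UNIV)

lemma locally_injective_on_append_at:
  assumes f: "inj_on f {0..c}" and g: "locally_injective_on g {0..}" "f c = g 0" and "0 < c" "0 < \<eta>"
    and cross: "\<And>s t. 0 \<le> s \<Longrightarrow> c - \<eta> < s \<Longrightarrow> s < c \<Longrightarrow> 0 < t \<Longrightarrow> t < \<eta> \<Longrightarrow> f s \<noteq> g t"
  shows "locally_injective_on (append_at c f g) {0..}"
  unfolding locally_injective_on_def
proof
  fix x assume x: "x \<in> {0::real..}"
  show "\<exists>N. open N \<and> x \<in> N \<and> inj_on (append_at c f g) ({0..} \<inter> N)"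
  proof (cases "x < c")
    case True
    have "inj_on (append_at c f g) ({0..} \<inter> {..<c})"
      by (rule inj_onI) (use inj_onD[OF f] in \<open>auto simp: append_at_left\<close>)
    then show ?thesis using True by (intro exI[of _ "{..<c}"]) auto
  next
    case False
    then have "x - c \<in> {0..}" by simp
    then obtain M where M: "open M" "x - c \<in> M" "inj_on g ({0..} \<inter> M)" using g(1) unfolding locally_injective_on_def by blast
    define N where "N = (\<lambda>t. t - c) -` M \<inter> {if x = c then c - \<eta> else c<..} \<inter> {..<if x = c then c + \<eta> else x + 1}"
    have "open ((\<lambda>t. t - c) -` M)" by (rule open_vimage[OF M(1)]) (intro continuous_intros)
    then have "open N" unfolding N_def by (intro open_Int open_greaterThan open_lessThan) (auto intro: open_Int)
    moreover have "x \<in> N" using M(2) False \<open>0 < \<eta>\<close> by (auto simp: N_def)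
    moreover have "inj_on (append_at c f g) ({0..} \<inter> N)"
    proof (rule linorder_inj_onI)
      fix s t assume st: "s < t" "s \<in> {0..} \<inter> N" "t \<in> {0..} \<inter> N"
      consider "t \<le> c" | "s < c" "c < t" | "c \<le> s" by linarith
      then show "append_at c f g s \<noteq> append_at c f g t"
      proof cases
        case 1 then show ?thesis using st inj_onD[OF f, of s t] by (auto simp: append_at_left)
      next
        case 2
        then have "f s \<noteq> g (t - c)" using st by (intro cross) (auto simp: N_def split: if_splits)
        then show ?thesis using 2 by (simp add: append_at_def)
      next
        case 3
        then show ?thesis using st inj_onD[OF M(3), of "s - c" "t - c"] by (auto simp: N_def append_at_right[of f c g, OF g(2)])
      qed
    qed auto
    ultimately show ?thesis by blast
  qed
qed

lemma ray_in_append_at: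
  assumes f: "continuous_on {0..c} f" "inj_on f {0..c}" "f ` {0..c} \<subseteq> A" and g: "ray_in A g" "f c = g 0"
    and "0 < c" "0 < \<eta>" and cross: "\<And>s t. 0 \<le> s \<Longrightarrow> c - \<eta> < s \<Longrightarrow> s < c \<Longrightarrow> 0 < t \<Longrightarrow> t < \<eta> \<Longrightarrow> f s \<noteq> g t"
  shows "ray_in A (append_at c f g)"
proof -
  have "{0..c} \<union> (+) c ` {0..} = {0..}" using \<open>0 < c\<close> by auto
  then have "continuous_on {0..} (append_at c f g)"
    using continuous_on_append_at[OF f(1), of "{0..}" g] g unfolding ray_in_def by auto
  moreover have "locally_injective_on (append_at c f g) {0..}"
    using g assms(6,7) by (intro locally_injective_on_append_at[OF f(2) _ _ _ _ cross]) (auto simp: ray_in_def)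
  moreover have "append_at c f g ` {0..} \<subseteq> A" using f(3) g(1) by (auto simp: append_at_def ray_in_def)
  ultimately show ?thesis by (simp add: ray_in_def)
qed

locale arc_extension =
  fixes A :: "'a::banach set" and \<gamma> \<tau> :: "real \<Rightarrow> 'a" and c0 :: real
  assumes compact_bounded: "\<And>R. compact (A \<inter> cball 0 R)"
    and arc_linked: "\<And>y \<epsilon>. y \<in> A \<Longrightarrow> 0 < \<epsilon> \<Longrightarrow> arc_linked_at (A \<inter> ball y \<epsilon>) y"
    and \<gamma>: "0 < c0" "continuous_on {0..c0} \<gamma>" "inj_on \<gamma> {0..c0}" "\<gamma> ` {0..c0} \<subseteq> A"
    and \<tau>: "continuous_on {0..} \<tau>" "inj_on \<tau> {0..}" "\<tau> ` {0..} \<subseteq> A" "\<tau> 0 = \<gamma> 0"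
    and \<gamma>\<tau>: "\<And>s t. 0 < s \<Longrightarrow> 0 < t \<Longrightarrow> t \<le> c0 \<Longrightarrow> \<tau> s \<noteq> \<gamma> t"
begin

definition extendable :: bool where
  "extendable \<longleftrightarrow> (\<exists>\<Gamma>. ray_in A \<Gamma> \<and> (\<exists>\<delta>. 0 < \<delta> \<and> \<delta> \<le> c0 \<and> (\<forall>t\<in>{0<..<\<delta>}. \<Gamma> t = \<gamma> t)) \<and>
      (filterlim (\<lambda>t. norm (\<Gamma> t)) at_top at_top \<or> (\<exists>T>0. \<Gamma> T = \<gamma> 0)))"

definition prolongs :: "(real \<Rightarrow> 'a) \<Rightarrow> real \<Rightarrow> bool" where
  "prolongs \<beta> c \<longleftrightarrow> 0 < c \<and> continuous_on {0..c} \<beta> \<and> inj_on \<beta> {0..c} \<and> \<beta> ` {0..c} \<subseteq> A \<and>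
      (\<exists>\<delta>. 0 < \<delta> \<and> \<delta> \<le> c0 \<and> \<delta> \<le> c \<and> (\<forall>t\<in>{0..\<delta>}. \<beta> t = \<gamma> t))"

lemma prolongsD:
  assumes "prolongs \<beta> c"
  shows "0 < c" "continuous_on {0..c} \<beta>" "inj_on \<beta> {0..c}" "\<beta> ` {0..c} \<subseteq> A" "\<beta> 0 = \<gamma> 0"
  using assms unfolding prolongs_def by (blast, blast, blast, blast, force)

lemma prolongs_initial:
  assumes "prolongs \<beta> c"
  obtains \<delta> where "0 < \<delta>" "\<delta> \<le> c0" "\<delta> \<le> c" "\<forall>t\<in>{0..\<delta>}. \<beta> t = \<gamma> t"
  using assms unfolding prolongs_def by blast

lemma prolongs_subset:
  assumes "prolongs \<beta> c" "0 < c'" "c' \<le> c"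
  shows "prolongs \<beta> c'"
proof -
  obtain \<delta> where "0 < \<delta>" "\<delta> \<le> c0" "\<delta> \<le> c" "\<forall>t\<in>{0..\<delta>}. \<beta> t = \<gamma> t" by (rule prolongs_initial[OF assms(1)])
  then have "\<exists>\<delta>. 0 < \<delta> \<and> \<delta> \<le> c0 \<and> \<delta> \<le> c' \<and> (\<forall>t\<in>{0..\<delta>}. \<beta> t = \<gamma> t)"
    using assms(2,3) by (intro exI[of _ "min \<delta> c'"]) auto
  moreover have "{0..c'} \<subseteq> {0..c}" using assms(3) by auto
  ultimately show ?thesis using prolongsD(2-4)[OF assms(1)] assms(2) unfolding prolongs_def
    by (blast intro: continuous_on_subset inj_on_subset)
qed

lemma prolongs_cong:
  assumes "prolongs \<beta> c" "\<And>t. t \<in> {0..c} \<Longrightarrow> \<beta>' t = \<beta> t"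
  shows "prolongs \<beta>' c"
proof -
  have "continuous_on {0..c} \<beta>'" by (rule continuous_on_eq[OF prolongsD(2)[OF assms(1)]]) (simp add: assms(2))
  moreover have "inj_on \<beta>' {0..c}" using prolongsD(3)[OF assms(1)] assms(2) inj_on_cong[of "{0..c}" \<beta>' \<beta>] by blast
  moreover have "\<beta>' ` {0..c} \<subseteq> A" using prolongsD(4)[OF assms(1)] assms(2) by auto
  moreover obtain \<delta> where "0 < \<delta>" "\<delta> \<le> c0" "\<delta> \<le> c" "\<forall>t\<in>{0..\<delta>}. \<beta> t = \<gamma> t" by (rule prolongs_initial[OF assms(1)])
  then have "\<exists>\<delta>. 0 < \<delta> \<and> \<delta> \<le> c0 \<and> \<delta> \<le> c \<and> (\<forall>t\<in>{0..\<delta>}. \<beta>' t = \<gamma> t)" using assms(2) by (intro exI[of _ \<delta>]) auto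
  ultimately show ?thesis unfolding prolongs_def using prolongsD(1)[OF assms(1)] by blast
qed

lemma prolongs_append_at:
  assumes \<beta>: "prolongs \<beta> c" and g: "arc g" "pathstart g = \<beta> c" "path_image g \<subseteq> A" "path_image g \<inter> \<beta> ` {0..c} \<subseteq> {\<beta> c}"
  shows "prolongs (append_at c \<beta> g) (c + 1)"
proof -
  have g': "continuous_on {0..1} g" "inj_on g {0..1}" "\<beta> c = g 0" "g ` {0..1} \<subseteq> A"
    using g by (simp_all add: arc_def path_def pathstart_def path_image_def)
  have "{0..c} \<union> (+) c ` {0..1} = {0..c+1}" using prolongsD(1)[OF \<beta>] by auto
  then have "continuous_on {0..c+1} (append_at c \<beta> g)"
    using continuous_on_append_at[OF prolongsD(2)[OF \<beta>] g'(1) _ _ g'(3)] by auto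
  moreover have "inj_on (append_at c \<beta> g) {0..c+1}"
    using g(4) by (intro inj_on_append_at prolongsD(3)[OF \<beta>] g') (auto simp: path_image_def)
  moreover have "append_at c \<beta> g ` {0..c+1} \<subseteq> A"
    using prolongsD(4)[OF \<beta>] g'(4) by (auto simp: append_at_def)
  moreover obtain \<delta> where "0 < \<delta>" "\<delta> \<le> c0" "\<delta> \<le> c" "\<forall>t\<in>{0..\<delta>}. \<beta> t = \<gamma> t" by (rule prolongs_initial[OF \<beta>])
  then have "\<exists>\<delta>. 0 < \<delta> \<and> \<delta> \<le> c0 \<and> \<delta> \<le> c + 1 \<and> (\<forall>t\<in>{0..\<delta>}. append_at c \<beta> g t = \<gamma> t)"
    by (intro exI[of _ \<delta>]) (auto simp: append_at_left)
  ultimately show ?thesis unfolding prolongs_def using prolongsD(1)[OF \<beta>] by auto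
qed

subsection \<open>Closing up a curve\<close>

lemma return_path:
  assumes \<beta>: "prolongs \<beta> c" and t: "0 \<le> t" "t < c"
  obtains \<omega> \<eta> where "ray_in A \<omega>" "\<omega> 0 = \<beta> t" "\<omega> t = \<gamma> 0" "0 < \<eta>" "\<And>s. 0 < s \<Longrightarrow> s < \<eta> \<Longrightarrow> \<omega> s \<in> \<beta> ` {0..c}"
proof (cases "t = 0")
  case True
  define q where "q s = c * (s / (1 + s))" for s :: real
  have "s / (1 + s) \<in> {0..1}" if "0 \<le> s" for s :: real using that by auto
  then have q: "q s \<in> {0..c}" if "0 \<le> s" for s
    unfolding q_def using that prolongsD(1)[OF \<beta>] mult_left_le[of "s / (1 + s)" c] by auto
  have q_inj: "inj_on q {0..}"
  proof (rule inj_onI)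
    fix s u :: real assume su: "s \<in> {0..}" "u \<in> {0..}" "q s = q u"
    then have "s / (1 + s) = u / (1 + u)" using prolongsD(1)[OF \<beta>] by (simp add: q_def del: times_divide_eq_right)
    then have "s * (1 + u) = u * (1 + s)" using su(1,2) by (simp add: frac_eq_eq)
    then show "s = u" by (simp add: algebra_simps)
  qed
  have image: "q ` {0..} \<subseteq> {0..c}" using q by blast
  have "continuous_on {0..} q" unfolding q_def by (intro continuous_intros) auto
  then have "continuous_on {0..} (\<beta> \<circ> q)"
    by (rule continuous_on_compose[OF _ continuous_on_subset[OF prolongsD(2)[OF \<beta>] image]])
  moreover have "inj_on (\<beta> \<circ> q) {0..}" by (rule comp_inj_on[OF q_inj inj_on_subset[OF prolongsD(3)[OF \<beta>] image]])
  moreover have "(\<beta> \<circ> q) ` {0..} \<subseteq> A" using image prolongsD(4)[OF \<beta>] unfolding image_comp[symmetric] by blast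
  ultimately have "ray_in A (\<beta> \<circ> q)" by (rule ray_in_inj_on)
  then show thesis by (rule that[of _ 1]) (use q True prolongsD(5)[OF \<beta>] in \<open>auto simp: q_def\<close>)
next
  case False
  define \<rho> where "\<rho> s = \<beta> (t - s)" for s
  obtain \<delta> where \<delta>: "0 < \<delta>" "\<delta> \<le> c0" "\<forall>s\<in>{0..\<delta>}. \<beta> s = \<gamma> s" by (rule prolongs_initial[OF \<beta>])
  have start: "\<rho> t = \<tau> 0" using prolongsD(5)[OF \<beta>] \<tau>(4) by (simp add: \<rho>_def)
  have "ray_in A (append_at t \<rho> \<tau>)"
  proof (rule ray_in_append_at[where \<eta> = \<delta>])
    show "continuous_on {0..t} \<rho>" unfolding \<rho>_def
      by (rule continuous_on_compose2[OF prolongsD(2)[OF \<beta>]]) (use t in \<open>auto intro!: continuous_intros\<close>)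
    show "inj_on \<rho> {0..t}" unfolding \<rho>_def by (rule inj_onI) (use t inj_onD[OF prolongsD(3)[OF \<beta>]] in fastforce)
    show "\<rho> ` {0..t} \<subseteq> A" using t prolongsD(4)[OF \<beta>] by (auto simp: \<rho>_def)
    show "ray_in A \<tau>" by (rule ray_in_inj_on[OF \<tau>(1-3)])
    show "\<rho> s \<noteq> \<tau> u" if "t - \<delta> < s" "s < t" "0 < u" for s u using \<delta> that \<gamma>\<tau>[of u "t - s"] by (auto simp: \<rho>_def)
  qed (use start False t \<delta> in auto)
  then show thesis
    by (rule that[of _ t])
      (use False t start \<tau>(4) in \<open>auto simp: append_at_left append_at_right[of \<rho> t \<tau>, OF start] \<rho>_def\<close>)
qed

lemma extendable_if_closed:
  assumes \<beta>: "prolongs \<beta> c" and \<sigma>: "arc \<sigma>" "pathstart \<sigma> = \<beta> c" "pathfinish \<sigma> = \<beta> t" "path_image \<sigma> \<subseteq> A"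
    and t: "0 \<le> t" "t < c" and disjoint: "path_image \<sigma> \<inter> \<beta> ` {0..c} \<subseteq> {\<beta> c, \<beta> t}"
  shows extendable
proof -
  obtain \<omega> \<eta> where \<omega>: "ray_in A \<omega>" "\<omega> 0 = \<beta> t" "\<omega> t = \<gamma> 0" "0 < \<eta>" "\<And>s. 0 < s \<Longrightarrow> s < \<eta> \<Longrightarrow> \<omega> s \<in> \<beta> ` {0..c}"
    by (rule return_path[OF \<beta> t]) (rule that)
  obtain \<delta> where \<delta>: "0 < \<delta>" "\<delta> \<le> c0" "\<delta> \<le> c" "\<forall>s\<in>{0..\<delta>}. \<beta> s = \<gamma> s" by (rule prolongs_initial[OF \<beta>])
  have \<sigma>': "continuous_on {0..1} \<sigma>" "inj_on \<sigma> {0..1}" "\<sigma> ` {0..1} \<subseteq> A" "\<sigma> 0 = \<beta> c" "\<sigma> 1 = \<beta> t"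
    using \<sigma> by (simp_all add: arc_def path_def path_image_def pathstart_def pathfinish_def)
  have free: "\<sigma> x \<notin> \<beta> ` {0..c}" if x: "0 < x" "x < 1" for x
  proof
    assume "\<sigma> x \<in> \<beta> ` {0..c}"
    moreover have "\<sigma> x \<in> path_image \<sigma>" using x by (simp add: path_image_def)
    ultimately have "\<sigma> x \<in> {\<sigma> 0, \<sigma> 1}" using disjoint \<sigma>'(4,5) by auto
    then show False using inj_onD[OF \<sigma>'(2), of x 0] inj_onD[OF \<sigma>'(2), of x 1] x by auto
  qed
  define \<zeta> where "\<zeta> = append_at 1 \<sigma> \<omega>"
  have \<zeta>: "ray_in A \<zeta>" unfolding \<zeta>_def
  proof (rule ray_in_append_at[OF \<sigma>'(1-3) \<omega>(1)])
    show "\<sigma> s \<noteq> \<omega> u" if "0 \<le> s" "1 - min 1 \<eta> < s" "s < 1" "0 < u" "u < min 1 \<eta>" for s u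
      using free[of s] \<omega>(5)[of u] that by (auto simp: min_def split: if_splits)
  qed (use \<sigma>'(5) \<omega>(2,4) in auto)
  define \<Gamma> where "\<Gamma> = append_at c \<beta> \<zeta>"
  have start: "\<beta> c = \<zeta> 0" by (simp add: \<zeta>_def append_at_left \<sigma>'(4))
  have "ray_in A \<Gamma>" unfolding \<Gamma>_def
  proof (rule ray_in_append_at[OF prolongsD(2-4)[OF \<beta>] \<zeta> start prolongsD(1)[OF \<beta>] zero_less_one])
    fix s u :: real assume "0 \<le> s" "s < c" "0 < u" "u < 1"
    then have "\<zeta> u = \<sigma> u" "\<beta> s \<in> \<beta> ` {0..c}" by (simp_all add: \<zeta>_def append_at_left)
    then show "\<beta> s \<noteq> \<zeta> u" using free[of u] \<open>0 < u\<close> \<open>u < 1\<close> by metis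
  qed
  moreover have "\<forall>s\<in>{0<..<\<delta>}. \<Gamma> s = \<gamma> s" using \<delta> by (auto simp: \<Gamma>_def append_at_left)
  moreover have "\<Gamma> (c + 1 + t) = \<gamma> 0"
    using t(1) \<omega>(2,3) \<sigma>'(5) start by (simp add: \<Gamma>_def \<zeta>_def append_at_right)
  moreover have "0 < c + 1 + t" using prolongsD(1)[OF \<beta>] t(1) by simp
  ultimately show extendable unfolding extendable_def using \<delta>(1,2) by blast
qed

lemma extendable_if_shortcut:
  assumes \<beta>: "prolongs \<beta> c" and ab: "0 \<le> a" "a < b" "b < c" and "path_component (A - {\<beta> b}) (\<beta> c) (\<beta> a)"
  shows extendable
proof -
  obtain t1 t2 \<sigma> where \<sigma>: "t1 \<in> {b<..c}" "t2 \<in> {0..<b}" "arc \<sigma>" "pathstart \<sigma> = \<beta> t1" "pathfinish \<sigma> = \<beta> t2"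
    "path_image \<sigma> \<subseteq> A - {\<beta> b}" "path_image \<sigma> \<inter> \<beta> ` {0..c} \<subseteq> {\<beta> t1, \<beta> t2}"
    by (rule arc_between_branches[OF prolongsD(2,3)[OF \<beta>] _ _ _ assms(5)]) (use ab in auto)
  have "prolongs \<beta> t1" by (rule prolongs_subset[OF \<beta>]) (use ab \<sigma>(1) in auto)
  then show extendable
  proof (rule extendable_if_closed[OF _ \<sigma>(3-5)])
    show "path_image \<sigma> \<inter> \<beta> ` {0..t1} \<subseteq> {\<beta> t1, \<beta> t2}" using \<sigma>(1,7) by auto
  qed (use \<sigma>(1,2,6) in auto)
qed

lemma extendable_if_meets_loop:
  assumes \<beta>: "prolongs \<beta> c" and g: "simple_path g" "pathfinish g = pathstart g" "path_image g \<subseteq> A"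
    and hit: "\<beta> c \<in> path_image g" "\<beta> 0 \<notin> path_image g"
  shows extendable
proof -
  have "closed (path_image g)" by (intro compact_imp_closed compact_simple_path_image g)
  then obtain t where t: "t \<in> {0..c}" "\<beta> t \<in> path_image g" and before: "\<And>s. s \<in> {0..<t} \<Longrightarrow> \<beta> s \<notin> path_image g"
    using first_hitting_time[OF prolongsD(2)[OF \<beta>] _ less_imp_le[OF prolongsD(1)[OF \<beta>]] hit(1)] by blast
  have t0: "0 < t" using t hit(2) by (cases "t = 0") auto
  have "g 0 \<noteq> g (1/2)" using g(1) unfolding simple_path_def loop_free_def by (force dest: bspec[of _ _ 0] bspec[of _ _ "1/2"])
  moreover have "g 0 \<in> path_image g" "g (1/2) \<in> path_image g" by (auto simp: path_image_def)
  ultimately obtain b where b: "b \<in> path_image g" "\<beta> t \<noteq> b" by metis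
  obtain u d where u: "arc u" "pathstart u = \<beta> t" "pathfinish u = b" and d: "arc d" "pathstart d = b" "pathfinish d = \<beta> t"
    and ud: "path_image u \<inter> path_image d = {\<beta> t, b}" "path_image u \<union> path_image d = path_image g"
    by (rule exists_double_arc[OF g(1,2) t(2) b])
  have disjoint: "path_image g \<inter> \<beta> ` {0..t} \<subseteq> {\<beta> t}"
  proof
    fix v assume "v \<in> path_image g \<inter> \<beta> ` {0..t}"
    then obtain s where "s \<in> {0..t}" "v = \<beta> s" "\<beta> s \<in> path_image g" by auto
    then show "v \<in> {\<beta> t}" using before[of s] by (cases "s = t") auto
  qed
  have u': "path_image u \<subseteq> A" "path_image u \<inter> \<beta> ` {0..t} \<subseteq> {\<beta> t}" using ud(2) g(3) disjoint by auto
  have image: "append_at t \<beta> u ` {0..t+1} \<subseteq> \<beta> ` {0..t} \<union> path_image u" by (auto simp: append_at_def path_image_def)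
  have ends: "append_at t \<beta> u (t + 1) = b" "append_at t \<beta> u t = \<beta> t"
    using u(3) by (simp_all add: append_at_def pathfinish_def)
  have "prolongs \<beta> t" by (rule prolongs_subset[OF \<beta> t0]) (use t(1) in simp)
  then have "prolongs (append_at t \<beta> u) (t + 1)" by (rule prolongs_append_at[OF _ u(1,2) u'])
  then show extendable
  proof (rule extendable_if_closed[OF _ d(1)])
    show "path_image d \<inter> append_at t \<beta> u ` {0..t+1} \<subseteq> {append_at t \<beta> u (t + 1), append_at t \<beta> u t}"
      unfolding ends using image disjoint ud by blast
  qed (use d ud(2) g(3) t0 ends in auto)
qed

subsection \<open>Continuing a curve that does not close up\<close>

lemma arc_leaves_curve:
  assumes ext: "\<not> extendable" and \<beta>: "prolongs \<beta> c" and B: "B \<subseteq> A" "B \<inter> \<beta> ` {0..c/2} = {}"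
    and \<phi>: "arc_through B (\<beta> c) \<phi>" and s: "s \<in> {c/2<..<c}" "path_component (B - {\<beta> c}) (\<beta> s) (\<phi> 1)"
  shows "\<phi> ` {-1..<0} \<inter> \<beta> ` {0..c} = {}"
proof (rule ccontr)
  assume "\<phi> ` {-1..<0} \<inter> \<beta> ` {0..c} \<noteq> {}"
  then obtain x t where x: "x \<in> {-1..<0}" "t \<in> {0..c}" "\<phi> x = \<beta> t" by blast
  have \<phi>': "continuous_on {-1..1} \<phi>" "inj_on \<phi> {-1..1}" "\<phi> ` {-1..1} \<subseteq> B" "\<phi> 0 = \<beta> c" using \<phi> by (auto simp: arc_through_def)
  have sub: "{x..1} \<subseteq> {-1..1}" using x(1) by auto
  note c = prolongsD(1)[OF \<beta>]
  have \<beta>_inj: "p = q" if "\<beta> p = \<beta> q" "p \<in> {0..c}" "q \<in> {0..c}" for p q using inj_onD[OF prolongsD(3)[OF \<beta>] that] .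
  have "\<phi> x \<noteq> \<phi> 0" using inj_onD[OF \<phi>'(2), of x 0] x(1) by auto
  then have "t \<noteq> c" using x(3) \<phi>'(4) by auto
  moreover have "\<phi> x \<in> B" using \<phi>'(3) x(1) by (auto simp: image_subset_iff)
  then have "t \<notin> {0..c/2}" using B(2) x(3) by auto
  ultimately have t: "t \<in> {c/2<..<c}" using x(2) by auto
  have "\<beta> 0 \<in> \<beta> ` {0..c/2}" using c by simp
  then have \<beta>0: "\<beta> 0 \<notin> B" using B(2) by blast
  have "path_component (A - {\<beta> 0} - {\<beta> c}) (\<phi> 1) (\<beta> s)"
    by (rule path_component_sym[OF path_component_of_subset[OF _ s(2)]]) (use B(1) \<beta>0 in blast)
  moreover have "\<beta> ` {c/2<..<c} \<subseteq> A - {\<beta> 0} - {\<beta> c}" using \<beta>_inj[of _ 0] \<beta>_inj[of _ c] prolongsD(4)[OF \<beta>] c by fastforce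
  then have "path_component (A - {\<beta> 0} - {\<beta> c}) (\<beta> s) (\<beta> t)"
    by (intro path_component_on_interval[OF _ is_interval_oo s(1) t] continuous_on_subset[OF prolongsD(2)[OF \<beta>]]) (use c in auto)
  ultimately have "path_component (A - {\<beta> 0} - {\<phi> 0}) (\<phi> 1) (\<phi> x)" using path_component_trans x(3) \<phi>'(4) by metis
  then obtain g where "simple_path g" "pathfinish g = pathstart g" "path_image g \<subseteq> A - {\<beta> 0}" "\<phi> 0 \<in> path_image g"
  proof (rule simple_loop_through[OF continuous_on_subset[OF \<phi>'(1) sub] inj_on_subset[OF \<phi>'(2) sub], rotated -2])
    show "\<phi> ` {x..1} \<subseteq> A - {\<beta> 0}" using image_mono[OF sub, of \<phi>] \<phi>'(3) B(1) \<beta>0 by blast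
  qed (use x(1) in auto)
  then have extendable using \<phi>'(4) by (intro extendable_if_meets_loop[OF \<beta>, of g]) auto
  then show False using ext by simp
qed

lemma exists_new_arc:
  assumes ext: "\<not> extendable" and \<beta>: "prolongs \<beta> c"
  obtains g where "arc g" "pathstart g = \<beta> c" "path_image g \<subseteq> A" "path_image g \<inter> \<beta> ` {0..c} \<subseteq> {\<beta> c}"
proof -
  note c = prolongsD(1)[OF \<beta>]
  have \<beta>_inj: "s = t" if "\<beta> s = \<beta> t" "s \<in> {0..c}" "t \<in> {0..c}" for s t using inj_onD[OF prolongsD(3)[OF \<beta>] that] .
  have "compact (\<beta> ` {0..c/2})"
    using c by (intro compact_continuous_image continuous_on_subset[OF prolongsD(2)[OF \<beta>]]) auto
  moreover have "\<beta> c \<notin> \<beta> ` {0..c/2}" using \<beta>_inj[of c] c by force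
  ultimately have "open (- \<beta> ` {0..c/2})" "\<beta> c \<in> - \<beta> ` {0..c/2}" by (auto intro: compact_imp_closed)
  then obtain \<epsilon> where \<epsilon>: "0 < \<epsilon>" "ball (\<beta> c) \<epsilon> \<subseteq> - \<beta> ` {0..c/2}" by (rule openE)
  define B where "B = A \<inter> ball (\<beta> c) \<epsilon>"
  have \<beta>c: "\<beta> c \<in> A" using prolongsD(4)[OF \<beta>] c by auto
  obtain N where N: "open N" "\<beta> c \<in> N"
    "\<forall>x\<in>B \<inter> N - {\<beta> c}. \<exists>\<phi>. arc_through B (\<beta> c) \<phi> \<and> path_component (B - {\<beta> c}) x (\<phi> 1)"
    using arc_linked[OF \<beta>c \<epsilon>(1)] unfolding arc_linked_at_def B_def by blast
  have "(\<beta> \<longlongrightarrow> \<beta> c) (at_left c)"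
    using prolongsD(2)[OF \<beta>] c by (auto simp: continuous_on_def at_within_Icc_at_left[symmetric])
  then have "\<forall>\<^sub>F s in at_left c. \<beta> s \<in> N \<inter> ball (\<beta> c) \<epsilon>" using N(1,2) \<epsilon>(1) by (intro topological_tendstoD) auto
  moreover have "\<forall>\<^sub>F s in at_left c. s \<in> {c/2<..<c}" using c by (intro eventually_at_left_real) simp
  ultimately have "\<forall>\<^sub>F s in at_left c. \<beta> s \<in> N \<inter> ball (\<beta> c) \<epsilon> \<and> s \<in> {c/2<..<c}" by eventually_elim simp
  from eventually_happens'[OF _ this] obtain s where s: "s \<in> {c/2<..<c}" "\<beta> s \<in> N" "\<beta> s \<in> ball (\<beta> c) \<epsilon>" by auto
  then have "\<beta> s \<in> B \<inter> N - {\<beta> c}" using prolongsD(4)[OF \<beta>] \<beta>_inj[of s c] c by (force simp: B_def)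
  with N(3) obtain \<phi> where \<phi>: "arc_through B (\<beta> c) \<phi>" "path_component (B - {\<beta> c}) (\<beta> s) (\<phi> 1)" by blast
  have disjoint: "\<phi> ` {-1..<0} \<inter> \<beta> ` {0..c} = {}"
    using arc_leaves_curve[OF ext \<beta> _ _ \<phi>(1) s(1) \<phi>(2)] \<epsilon>(2) by (auto simp: B_def)
  have sub: "{-1..0} \<subseteq> {-1..1::real}" by auto
  have \<phi>': "continuous_on {-1..0} \<phi>" "inj_on \<phi> {-1..0}" "\<phi> ` {-1..0} \<subseteq> A" "\<phi> 0 = \<beta> c"
    using \<phi>(1) continuous_on_subset[OF _ sub] inj_on_subset[OF _ sub] by (auto simp: arc_through_def B_def)
  have seg: "closed_segment 0 (-1) = {-1..0::real}" by (simp add: closed_segment_eq_real_ivl)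
  have image: "path_image (\<phi> \<circ> linepath 0 (-1)) = \<phi> ` {-1..0}" by (simp add: path_image_compose seg)
  have "{-1..0} = insert 0 {-1..<0::real}" by auto
  then have "\<phi> ` {-1..0} = insert (\<beta> c) (\<phi> ` {-1..<0})" using \<phi>'(4) by simp
  then have "\<phi> ` {-1..0} \<inter> \<beta> ` {0..c} \<subseteq> {\<beta> c}" using disjoint by blast
  then show thesis
    using \<phi>' by (intro that[of "\<phi> \<circ> linepath 0 (-1)"] arc_on_segment) (simp_all add: seg image pathstart_compose)
qed

subsection \<open>Greedy extension\<close>

text \<open>Every unit step of a greedy curve reaches at least half as far as any competing step. Were such a curve to
  converge, an arc past its limit would offer competing steps of a fixed size.\<close>

definition greedy_step :: "real \<Rightarrow> (real \<Rightarrow> 'a) \<Rightarrow> bool" where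
  "greedy_step c \<beta> \<longleftrightarrow> (\<forall>h. prolongs h (c + 1) \<longrightarrow> (\<forall>t\<in>{0..c}. h t = \<beta> t) \<longrightarrow>
      min 1 (dist (h (c + 1)) (\<beta> c)) \<le> 2 * dist (\<beta> (c + 1)) (\<beta> c))"

lemma greedy_step_cong:
  assumes "greedy_step c g" "0 < c" "\<And>t. t \<in> {0..c+1} \<Longrightarrow> \<beta> t = g t"
  shows "greedy_step c \<beta>"
  using assms unfolding greedy_step_def by simp

lemma exists_greedy_step:
  assumes ext: "\<not> extendable" and \<beta>: "prolongs \<beta> c"
  obtains g where "prolongs g (c + 1)" "\<forall>t\<in>{0..c}. g t = \<beta> t" "greedy_step c g"
proof -
  define E where "E = {h. prolongs h (c + 1) \<and> (\<forall>t\<in>{0..c}. h t = \<beta> t)}"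
  define D where "D h = min 1 (dist (h (c + 1)) (\<beta> c))" for h :: "real \<Rightarrow> 'a"
  have c: "0 < c" by (rule prolongsD(1)[OF \<beta>])
  obtain g0 where "arc g0" "pathstart g0 = \<beta> c" "path_image g0 \<subseteq> A" "path_image g0 \<inter> \<beta> ` {0..c} \<subseteq> {\<beta> c}"
    by (rule exists_new_arc[OF ext \<beta>])
  from prolongs_append_at[OF \<beta> this] have ne: "E \<noteq> {}" unfolding E_def by (auto simp: append_at_left)
  have pos: "0 < D h" if "h \<in> E" for h
  proof -
    have "prolongs h (c + 1)" "h c = \<beta> c" using that c by (auto simp: E_def)
    then have "h (c + 1) \<noteq> \<beta> c" using inj_onD[OF prolongsD(3), of h "c + 1" "c + 1" c] c by auto
    then show ?thesis by (simp add: D_def)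
  qed
  have bdd: "bdd_above (D ` E)" by (rule bdd_aboveI[of _ 1]) (auto simp: D_def)
  have "0 < Sup (D ` E)" using ne pos by (meson all_not_in_conv bdd cSup_upper imageI less_le_trans)
  then have "Sup (D ` E) / 2 < Sup (D ` E)" by simp
  then obtain g where g: "g \<in> E" "Sup (D ` E) / 2 < D g" using ne by (elim less_cSupE) auto
  have "D h \<le> 2 * dist (g (c + 1)) (g c)" if "h \<in> E" for h
  proof -
    have "D h \<le> Sup (D ` E)" using that bdd by (intro cSup_upper) auto
    also have "\<dots> \<le> 2 * D g" using g(2) by simp
    also have "D g \<le> dist (g (c + 1)) (g c)" using g(1) c by (simp add: D_def E_def)
    finally show ?thesis by simp
  qed
  then have "greedy_step c g" using g(1) c by (auto simp: greedy_step_def E_def D_def)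
  then show thesis using that g(1) unfolding E_def by blast
qed

end

lemma coherent_limit:
  fixes S :: "nat \<Rightarrow> 'a set" and B :: "nat \<Rightarrow> 'a \<Rightarrow> 'b"
  assumes "mono S" and coherent: "\<And>n t. t \<in> S n \<Longrightarrow> B (Suc n) t = B n t"
  obtains \<beta> where "\<And>n t. t \<in> S n \<Longrightarrow> \<beta> t = B n t"
proof
  define \<beta> where "\<beta> t = B (LEAST n. t \<in> S n) t" for t
  fix n t assume t: "t \<in> S n"
  define m where "m = (LEAST n. t \<in> S n)"
  have m: "t \<in> S m" "m \<le> n" unfolding m_def using t by (auto intro: LeastI Least_le)
  from m(2) have "B n t = B m t"
  proof (induction n rule: dec_induct)
    case (step k)
    then have "t \<in> S k" using m(1) \<open>mono S\<close> by (meson monoD subsetD)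
    then show ?case using coherent step.IH by simp
  qed simp
  then show "\<beta> t = B n t" by (simp add: \<beta>_def m_def)
qed

context arc_extension begin

lemma exists_greedy_curve:
  assumes ext: "\<not> extendable"
  obtains \<beta> where "\<forall>c>0. prolongs \<beta> c" "\<forall>n. greedy_step (c0 + real n) \<beta>"
proof -
  define Q where "Q n \<beta> \<beta>' \<longleftrightarrow> (\<forall>t\<in>{0..c0 + real n}. \<beta>' t = \<beta> t) \<and> greedy_step (c0 + real n) \<beta>'" for n and \<beta> \<beta>' :: "real \<Rightarrow> 'a"
  have "\<exists>B. \<forall>n. prolongs (B n) (c0 + real n) \<and> Q n (B n) (B (Suc n))"
  proof (rule dependent_nat_choice)
    have "prolongs \<gamma> c0" unfolding prolongs_def using \<gamma> by auto
    then show "\<exists>\<beta>. prolongs \<beta> (c0 + real 0)" by auto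
    fix \<beta> n assume "prolongs \<beta> (c0 + real n)"
    then obtain g where "prolongs g (c0 + real n + 1)" "\<forall>t\<in>{0..c0 + real n}. g t = \<beta> t" "greedy_step (c0 + real n) g"
      by (rule exists_greedy_step[OF ext])
    moreover have "c0 + real (Suc n) = c0 + real n + 1" by simp
    ultimately have "prolongs g (c0 + real (Suc n)) \<and> Q n \<beta> g" unfolding Q_def by (simp only: simp_thms)
    then show "\<exists>\<beta>'. prolongs \<beta>' (c0 + real (Suc n)) \<and> Q n \<beta> \<beta>'" by blast
  qed
  then obtain B where B: "\<And>n. prolongs (B n) (c0 + real n)" "\<And>n. Q n (B n) (B (Suc n))" by blast
  have "mono (\<lambda>n. {0..c0 + real n})" by (rule monoI) auto
  moreover have "B (Suc n) t = B n t" if "t \<in> {0..c0 + real n}" for n t using B(2)[of n] that unfolding Q_def by blast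
  ultimately obtain \<beta> where \<beta>: "\<And>n t. t \<in> {0..c0 + real n} \<Longrightarrow> \<beta> t = B n t" by (rule coherent_limit) (assumption, rule that)
  show thesis
  proof (rule that; intro allI impI)
    fix c :: real assume "0 < c"
    obtain n where "c \<le> real n" using real_arch_simple by blast
    then have n: "c \<le> c0 + real n" using \<gamma>(1) by simp
    show "prolongs \<beta> c" by (rule prolongs_cong[OF prolongs_subset[OF B(1) \<open>0 < c\<close> n]]) (use \<beta> n in auto)
  next
    fix n
    have "greedy_step (c0 + real n) (B (Suc n))" using B(2)[of n] unfolding Q_def by blast
    then show "greedy_step (c0 + real n) \<beta>" by (rule greedy_step_cong) (use \<beta>[of _ "Suc n"] \<gamma>(1) in auto)
  qed
qed

lemma prolongs_ray:
  assumes \<beta>: "\<forall>c>0. prolongs \<beta> c"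
  shows "continuous_on {0..} \<beta>" "inj_on \<beta> {0..}" "\<beta> ` {0..} \<subseteq> A"
proof -
  have "continuous (at t within {0..}) \<beta>" if "0 \<le> t" for t
  proof -
    have "continuous (at t within {0..t+1}) \<beta>"
      using prolongsD(2)[OF \<beta>[rule_format], of "t + 1"] that by (simp add: continuous_on_eq_continuous_within)
    moreover have "at t within {0..} = at t within {0..t+1}" by (rule at_within_nhd[of t "{..<t+1}"]) auto
    ultimately show ?thesis by (simp add: continuous_within)
  qed
  then show "continuous_on {0..} \<beta>" by (simp add: continuous_on_eq_continuous_within)
  show "inj_on \<beta> {0..}"
  proof (rule inj_onI)
    fix s t assume "s \<in> {0..}" "t \<in> {0..}" "\<beta> s = \<beta> t"
    then show "s = t" using inj_onD[OF prolongsD(3)[OF \<beta>[rule_format, of "max s t + 1"]], of s t] by auto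
  qed
  show "\<beta> ` {0..} \<subseteq> A"
  proof
    fix v assume "v \<in> \<beta> ` {0..}"
    then obtain t where "0 \<le> t" "v = \<beta> t" by auto
    then show "v \<in> A" using prolongsD(4)[OF \<beta>[rule_format, of "t + 1"]] by auto
  qed
qed

lemma bounded_ray_accumulates:
  fixes \<beta> :: "real \<Rightarrow> 'a"
  assumes \<beta>: "\<beta> ` {0..} \<subseteq> A" and bounded: "\<not> filterlim (\<lambda>t. norm (\<beta> t)) at_top at_top"
  obtains y where "y \<in> A" "\<forall>\<epsilon>>0. \<forall>N. \<exists>t\<ge>N. dist (\<beta> t) y < \<epsilon>"
proof -
  obtain R where R: "\<forall>N. \<exists>t\<ge>N. norm (\<beta> t) < R"
    using bounded unfolding filterlim_at_top eventually_at_top_linorder by (auto simp: not_le)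
  have "\<exists>u. \<forall>n::nat. u n \<ge> real n \<and> norm (\<beta> (u n)) < R" using R by (intro choice) blast
  then obtain u where u: "\<And>n. real n \<le> u n" "\<And>n. norm (\<beta> (u n)) < R" by blast
  have "\<beta> (u n) \<in> A \<inter> cball 0 R" for n
    using \<beta> u(2)[of n] order_trans[OF of_nat_0_le_iff u(1)[of n]] by auto
  then obtain y r where y: "y \<in> A" "strict_mono r" "((\<lambda>n. \<beta> (u n)) \<circ> r) \<longlonglongrightarrow> y"
    using compact_bounded[of R] unfolding compact_def by (metis IntE)
  have "\<exists>t\<ge>N. dist (\<beta> t) y < \<epsilon>" if "0 < \<epsilon>" for N \<epsilon>
  proof -
    obtain n0 where n0: "\<forall>n\<ge>n0. dist (((\<lambda>n. \<beta> (u n)) \<circ> r) n) y < \<epsilon>" using metric_LIMSEQ_D[OF y(3) \<open>0 < \<epsilon>\<close>] by blast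
    obtain k where k: "N \<le> real k" using real_arch_simple by blast
    have "k \<le> r (max n0 k)" using seq_suble[OF y(2), of "max n0 k"] by linarith
    then have "N \<le> u (r (max n0 k))" using u(1)[of "r (max n0 k)"] k by linarith
    then show ?thesis using n0 by (intro exI[of _ "u (r (max n0 k))"]) auto
  qed
  then show thesis using that y(1) by blast
qed

lemma path_component_near:
  assumes y: "y \<in> A" and \<epsilon>: "0 < \<epsilon>"
  shows "\<exists>N. open N \<and> y \<in> N \<and> (\<forall>x\<in>A \<inter> N. path_component (A \<inter> ball y \<epsilon>) x y)"
proof -
  have "y \<in> A \<inter> ball y \<epsilon>" using y \<epsilon> by simp
  then obtain N where N: "open N" "y \<in> N" "\<And>x. x \<in> A \<inter> ball y \<epsilon> \<inter> N \<Longrightarrow> path_component (A \<inter> ball y \<epsilon>) x y"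
    by (rule arc_linked_at_path_component[OF arc_linked[OF y \<epsilon>]]) (rule that)
  show ?thesis using N \<epsilon> by (intro exI[of _ "N \<inter> ball y \<epsilon>"]) auto
qed

lemma ray_limit:
  assumes ext: "\<not> extendable" and \<beta>: "\<forall>c>0. prolongs \<beta> c"
    and y: "y \<in> A" "\<forall>\<epsilon>>0. \<forall>N. \<exists>t\<ge>N. dist (\<beta> t) y < \<epsilon>"
  shows "(\<beta> \<longlongrightarrow> y) at_top" "y \<notin> \<beta> ` {0..}"
proof -
  have no_shortcut: False if "0 \<le> a" "a < b" "b < c" "path_component (A - {\<beta> b}) (\<beta> c) (\<beta> a)" for a b c
    using extendable_if_shortcut[OF \<beta>[rule_format] that] that ext by auto
  have \<beta>A: "\<beta> t \<in> A" if "0 \<le> t" for t using prolongs_ray(3)[OF \<beta>] that by auto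
  have returns: "\<exists>t\<ge>K. \<beta> t \<in> N" if "open N" "y \<in> N" for N K
  proof -
    obtain \<delta> where \<delta>: "0 < \<delta>" "ball y \<delta> \<subseteq> N" using openE[OF \<open>open N\<close> \<open>y \<in> N\<close>] .
    show ?thesis using y(2)[rule_format, OF \<delta>(1), of K] \<delta>(2) by (auto simp: dist_commute)
  qed
  show "(\<beta> \<longlongrightarrow> y) at_top"
  proof (rule ccontr)
    assume "\<not> (\<beta> \<longlongrightarrow> y) at_top"
    then obtain \<epsilon> where \<epsilon>: "0 < \<epsilon>" "\<And>K. \<exists>t\<ge>K. \<beta> t \<notin> ball y \<epsilon>"
      unfolding tendsto_iff eventually_at_top_linorder by (auto simp: dist_commute)
    from path_component_near[OF y(1) \<epsilon>(1)] obtain N where N: "open N" "y \<in> N" "\<forall>x\<in>A \<inter> N. path_component (A \<inter> ball y \<epsilon>) x y" by blast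
    obtain a where a: "0 \<le> a" "\<beta> a \<in> N" using returns[OF N(1,2)] by blast
    obtain b where b: "a + 1 \<le> b" "\<beta> b \<notin> ball y \<epsilon>" using \<epsilon>(2) by blast
    obtain c where c: "b + 1 \<le> c" "\<beta> c \<in> N" using returns[OF N(1,2)] by blast
    have "path_component (A \<inter> ball y \<epsilon>) (\<beta> c) y" "path_component (A \<inter> ball y \<epsilon>) (\<beta> a) y" using N(3) \<beta>A a b c by auto
    then have "path_component (A \<inter> ball y \<epsilon>) (\<beta> c) (\<beta> a)" by (metis path_component_sym path_component_trans)
    then have "path_component (A - {\<beta> b}) (\<beta> c) (\<beta> a)" by (rule path_component_of_subset[rotated]) (use b in auto)
    then show False using no_shortcut[of a b c] a b c by simp
  qed
  show "y \<notin> \<beta> ` {0..}"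
  proof
    assume "y \<in> \<beta> ` {0..}"
    then obtain s where s: "0 \<le> s" "y = \<beta> s" by auto
    then have "0 < dist (\<beta> (s + 1)) y" using inj_onD[OF prolongs_ray(2)[OF \<beta>], of "s + 1" s] by auto
    from path_component_near[OF y(1) this] obtain N where N: "open N" "y \<in> N" "\<forall>x\<in>A \<inter> N. path_component (A \<inter> ball y (dist (\<beta> (s + 1)) y)) x y"
      by blast
    obtain c where c: "s + 2 \<le> c" "\<beta> c \<in> N" using returns[OF N(1,2)] by blast
    have "path_component (A \<inter> ball y (dist (\<beta> (s + 1)) y)) (\<beta> c) (\<beta> s)" using N(3) \<beta>A[of c] c s by auto
    then have "path_component (A - {\<beta> (s + 1)}) (\<beta> c) (\<beta> s)"
      by (rule path_component_of_subset[rotated]) (auto simp: dist_commute)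
    then show False using no_shortcut[of s "s + 1" c] s(1) c by simp
  qed
qed

lemma ray_end_arc:
  assumes \<beta>: "\<forall>c>0. prolongs \<beta> c" and y: "y \<in> A" "(\<beta> \<longlongrightarrow> y) at_top" "y \<notin> \<beta> ` {0..}" and c: "0 < c"
  obtains e where "arc e" "pathstart e = \<beta> c" "pathfinish e = y" "path_image e = insert y (\<beta> ` {c..})"
    "path_image e \<subseteq> A" "path_image e \<inter> \<beta> ` {0..c} \<subseteq> {\<beta> c}"
proof -
  note ray = prolongs_ray[OF \<beta>]
  have sub: "{c..} \<subseteq> {0..}" using c by auto
  have "y \<notin> \<beta> ` {c..}" using y(3) image_mono[OF sub, of \<beta>] by (rule contra_subsetD[rotated])
  then obtain e where e: "arc e" "pathstart e = \<beta> c" "pathfinish e = y" "path_image e = insert y (\<beta> ` {c..})"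
    by (rule arc_to_limit[OF continuous_on_subset[OF ray(1) sub] inj_on_subset[OF ray(2) sub] y(2)])
  have "path_image e \<subseteq> A" unfolding e(4) using ray(3) y(1) image_mono[OF sub, of \<beta>] by blast
  moreover have "\<beta> ` {c..} \<inter> \<beta> ` {0..c} \<subseteq> {\<beta> c}" using inj_on_image_Int[OF ray(2), of "{c..}" "{0..c}"] c by auto
  then have "path_image e \<inter> \<beta> ` {0..c} \<subseteq> {\<beta> c}" using y(3) e(4) by auto
  ultimately show thesis using that e by blast
qed

lemma exists_arc_from_limit:
  assumes ext: "\<not> extendable" and \<beta>: "\<forall>c>0. prolongs \<beta> c" and y: "y \<in> A" "(\<beta> \<longlongrightarrow> y) at_top" "y \<notin> \<beta> ` {0..}"
  obtains g where "arc g" "pathstart g = y" "path_image g \<subseteq> A" "path_image g \<inter> \<beta> ` {0..} = {}"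
proof -
  obtain e where e: "arc e" "pathstart e = \<beta> c0" "pathfinish e = y" "path_image e = insert y (\<beta> ` {c0..})"
    "path_image e \<subseteq> A" "path_image e \<inter> \<beta> ` {0..c0} \<subseteq> {\<beta> c0}" by (rule ray_end_arc[OF \<beta> y \<gamma>(1)])
  have "prolongs (append_at c0 \<beta> e) (c0 + 1)" by (rule prolongs_append_at[OF \<beta>[rule_format, OF \<gamma>(1)] e(1,2,5,6)])
  from exists_new_arc[OF ext this] obtain g where g: "arc g" "pathstart g = y" "path_image g \<subseteq> A"
      "path_image g \<inter> append_at c0 \<beta> e ` {0..c0+1} \<subseteq> {y}"
    using e(3) by (auto simp: append_at_def pathfinish_def)
  have "\<beta> ` {0..} \<subseteq> append_at c0 \<beta> e ` {0..c0+1}"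
  proof
    fix v assume "v \<in> \<beta> ` {0..}"
    then obtain s where s: "0 \<le> s" "v = \<beta> s" by auto
    show "v \<in> append_at c0 \<beta> e ` {0..c0+1}"
    proof (cases "s \<le> c0")
      case True
      then show ?thesis using s \<gamma>(1) by (intro image_eqI[of _ _ s]) (auto simp: append_at_left)
    next
      case False
      then have "v \<in> e ` {0..1}" using e(4) s(2) by (simp add: path_image_def)
      then obtain x where "x \<in> {0..1}" "v = e x" by blast
      then show ?thesis
        using e(2) by (intro image_eqI[of _ _ "c0 + x"]) (auto simp: append_at_right pathstart_def \<gamma>(1) less_imp_le)
    qed
  qed
  then have "path_image g \<inter> \<beta> ` {0..} = {}" using g(4) y(3) by blast
  then show thesis using that g(1-3) by blast
qed

lemma exists_common_step:
  assumes ext: "\<not> extendable" and \<beta>: "\<forall>c>0. prolongs \<beta> c" and y: "y \<in> A" "(\<beta> \<longlongrightarrow> y) at_top" "y \<notin> \<beta> ` {0..}"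
  obtains w where "w \<noteq> y" "\<forall>c>0. \<exists>h. prolongs h (c + 1) \<and> (\<forall>t\<in>{0..c}. h t = \<beta> t) \<and> h (c + 1) = w"
proof -
  obtain g where g: "arc g" "pathstart g = y" "path_image g \<subseteq> A" "path_image g \<inter> \<beta> ` {0..} = {}"
    by (rule exists_arc_from_limit[OF ext \<beta> y])
  have "\<exists>h. prolongs h (c + 1) \<and> (\<forall>t\<in>{0..c}. h t = \<beta> t) \<and> h (c + 1) = pathfinish g" if c: "0 < c" for c
  proof -
    obtain e where e: "arc e" "pathstart e = \<beta> c" "pathfinish e = y" "path_image e = insert y (\<beta> ` {c..})"
      "path_image e \<subseteq> A" "path_image e \<inter> \<beta> ` {0..c} \<subseteq> {\<beta> c}" by (rule ray_end_arc[OF \<beta> y c])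
    have sub: "path_image e \<subseteq> insert y (\<beta> ` {0..})" using c unfolding e(4) by auto
    have image: "path_image (e +++ g) = path_image e \<union> path_image g" by (simp add: path_image_join e(3) g(2))
    have "prolongs (append_at c \<beta> (e +++ g)) (c + 1)"
    proof (rule prolongs_append_at[OF \<beta>[rule_format, OF c]])
      show "arc (e +++ g)" by (rule arc_join[OF e(1) g(1)]) (use e(3) g(2,4) sub in auto)
      show "path_image (e +++ g) \<subseteq> A" unfolding image using e(5) g(3) by blast
      have "\<beta> ` {0..c} \<subseteq> \<beta> ` {0..}" by (rule image_mono) auto
      then show "path_image (e +++ g) \<inter> \<beta> ` {0..c} \<subseteq> {\<beta> c}" unfolding image using e(6) g(4) by blast
    qed (simp add: e(2))
    then show ?thesis
      by (intro exI[of _ "append_at c \<beta> (e +++ g)"]) (auto simp: append_at_def joinpaths_def pathfinish_def)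
  qed
  then show thesis using that arc_distinct_ends[OF g(1)] g(2) by metis
qed

theorem extendable: extendable
proof (rule ccontr)
  assume ext: "\<not> extendable"
  obtain \<beta> where \<beta>: "\<forall>c>0. prolongs \<beta> c" and greedy: "\<forall>n. greedy_step (c0 + real n) \<beta>"
    by (rule exists_greedy_curve[OF ext])
  note ray = prolongs_ray[OF \<beta>]
  obtain \<delta> where "0 < \<delta>" "\<delta> \<le> c0" "\<forall>t\<in>{0..\<delta>}. \<beta> t = \<gamma> t" by (rule prolongs_initial[OF \<beta>[rule_format, OF \<gamma>(1)]])
  then have "\<not> filterlim (\<lambda>t. norm (\<beta> t)) at_top at_top"
    using ext ray_in_inj_on[OF ray] unfolding extendable_def by (metis atLeastAtMost_iff greaterThanLessThan_iff less_imp_le)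
  then obtain y where y: "y \<in> A" "\<forall>\<epsilon>>0. \<forall>N. \<exists>t\<ge>N. dist (\<beta> t) y < \<epsilon>"
    by (rule bounded_ray_accumulates[OF ray(3)])
  note limit = ray_limit[OF ext \<beta> y]
  obtain w where w: "w \<noteq> y" "\<forall>c>0. \<exists>h. prolongs h (c + 1) \<and> (\<forall>t\<in>{0..c}. h t = \<beta> t) \<and> h (c + 1) = w"
    by (rule exists_common_step[OF ext \<beta> y(1) limit])
  have step: "min 1 (dist w (\<beta> (c0 + real n))) \<le> 2 * dist (\<beta> (c0 + real n + 1)) (\<beta> (c0 + real n))" for n
    using greedy[rule_format, of n] w(2)[rule_format, of "c0 + real n"] \<gamma>(1) unfolding greedy_step_def by fastforce
  have to_y: "(\<lambda>n. \<beta> (c0 + real n + a)) \<longlonglongrightarrow> y" for a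
  proof (rule filterlim_compose[OF limit(1)])
    have "filterlim (\<lambda>n. (c0 + a) + real n) at_top sequentially"
      by (intro filterlim_tendsto_add_at_top[OF tendsto_const] filterlim_real_sequentially)
    then show "filterlim (\<lambda>n. c0 + real n + a) at_top sequentially" by (simp add: add_ac)
  qed
  have "(\<lambda>n. min 1 (dist w (\<beta> (c0 + real n)))) \<longlonglongrightarrow> min 1 (dist w y)"
    using to_y[of 0] by (intro tendsto_intros) simp
  moreover have "(\<lambda>n. 2 * dist (\<beta> (c0 + real n + 1)) (\<beta> (c0 + real n))) \<longlonglongrightarrow> 2 * dist y y"
    using to_y[of 0] to_y[of 1] by (intro tendsto_intros) simp_all
  ultimately have "min 1 (dist w y) \<le> 2 * dist y y" by (rule LIMSEQ_le) (use step in blast)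
  then show False using w(1) by (simp add: min_def split: if_splits)
qed

end

section \<open>Bounded functionals and bounded inverses\<close>

subsection \<open>Sublinear functionals\<close>

definition sublinear :: "('a::real_vector \<Rightarrow> real) \<Rightarrow> bool" where
  "sublinear p \<longleftrightarrow> (\<forall>x y. p (x + y) \<le> p x + p y) \<and> (\<forall>t x. 0 \<le> t \<longrightarrow> p (t *\<^sub>R x) = t * p x)"

lemma sublinearD:
  assumes "sublinear p"
  shows "p (x + y) \<le> p x + p y" "0 \<le> t \<Longrightarrow> p (t *\<^sub>R x) = t * p x" "p 0 = 0" "- p (- x) \<le> p x"
proof -
  show add: "p (x + y) \<le> p x + p y" and scale: "0 \<le> t \<Longrightarrow> p (t *\<^sub>R x) = t * p x" for x y t
    using assms unfolding sublinear_def by blast+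
  show zero: "p 0 = 0" using scale[of 0 0] by simp
  show "- p (- x) \<le> p x" using add[of x "-x"] zero by simp
qed

lemma sublinearI:
  fixes p :: "'a::real_vector \<Rightarrow> real"
  assumes add: "\<And>x y. p (x + y) \<le> p x + p y" and zero: "p 0 = 0" and scale: "\<And>t x. 0 < t \<Longrightarrow> t * p x \<le> p (t *\<^sub>R x)"
  shows "sublinear p"
proof -
  have "p (t *\<^sub>R x) = t * p x" if "0 \<le> t" for t x
  proof (cases "t = 0")
    case False
    then have t: "0 < t" using that by simp
    have "(1 / t) * p (t *\<^sub>R x) \<le> p x" using scale[of "1 / t" "t *\<^sub>R x"] t by simp
    then have "p (t *\<^sub>R x) \<le> t * p x" using t by (simp add: divide_le_eq mult.commute)
    then show ?thesis using scale[OF t, of x] by simp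
  qed (simp add: zero)
  then show ?thesis using add unfolding sublinear_def by blast
qed

definition lower_along :: "'a::real_vector \<Rightarrow> ('a \<Rightarrow> real) \<Rightarrow> 'a \<Rightarrow> real" where
  "lower_along y p x = (INF t\<in>{0..}. p (x + t *\<^sub>R y) - t * p y)"

lemma lower_along_le:
  assumes p: "sublinear p" and "0 \<le> t"
  shows "lower_along y p x \<le> p (x + t *\<^sub>R y) - t * p y"
  unfolding lower_along_def
proof (rule cINF_lower)
  have "- p (- x) \<le> p (x + s *\<^sub>R y) - s * p y" if "0 \<le> s" for s
    using sublinearD(1)[OF p, of "x + s *\<^sub>R y" "-x"] sublinearD(2)[OF p that, of y] by simp
  then show "bdd_below ((\<lambda>t. p (x + t *\<^sub>R y) - t * p y) ` {0..})" by (intro bdd_belowI2) auto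
qed (use assms(2) in auto)

lemma le_lower_along:
  assumes "\<And>t. 0 \<le> t \<Longrightarrow> c \<le> p (x + t *\<^sub>R y) - t * p y"
  shows "c \<le> lower_along y p x"
  unfolding lower_along_def by (rule cINF_greatest) (use assms in auto)

lemma sublinear_lower_along:
  assumes p: "sublinear p"
  shows "sublinear (lower_along y p)"
proof (rule sublinearI)
  fix x z
  have "lower_along y p (x + z) - (p (z + s *\<^sub>R y) - s * p y) \<le> lower_along y p x" if s: "0 \<le> s" for s
  proof (rule le_lower_along)
    fix t :: real assume t: "0 \<le> t"
    have "lower_along y p (x + z) \<le> p (x + z + (t + s) *\<^sub>R y) - (t + s) * p y" using s t by (intro lower_along_le[OF p]) simp
    also have "x + z + (t + s) *\<^sub>R y = (x + t *\<^sub>R y) + (z + s *\<^sub>R y)" by (simp add: algebra_simps)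
    also have "p \<dots> \<le> p (x + t *\<^sub>R y) + p (z + s *\<^sub>R y)" by (rule sublinearD(1)[OF p])
    finally show "lower_along y p (x + z) - (p (z + s *\<^sub>R y) - s * p y) \<le> p (x + t *\<^sub>R y) - t * p y"
      by (simp add: algebra_simps)
  qed
  then have "lower_along y p (x + z) - lower_along y p x \<le> lower_along y p z"
    by (intro le_lower_along) (simp add: algebra_simps)
  then show "lower_along y p (x + z) \<le> lower_along y p x + lower_along y p z" by simp
next
  show "lower_along y p 0 = 0"
  proof (rule antisym)
    show "lower_along y p 0 \<le> 0" using lower_along_le[OF p, of 0 y 0] sublinearD(3)[OF p] by simp
    show "0 \<le> lower_along y p 0" by (rule le_lower_along) (use sublinearD(2)[OF p] in simp)
  qed
next
  fix a :: real and x assume a: "0 < a"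
  show "a * lower_along y p x \<le> lower_along y p (a *\<^sub>R x)"
  proof (rule le_lower_along)
    fix s :: real assume s: "0 \<le> s"
    have "lower_along y p x \<le> p (x + (s / a) *\<^sub>R y) - (s / a) * p y" using a s by (intro lower_along_le[OF p]) simp
    then have "a * lower_along y p x \<le> a * p (x + (s / a) *\<^sub>R y) - s * p y"
      using a mult_left_mono[of "lower_along y p x" _ a] by (fastforce simp: right_diff_distrib)
    also have "a * p (x + (s / a) *\<^sub>R y) = p (a *\<^sub>R x + s *\<^sub>R y)"
      using a sublinearD(2)[OF p, of a "x + (s / a) *\<^sub>R y"] by (simp add: scaleR_add_right)
    finally show "a * lower_along y p x \<le> p (a *\<^sub>R x + s *\<^sub>R y) - s * p y" .
  qed
qed

lemma sublinear_INF_chain: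
  assumes "C \<noteq> {}" and C: "\<And>p. p \<in> C \<Longrightarrow> sublinear p" and bdd: "\<And>x. bdd_below ((\<lambda>p. p x) ` C)"
    and chain: "\<And>p r. p \<in> C \<Longrightarrow> r \<in> C \<Longrightarrow> p \<le> r \<or> r \<le> p"
  shows "sublinear (\<lambda>x. INF p\<in>C. p x)"
proof -
  define u where "u x = (INF p\<in>C. p x)" for x
  have lower: "u x \<le> p x" if "p \<in> C" for p x unfolding u_def by (rule cINF_lower[OF bdd that])
  have greatest: "c \<le> u x" if "\<And>p. p \<in> C \<Longrightarrow> c \<le> p x" for c x unfolding u_def by (rule cINF_greatest[OF assms(1) that])
  have "sublinear u"
  proof (rule sublinearI)
    fix x z
    have "u (x + z) - p x \<le> r z" if pr: "p \<in> C" "r \<in> C" for p r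
    proof -
      obtain s where s: "s \<in> C" "s x \<le> p x" "s z \<le> r z" using chain[OF pr] pr by (auto simp: le_fun_def)
      show ?thesis using lower[OF s(1), of "x + z"] sublinearD(1)[OF C[OF s(1)], of x z] s by linarith
    qed
    then have "u (x + z) - p x \<le> u z" if "p \<in> C" for p using that by (intro greatest)
    then have "u (x + z) - u z \<le> p x" if "p \<in> C" for p using that by (simp add: algebra_simps)
    then have "u (x + z) - u z \<le> u x" by (rule greatest)
    then show "u (x + z) \<le> u x + u z" by simp
  next
    obtain p where "p \<in> C" using assms(1) by blast
    then show "u 0 = 0" using lower[of p 0] greatest[of 0 0] sublinearD(3)[OF C] by fastforce
  next
    fix a :: real and x assume a: "0 < a"
    show "a * u x \<le> u (a *\<^sub>R x)"
    proof (rule greatest)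
      fix p assume p: "p \<in> C"
      have "a * u x \<le> a * p x" using lower[OF p] a by (intro mult_left_mono) auto
      then show "a * u x \<le> p (a *\<^sub>R x)" using sublinearD(2)[OF C[OF p], of a x] a by simp
    qed
  qed
  then show ?thesis by (simp add: u_def[abs_def])
qed

lemma exists_minimal_sublinear:
  assumes p: "sublinear p"
  obtains m where "sublinear m" "m \<le> p" "\<And>q. sublinear q \<Longrightarrow> q \<le> m \<Longrightarrow> q = m"
proof -
  define A where "A = {q. sublinear q \<and> q \<le> p}"
  have minorant: "- p (- x) \<le> q x" if "q \<in> A" for q x
  proof -
    have "q (- x) \<le> p (- x)" "- q (- x) \<le> q x" using that sublinearD(4) unfolding A_def le_fun_def by blast+
    then show ?thesis by simp
  qed
  have "\<exists>m\<in>A. \<forall>q\<in>A. q \<le> m \<longrightarrow> q = m"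
  proof (rule predicate_Zorn)
    show "partial_order_on A (relation_of (\<lambda>m q. q \<le> m) A)"
      by (rule partial_order_on_relation_ofI) auto
    fix C assume C: "C \<in> Chains (relation_of (\<lambda>m q. q \<le> m) A)"
    then have sub: "C \<subseteq> A" and chain: "\<And>q r. q \<in> C \<Longrightarrow> r \<in> C \<Longrightarrow> q \<le> r \<or> r \<le> q"
      unfolding Chains_def relation_of_def by auto
    show "\<exists>u\<in>A. \<forall>q\<in>C. u \<le> q"
    proof (cases "C = {}")
      case True
      then show ?thesis using p by (auto simp: A_def)
    next
      case False
      have bdd: "bdd_below ((\<lambda>q. q x) ` C)" for x by (rule bdd_belowI2[of _ "- p (- x)"]) (use minorant sub in blast)
      have INF_le: "(\<lambda>x. INF q\<in>C. q x) \<le> q" if "q \<in> C" for q using cINF_lower[OF bdd that] by (simp add: le_fun_def)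
      obtain q where q: "q \<in> C" using False by blast
      have "sublinear (\<lambda>x. INF q\<in>C. q x)" by (rule sublinear_INF_chain[OF False _ bdd chain]) (use sub in \<open>auto simp: A_def\<close>)
      moreover have "(\<lambda>x. INF q\<in>C. q x) \<le> p" using INF_le[OF q] q sub unfolding A_def by (auto intro: order_trans)
      ultimately show ?thesis using INF_le by (intro bexI[of _ "\<lambda>x. INF q\<in>C. q x"]) (auto simp: A_def)
    qed
  qed
  then obtain m where m: "m \<in> A" "\<forall>q\<in>A. q \<le> m \<longrightarrow> q = m" by blast
  show thesis
  proof (rule that)
    show "q = m" if "sublinear q" "q \<le> m" for q using m that unfolding A_def by (auto intro: order_trans)
  qed (use m(1) in \<open>auto simp: A_def\<close>)
qed

lemma linear_if_minimal_sublinear: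
  assumes m: "sublinear m" and minimal: "\<And>q. sublinear q \<Longrightarrow> q \<le> m \<Longrightarrow> q = m"
  shows "linear m"
proof -
  have add: "m (x + z) = m x + m z" for x z
  proof (rule antisym)
    show "m (x + z) \<le> m x + m z" by (rule sublinearD(1)[OF m])
    have "lower_along z m \<le> m" using lower_along_le[OF m, of 0 z] by (simp add: le_fun_def)
    then have "lower_along z m = m" by (rule minimal[OF sublinear_lower_along[OF m]])
    then show "m x + m z \<le> m (x + z)" using lower_along_le[OF m, of 1 z x] by simp
  qed
  have neg: "m (- x) = - m x" for x using add[of x "-x"] sublinearD(3)[OF m] by simp
  have "m (t *\<^sub>R x) = t * m x" for t x
  proof (cases "0 \<le> t")
    case False
    then have "m ((- t) *\<^sub>R x) = (- t) * m x" by (intro sublinearD(2)[OF m]) simp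
    then show ?thesis using neg[of "t *\<^sub>R x"] by simp
  qed (rule sublinearD(2)[OF m])
  then show ?thesis using add by (simp add: linear_iff)
qed

lemma hahn_banach_sublinear:
  assumes "sublinear p"
  obtains l where "linear l" "\<And>x. l x \<le> p x"
proof -
  obtain m where "sublinear m" "m \<le> p" "\<And>q. sublinear q \<Longrightarrow> q \<le> m \<Longrightarrow> q = m"
    by (rule exists_minimal_sublinear[OF assms]) (rule that)
  then show thesis using that linear_if_minimal_sublinear by (auto simp: le_fun_def)
qed

lemma exists_bounded_functional:
  fixes y :: "'a::real_normed_vector"
  assumes "y \<noteq> 0"
  obtains l :: "'a \<Rightarrow> real" where "bounded_linear l" "l y \<noteq> 0"
proof -
  have norm: "sublinear (norm :: 'a \<Rightarrow> real)" by (simp add: sublinear_def norm_triangle_ineq)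
  obtain l where l: "linear l" "\<And>x. l x \<le> lower_along y norm x"
    by (rule hahn_banach_sublinear[OF sublinear_lower_along[OF norm]]) (rule that)
  have upper: "l x \<le> norm x" for x using l(2)[of x] lower_along_le[OF norm, of 0 y x] by simp
  have "bounded_linear l"
  proof (rule bounded_linear_intro[where K = 1])
    show "norm (l x) \<le> norm x * 1" for x using upper[of x] upper[of "-x"] linear_neg[OF l(1), of x] by (simp add: abs_le_iff)
  qed (simp_all add: linear_add[OF l(1)] linear_scale[OF l(1)])
  moreover have "l y \<noteq> 0"
  proof -
    have "l (- y) \<le> - norm y" using l(2)[of "-y"] lower_along_le[OF norm, of 1 y "-y"] by simp
    then show ?thesis using linear_neg[OF l(1), of y] assms by auto
  qed
  ultimately show thesis by (rule that)
qed

lemma dual_functionals: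
  fixes B :: "'a::real_normed_vector set"
  assumes "finite B" "independent B"
  shows "\<exists>l. (\<forall>b\<in>B. bounded_linear (l b)) \<and> (\<forall>b\<in>B. \<forall>c\<in>B. l b c = (if b = c then 1 else (0::real)))"
  using assms
proof (induction rule: finite_induct)
  case (insert y B)
  have B: "independent B" "y \<notin> span B" using insert by (auto simp: independent_insert)
  obtain l where l: "\<And>b. b \<in> B \<Longrightarrow> bounded_linear (l b)" "\<And>b c. b \<in> B \<Longrightarrow> c \<in> B \<Longrightarrow> l b c = (if b = c then 1 else (0::real))"
    using insert.IH[OF B(1)] by blast
  define \<pi> where "\<pi> u = u - (\<Sum>b\<in>B. l b u *\<^sub>R b)" for u
  have \<pi>: "bounded_linear \<pi>" unfolding \<pi>_def
    by (intro bounded_linear_sub bounded_linear_ident bounded_linear_sum bounded_linear_scaleR_const l)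
  have \<pi>_zero: "\<pi> c = 0" if "c \<in> B" for c
  proof -
    have "(\<Sum>b\<in>B. l b c *\<^sub>R b) = (\<Sum>b\<in>B. if c = b then b else 0)" using l(2) that by (intro sum.cong) auto
    then show ?thesis using that insert.hyps by (simp add: \<pi>_def)
  qed
  have "(\<Sum>b\<in>B. l b y *\<^sub>R b) \<in> span B" by (intro span_sum span_scale span_base)
  then have "\<pi> y \<noteq> 0" using B(2) by (auto simp: \<pi>_def)
  then obtain f where f: "bounded_linear f" "f (\<pi> y) \<noteq> (0::real)" by (rule exists_bounded_functional)
  define ly where "ly u = f (\<pi> u) / f (\<pi> y)" for u
  have bounded_ly: "bounded_linear ly" unfolding ly_def
    using bounded_linear_compose[OF bounded_linear_divide bounded_linear_compose[OF f(1) \<pi>]] by simp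
  have ly: "ly y = 1" "\<And>c. c \<in> B \<Longrightarrow> ly c = 0" using f \<pi>_zero linear_0[OF bounded_linear.linear[OF f(1)]] by (auto simp: ly_def)
  define l' where "l' b = (if b = y then ly else (\<lambda>u. l b u - l b y * ly u))" for b
  have "bounded_linear (l' b)" if "b \<in> insert y B" for b
    unfolding l'_def using that bounded_ly l(1)
    by (auto intro!: bounded_linear_sub bounded_linear_const_mult)
  moreover have "l' b c = (if b = c then 1 else 0)" if "b \<in> insert y B" "c \<in> insert y B" for b c
    using that ly l(2) insert.hyps by (auto simp: l'_def)
  ultimately show ?case by blast
qed simp

subsection \<open>The open mapping theorem\<close>

lemma surj_image_cball_somewhere_dense:
  fixes S :: "'a::real_normed_vector \<Rightarrow> 'b::banach"
  assumes "surj S"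
  obtains y0 e and n :: nat where "0 < e" "ball y0 e \<subseteq> closure (S ` cball 0 (real n))"
proof -
  define K where "K n = closure (S ` cball 0 (real n))" for n :: nat
  have "\<exists>n. interior (K n) \<noteq> {}"
  proof (rule ccontr)
    assume "\<not> ?thesis"
    then have empty: "interior (K n) = {}" for n by blast
    have "euclidean interior_of (\<Union>(range K)) = {}"
    proof (rule Baire_category_alt)
      show "completely_metrizable_space (euclidean :: 'b topology) \<or> locally_compact_space (euclidean::'b topology) \<and> regular_space (euclidean::'b topology)"
        by (simp add: completely_metrizable_space_euclidean)
    qed (use empty in \<open>auto simp: K_def\<close>)
    moreover have "y \<in> \<Union>(range K)" for y
    proof -
      obtain x where x: "y = S x" by (rule surjE[OF assms])
      obtain n where "norm x \<le> real n" using real_arch_simple by blast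
      then have "y \<in> S ` cball 0 (real n)" using x by auto
      then have "y \<in> K n" unfolding K_def by (rule subsetD[OF closure_subset])
      then show ?thesis by blast
    qed
    then have "\<Union>(range K) = UNIV" by blast
    ultimately show False by simp
  qed
  then obtain n y0 where "y0 \<in> interior (K n)" by blast
  then obtain e where "0 < e" "ball y0 e \<subseteq> K n" unfolding mem_interior by blast
  then show thesis using that unfolding K_def by blast
qed

lemma surj_approximate_preimage:
  fixes S :: "'a::real_normed_vector \<Rightarrow> 'b::banach"
  assumes "bounded_linear S" "surj S"
  obtains M where "0 < M" "\<forall>y. \<exists>x. norm x \<le> M * norm y \<and> norm (y - S x) \<le> norm y / 2"
proof -
  interpret S: bounded_linear S by (rule assms(1))
  obtain y0 e and n :: nat where e: "0 < e" "ball y0 e \<subseteq> closure (S ` cball 0 (real n))"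
    by (rule surj_image_cball_somewhere_dense[OF assms(2)])
  have near: "\<exists>x. norm x \<le> real n \<and> dist (S x) y < e / 8" if "dist y0 y < e" for y
  proof -
    have "y \<in> closure (S ` cball 0 (real n))" using that e(2) by auto
    then show ?thesis using e(1) unfolding closure_approachable by (fastforce dest: spec[of _ "e / 8"])
  qed
  define M where "M = 4 * (real n + 1) / e"
  have "\<exists>x. norm x \<le> M * norm y \<and> norm (y - S x) \<le> norm y / 2" for y
  proof (cases "y = 0")
    case True then show ?thesis by (intro exI[of _ 0]) (simp add: S.zero)
  next
    case False
    define c where "c = e / (2 * norm y)"
    have c: "0 < c" using False e by (simp add: c_def)
    have "norm (c *\<^sub>R y) = e / 2" using False e by (simp add: c_def)
    then obtain x1 where x1: "norm x1 \<le> real n" "dist (S x1) (y0 + c *\<^sub>R y) < e / 8"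
      using near[of "y0 + c *\<^sub>R y"] e(1) by (auto simp: dist_norm)
    obtain x2 where x2: "norm x2 \<le> real n" "dist (S x2) y0 < e / 8" using near[of y0] e(1) by auto
    define x where "x = (1 / c) *\<^sub>R (x1 - x2)"
    have "norm (x1 - x2) \<le> 2 * (real n + 1)" using norm_triangle_ineq4[of x1 x2] x1 x2 by simp
    then have "norm x \<le> (1 / c) * (2 * (real n + 1))" using c by (simp add: x_def divide_right_mono)
    also have "\<dots> = M * norm y" using e False by (simp add: c_def M_def field_simps)
    finally have x_bound: "norm x \<le> M * norm y" .
    have "c *\<^sub>R y - (S x1 - S x2) = (S x2 - y0) - (S x1 - (y0 + c *\<^sub>R y))" by simp
    then have "norm (c *\<^sub>R y - (S x1 - S x2)) \<le> norm (S x2 - y0) + norm (S x1 - (y0 + c *\<^sub>R y))"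
      by (metis norm_triangle_ineq4)
    then have "norm (c *\<^sub>R y - (S x1 - S x2)) \<le> e / 4" using x1 x2 by (simp add: dist_norm)
    moreover have "y - S x = (1 / c) *\<^sub>R (c *\<^sub>R y - (S x1 - S x2))"
      using c by (simp add: x_def S.scaleR S.diff scaleR_diff_right)
    ultimately have "norm (y - S x) \<le> (1 / c) * (e / 4)"
      using c mult_left_mono[of "norm (c *\<^sub>R y - (S x1 - S x2))" "e / 4" "1 / c"] by simp
    also have "\<dots> = norm y / 2" using e False by (simp add: c_def field_simps)
    finally show ?thesis using x_bound by blast
  qed
  moreover have "0 < M" using e by (simp add: M_def)
  ultimately show thesis using that by blast
qed

lemma approximate_preimage_imp_preimage:
  fixes S :: "'a::banach \<Rightarrow> 'b::real_normed_vector"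
  assumes "bounded_linear S" "0 < M" and step: "\<forall>y. \<exists>x. norm x \<le> M * norm y \<and> norm (y - S x) \<le> norm y / 2"
  shows "\<exists>x. S x = y \<and> norm x \<le> 2 * M * norm y"
proof -
  interpret S: bounded_linear S by (rule assms(1))
  obtain X where X: "\<And>y. norm (X y) \<le> M * norm y" "\<And>y. norm (y - S (X y)) \<le> norm y / 2" using step by metis
  define r where "r k = ((\<lambda>y. y - S (X y)) ^^ k) y" for k
  have r: "norm (r k) \<le> norm y * (1/2) ^ k" for k
  proof (induction k)
    case (Suc k)
    have "norm (r (Suc k)) \<le> norm (r k) / 2" using X(2)[of "r k"] by (simp add: r_def)
    then show ?case using Suc by simp
  qed (simp add: r_def)
  have Xr: "norm (X (r k)) \<le> (M * norm y) * (1/2) ^ k" for k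
    using order_trans[OF X(1)[of "r k"] mult_left_mono[OF r[of k], of M]] assms(2) by (simp add: mult.assoc)
  have geometric: "summable (\<lambda>k. (M * norm y) * (1/2::real) ^ k)" by (intro summable_mult summable_geometric) simp
  have summable: "summable (\<lambda>k. X (r k))" by (rule summable_comparison_test'[OF geometric]) (use Xr in simp)
  have partial: "S (\<Sum>k<N. X (r k)) = y - r N" for N
  proof (induction N)
    case (Suc N)
    have "r (Suc N) = r N - S (X (r N))" by (simp add: r_def)
    then show ?case using Suc by (simp add: S.add)
  qed (simp add: r_def S.zero)
  have "(\<lambda>N. norm y * (1/2::real) ^ N) \<longlonglongrightarrow> norm y * 0"
    by (intro tendsto_intros LIMSEQ_realpow_zero) auto
  then have "r \<longlonglongrightarrow> 0" using r by (intro Lim_null_comparison[of r "\<lambda>N. norm y * (1/2) ^ N"]) auto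
  then have "(\<lambda>N. y - r N) \<longlonglongrightarrow> y - 0" by (intro tendsto_intros)
  then have "(\<lambda>N. S (\<Sum>k<N. X (r k))) \<longlonglongrightarrow> y" by (simp add: partial)
  moreover have "(\<lambda>N. S (\<Sum>k<N. X (r k))) \<longlonglongrightarrow> S (\<Sum>k. X (r k))"
    by (rule S.tendsto[OF summable_LIMSEQ[OF summable]])
  ultimately have "S (\<Sum>k. X (r k)) = y" using LIMSEQ_unique by blast
  moreover have "norm (\<Sum>k. X (r k)) \<le> (\<Sum>k. (M * norm y) * (1/2) ^ k)" by (rule norm_suminf_le[OF Xr geometric])
  then have "norm (\<Sum>k. X (r k)) \<le> 2 * M * norm y"
    using suminf_mult[OF summable_geometric[of "1/2::real"], of "M * norm y"] by (simp add: suminf_geometric)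
  ultimately show ?thesis by blast
qed

lemma bounded_inverse:
  fixes S :: "'a::banach \<Rightarrow> 'b::banach"
  assumes S: "bounded_linear S" and bij: "bij S"
  shows "bounded_linear (inv_into UNIV S)"
proof -
  interpret S: bounded_linear S by (rule S)
  obtain M where M: "0 < M" "\<forall>y. \<exists>x. norm x \<le> M * norm y \<and> norm (y - S x) \<le> norm y / 2"
    by (rule surj_approximate_preimage[OF S bij_is_surj[OF bij]])
  have bound: "norm (inv_into UNIV S y) \<le> norm y * (2 * M)" for y
  proof -
    obtain x where "S x = y" "norm x \<le> 2 * M * norm y" using approximate_preimage_imp_preimage[OF S M] by blast
    then show ?thesis using bij by (auto simp: bij_is_inj mult.commute)
  qed
  have inverse: "S (inv_into UNIV S y) = y" for y by (rule surj_f_inv_f[OF bij_is_surj[OF bij]])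
  show ?thesis
  proof (rule bounded_linear_intro[OF _ _ bound])
    show "inv_into UNIV S (x + y) = inv_into UNIV S x + inv_into UNIV S y"
      "inv_into UNIV S (c *\<^sub>R x) = c *\<^sub>R inv_into UNIV S x" for x y c
      by (rule inv_f_eq[OF bij_is_inj[OF bij]], simp add: S.add S.scaleR inverse)+
  qed
qed

subsection \<open>Finite rank corrections of Fredholm operators\<close>

lemma complement_of_codim:
  assumes "finite D" "span (R \<union> D) = UNIV"
  obtains C where "finite C" "card C = codim R" "span (R \<union> C) = UNIV" "\<forall>v\<in>C. v \<notin> span (R \<union> (C - {v}))"
proof -
  have "\<exists>m C. finite C \<and> card C = m \<and> span (R \<union> C) = UNIV" using assms by blast
  then have "\<exists>C. finite C \<and> card C = codim R \<and> span (R \<union> C) = UNIV" unfolding codim_def by (rule LeastI_ex)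
  then obtain C where C: "finite C" "card C = codim R" "span (R \<union> C) = UNIV" by blast
  have "v \<notin> span (R \<union> (C - {v}))" if v: "v \<in> C" for v
  proof
    assume "v \<in> span (R \<union> (C - {v}))"
    then have "R \<union> C \<subseteq> span (R \<union> (C - {v}))" by (auto intro: span_base)
    then have "span (R \<union> C) \<subseteq> span (R \<union> (C - {v}))" by (rule span_minimal[OF _ subspace_span])
    then have "span (R \<union> (C - {v})) = UNIV" unfolding C(3) by (simp add: top.extremum_unique)
    then have "codim R \<le> card (C - {v})" unfolding codim_def using C(1)
      by (intro Least_le exI[of _ "C - {v}"]) simp
    then show False using v C card_Diff1_less[of C v] by simp
  qed
  then show thesis using that C by blast
qed

lemma coefficient_zero_modulo:
  assumes I: "finite I" "inj_on v I" "\<forall>i\<in>I. v i \<notin> span (R \<union> (v ` I - {v i}))"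
    and r: "r \<in> R" "r + (\<Sum>i\<in>I. a i *\<^sub>R v i) = 0" and i: "i \<in> I"
  shows "a i = 0"
proof (rule ccontr)
  assume "a i \<noteq> 0"
  let ?T = "span (R \<union> (v ` I - {v i}))"
  have "v j \<in> ?T" if "j \<in> I - {i}" for j using that i I(2) by (intro span_base) (auto simp: inj_on_eq_iff)
  then have "(\<Sum>j\<in>I - {i}. a j *\<^sub>R v j) \<in> ?T" "r \<in> ?T" using r(1) by (auto intro!: span_sum span_scale intro: span_base)
  then have "- (r + (\<Sum>j\<in>I - {i}. a j *\<^sub>R v j)) \<in> ?T" by (intro span_neg span_add)
  moreover have "- (r + (\<Sum>j\<in>I - {i}. a j *\<^sub>R v j)) = a i *\<^sub>R v i"
    using r(2) I(1) i by (simp add: sum.remove[of I i] algebra_simps neg_eq_iff_add_eq_0)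
  ultimately have "(1 / a i) *\<^sub>R (a i *\<^sub>R v i) \<in> ?T" by (metis span_scale)
  then show False using \<open>a i \<noteq> 0\<close> I(3) i by simp
qed

lemma span_finite_image:
  assumes "finite I" "inj_on v I" "x \<in> span (v ` I)"
  obtains a where "x = (\<Sum>i\<in>I. a i *\<^sub>R v i)"
proof -
  obtain c where "x = (\<Sum>y\<in>v ` I. c y *\<^sub>R y)" using assms(1,3) by (auto simp: span_finite)
  then have "x = (\<Sum>i\<in>I. c (v i) *\<^sub>R v i)" using assms(2) by (simp add: sum.reindex)
  then show thesis by (rule that)
qed

lemma bij_finite_rank_correction:
  fixes T :: "'a::real_vector \<Rightarrow> 'b::real_vector"
  assumes T: "linear T" and I: "finite I" "inj_on b I" "inj_on v I"
    and kernel: "null_space T = span (b ` I)"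
    and l: "\<And>i. i \<in> I \<Longrightarrow> linear (l i)" "\<And>i j. i \<in> I \<Longrightarrow> j \<in> I \<Longrightarrow> l i (b j) = (if i = j then 1 else (0::real))"
    and v: "span (range T \<union> v ` I) = UNIV" "\<forall>i\<in>I. v i \<notin> span (range T \<union> (v ` I - {v i}))"
  shows "bij (\<lambda>u. T u + (\<Sum>i\<in>I. l i u *\<^sub>R v i))"
proof -
  define S where "S u = T u + (\<Sum>i\<in>I. l i u *\<^sub>R v i)" for u
  have coordinate: "l i (\<Sum>j\<in>I. a j *\<^sub>R b j) = a i" if "i \<in> I" for i a
  proof -
    have "l i (\<Sum>j\<in>I. a j *\<^sub>R b j) = (\<Sum>j\<in>I. if i = j then a j else 0)"
      unfolding linear_sum[OF l(1)[OF that]] using that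
      by (intro sum.cong) (auto simp: linear_scale[OF l(1)] l(2))
    then show ?thesis using that I(1) by simp
  qed
  have vanish: "T (\<Sum>j\<in>I. a j *\<^sub>R b j) = 0" for a
  proof -
    have "(\<Sum>j\<in>I. a j *\<^sub>R b j) \<in> null_space T" unfolding kernel by (intro span_sum span_scale span_base) simp
    then show ?thesis by (simp add: null_space_def)
  qed
  have "linear (\<lambda>u. l i u *\<^sub>R v i)" if "i \<in> I" for i
    using linear_add[OF l(1)[OF that]] linear_scale[OF l(1)[OF that]] by (intro linearI) (simp_all add: scaleR_add_left)
  then have S: "linear S" unfolding S_def by (intro linear_compose_add T linear_compose_sum ballI)
  have "inj S"
  proof (rule linear_injective_0[OF S, THEN iffD2], intro allI impI)
    fix u assume Su: "S u = 0"
    then have l0: "l i u = 0" if "i \<in> I" for i using coefficient_zero_modulo[OF I(1,3) v(2) rangeI _ that] by (simp add: S_def)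
    then have "u \<in> span (b ` I)" using Su unfolding kernel[symmetric] by (simp add: S_def null_space_def)
    then obtain a where u: "u = (\<Sum>i\<in>I. a i *\<^sub>R b i)" by (rule span_finite_image[OF I(1,2)])
    then have "a i = 0" if "i \<in> I" for i using coordinate[OF that] l0[OF that] by metis
    then show "u = 0" using u by simp
  qed
  moreover have "y \<in> range S" for y
  proof -
    have "y \<in> span (range T \<union> v ` I)" using v(1) by simp
    then obtain t w where tw: "t \<in> span (range T)" "w \<in> span (v ` I)" "y = t + w" by (auto simp: span_Un)
    have "span (range T) = range T" using linear_subspace_image[OF T subspace_UNIV] by (simp only: span_eq_iff)
    then obtain u where u: "t = T u" using tw(1) by blast
    obtain a where w: "w = (\<Sum>i\<in>I. a i *\<^sub>R v i)" by (rule span_finite_image[OF I(1,3) tw(2)])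
    have "S (u + (\<Sum>j\<in>I. (a j - l j u) *\<^sub>R b j)) = T u + (\<Sum>i\<in>I. a i *\<^sub>R v i)"
      unfolding S_def linear_add[OF T] vanish by (simp add: linear_add[OF l(1)] coordinate cong: sum.cong)
    then show ?thesis using tw(3) u w by (metis rangeI)
  qed
  ultimately show ?thesis unfolding S_def[symmetric, abs_def] bij_def by blast
qed

lemma fredholm_index_zero_perturbation:
  fixes T :: "'a::banach \<Rightarrow> 'b::banach"
  assumes "T \<in> Phi0"
  obtains Q :: "'b \<Rightarrow> 'a" and n :: nat and l :: "nat \<Rightarrow> 'a \<Rightarrow> real" and e :: "nat \<Rightarrow> 'a"
  where "bounded_linear Q" "inj Q" "\<forall>i<n. bounded_linear (l i)" "\<forall>u. Q (T u) = u - (\<Sum>i<n. l i u *\<^sub>R e i)"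
proof -
  have T: "bounded_linear T" and index: "dim (null_space T) = codim (range T)"
    using assms by (auto simp: Phi0_def fredholm_def fredholm_index_def)
  obtain B0 where B0: "finite B0" "null_space T = span B0" using assms by (auto simp: Phi0_def fredholm_def)
  obtain B where B: "B \<subseteq> null_space T" "independent B" "null_space T \<subseteq> span B" "card B = dim (null_space T)"
    by (rule basis_exists)
  have finB: "finite B" using B(1,2) B0 independent_span_bound[of B0 B] by auto
  have kernel: "null_space T = span B" using B(1,3) span_minimal[OF B(1)] B0(2) by auto
  obtain C where C: "finite C" "card C = codim (range T)" "span (range T \<union> C) = UNIV"
      "\<forall>v\<in>C. v \<notin> span (range T \<union> (C - {v}))"
    using assms complement_of_codim[of _ "range T"] by (auto simp: Phi0_def fredholm_def)
  define n where "n = card B"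
  obtain b where b: "bij_betw b {..<n} B" using ex_bij_betw_nat_finite[OF finB] by (auto simp: n_def atLeast0LessThan)
  obtain v where v: "bij_betw v {..<n} C" using ex_bij_betw_nat_finite[OF C(1)] C(2) B(4) index by (auto simp: n_def atLeast0LessThan)
  have bv: "b ` {..<n} = B" "v ` {..<n} = C" "inj_on b {..<n}" "inj_on v {..<n}" using b v by (auto simp: bij_betw_def)
  obtain d where d: "\<forall>c\<in>B. bounded_linear (d c)" "\<forall>c\<in>B. \<forall>c'\<in>B. d c c' = (if c = c' then 1 else (0::real))"
    using dual_functionals[OF finB B(2)] by blast
  define l where "l i = d (b i)" for i
  have l: "bounded_linear (l i)" if "i < n" for i using d(1) bv(1) that by (auto simp: l_def)
  define S where "S u = T u + (\<Sum>i<n. l i u *\<^sub>R v i)" for u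
  have "bij S" unfolding S_def
  proof (rule bij_finite_rank_correction[OF bounded_linear.linear[OF T] finite_lessThan bv(3,4)])
    show "l i (b j) = (if i = j then 1 else 0)" if "i \<in> {..<n}" "j \<in> {..<n}" for i j
      using d(2) bv(1,3) that by (auto simp: l_def inj_on_eq_iff)
  qed (use l bv(1,2) kernel C(3,4) in \<open>auto intro: bounded_linear.linear\<close>)
  moreover have "bounded_linear S" unfolding S_def
    by (intro bounded_linear_add T bounded_linear_sum bounded_linear_scaleR_const l) auto
  ultimately have Q: "bounded_linear (inv_into UNIV S)" by (intro bounded_inverse)
  interpret Q: bounded_linear "inv_into UNIV S" by (rule Q)
  have left_inverse: "inv_into UNIV S (T u) = u - (\<Sum>i<n. l i u *\<^sub>R inv_into UNIV S (v i))" for u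
  proof -
    have "inv_into UNIV S (S u) = u" using \<open>bij S\<close> by (simp add: bij_is_inj)
    then have "inv_into UNIV S (T u) + (\<Sum>i<n. l i u *\<^sub>R inv_into UNIV S (v i)) = u"
      by (simp add: S_def Q.add Q.sum Q.scaleR)
    then show ?thesis by (simp add: eq_diff_eq)
  qed
  have "inj (inv_into UNIV S)" using \<open>bij S\<close> by (simp add: bij_imp_bij_inv bij_is_inj)
  then show thesis using Q l left_inverse by (intro that[of "inv_into UNIV S" n l]) auto
qed

section \<open>Power series of multilinear maps and their complexification\<close>

subsection \<open>Bounded multilinear maps\<close>

definition multilinear_bounded :: "nat \<Rightarrow> real \<Rightarrow> ((nat \<Rightarrow> 'a::real_normed_vector) \<Rightarrow> 'b::real_normed_vector) \<Rightarrow> bool" where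
  "multilinear_bounded n C m \<longleftrightarrow> (\<forall>v w. (\<forall>i<n. v i = w i) \<longrightarrow> m v = m w) \<and>
      (\<forall>v. \<forall>i<n. linear (\<lambda>x. m (v(i := x)))) \<and> (\<forall>v. norm (m v) \<le> C * (\<Prod>i<n. norm (v i)))"

lemma multilinear_boundedD:
  assumes "multilinear_bounded n C m"
  shows "(\<And>i. i < n \<Longrightarrow> v i = w i) \<Longrightarrow> m v = m w" "i < n \<Longrightarrow> linear (\<lambda>x. m (v(i := x)))"
    "norm (m v) \<le> C * (\<Prod>i<n. norm (v i))"
  using assms unfolding multilinear_bounded_def by blast+

lemma sym_multilinear_imp_bounded: "sym_multilinear n C m \<Longrightarrow> multilinear_bounded n C m"
  unfolding sym_multilinear_def multilinear_bounded_def by blast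

lemma multilinear_bounded_mono:
  fixes m :: "(nat \<Rightarrow> 'a::real_normed_vector) \<Rightarrow> 'b::real_normed_vector"
  assumes "multilinear_bounded n C m" "C \<le> C'"
  shows "multilinear_bounded n C' m"
proof -
  have "norm (m v) \<le> C' * (\<Prod>i<n. norm (v i))" for v
    by (rule order_trans[OF multilinear_boundedD(3)[OF assms(1)]]) (intro mult_right_mono prod_nonneg assms(2), auto)
  then show ?thesis using assms(1) unfolding multilinear_bounded_def by blast
qed

lemma multilinear_telescope:
  assumes m: "multilinear_bounded n C m"
  shows "m v - m w = (\<Sum>j<n. m ((\<lambda>i. if i < j then v i else w i)(j := v j - w j)))"
proof -
  define f where "f j = m (\<lambda>i. if i < j then v i else w i)" for j
  have "f (Suc j) - f j = m ((\<lambda>i. if i < j then v i else w i)(j := v j - w j))" if j: "j < n" for j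
  proof -
    let ?u = "\<lambda>i. if i < j then v i else w i"
    have "f (Suc j) = m (?u(j := v j))" "f j = m (?u(j := w j))"
      unfolding f_def by (intro arg_cong[where f = m]; auto simp: fun_eq_iff)+
    then show ?thesis using linear_diff[OF multilinear_boundedD(2)[OF m j], of ?u] by simp
  qed
  then have "(\<Sum>j<n. m ((\<lambda>i. if i < j then v i else w i)(j := v j - w j))) = (\<Sum>j<n. f (Suc j) - f j)"
    by (intro sum.cong) auto
  also have "\<dots> = f n - f 0" by (rule sum_lessThan_telescope)
  also have "f n = m v" unfolding f_def by (rule multilinear_boundedD(1)[OF m]) simp
  also have "f 0 = m w" by (simp add: f_def)
  finally show ?thesis by (rule sym)
qed

lemma multilinear_slot_le:
  assumes m: "multilinear_bounded n C m" and C: "0 \<le> C" and j: "j < n" and v: "\<And>i. i < n \<Longrightarrow> i \<noteq> j \<Longrightarrow> norm (v i) \<le> R"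
  shows "norm (m (v(j := h))) \<le> C * R ^ (n - 1) * norm h"
proof -
  have "(\<Prod>i<n. norm ((v(j := h)) i)) = norm h * (\<Prod>i\<in>{..<n}-{j}. norm ((v(j := h)) i))"
    using j by (subst prod.remove[of _ j]) auto
  also have "(\<Prod>i\<in>{..<n}-{j}. norm ((v(j := h)) i)) \<le> (\<Prod>i\<in>{..<n}-{j}. R)" using v by (intro prod_mono) auto
  also have "(\<Prod>i\<in>{..<n}-{j}. R) = R ^ (n - 1)" using j by simp
  finally have "(\<Prod>i<n. norm ((v(j := h)) i)) \<le> norm h * R ^ (n - 1)" by (simp add: mult_left_mono)
  then have "C * (\<Prod>i<n. norm ((v(j := h)) i)) \<le> C * (norm h * R ^ (n - 1))" using C by (rule mult_left_mono)
  then show ?thesis using multilinear_boundedD(3)[OF m, of "v(j := h)"] by (simp add: mult_ac)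
qed

lemma multilinear_Lipschitz:
  assumes m: "multilinear_bounded n C m" and C: "0 \<le> C" and v: "\<And>i. i < n \<Longrightarrow> norm (v i) \<le> R" "\<And>i. i < n \<Longrightarrow> norm (w i) \<le> R"
  shows "norm (m v - m w) \<le> C * R ^ (n - 1) * (\<Sum>j<n. norm (v j - w j))"
proof -
  have "norm (m v - m w) \<le> (\<Sum>j<n. C * R ^ (n - 1) * norm (v j - w j))"
    unfolding multilinear_telescope[OF m]
    by (intro sum_norm_le multilinear_slot_le[OF m C]) (use v in auto)
  then show ?thesis by (simp add: sum_distrib_left)
qed

lemma multilinear_slot_Lipschitz:
  assumes m: "multilinear_bounded n C m" and C: "0 \<le> C" and j: "j < n" and R: "1 \<le> R"
    and v: "\<And>i. i < n \<Longrightarrow> norm (v i) \<le> R" "\<And>i. i < n \<Longrightarrow> norm (w i) \<le> R"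
  shows "norm (m (v(j := h)) - m (w(j := h))) \<le> C * R ^ (n - 1) * (\<Sum>i<n. norm (v i - w i)) * norm h"
proof (cases "h = 0")
  case True
  then show ?thesis using linear_0[OF multilinear_boundedD(2)[OF m j]] by simp
next
  case False
  define a where "a = (1 / norm h) *\<^sub>R h"
  have a: "h = norm h *\<^sub>R a" "norm a = 1" using False by (auto simp: a_def)
  have "m (u(j := h)) = norm h *\<^sub>R m (u(j := a))" for u
    using linear_scale[OF multilinear_boundedD(2)[OF m j], of u "norm h" a] unfolding a(1)[symmetric] .
  then have "norm (m (v(j := h)) - m (w(j := h))) = norm h * norm (m (v(j := a)) - m (w(j := a)))"
    by (simp add: scaleR_diff_right[symmetric])
  moreover have "norm (m (v(j := a)) - m (w(j := a))) \<le> C * R ^ (n - 1) * (\<Sum>i<n. norm (v i - w i))"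
  proof (rule order_trans[OF multilinear_Lipschitz[OF m C]])
    show "C * R ^ (n - 1) * (\<Sum>i<n. norm ((v(j := a)) i - (w(j := a)) i)) \<le> C * R ^ (n - 1) * (\<Sum>i<n. norm (v i - w i))"
      using C R by (intro mult_left_mono sum_mono) auto
  qed (use v R a(2) in auto)
  ultimately show ?thesis by (simp only: mult.commute[of _ "norm h"] mult_left_mono norm_ge_zero)
qed

definition diag_derivative :: "nat \<Rightarrow> ((nat \<Rightarrow> 'a) \<Rightarrow> 'b::comm_monoid_add) \<Rightarrow> 'a \<Rightarrow> 'a \<Rightarrow> 'b" where
  "diag_derivative n m x h = (\<Sum>j<n. m ((\<lambda>_. x)(j := h)))"

lemma norm_diag_derivative_le:
  assumes "multilinear_bounded n C m" "0 \<le> C" "norm x \<le> s"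
  shows "norm (diag_derivative n m x h) \<le> real n * (C * s ^ (n - 1)) * norm h"
proof -
  have "norm (diag_derivative n m x h) \<le> (\<Sum>j<n. C * s ^ (n - 1) * norm h)"
    unfolding diag_derivative_def using assms by (intro sum_norm_le multilinear_slot_le) auto
  then show ?thesis by (simp add: mult_ac)
qed

lemma bounded_linear_diag_derivative:
  assumes m: "multilinear_bounded n C m" and C: "0 \<le> C"
  shows "bounded_linear (diag_derivative n m x)"
proof (rule bounded_linear_intro)
  show "diag_derivative n m x (h + h') = diag_derivative n m x h + diag_derivative n m x h'" for h h'
    unfolding diag_derivative_def
    by (simp add: linear_add[OF multilinear_boundedD(2)[OF m]] sum.distrib)
  show "diag_derivative n m x (a *\<^sub>R h) = a *\<^sub>R diag_derivative n m x h" for a h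
    unfolding diag_derivative_def
    by (simp add: linear_scale[OF multilinear_boundedD(2)[OF m]] scaleR_sum_right)
  show "norm (diag_derivative n m x h) \<le> norm h * (real n * (C * norm x ^ (n - 1)))" for h
    using norm_diag_derivative_le[OF m C order_refl, of x h] by (simp add: mult_ac)
qed

lemma multilinear_diag_remainder:
  assumes m: "multilinear_bounded n C m" and C: "0 \<le> C" and y: "norm (y - x) \<le> 1"
  shows "norm (m (\<lambda>_. y) - m (\<lambda>_. x) - diag_derivative n m x (y - x)) \<le>
    real n * (C * (norm x + 1) ^ (n - 1) * real n) * norm (y - x) * norm (y - x)"
proof -
  let ?L = "C * (norm x + 1) ^ (n - 1)"
  let ?v = "\<lambda>j i. if i < j then y else x"
  have R: "norm y \<le> norm x + 1" using norm_triangle_ineq[of x "y - x"] y by simp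
  have slot: "norm (m ((?v j)(j := y - x)) - m ((\<lambda>_. x)(j := y - x))) \<le> ?L * real n * norm (y - x) * norm (y - x)"
    if j: "j < n" for j
  proof -
    have "norm (m ((?v j)(j := y - x)) - m ((\<lambda>_. x)(j := y - x))) \<le> ?L * (\<Sum>i<n. norm (?v j i - x)) * norm (y - x)"
      by (rule multilinear_slot_Lipschitz[OF m C j]) (use R in auto)
    also have "(\<Sum>i<n. norm (?v j i - x)) \<le> (\<Sum>i<n. norm (y - x))" by (intro sum_mono) auto
    finally show ?thesis using C by (simp add: mult_right_mono mult_left_mono mult.assoc)
  qed
  have "m (\<lambda>_. y) - m (\<lambda>_. x) - diag_derivative n m x (y - x) = (\<Sum>j<n. m ((?v j)(j := y - x)) - m ((\<lambda>_. x)(j := y - x)))"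
    using multilinear_telescope[OF m, of "\<lambda>_. y" "\<lambda>_. x"] by (simp only: sum_subtractf diag_derivative_def)
  also have "norm \<dots> \<le> (\<Sum>j<n. ?L * real n * norm (y - x) * norm (y - x))" using slot by (intro sum_norm_le) auto
  finally show ?thesis by (simp add: mult_ac)
qed

lemma has_derivative_if_quadratic_remainder:
  fixes f :: "'a::real_normed_vector \<Rightarrow> 'b::real_normed_vector"
  assumes L: "bounded_linear L" and K: "0 \<le> K"
    and remainder: "\<And>y. norm (y - x) \<le> 1 \<Longrightarrow> norm (f y - f x - L (y - x)) \<le> K * norm (y - x) * norm (y - x)"
  shows "(f has_derivative L) (at x)"
  unfolding has_derivative_within_alt
proof (intro conjI allI impI)
  fix e :: real assume e: "0 < e"
  define d where "d = min 1 (e / (K + 1))"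
  have "norm (f y - f x - L (y - x)) \<le> e * norm (y - x)" if "norm (y - x) < d" for y
  proof -
    have y: "norm (y - x) \<le> 1" "norm (y - x) \<le> e / (K + 1)" using that by (auto simp: d_def)
    then have "(K + 1) * norm (y - x) \<le> e" using K by (simp add: pos_le_divide_eq mult.commute)
    then have "K * norm (y - x) \<le> e" using norm_ge_zero[of "y - x"] by (simp only: distrib_right)
    then have "K * norm (y - x) * norm (y - x) \<le> e * norm (y - x)" by (intro mult_right_mono) auto
    then show ?thesis by (rule order_trans[OF remainder[OF y(1)]])
  qed
  moreover have "0 < d" using e K by (simp add: d_def)
  ultimately show "\<exists>d>0. \<forall>y\<in>UNIV. norm (y - x) < d \<longrightarrow> norm (f y - f x - L (y - x)) \<le> e * norm (y - x)" by blast
qed (rule L)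

lemma has_derivative_multilinear_diag:
  assumes m: "multilinear_bounded n C m" and C: "0 \<le> C"
  shows "((\<lambda>x. m (\<lambda>_. x)) has_derivative diag_derivative n m x) (at x)"
proof (rule has_derivative_if_quadratic_remainder[OF bounded_linear_diag_derivative[OF m C] _ multilinear_diag_remainder[OF m C]])
  show "0 \<le> real n * (C * (norm x + 1) ^ (n - 1) * real n)" using C by (intro mult_nonneg_nonneg) auto
qed

subsection \<open>Differentiation of power series\<close>

definition series_sum :: "(nat \<Rightarrow> (nat \<Rightarrow> 'a) \<Rightarrow> 'b::real_normed_vector) \<Rightarrow> 'a \<Rightarrow> 'b" where
  "series_sum m x = (\<Sum>n. m n (\<lambda>_. x))"

definition series_derivative :: "(nat \<Rightarrow> (nat \<Rightarrow> 'a) \<Rightarrow> 'b::real_normed_vector) \<Rightarrow> 'a \<Rightarrow> 'a \<Rightarrow> 'b" where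
  "series_derivative m x h = (\<Sum>n. diag_derivative n (m n) x h)"

locale multilinear_series =
  fixes m :: "nat \<Rightarrow> (nat \<Rightarrow> 'a::real_normed_vector) \<Rightarrow> 'b::banach" and r K :: real
  assumes r: "0 < r" and K: "0 \<le> K" and bounded: "multilinear_bounded n (K / r ^ n) (m n)"
begin

definition derivative_bound :: "nat \<Rightarrow> real" where
  "derivative_bound n = K / (r / 4) * (real n * (1 / 4) ^ n)"

lemma coefficient_nonneg: "0 \<le> K / r ^ n"
  using K r by simp

lemma summable_derivative_bound: "summable derivative_bound"
proof -
  have "summable (\<lambda>n. real n * (1 / 4) ^ n)"
  proof (rule summable_comparison_test'[of "\<lambda>n. (1 / 2::real) ^ n" 0])
    show "summable (\<lambda>n. (1 / 2::real) ^ n)" by (rule summable_geometric) simp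
    fix n :: nat
    have "real n \<le> 2 ^ n" using of_nat_less_two_power[of n, where 'a=real] by linarith
    then have "real n * (1 / 4) ^ n \<le> 2 ^ n * (1 / 4) ^ n" by (intro mult_right_mono) auto
    also have "\<dots> = (1 / 2) ^ n" by (simp add: power_mult_distrib[symmetric])
    finally show "norm (real n * (1 / 4) ^ n) \<le> (1 / 2::real) ^ n" by simp
  qed
  then show ?thesis unfolding derivative_bound_def[abs_def] by (rule summable_mult)
qed

lemma norm_diag_derivative_le_bound:
  assumes "norm x \<le> r / 4"
  shows "norm (diag_derivative n (m n) x h) \<le> derivative_bound n * norm h"
proof (cases n)
  case (Suc k)
  have "(1 / 4) ^ n = (r / 4) ^ n / r ^ n" using r by (simp add: power_divide)
  then have "real n * (K / r ^ n * (r / 4) ^ (n - 1)) = derivative_bound n"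
    using Suc r by (simp add: derivative_bound_def field_simps)
  then show ?thesis using norm_diag_derivative_le[OF bounded coefficient_nonneg assms, of n h] by simp
qed (simp add: diag_derivative_def derivative_bound_def)

lemma sums_series_derivative:
  assumes "norm x < r / 4"
  shows "(\<lambda>n. diag_derivative n (m n) x h) sums series_derivative m x h"
  unfolding series_derivative_def
proof (rule summable_sums, rule summable_comparison_test'[of "\<lambda>n. derivative_bound n * norm h" 0])
  show "summable (\<lambda>n. derivative_bound n * norm h)" by (intro summable_mult2 summable_derivative_bound)
qed (use norm_diag_derivative_le_bound assms in simp)

lemma series_derivative_tail:
  assumes x: "norm x < r / 4"
  shows "norm (series_derivative m x h - (\<Sum>n<N. diag_derivative n (m n) x h)) \<le> (\<Sum>n. derivative_bound (n + N)) * norm h"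
proof -
  have shifted: "summable (\<lambda>n. derivative_bound (n + N))" by (rule summable_ignore_initial_segment[OF summable_derivative_bound])
  have "series_derivative m x h - (\<Sum>n<N. diag_derivative n (m n) x h) = (\<Sum>n. diag_derivative (n + N) (m (n + N)) x h)"
    using suminf_split_initial_segment[OF sums_summable[OF sums_series_derivative[OF x]], of h N]
    by (simp add: series_derivative_def)
  also have "norm \<dots> \<le> (\<Sum>n. derivative_bound (n + N) * norm h)"
    using x by (intro norm_suminf_le norm_diag_derivative_le_bound summable_mult2 shifted) simp
  also have "\<dots> = (\<Sum>n. derivative_bound (n + N)) * norm h" by (rule suminf_mult2[OF shifted, symmetric])
  finally show ?thesis .
qed

lemma series_derivative_uniform:
  assumes "0 < e"
  shows "\<forall>\<^sub>F N in sequentially. \<forall>x\<in>ball 0 (r / 4). \<forall>h.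
    norm ((\<Sum>n<N. diag_derivative n (m n) x h) - series_derivative m x h) \<le> e * norm h"
proof -
  obtain N0 where N0: "\<forall>N\<ge>N0. norm (\<Sum>n. derivative_bound (n + N)) < e"
    using suminf_exist_split[OF assms summable_derivative_bound] by blast
  show ?thesis
  proof (rule eventually_sequentiallyI[of N0], intro ballI allI)
    fix N and x h :: 'a assume N: "N \<ge> N0" and x: "x \<in> ball 0 (r / 4)"
    have "(\<Sum>n. derivative_bound (n + N)) \<le> e" using N0 N by (fastforce simp: abs_less_iff)
    then have "(\<Sum>n. derivative_bound (n + N)) * norm h \<le> e * norm h" by (rule mult_right_mono) simp
    moreover have "norm ((\<Sum>n<N. diag_derivative n (m n) x h) - series_derivative m x h) \<le> (\<Sum>n. derivative_bound (n + N)) * norm h"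
      using series_derivative_tail[of x h N] x by (simp add: norm_minus_commute)
    ultimately show "norm ((\<Sum>n<N. diag_derivative n (m n) x h) - series_derivative m x h) \<le> e * norm h" by simp
  qed
qed

lemma sums_series_sum:
  assumes "norm x < r"
  shows "(\<lambda>n. m n (\<lambda>_. x)) sums series_sum m x"
  unfolding series_sum_def
proof (rule summable_sums, rule summable_comparison_test'[of "\<lambda>n. K * (norm x / r) ^ n" 0])
  show "summable (\<lambda>n. K * (norm x / r) ^ n)" using assms r by (intro summable_mult summable_geometric) simp
  show "norm (m n (\<lambda>_. x)) \<le> K * (norm x / r) ^ n" for n
    using multilinear_boundedD(3)[OF bounded, of n "\<lambda>_. x"] by (simp add: power_divide)
qed

lemma has_derivative_series_sum:
  assumes x: "norm x < r / 4"
  shows "(series_sum m has_derivative series_derivative m x) (at x)"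
proof -
  have "\<exists>g. \<forall>x\<in>ball 0 (r / 4). (\<lambda>n. m n (\<lambda>_. x)) sums g x \<and>
      (g has_derivative series_derivative m x) (at x within ball 0 (r / 4))"
  proof (rule has_derivative_series[OF convex_ball _ series_derivative_uniform])
    show "((\<lambda>x. m n (\<lambda>_. x)) has_derivative diag_derivative n (m n) x) (at x within ball 0 (r / 4))" for n x
      by (rule has_derivative_at_withinI[OF has_derivative_multilinear_diag[OF bounded coefficient_nonneg]])
    show "0 \<in> ball 0 (r / 4)" "(\<lambda>n. m n (\<lambda>_. 0)) sums series_sum m 0" using r sums_series_sum[of 0] by auto
  qed
  then obtain g where g: "\<And>x. x \<in> ball 0 (r / 4) \<Longrightarrow> (\<lambda>n. m n (\<lambda>_. x)) sums g x"
    "\<And>x. x \<in> ball 0 (r / 4) \<Longrightarrow> (g has_derivative series_derivative m x) (at x within ball 0 (r / 4))" by blast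
  have "g y = series_sum m y" if "y \<in> ball 0 (r / 4)" for y
    using sums_unique2[OF g(1)[OF that] sums_series_sum] that r by simp
  moreover have "(g has_derivative series_derivative m x) (at x)"
    using g(2)[of x] x at_within_open[of x "ball 0 (r / 4)"] by simp
  ultimately show ?thesis
    using x by (auto intro: has_derivative_transform_within_open[OF _ open_ball[of 0 "r / 4"]])
qed

lemma diag_derivative_one: "diag_derivative 1 (m 1) x h = m 1 (\<lambda>_. h)"
proof -
  have "m 1 ((\<lambda>_. x)(0 := h)) = m 1 (\<lambda>_. h)" by (rule multilinear_boundedD(1)[OF bounded]) simp
  then show ?thesis by (simp add: diag_derivative_def)
qed

lemma norm_diag_derivative_le_linear:
  assumes x: "norm x < r / 4"
  shows "norm (diag_derivative (n + 2) (m (n + 2)) x h) \<le> derivative_bound (n + 2) * (norm x * norm h / (r / 4))"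
proof -
  have "norm x ^ n * norm x \<le> (r / 4) ^ n * norm x" using x by (intro mult_right_mono power_mono) auto
  then have power: "norm x ^ (n + 2 - 1) \<le> (r / 4) ^ n * norm x" by (simp add: mult.commute)
  have "norm (diag_derivative (n + 2) (m (n + 2)) x h) \<le> real (n + 2) * (K / r ^ (n + 2) * norm x ^ (n + 2 - 1)) * norm h"
    by (rule norm_diag_derivative_le[OF bounded coefficient_nonneg order_refl])
  also have "\<dots> \<le> real (n + 2) * (K / r ^ (n + 2) * ((r / 4) ^ n * norm x)) * norm h"
    using K r power by (intro mult_right_mono mult_left_mono) auto
  also have "\<dots> = derivative_bound (n + 2) * (norm x * norm h / (r / 4))"
  proof -
    have "(1 / 4) ^ (n + 2) = (r / 4) ^ n * (r / 4) * (r / 4) / r ^ (n + 2)"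
      using r by (simp add: power_divide power_add power2_eq_square)
    then show ?thesis unfolding derivative_bound_def using r by (simp del: power_Suc power_add of_nat_add)
  qed
  finally show ?thesis .
qed

lemma series_derivative_near_linear_part:
  obtains M where "0 \<le> M" "\<forall>x h. norm x < r / 4 \<longrightarrow> norm (series_derivative m x h - m 1 (\<lambda>_. h)) \<le> M * norm x * norm h"
proof
  define M where "M = (\<Sum>n. derivative_bound (n + 2)) / (r / 4)"
  have shifted: "summable (\<lambda>n. derivative_bound (n + 2))" by (rule summable_ignore_initial_segment[OF summable_derivative_bound])
  have "0 \<le> derivative_bound n" for n using K r by (simp add: derivative_bound_def)
  then show "0 \<le> M" unfolding M_def using r by (intro divide_nonneg_nonneg suminf_nonneg shifted) auto
  have "norm (series_derivative m x h - m 1 (\<lambda>_. h)) \<le> M * norm x * norm h" if x: "norm x < r / 4" for x h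
  proof -
    have "(\<Sum>n<2. diag_derivative n (m n) x h) = m 1 (\<lambda>_. h)"
      using diag_derivative_one[of x h] by (simp add: numeral_2_eq_2 diag_derivative_def)
    then have "series_derivative m x h - m 1 (\<lambda>_. h) = (\<Sum>n. diag_derivative (n + 2) (m (n + 2)) x h)"
      using suminf_split_initial_segment[OF sums_summable[OF sums_series_derivative[OF x]], of h 2]
      by (simp add: series_derivative_def)
    also have "norm \<dots> \<le> (\<Sum>n. derivative_bound (n + 2) * (norm x * norm h / (r / 4)))"
      using norm_diag_derivative_le_linear[OF x] by (intro norm_suminf_le summable_mult2 shifted)
    also have "\<dots> = M * norm x * norm h" unfolding suminf_mult2[OF shifted, symmetric] by (simp add: M_def)
    finally show ?thesis .
  qed
  then show "\<forall>x h. norm x < r / 4 \<longrightarrow> norm (series_derivative m x h - m 1 (\<lambda>_. h)) \<le> M * norm x * norm h" by blast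
qed

lemma has_derivative_linear_part: "(series_sum m has_derivative (\<lambda>h. m 1 (\<lambda>_. h))) (at 0)"
proof -
  obtain M where M: "\<forall>x h. norm x < r / 4 \<longrightarrow> norm (series_derivative m x h - m 1 (\<lambda>_. h)) \<le> M * norm x * norm h"
    by (rule series_derivative_near_linear_part)
  have "series_derivative m 0 h = m 1 (\<lambda>_. h)" for h using M[rule_format, of 0 h] r by simp
  then have "series_derivative m 0 = (\<lambda>h. m 1 (\<lambda>_. h))" by (rule ext)
  then show ?thesis using has_derivative_series_sum[of 0] r by simp
qed

end

subsection \<open>Complexification\<close>

text \<open>The complexification of a real space is the product of two copies of it.\<close>

definition imult :: "'a::real_normed_vector \<times> 'a \<Rightarrow> 'a \<times> 'a" where
  "imult w = (- snd w, fst w)"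

lemma bounded_linear_imult: "bounded_linear imult"
  unfolding imult_def[abs_def]
  by (intro bounded_linear_Pair bounded_linear_minus bounded_linear_fst bounded_linear_snd)

lemma linear_imult: "linear imult" by (rule bounded_linear.linear[OF bounded_linear_imult])

lemma imult_imult: "imult (imult w) = - w" by (simp add: imult_def prod_eq_iff)

lemma fst_imult: "fst (imult w) = - snd w" and snd_imult: "snd (imult w) = fst w" by (simp_all add: imult_def)

lemma norm_imult: "norm (imult w) = norm w" by (cases w) (simp add: imult_def norm_Pair add.commute)

primrec complexify_upto :: "nat \<Rightarrow> ((nat \<Rightarrow> 'a::real_normed_vector) \<Rightarrow> 'b::real_normed_vector) \<Rightarrow> (nat \<Rightarrow> 'a \<times> 'a) \<Rightarrow> (nat \<Rightarrow> 'a) \<Rightarrow> 'b \<times> 'b" where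
  "complexify_upto 0 m w v = (m v, 0)"
| "complexify_upto (Suc k) m w v = complexify_upto k m w (v(k := fst (w k))) + imult (complexify_upto k m w (v(k := snd (w k))))"

lemma complexify_upto_cong:
  assumes m: "multilinear_bounded n C m"
  shows "(\<And>i. i < k \<Longrightarrow> w i = w' i) \<Longrightarrow> (\<And>i. k \<le> i \<Longrightarrow> i < n \<Longrightarrow> v i = v' i) \<Longrightarrow> complexify_upto k m w v = complexify_upto k m w' v'"
proof (induction k arbitrary: v v')
  case 0 then show ?case using multilinear_boundedD(1)[OF m, of v v'] by simp
next
  case (Suc k)
  have "complexify_upto k m w (v(k := a)) = complexify_upto k m w' (v'(k := a))" for a
    by (rule Suc.IH) (use Suc.prems in auto)
  then show ?case using Suc.prems(1)[of k] by simp
qed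

lemma complexify_upto_linear:
  assumes m: "multilinear_bounded n C m" and i: "i < n"
  shows "k \<le> i \<Longrightarrow> linear (\<lambda>x. complexify_upto k m w (v(i := x)))"
proof (induction k arbitrary: v)
  case 0
  have linear_m: "linear (\<lambda>x. m (v(i := x)))" by (rule multilinear_boundedD(2)[OF m i])
  show ?case unfolding complexify_upto.simps by (rule linearI) (simp_all add: linear_add[OF linear_m] linear_scale[OF linear_m])
next
  case (Suc k)
  have swap: "(v(i := x))(k := a) = (v(k := a))(i := x)" for x a using Suc.prems by (simp add: fun_upd_twist)
  have linear: "linear (\<lambda>x. complexify_upto k m w ((v(k := a))(i := x)))" for a by (rule Suc.IH) (use Suc.prems in simp)
  show ?case unfolding complexify_upto.simps swap
    by (intro linear_compose_add linear linear_compose[OF linear linear_imult, unfolded o_def])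
qed

lemma complexify_upto_slot:
  assumes m: "multilinear_bounded n C m" and j: "j < k" "k \<le> n"
  shows "linear (\<lambda>x. complexify_upto k m (w(j := x)) v) \<and> complexify_upto k m (w(j := imult y)) v = imult (complexify_upto k m (w(j := y)) v)"
  using j
proof (induction k arbitrary: v)
  case (Suc k)
  show ?case
  proof (cases "j = k")
    case True
    have below: "complexify_upto k m (w(j := x)) u = complexify_upto k m w u" for x u
      by (rule complexify_upto_cong[OF m]) (use True in auto)
    have linear_k: "linear (\<lambda>x. complexify_upto k m w (v(k := x)))" using Suc.prems by (intro complexify_upto_linear[OF m]) auto
    have parts: "linear (\<lambda>x. complexify_upto k m w (v(k := fst x)))" "linear (\<lambda>x. complexify_upto k m w (v(k := snd x)))"
      using linear_compose[OF linear_fst linear_k] linear_compose[OF linear_snd linear_k] by (simp_all add: o_def)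
    have expand: "complexify_upto (Suc k) m (w(j := x)) v = complexify_upto k m w (v(k := fst x)) + imult (complexify_upto k m w (v(k := snd x)))" for x
      unfolding complexify_upto.simps below using True by (simp only: fun_upd_same)
    have "linear (\<lambda>x. complexify_upto (Suc k) m (w(j := x)) v)"
      unfolding expand by (intro linear_compose_add parts linear_compose[OF parts(2) linear_imult, unfolded o_def])
    moreover have "complexify_upto (Suc k) m (w(j := imult y)) v = imult (complexify_upto (Suc k) m (w(j := y)) v)"
      unfolding expand fst_imult snd_imult linear_neg[OF linear_k] linear_add[OF linear_imult] imult_imult by simp
    ultimately show ?thesis by blast
  next
    case False
    then have j: "j < k" "k \<le> n" using Suc.prems by auto
    have IH: "linear (\<lambda>x. complexify_upto k m (w(j := x)) u)" "complexify_upto k m (w(j := imult y)) u = imult (complexify_upto k m (w(j := y)) u)" for u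
      using Suc.IH[OF j] by blast+
    have expand: "complexify_upto (Suc k) m (w(j := x)) v =
        complexify_upto k m (w(j := x)) (v(k := fst (w k))) + imult (complexify_upto k m (w(j := x)) (v(k := snd (w k))))" for x
      unfolding complexify_upto.simps using False by (simp only: fun_upd_other not_sym[of j k] simp_thms)
    have "linear (\<lambda>x. complexify_upto (Suc k) m (w(j := x)) v)"
      unfolding expand by (intro linear_compose_add IH(1) linear_compose[OF IH(1) linear_imult, unfolded o_def])
    moreover have "complexify_upto (Suc k) m (w(j := imult y)) v = imult (complexify_upto (Suc k) m (w(j := y)) v)"
      unfolding expand IH(2) linear_add[OF linear_imult] ..
    ultimately show ?thesis by blast
  qed
qed simp

lemma norm_complexify_upto_le:
  assumes m: "multilinear_bounded n C m" and C: "0 \<le> C"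
  shows "norm (complexify_upto k m w v) \<le> 2 ^ k * C * (\<Prod>i<n. if i < k then norm (w i) else norm (v i))"
proof (induction k arbitrary: v)
  case 0 then show ?case using multilinear_boundedD(3)[OF m, of v] by (simp add: norm_Pair)
next
  case (Suc k)
  let ?P = "\<Prod>i<n. if i < Suc k then norm (w i) else norm (v i)"
  have slot: "norm (complexify_upto k m w (v(k := a))) \<le> 2 ^ k * C * ?P" if a: "norm a \<le> norm (w k)" for a
  proof -
    have "norm (complexify_upto k m w (v(k := a))) \<le> 2 ^ k * C * (\<Prod>i<n. if i < k then norm (w i) else norm ((v(k := a)) i))"
      by (rule Suc.IH)
    also have "\<dots> \<le> 2 ^ k * C * ?P"
      using C a by (intro mult_left_mono prod_mono) (auto simp: less_Suc_eq)
    finally show ?thesis .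
  qed
  have "norm (fst (w k)) \<le> norm (w k)" "norm (snd (w k)) \<le> norm (w k)"
    by (cases "w k", simp add: norm_fst_le norm_snd_le)+
  from slot[OF this(1)] slot[OF this(2)] show ?case
    unfolding complexify_upto.simps
    using norm_triangle_ineq[of "complexify_upto k m w (v(k := fst (w k)))" "imult (complexify_upto k m w (v(k := snd (w k))))"]
    by (simp add: norm_imult)
qed

lemma complexify_upto_real:
  assumes m: "multilinear_bounded n C m"
  shows "k \<le> n \<Longrightarrow> complexify_upto k m (\<lambda>i. (u i, 0)) v = (m (\<lambda>i. if i < k then u i else v i), 0)"
proof (induction k arbitrary: v)
  case (Suc k)
  have upd: "m (\<lambda>i. if i < k then u i else (v(k := a)) i) = m ((\<lambda>i. if i < Suc k then u i else v i)(k := a))" for a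
    by (rule arg_cong[where f = m]) auto
  have "m ((\<lambda>i. if i < Suc k then u i else v i)(k := 0)) = 0"
    using linear_0[OF multilinear_boundedD(2)[OF m, of k]] Suc.prems by simp
  moreover have "(\<lambda>i. if i < Suc k then u i else v i)(k := u k) = (\<lambda>i. if i < Suc k then u i else v i)" by auto
  ultimately show ?case using Suc by (simp only: complexify_upto.simps upd fst_conv snd_conv Suc_leD) (simp add: imult_def)
qed simp

definition complexification :: "nat \<Rightarrow> ((nat \<Rightarrow> 'a::real_normed_vector) \<Rightarrow> 'b::real_normed_vector) \<Rightarrow> (nat \<Rightarrow> 'a \<times> 'a) \<Rightarrow> 'b \<times> 'b" where
  "complexification n m w = complexify_upto n m w (\<lambda>_. 0)"

lemma multilinear_bounded_complexification:
  assumes m: "multilinear_bounded n C m" and C: "0 \<le> C"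
  shows "multilinear_bounded n (2 ^ n * C) (complexification n m)"
  unfolding multilinear_bounded_def
proof (intro conjI allI impI)
  show "complexification n m v = complexification n m w" if "\<forall>i<n. v i = w i" for v w
    unfolding complexification_def by (rule complexify_upto_cong[OF m]) (use that in auto)
  show "linear (\<lambda>x. complexification n m (v(i := x)))" if "i < n" for v i
    unfolding complexification_def using complexify_upto_slot[OF m that] by blast
  fix w
  have "norm (complexification n m w) \<le> 2 ^ n * C * (\<Prod>i<n. if i < n then norm (w i) else norm (0::'a))"
    unfolding complexification_def by (rule norm_complexify_upto_le[OF m C])
  also have "(\<Prod>i<n. if i < n then norm (w i) else norm (0::'a)) = (\<Prod>i<n. norm (w i))" by (intro prod.cong) auto
  finally show "norm (complexification n m w) \<le> 2 ^ n * C * (\<Prod>i<n. norm (w i))" .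
qed

context multilinear_series
begin

lemma multilinear_series_complexification: "multilinear_series (\<lambda>n. complexification n (m n)) (r / 2) K"
proof
  show "multilinear_bounded n (K / (r / 2) ^ n) (complexification n (m n))" for n
    using multilinear_bounded_complexification[OF bounded coefficient_nonneg, of n] by (simp add: power_divide mult.commute)
qed (use r K in auto)

lemma complexification_one: "complexification 1 (m 1) (\<lambda>_. h) = (m 1 (\<lambda>_. fst h), m 1 (\<lambda>_. snd h))"
proof -
  have "m (Suc 0) ((\<lambda>_. 0)(0 := a)) = m (Suc 0) (\<lambda>_. a)" for a by (rule multilinear_boundedD(1)[OF bounded]) simp
  then show ?thesis by (simp add: complexification_def imult_def)
qed

lemma series_sum_complexification_real:
  assumes "norm h < r / 2"
  shows "series_sum (\<lambda>n. complexification n (m n)) (h, 0) = (series_sum m h, 0)"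
proof -
  interpret X: multilinear_series "\<lambda>n. complexification n (m n)" "r / 2" K by (rule multilinear_series_complexification)
  have "complexification n (m n) (\<lambda>_. (h, 0)) = (m n (\<lambda>_. h), 0)" for n
  proof -
    have "m n (\<lambda>i. if i < n then h else 0) = m n (\<lambda>_. h)" by (rule multilinear_boundedD(1)[OF bounded]) simp
    then show ?thesis using complexify_upto_real[OF bounded order_refl, of n "\<lambda>_. h" "\<lambda>_. 0"] by (simp add: complexification_def)
  qed
  moreover have "(\<lambda>n. (m n (\<lambda>_. h), 0::'b)) sums (series_sum m h, 0)"
    by (rule bounded_linear.sums[OF bounded_linear_Pair[OF bounded_linear_ident bounded_linear_zero] sums_series_sum])
      (use assms r in simp)
  ultimately show ?thesis using X.sums_series_sum[of "(h, 0)"] assms by (simp add: norm_Pair sums_unique2)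
qed

lemma series_derivative_complexification_imult:
  assumes "norm x < r / 8"
  shows "series_derivative (\<lambda>n. complexification n (m n)) x (imult h) = imult (series_derivative (\<lambda>n. complexification n (m n)) x h)"
proof -
  interpret X: multilinear_series "\<lambda>n. complexification n (m n)" "r / 2" K by (rule multilinear_series_complexification)
  have "diag_derivative n (complexification n (m n)) x (imult h) = imult (diag_derivative n (complexification n (m n)) x h)" for n
    unfolding diag_derivative_def linear_sum[OF linear_imult] complexification_def
    by (intro sum.cong refl) (use complexify_upto_slot[OF bounded] in auto)
  moreover have "(\<lambda>n. imult (diag_derivative n (complexification n (m n)) x h)) sums imult (series_derivative (\<lambda>n. complexification n (m n)) x h)"
    using assms by (intro bounded_linear.sums[OF bounded_linear_imult X.sums_series_derivative]) simp
  ultimately show ?thesis using X.sums_series_derivative[of x "imult h"] assms by (simp add: sums_unique2)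
qed

end

subsection \<open>Local inverses of maps close to the identity\<close>

lemma bij_if_near_identity:
  fixes T :: "'a::banach \<Rightarrow> 'a"
  assumes T: "bounded_linear T" and near: "\<And>h. norm (T h - h) \<le> norm h / 2"
  shows "bij T"
proof -
  interpret T: bounded_linear T by (rule T)
  have "inj T"
  proof (rule linear_injective_0[OF T.linear, THEN iffD2], intro allI impI)
    fix h assume "T h = 0"
    then show "h = 0" using near[of h] by simp
  qed
  moreover have "y \<in> range T" for y
  proof -
    have "\<exists>!h. y - (T h - h) = h"
    proof (rule banach_fix_type[of "1/2"])
      show "\<forall>x z. dist (y - (T x - x)) (y - (T z - z)) \<le> 1/2 * dist x z"
      proof (intro allI)
        fix x z
        have "(y - (T x - x)) - (y - (T z - z)) = - (T (x - z) - (x - z))" by (simp add: T.diff)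
        then show "dist (y - (T x - x)) (y - (T z - z)) \<le> 1/2 * dist x z"
          unfolding dist_norm using near[of "x - z"] by (simp only: norm_minus_cancel)
      qed
    qed auto
    then obtain h where h: "y - (T h - h) = h" by blast
    then have "y = T h" by (simp add: algebra_simps)
    then show ?thesis by simp
  qed
  ultimately show ?thesis unfolding bij_def by blast
qed

locale near_identity =
  fixes G :: "'a::banach \<Rightarrow> 'a" and D :: "'a \<Rightarrow> 'a \<Rightarrow> 'a" and \<rho> :: real
  assumes \<rho>: "0 < \<rho>" and derivative: "norm x < \<rho> \<Longrightarrow> (G has_derivative D x) (at x)"
    and near: "norm x < \<rho> \<Longrightarrow> norm (D x h - h) \<le> norm h / 2" and G_zero: "G 0 = 0"
begin

definition local_inverse :: "'a \<Rightarrow> 'a" where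
  "local_inverse y = (SOME x. norm x < \<rho> \<and> G x = y)"

lemma contraction:
  assumes "norm x < \<rho>" "norm y < \<rho>"
  shows "norm ((G x - x) - (G y - y)) \<le> norm (x - y) / 2"
proof -
  have "norm ((G x - x) - (G y - y)) \<le> 1 / 2 * norm (x - y)"
  proof (rule differentiable_bound[of "ball 0 \<rho>" "\<lambda>x. G x - x" "\<lambda>x h. D x h - h"])
    fix z :: 'a assume "z \<in> ball 0 \<rho>"
    then have z: "norm z < \<rho>" by simp
    show "((\<lambda>x. G x - x) has_derivative (\<lambda>h. D z h - h)) (at z within ball 0 \<rho>)"
      by (intro has_derivative_diff has_derivative_at_withinI[OF derivative[OF z]] has_derivative_ident)
    show "onorm (\<lambda>h. D z h - h) \<le> 1 / 2" by (rule onorm_bound) (use near[OF z] in auto)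
  qed (use assms in auto)
  then show ?thesis by simp
qed

lemma inj_near_zero: "norm x < \<rho> \<Longrightarrow> norm y < \<rho> \<Longrightarrow> G x = G y \<Longrightarrow> x = y"
  using contraction[of x y] by (simp add: norm_minus_commute)

lemma exists_preimage_in_closed:
  assumes y: "norm y < \<rho> / 4" and S: "closed S" "0 \<in> S" "\<And>w. w \<in> S \<Longrightarrow> norm w < \<rho> \<Longrightarrow> y - (G w - w) \<in> S"
  shows "\<exists>x\<in>S. norm x < \<rho> \<and> G x = y"
proof -
  let ?B = "S \<inter> cball 0 (\<rho> / 2)"
  have small: "norm w < \<rho>" if "w \<in> ?B" for w using that \<rho> by simp
  have "\<exists>!x\<in>?B. y - (G x - x) = x"
  proof (rule Banach_fix[where c = "1/2"])
    show "complete ?B" unfolding complete_eq_closed using S(1) by (intro closed_Int) auto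
    show "?B \<noteq> {}" using S(2) \<rho> by auto
    show "(\<lambda>x. y - (G x - x)) ` ?B \<subseteq> ?B"
    proof (rule image_subsetI)
      fix w assume w: "w \<in> ?B"
      have "norm (G w - w) \<le> norm w / 2" using contraction[OF small[OF w], of 0] G_zero \<rho> by simp
      moreover have "norm w \<le> \<rho> / 2" using w by simp
      ultimately have "norm (y - (G w - w)) \<le> \<rho> / 2" using norm_triangle_ineq4[of y "G w - w"] y by linarith
      then show "y - (G w - w) \<in> ?B" using S(3)[of w] w small by simp
    qed
    fix x z assume xz: "x \<in> ?B" "z \<in> ?B"
    have flip: "(y - (G x - x)) - (y - (G z - z)) = - ((G x - x) - (G z - z))" by simp
    show "dist (y - (G x - x)) (y - (G z - z)) \<le> 1/2 * dist x z"
      unfolding dist_norm flip norm_minus_cancel using contraction[OF small[OF xz(1)] small[OF xz(2)]] by simp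
  qed auto
  then obtain x where x: "x \<in> ?B" "y - (G x - x) = x" by (metis (no_types, lifting))
  then have "G x = y" by (simp add: algebra_simps)
  then show ?thesis using x(1) small[OF x(1)] by blast
qed

lemma local_inverse:
  assumes "norm y < \<rho> / 4"
  shows "norm (local_inverse y) < \<rho>" "G (local_inverse y) = y"
proof -
  have "\<exists>x. norm x < \<rho> \<and> G x = y" using exists_preimage_in_closed[OF assms, of UNIV] by auto
  then have "norm (local_inverse y) < \<rho> \<and> G (local_inverse y) = y" unfolding local_inverse_def by (rule someI_ex)
  then show "norm (local_inverse y) < \<rho>" "G (local_inverse y) = y" by blast+
qed

lemma local_inverse_eq: "norm x < \<rho> \<Longrightarrow> norm (G x) < \<rho> / 4 \<Longrightarrow> local_inverse (G x) = x"
  using inj_near_zero local_inverse by blast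

lemma local_inverse_in_closed:
  assumes "norm y < \<rho> / 4" "closed S" "0 \<in> S" "\<And>w. w \<in> S \<Longrightarrow> norm w < \<rho> \<Longrightarrow> y - (G w - w) \<in> S"
  shows "local_inverse y \<in> S"
proof -
  obtain x where "x \<in> S" "norm x < \<rho>" "G x = y" using exists_preimage_in_closed[OF assms] by blast
  then show ?thesis using local_inverse_eq[of x] assms(1) by simp
qed

lemma local_inverse_Lipschitz:
  assumes "norm y < \<rho> / 4" "norm z < \<rho> / 4"
  shows "norm (local_inverse y - local_inverse z) \<le> 2 * norm (y - z)"
proof -
  define a where "a = (y - local_inverse y) - (z - local_inverse z)"
  have "norm a \<le> norm (local_inverse y - local_inverse z) / 2"
    unfolding a_def using contraction[of "local_inverse y" "local_inverse z"] local_inverse[OF assms(1)] local_inverse[OF assms(2)] by simp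
  moreover have "norm ((y - z) - a) \<le> norm (y - z) + norm a" by (rule norm_triangle_ineq4)
  moreover have "(y - z) - a = local_inverse y - local_inverse z" by (simp add: a_def)
  ultimately show ?thesis by simp
qed

lemma isCont_local_inverse:
  assumes y: "norm y < \<rho> / 4"
  shows "isCont local_inverse y"
  unfolding continuous_at_eps_delta
proof (intro allI impI)
  fix e :: real assume e: "0 < e"
  define d where "d = min (e / 2) (\<rho> / 4 - norm y)"
  have "dist (local_inverse z) (local_inverse y) < e" if z: "dist z y < d" for z
  proof -
    have "norm z < \<rho> / 4" using z norm_triangle_ineq2[of z y] by (simp add: d_def dist_norm)
    then show ?thesis using local_inverse_Lipschitz[of z y] y z by (simp add: d_def dist_norm)
  qed
  moreover have "0 < d" using e y by (simp add: d_def)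
  ultimately show "\<exists>d>0. \<forall>z. dist z y < d \<longrightarrow> dist (local_inverse z) (local_inverse y) < e" by blast
qed

lemma bij_derivative:
  assumes "norm x < \<rho>"
  shows "bij (D x)"
  using bij_if_near_identity[OF has_derivative_bounded_linear[OF derivative[OF assms]]] near[OF assms] by blast

lemma has_derivative_local_inverse:
  assumes y: "norm y < \<rho> / 4"
  shows "(local_inverse has_derivative inv_into UNIV (D (local_inverse y))) (at y)"
proof -
  note x = local_inverse(1)[OF y]
  have linear: "bounded_linear (D (local_inverse y))" using derivative[OF x] by (rule has_derivative_bounded_linear)
  show ?thesis
  proof (rule has_derivative_inverse_basic[OF derivative[OF x] bounded_inverse[OF linear bij_derivative[OF x]] _ isCont_local_inverse[OF y] open_ball])
    show "inv_into UNIV (D (local_inverse y)) \<circ> D (local_inverse y) = id" using bij_derivative[OF x] by (simp add: bij_is_inj)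
    show "y \<in> ball 0 (\<rho> / 4)" using y by simp
    show "G (local_inverse z) = z" if "z \<in> ball 0 (\<rho> / 4)" for z using local_inverse(2)[of z] that by simp
  qed
qed

end

section \<open>Zero sets of analytic maps with finite rank defect\<close>

subsection \<open>Holomorphic coordinates in a complexified space\<close>

lemma complex_linear_imp_field_differentiable:
  assumes f: "(f has_derivative P) (at s)" and P: "\<And>t. P (\<i> * t) = \<i> * P t"
  shows "f field_differentiable (at s)"
proof -
  have linear: "linear P" using f by (rule has_derivative_linear)
  have "P t = P 1 * t" for t
  proof -
    have "t = Re t *\<^sub>R 1 + Im t *\<^sub>R (\<i> * 1)" by (simp add: complex_eq_iff)
    then have "P t = Re t *\<^sub>R P 1 + Im t *\<^sub>R P (\<i> * 1)" by (metis linear_add[OF linear] linear_scale[OF linear])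
    also have "P (\<i> * 1) = \<i> * P 1" by (rule P)
    also have "Re t *\<^sub>R P 1 + Im t *\<^sub>R (\<i> * P 1) = P 1 * t" by (simp add: complex_eq_iff algebra_simps)
    finally show ?thesis .
  qed
  then have "P = (*) (P 1)" by (rule ext)
  then show ?thesis using f unfolding field_differentiable_def has_field_derivative_def by metis
qed

definition complex_functional :: "('a \<Rightarrow> real) \<Rightarrow> 'a \<times> 'a \<Rightarrow> complex" where
  "complex_functional c w = complex_of_real (c (fst w)) + \<i> * complex_of_real (c (snd w))"

definition complex_combination :: "nat \<Rightarrow> (nat \<Rightarrow> 'a::real_normed_vector) \<Rightarrow> (nat \<Rightarrow> complex) \<Rightarrow> 'a \<times> 'a" where
  "complex_combination k e x = (\<Sum>i<k. (Re (x i) *\<^sub>R e i, Im (x i) *\<^sub>R e i))"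

lemma bounded_linear_complex_functional:
  assumes "bounded_linear c"
  shows "bounded_linear (complex_functional c)"
  unfolding complex_functional_def[abs_def]
  by (rule bounded_linear_add[OF bounded_linear_compose[OF bounded_linear_of_real bounded_linear_compose[OF assms bounded_linear_fst]]
      bounded_linear_compose[OF bounded_linear_mult_right
        bounded_linear_compose[OF bounded_linear_of_real bounded_linear_compose[OF assms bounded_linear_snd]]]])

lemma complex_functional_imult: "bounded_linear c \<Longrightarrow> complex_functional c (imult w) = \<i> * complex_functional c w"
  using linear_neg[of c] by (simp add: complex_functional_def imult_def bounded_linear.linear algebra_simps)

lemma complex_combination_imult: "complex_combination k e (\<lambda>i. \<i> * x i) = imult (complex_combination k e x)"
  unfolding complex_combination_def linear_sum[OF linear_imult] by (intro sum.cong) (auto simp: imult_def algebra_simps)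

lemma continuous_on_complex_combination: "continuous_on A (complex_combination k e)"
  unfolding complex_combination_def[abs_def]
  by (intro continuous_intros continuous_on_subset[OF continuous_on_product_coordinates]) auto

lemma has_derivative_complex_combination:
  fixes e :: "nat \<Rightarrow> 'a::real_normed_vector"
  assumes "\<And>i. ((\<lambda>s. \<psi> s i) has_derivative (\<lambda>t. d i * t)) (at s)"
  shows "((\<lambda>s. complex_combination k e (\<psi> s)) has_derivative (\<lambda>t. complex_combination k e (\<lambda>i. d i * t))) (at s)"
proof -
  have "bounded_linear (\<lambda>z. (Re z *\<^sub>R u, Im z *\<^sub>R u))" for u :: 'a
    by (intro bounded_linear_Pair bounded_linear_scaleR_const bounded_linear_Re bounded_linear_Im)
  from bounded_linear.has_derivative[OF this assms] show ?thesis
    unfolding complex_combination_def by (intro has_derivative_sum)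
qed

lemma norm_complex_combination_le:
  assumes "x \<in> polydisc k \<delta>"
  shows "norm (complex_combination k e x) \<le> 2 * \<delta> * (\<Sum>i<k. norm (e i))"
proof -
  have "norm (complex_combination k e x) \<le> (\<Sum>i<k. 2 * \<delta> * norm (e i))" unfolding complex_combination_def
  proof (rule sum_norm_le)
    fix i assume "i \<in> {..<k}"
    then have x: "cmod (x i) < \<delta>" using assms by (simp add: polydisc_def)
    have "norm (Re (x i) *\<^sub>R e i, Im (x i) *\<^sub>R e i) \<le> norm (Re (x i) *\<^sub>R e i) + norm (Im (x i) *\<^sub>R e i)"
      by (rule norm_Pair_le)
    also have "\<dots> \<le> \<delta> * norm (e i) + \<delta> * norm (e i)" unfolding norm_scaleR
      using x abs_Re_le_cmod[of "x i"] abs_Im_le_cmod[of "x i"] by (intro add_mono mult_right_mono) auto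
    finally show "norm (Re (x i) *\<^sub>R e i, Im (x i) *\<^sub>R e i) \<le> 2 * \<delta> * norm (e i)" by simp
  qed
  then show ?thesis by (simp add: sum_distrib_left)
qed

lemma complex_combination_real:
  assumes "real_point x"
  shows "complex_combination k e x = (\<Sum>i<k. Re (x i) *\<^sub>R e i, 0)"
proof -
  have "Im (x i) = 0" for i using assms by (simp add: real_point_def complex_is_Real_iff)
  then show ?thesis unfolding complex_combination_def by (simp add: prod_eq_iff fst_sum snd_sum)
qed

lemma curve_holomorphic_chart:
  fixes \<Theta> :: "'a::real_normed_vector \<times> 'a \<Rightarrow> 'a \<times> 'a"
  assumes \<Theta>: "\<And>y. norm y < \<sigma> \<Longrightarrow> (\<Theta> has_derivative E y) (at y)" "\<And>y h. norm y < \<sigma> \<Longrightarrow> E y (imult h) = imult (E y h)"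
    and small: "\<And>x. x \<in> polydisc k \<delta> \<Longrightarrow> norm (complex_combination k e x) < \<sigma>" and c: "bounded_linear c"
  shows "curve_holomorphic k \<delta> (\<lambda>x. complex_functional c (\<Theta> (complex_combination k e x)))"
proof (rule curve_holomorphicI)
  have "continuous_on (ball 0 \<sigma>) \<Theta>"
    by (rule continuous_at_imp_continuous_on) (use has_derivative_continuous[OF \<Theta>(1)] in auto)
  then have "continuous_on (polydisc k \<delta>) (\<lambda>x. \<Theta> (complex_combination k e x))"
    by (rule continuous_on_compose2[OF _ continuous_on_complex_combination]) (use small in auto)
  then show "continuous_on (polydisc k \<delta>) (\<lambda>x. complex_functional c (\<Theta> (complex_combination k e x)))"
    by (rule bounded_linear.continuous_on[OF bounded_linear_complex_functional[OF c]])
next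
  fix S and \<psi> :: "complex \<Rightarrow> nat \<Rightarrow> complex"
  assume S: "open S" and \<psi>: "\<And>i. (\<lambda>s. \<psi> s i) holomorphic_on S" and sub: "\<psi> ` S \<subseteq> polydisc k \<delta>"
  have "(\<lambda>s. complex_functional c (\<Theta> (complex_combination k e (\<psi> s)))) field_differentiable (at s)" if s: "s \<in> S" for s
  proof -
    define d where "d i = deriv (\<lambda>s. \<psi> s i) s" for i
    define P where "P t = complex_combination k e (\<lambda>i. d i * t)" for t
    have "((\<lambda>s. \<psi> s i) has_derivative (\<lambda>t. d i * t)) (at s)" for i
      using holomorphic_derivI[OF \<psi> S s] unfolding d_def has_field_derivative_def .
    then have inner: "((\<lambda>s. complex_combination k e (\<psi> s)) has_derivative P) (at s)"
      unfolding P_def[abs_def] by (rule has_derivative_complex_combination)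
    have P: "P (\<i> * t) = imult (P t)" for t
      using complex_combination_imult[of k e "\<lambda>i. d i * t"] by (simp add: P_def mult.left_commute)
    have n: "norm (complex_combination k e (\<psi> s)) < \<sigma>" using small sub s by blast
    have "((\<lambda>s. complex_functional c (\<Theta> (complex_combination k e (\<psi> s)))) has_derivative
        (\<lambda>t. complex_functional c (E (complex_combination k e (\<psi> s)) (P t)))) (at s)"
      by (rule bounded_linear.has_derivative[OF bounded_linear_complex_functional[OF c] has_derivative_compose[OF inner \<Theta>(1)[OF n]]])
    then show ?thesis
      by (rule complex_linear_imp_field_differentiable) (simp only: P \<Theta>(2)[OF n] complex_functional_imult[OF c])
  qed
  then show "(\<lambda>s. complex_functional c (\<Theta> (complex_combination k e (\<psi> s)))) holomorphic_on S"
    using S by (auto simp: holomorphic_on_def field_differentiable_at_within)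
qed

subsection \<open>Lyapunov--Schmidt reduction\<close>

text \<open>The series plus the finite rank map is locally invertible, so that a zero of the series is determined by the values
  of the functionals \<open>c i\<close>, which solve a finite system of analytic equations.\<close>

locale finite_rank_defect = multilinear_series m r K for m :: "nat \<Rightarrow> (nat \<Rightarrow> 'a::banach) \<Rightarrow> 'a" and r K +
  fixes k :: nat and c :: "nat \<Rightarrow> 'a \<Rightarrow> real" and e :: "nat \<Rightarrow> 'a"
  assumes c: "i < k \<Longrightarrow> bounded_linear (c i)" and linear_part: "m 1 (\<lambda>_. h) = h - (\<Sum>i<k. c i h *\<^sub>R e i)"
    and zero: "series_sum m 0 = 0"
begin

definition rank_part :: "'a \<Rightarrow> 'a" where
  "rank_part h = (\<Sum>i<k. c i h *\<^sub>R e i)"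

definition corrected :: "nat \<Rightarrow> (nat \<Rightarrow> 'a) \<Rightarrow> 'a" where
  "corrected n = (if n = 1 then (\<lambda>v. v 0) else m n)"

definition corrected_map :: "'a \<times> 'a \<Rightarrow> 'a \<times> 'a" where
  "corrected_map = series_sum (\<lambda>n. complexification n (corrected n))"

definition corrected_derivative :: "'a \<times> 'a \<Rightarrow> 'a \<times> 'a \<Rightarrow> 'a \<times> 'a" where
  "corrected_derivative = series_derivative (\<lambda>n. complexification n (corrected n))"

lemma c_zero: "i < k \<Longrightarrow> c i 0 = 0"
  using c by (simp add: linear_0 bounded_linear.linear)

lemma corrected_series: "multilinear_series corrected r (max K r)"
proof
  fix n
  show "multilinear_bounded n (max K r / r ^ n) (corrected n)"
  proof (cases "n = 1")
    case True
    have "multilinear_bounded 1 1 (\<lambda>v :: nat \<Rightarrow> 'a. v 0)" by (simp add: multilinear_bounded_def linear_iff)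
    then have "multilinear_bounded 1 (max K r / r) (\<lambda>v :: nat \<Rightarrow> 'a. v 0)"
      by (rule multilinear_bounded_mono) (use r in \<open>simp add: le_divide_eq\<close>)
    then show ?thesis using True by (simp add: corrected_def)
  next
    case False
    then show ?thesis using multilinear_bounded_mono[OF bounded, of n "max K r / r ^ n"] r
      by (simp add: corrected_def divide_right_mono)
  qed
qed (use r K in auto)

lemma series_sum_corrected:
  assumes "norm h < r"
  shows "series_sum corrected h = series_sum m h + rank_part h"
proof -
  interpret C: multilinear_series corrected r "max K r" by (rule corrected_series)
  have "(\<lambda>n. if n = 1 then rank_part h else 0) sums rank_part h" using sums_single[of 1 "\<lambda>_. rank_part h"] by simp
  from sums_add[OF sums_series_sum[OF assms] this]
  have "(\<lambda>n. m n (\<lambda>_. h) + (if n = 1 then rank_part h else 0)) sums (series_sum m h + rank_part h)" .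
  moreover have "(\<lambda>n. m n (\<lambda>_. h) + (if n = 1 then rank_part h else 0)) = (\<lambda>n. corrected n (\<lambda>_. h))"
    using linear_part[of h] by (auto simp: corrected_def rank_part_def fun_eq_iff)
  ultimately show ?thesis using sums_unique2[OF C.sums_series_sum[OF assms]] by simp
qed

lemma corrected_map_real: "norm h < r / 2 \<Longrightarrow> corrected_map (h, 0) = (series_sum m h + rank_part h, 0)"
  using multilinear_series.series_sum_complexification_real[OF corrected_series, of h] series_sum_corrected[of h] r
  by (simp add: corrected_map_def)

lemma corrected_derivative_imult:
  "norm x < r / 8 \<Longrightarrow> corrected_derivative x (imult h) = imult (corrected_derivative x h)"
  unfolding corrected_derivative_def by (rule multilinear_series.series_derivative_complexification_imult[OF corrected_series])

lemma exists_near_identity: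
  assumes "0 < \<epsilon>"
  obtains \<rho> where "0 < \<rho>" "\<rho> \<le> \<epsilon>" "\<rho> \<le> r / 8" "near_identity corrected_map corrected_derivative \<rho>"
proof -
  interpret C: multilinear_series corrected r "max K r" by (rule corrected_series)
  interpret X: multilinear_series "\<lambda>n. complexification n (corrected n)" "r / 2" "max K r"
    by (rule C.multilinear_series_complexification)
  have one: "complexification 1 (corrected 1) (\<lambda>_. h) = h" for h
    unfolding C.complexification_one by (simp add: corrected_def)
  obtain M where M: "0 \<le> M" "\<forall>x h. norm x < r / 2 / 4 \<longrightarrow> norm (corrected_derivative x h - h) \<le> M * norm x * norm h"
    using X.series_derivative_near_linear_part unfolding one corrected_derivative_def by blast
  define \<rho> where "\<rho> = min (min (r / 8) \<epsilon>) (1 / (2 * (M + 1)))"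
  have \<rho>: "0 < \<rho>" "\<rho> \<le> \<epsilon>" "\<rho> \<le> r / 8" "\<rho> \<le> 1 / (2 * (M + 1))" using r assms M(1) by (auto simp: \<rho>_def)
  have "near_identity corrected_map corrected_derivative \<rho>"
  proof
    fix x :: "'a \<times> 'a" assume x: "norm x < \<rho>"
    then have small: "norm x < r / 2 / 4" using \<rho>(3) by simp
    show "(corrected_map has_derivative corrected_derivative x) (at x)"
      unfolding corrected_map_def corrected_derivative_def by (rule X.has_derivative_series_sum[OF small])
    fix h :: "'a \<times> 'a"
    have "M * norm x \<le> (M + 1) * (1 / (2 * (M + 1)))" using x \<rho>(4) M(1) by (intro mult_mono) auto
    also have "\<dots> = 1 / 2" using M(1) by (simp add: field_simps)
    finally have "M * norm x * norm h \<le> 1 / 2 * norm h" by (intro mult_right_mono) auto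
    then show "norm (corrected_derivative x h - h) \<le> norm h / 2" using M(2)[rule_format, OF small, of h] by linarith
  next
    show "corrected_map 0 = 0" using corrected_map_real[of 0] r zero c_zero by (simp add: rank_part_def zero_prod_def)
  qed (rule \<rho>(1))
  then show thesis using that \<rho>(1-3) by blast
qed

end

locale finite_rank_chart = finite_rank_defect +
  fixes \<rho> :: real
  assumes near_identity: "near_identity corrected_map corrected_derivative \<rho>" and \<rho>_le: "\<rho> \<le> r / 8"
begin

sublocale near_identity corrected_map corrected_derivative \<rho>
  by (rule near_identity)

definition chart :: "(nat \<Rightarrow> complex) \<Rightarrow> 'a" where
  "chart x = fst (local_inverse (complex_combination k e x))"

definition coordinates :: "'a \<Rightarrow> nat \<Rightarrow> complex" where
  "coordinates \<xi> i = (if i < k then complex_of_real (c i \<xi>) else 0)"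

definition radius :: real where
  "radius = \<rho> / (8 * ((\<Sum>i<k. norm (e i)) + 1))"

definition equation :: "nat \<Rightarrow> (nat \<Rightarrow> complex) \<Rightarrow> complex" where
  "equation i x = complex_functional (c i) (local_inverse (complex_combination k e x)) - x i"

definition reduced_zeros :: "(nat \<Rightarrow> complex) set" where
  "reduced_zeros = {x \<in> polydisc k radius. real_point x \<and> (\<forall>h\<in>equation ` {..<k}. h x = 0)}"

lemma radius_pos: "0 < radius"
proof -
  have "0 < (\<Sum>i<k. norm (e i)) + 1" by (intro add_nonneg_pos sum_nonneg) auto
  then show ?thesis using \<rho> by (simp add: radius_def)
qed

lemma norm_combination_less:
  assumes "x \<in> polydisc k radius"
  shows "norm (complex_combination k e x) < \<rho> / 4"
proof -
  have pos: "0 < (\<Sum>i<k. norm (e i)) + 1" by (intro add_nonneg_pos sum_nonneg) auto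
  have "norm (complex_combination k e x) \<le> 2 * radius * (\<Sum>i<k. norm (e i))" by (rule norm_complex_combination_le[OF assms])
  also have "\<dots> < 2 * radius * ((\<Sum>i<k. norm (e i)) + 1)" using radius_pos by simp
  also have "\<dots> = \<rho> / 4" using pos by (simp add: radius_def field_simps)
  finally show ?thesis .
qed

lemma local_inverse_real:
  assumes "norm (y, 0::'a) < \<rho> / 4"
  shows "snd (local_inverse (y, 0)) = 0"
proof -
  have "local_inverse (y, 0) \<in> {w. snd w = 0}"
  proof (rule local_inverse_in_closed[OF assms])
    show "closed {w :: 'a \<times> 'a. snd w = 0}" by (intro closed_Collect_eq continuous_intros)
    fix w :: "'a \<times> 'a" assume w: "w \<in> {w. snd w = 0}" "norm w < \<rho>"
    then have real: "w = (fst w, 0)" by (simp add: prod_eq_iff)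
    have "norm (fst w) < r / 2" using norm_fst_le[of "fst w" "snd w"] w(2) \<rho>_le r by simp
    from corrected_map_real[OF this] real have "snd (corrected_map w) = 0" by (metis snd_conv)
    then show "(y, 0) - (corrected_map w - w) \<in> {w. snd w = 0}" using w(1) by simp
  qed simp
  then show ?thesis by simp
qed

lemma curve_holomorphic_equation:
  assumes i: "i < k"
  shows "curve_holomorphic k radius (equation i)"
proof -
  have "curve_holomorphic k radius (\<lambda>x. complex_functional (c i) (local_inverse (complex_combination k e x)))"
  proof (rule curve_holomorphic_chart[OF has_derivative_local_inverse _ norm_combination_less c[OF i]])
    fix y h :: "'a \<times> 'a" assume y: "norm y < \<rho> / 4"
    define D where "D = corrected_derivative (local_inverse y)"
    have bij: "bij D" unfolding D_def by (rule bij_derivative[OF local_inverse(1)[OF y]])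
    have "D (imult (inv_into UNIV D h)) = imult (D (inv_into UNIV D h))"
      unfolding D_def by (rule corrected_derivative_imult) (use local_inverse(1)[OF y] \<rho>_le in simp)
    then show "inv_into UNIV D (imult h) = imult (inv_into UNIV D h)"
      using bij by (intro inv_f_eq) (simp_all add: bij_is_inj bij_is_surj surj_f_inv_f)
  qed
  moreover have "curve_holomorphic k radius (\<lambda>x. - x i)"
    using curve_holomorphic_mult[OF curve_holomorphic_const[of k radius "-1"] curve_holomorphic_coord[of k radius i]] by simp
  ultimately show ?thesis unfolding equation_def[abs_def] using curve_holomorphic_add by fastforce
qed

lemma chart_reduced_zero:
  assumes x: "x \<in> reduced_zeros"
  shows "series_sum m (chart x) = 0" "norm (chart x) < \<rho>" "coordinates (chart x) = x"
proof -
  have x': "x \<in> polydisc k radius" "real_point x" "\<And>i. i < k \<Longrightarrow> equation i x = 0" using x by (auto simp: reduced_zeros_def)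
  define y where "y = (\<Sum>i<k. Re (x i) *\<^sub>R e i)"
  have comb: "complex_combination k e x = (y, 0)" using complex_combination_real[OF x'(2)] by (simp add: y_def)
  have n: "norm (y, 0::'a) < \<rho> / 4" using norm_combination_less[OF x'(1)] by (simp add: comb)
  have inverse: "local_inverse (y, 0) = (chart x, 0)" using local_inverse_real[OF n] by (simp add: chart_def comb prod_eq_iff)
  show small: "norm (chart x) < \<rho>" using local_inverse(1)[OF n] by (simp add: inverse norm_Pair)
  have coord: "complex_of_real (c i (chart x)) = x i" if "i < k" for i
    using x'(3)[OF that] c_zero[OF that] by (simp add: equation_def comb inverse complex_functional_def)
  have "Re (x i) = c i (chart x)" if "i < k" for i using coord[OF that] by (metis Re_complex_of_real)
  then have "y = rank_part (chart x)" unfolding y_def rank_part_def by (intro sum.cong) simp_all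
  moreover have "series_sum m (chart x) + rank_part (chart x) = y"
    using corrected_map_real[of "chart x"] local_inverse(2)[OF n] small \<rho>_le r by (simp add: inverse)
  ultimately show "series_sum m (chart x) = 0" by simp
  show "coordinates (chart x) = x" using coord x'(1) by (auto simp: coordinates_def polydisc_def fun_eq_iff)
qed

lemma chart_coordinates:
  assumes \<xi>: "series_sum m \<xi> = 0" "norm \<xi> < \<rho>" and small: "coordinates \<xi> \<in> polydisc k radius"
  shows "coordinates \<xi> \<in> reduced_zeros" "chart (coordinates \<xi>) = \<xi>"
proof -
  have real: "real_point (coordinates \<xi>)" by (simp add: real_point_def coordinates_def)
  have comb: "complex_combination k e (coordinates \<xi>) = (rank_part \<xi>, 0)"
    unfolding complex_combination_real[OF real] rank_part_def by (simp add: coordinates_def)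
  have "corrected_map (\<xi>, 0) = (rank_part \<xi>, 0)" using corrected_map_real[of \<xi>] \<xi> \<rho>_le r by simp
  then have inverse: "local_inverse (complex_combination k e (coordinates \<xi>)) = (\<xi>, 0)"
    using local_inverse_eq[of "(\<xi>, 0)"] \<xi>(2) norm_combination_less[OF small] by (simp add: comb norm_Pair)
  then show "chart (coordinates \<xi>) = \<xi>" by (simp add: chart_def)
  show "coordinates \<xi> \<in> reduced_zeros"
    using small real c_zero by (auto simp: reduced_zeros_def equation_def inverse complex_functional_def coordinates_def)
qed

lemma coordinates_zero: "coordinates 0 = (\<lambda>_. 0)"
  by (auto simp: coordinates_def c_zero)

lemma zero_in_reduced_zeros: "(\<lambda>_. 0) \<in> reduced_zeros" and chart_zero: "chart (\<lambda>_. 0) = 0"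
  using chart_coordinates[OF zero] \<rho> zero_in_polydisc[OF radius_pos, of k] by (simp_all add: coordinates_zero)

lemma continuous_on_chart: "continuous_on reduced_zeros chart"
proof -
  have "continuous_on (ball 0 (\<rho> / 4)) local_inverse"
    by (rule continuous_at_imp_continuous_on) (use isCont_local_inverse in auto)
  then have "continuous_on reduced_zeros (\<lambda>x. local_inverse (complex_combination k e x))"
    by (rule continuous_on_compose2[OF _ continuous_on_complex_combination])
      (use norm_combination_less in \<open>auto simp: reduced_zeros_def\<close>)
  then show ?thesis unfolding chart_def[abs_def] by (rule continuous_on_fst)
qed

lemma arc_linked_at_zeros:
  assumes "\<rho> \<le> \<epsilon>"
  shows "arc_linked_at ({x. series_sum m x = 0} \<inter> ball 0 \<epsilon>) 0"
proof -
  have "arc_linked_at ({x. series_sum m x = 0} \<inter> ball 0 \<epsilon>) (chart (\<lambda>_. 0))"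
  proof (rule arc_linked_at_image[OF _ zero_in_reduced_zeros continuous_on_chart])
    show "arc_linked_at reduced_zeros (\<lambda>_. 0)" unfolding reduced_zeros_def
      by (rule arc_linked_at_real_zero_set) (use curve_holomorphic_equation radius_pos in auto)
    show "inj_on chart reduced_zeros" by (rule inj_on_inverseI[of _ coordinates]) (rule chart_reduced_zero(3))
    show "chart ` reduced_zeros \<subseteq> {x. series_sum m x = 0} \<inter> ball 0 \<epsilon>"
      using chart_reduced_zero(1,2) assms by fastforce
    fix M :: "(nat \<Rightarrow> complex) set" assume "open M" "(\<lambda>_. 0) \<in> M"
    then obtain \<delta> where \<delta>: "0 < \<delta>" "polydisc k \<delta> \<subseteq> M" using polydisc_subset_open by blast
    define \<eta> where "\<eta> = min \<delta> radius"
    define N where "N = ball 0 \<rho> \<inter> (\<Inter>i<k. {\<xi>. \<bar>c i \<xi>\<bar> < \<eta>})"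
    have "open {\<xi>. \<bar>c i \<xi>\<bar> < \<eta>}" if "i < k" for i
      by (intro open_Collect_less continuous_intros linear_continuous_on c that)
    then have "open N" unfolding N_def by (intro open_Int open_ball open_INT) auto
    moreover have "0 \<in> N" using \<rho> \<delta>(1) radius_pos by (simp add: N_def \<eta>_def c_zero)
    moreover have "\<xi> \<in> chart ` (reduced_zeros \<inter> M)" if \<xi>: "series_sum m \<xi> = 0" "\<xi> \<in> N" for \<xi>
    proof -
      have "coordinates \<xi> \<in> polydisc k \<eta>" using \<xi>(2) by (simp add: N_def polydisc_def coordinates_def)
      then have "coordinates \<xi> \<in> polydisc k radius" "coordinates \<xi> \<in> M"
        using polydisc_mono[of \<eta> radius k] polydisc_mono[of \<eta> \<delta> k] \<delta>(2) by (auto simp: \<eta>_def)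
      then show ?thesis using chart_coordinates[of \<xi>] \<xi> by (intro image_eqI[of _ _ "coordinates \<xi>"]) (auto simp: N_def)
    qed
    ultimately show "\<exists>N. open N \<and> chart (\<lambda>_. 0) \<in> N \<and> {x. series_sum m x = 0} \<inter> ball 0 \<epsilon> \<inter> N \<subseteq> chart ` (reduced_zeros \<inter> M)"
      unfolding chart_zero by blast
  qed
  then show ?thesis by (simp add: chart_zero)
qed

end

lemma (in finite_rank_defect) arc_linked_at_zeros:
  assumes "0 < \<epsilon>"
  shows "arc_linked_at ({x. series_sum m x = 0} \<inter> ball 0 \<epsilon>) 0"
proof -
  obtain \<rho> where \<rho>: "0 < \<rho>" "\<rho> \<le> \<epsilon>" "\<rho> \<le> r / 8" "near_identity corrected_map corrected_derivative \<rho>"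
    by (rule exists_near_identity[OF assms])
  have "finite_rank_chart m r K k c e \<rho>"
    by (intro finite_rank_chart.intro finite_rank_chart_axioms.intro finite_rank_defect_axioms \<rho>(3,4))
  then show ?thesis by (rule finite_rank_chart.arc_linked_at_zeros[OF _ \<rho>(2)])
qed

section \<open>Zero sets of analytic Fredholm maps\<close>

lemma analytic_map_at_series:
  fixes F :: "'a::real_normed_vector \<Rightarrow> 'b::banach"
  assumes "analytic_map_at F y"
  obtains m r K where "multilinear_series m r K" "\<forall>h. norm h < r \<longrightarrow> F (y + h) = series_sum m h"
proof -
  obtain m C r K where m: "\<forall>n. sym_multilinear n (C n) (m n)" and r: "0 < r" and K: "\<forall>n. C n * r ^ n \<le> K"
    and F: "\<forall>h. norm h < r \<longrightarrow> (\<lambda>n. m n (\<lambda>_. h)) sums F (y + h)"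
    using assms unfolding analytic_map_at_def by (elim exE conjE) (rule that; (assumption | blast))
  have "multilinear_series m r \<bar>K\<bar>"
  proof
    fix n
    have "C n \<le> \<bar>K\<bar> / r ^ n" using K[rule_format, of n] r by (simp add: pos_le_divide_eq)
    then show "multilinear_bounded n (\<bar>K\<bar> / r ^ n) (m n)"
      using multilinear_bounded_mono[OF sym_multilinear_imp_bounded] m by blast
  qed (use r in auto)
  moreover have "\<forall>h. norm h < r \<longrightarrow> F (y + h) = series_sum m h" using F by (simp add: series_sum_def sums_iff)
  ultimately show thesis by (rule that)
qed

lemma (in multilinear_series) has_derivative_of_expansion:
  assumes F: "\<forall>h. norm h < r \<longrightarrow> F (y + h) = series_sum m h"
  shows "(F has_derivative (\<lambda>h. m 1 (\<lambda>_. h))) (at y)"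
proof -
  have "((\<lambda>x. F (y + x)) has_derivative (\<lambda>h. m 1 (\<lambda>_. h))) (at 0)"
    by (rule has_derivative_transform_within_open[OF has_derivative_linear_part open_ball[of 0 r]]) (use r F in auto)
  moreover have "((\<lambda>z. z - y) has_derivative (\<lambda>h. h)) (at y)" by (auto intro!: derivative_eq_intros)
  ultimately show ?thesis using has_derivative_compose[of "\<lambda>z. z - y" "\<lambda>h. h" y UNIV "\<lambda>x. F (y + x)"] by simp
qed

lemma analytic_map_at_continuous:
  fixes F :: "'a::real_normed_vector \<Rightarrow> 'b::banach"
  assumes "analytic_map_at F y"
  shows "isCont F y"
proof -
  obtain m r K where "multilinear_series m r K" "\<forall>h. norm h < r \<longrightarrow> F (y + h) = series_sum m h"
    by (rule analytic_map_at_series[OF assms])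
  then show ?thesis using multilinear_series.has_derivative_of_expansion has_derivative_continuous by blast
qed

lemma Du_eq:
  assumes "(F has_derivative T) (at (l, u))"
  shows "Du F l u = (\<lambda>w. T (0, w))"
proof -
  have "((\<lambda>w. (l, w)) has_derivative (\<lambda>w. (0, w))) (at u)"
    by (intro has_derivative_Pair has_derivative_const has_derivative_ident)
  from has_derivative_compose[OF this assms] have "((\<lambda>w. F (l, w)) has_derivative (\<lambda>w. T (0, w))) (at u)" .
  then show ?thesis unfolding Du_def by (rule frechet_derivative_at[symmetric])
qed

lemma (in multilinear_series) compose_bounded_linear:
  fixes A :: "'b \<Rightarrow> 'c::banach"
  assumes A: "bounded_linear A"
  obtains L where "multilinear_series (\<lambda>n v. A (m n v)) r L"
proof -
  interpret A: bounded_linear A by (rule A)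
  obtain a where a: "0 < a" "\<And>v. norm (A v) \<le> norm v * a" using A.pos_bounded by blast
  have "multilinear_series (\<lambda>n v. A (m n v)) r (a * K)"
  proof
    fix n
    show "multilinear_bounded n (a * K / r ^ n) (\<lambda>v. A (m n v))" unfolding multilinear_bounded_def
    proof (intro conjI allI impI)
      show "A (m n v) = A (m n w)" if "\<forall>i<n. v i = w i" for v w
        using multilinear_boundedD(1)[OF bounded, of n v w] that by simp
      show "linear (\<lambda>x. A (m n (v(i := x))))" if "i < n" for v i
        using linear_compose[OF multilinear_boundedD(2)[OF bounded that] A.linear] by (simp only: o_def)
      fix v
      have "norm (A (m n v)) \<le> norm (m n v) * a" by (rule a(2))
      also have "\<dots> \<le> (K / r ^ n * (\<Prod>i<n. norm (v i))) * a"
        using a(1) multilinear_boundedD(3)[OF bounded, of n v] by (intro mult_right_mono) auto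
      finally show "norm (A (m n v)) \<le> a * K / r ^ n * (\<Prod>i<n. norm (v i))" by (simp add: mult_ac)
    qed
  qed (use r K a(1) in auto)
  then show thesis by (rule that)
qed

lemma (in multilinear_series) series_sum_compose_bounded_linear:
  assumes "bounded_linear A" "norm x < r"
  shows "series_sum (\<lambda>n v. A (m n v)) x = A (series_sum m x)"
  using bounded_linear.sums[OF assms(1) sums_series_sum[OF assms(2)]] by (simp add: series_sum_def sums_iff)

text \<open>The parameter is treated as one more coordinate, so that the corrected derivative is the identity of the
  product space up to a map of rank \<open>Suc n\<close>.\<close>

lemma finite_rank_correction_with_parameter:
  fixes T :: "real \<times> 'u::real_normed_vector \<Rightarrow> 'v::real_normed_vector" and Q :: "'v \<Rightarrow> 'u"
  assumes T: "linear T" and Q: "linear Q" and l: "\<forall>i<n. bounded_linear (l i)"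
    and QT: "\<forall>u. Q (T (0, u)) = u - (\<Sum>i<n. l i u *\<^sub>R e i)"
  obtains c :: "nat \<Rightarrow> real \<times> 'u \<Rightarrow> real" and b :: "nat \<Rightarrow> real \<times> 'u"
  where "\<forall>i<Suc n. bounded_linear (c i)" "\<forall>h. (0, Q (T h)) = h - (\<Sum>i<Suc n. c i h *\<^sub>R b i)"
proof
  define c where "c i h = (if i = 0 then fst h else l (i - 1) (snd h))" for i and h :: "real \<times> 'u"
  define b where "b i = (if i = 0 then (1::real, - Q (T (1, 0))) else (0, e (i - 1)))" for i :: nat
  have "bounded_linear (c i)" if "i < Suc n" for i
  proof (cases i)
    case 0
    then have "c i = fst" by (simp add: c_def fun_eq_iff)
    then show ?thesis by (simp add: bounded_linear_fst)
  next
    case (Suc k)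
    then have "c i = (\<lambda>h. l k (snd h))" by (simp add: c_def fun_eq_iff)
    then show ?thesis using bounded_linear_compose[OF l[rule_format, of k] bounded_linear_snd] that Suc by simp
  qed
  then show "\<forall>i<Suc n. bounded_linear (c i)" by blast
  have "(0, Q (T (a, w))) = (a, w) - (\<Sum>i<Suc n. c i (a, w) *\<^sub>R b i)" for a w
  proof -
    have "T (a, w) = a *\<^sub>R T (1, 0) + T (0, w)"
      using linear_add[OF T, of "a *\<^sub>R (1, 0)" "(0, w)"] linear_scale[OF T, of a "(1, 0)"] by simp
    then have "Q (T (a, w)) = a *\<^sub>R Q (T (1, 0)) + (w - (\<Sum>i<n. l i w *\<^sub>R e i))"
      by (simp add: linear_add[OF Q] linear_scale[OF Q] QT)
    moreover have "(\<Sum>i<Suc n. c i (a, w) *\<^sub>R b i) = a *\<^sub>R (1, - Q (T (1, 0))) + (\<Sum>i<n. l i w *\<^sub>R (0, e i))"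
      unfolding sum.lessThan_Suc_shift by (simp add: c_def b_def)
    moreover have "(\<Sum>i<n. l i w *\<^sub>R (0::real, e i)) = (0, \<Sum>i<n. l i w *\<^sub>R e i)"
      by (simp add: prod_eq_iff fst_sum snd_sum)
    ultimately show ?thesis by (simp add: algebra_simps)
  qed
  then show "\<forall>h. (0, Q (T h)) = h - (\<Sum>i<Suc n. c i h *\<^sub>R b i)" by simp
qed

lemma fredholm_expansion_zeros_arc_linked:
  fixes F :: "real \<times> 'u::banach \<Rightarrow> 'v::banach"
  assumes m: "multilinear_series m r K" and F: "\<forall>h. norm h < r \<longrightarrow> F (y + h) = series_sum m h"
    and fredholm: "Du F (fst y) (snd y) \<in> Phi0" and zero: "F y = 0" and \<epsilon>: "0 < \<epsilon>"
  shows "arc_linked_at ({h. norm h < r \<and> F (y + h) = 0} \<inter> ball 0 \<epsilon>) 0"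
proof -
  interpret m: multilinear_series m r K by (rule m)
  define T where "T h = m 1 (\<lambda>_. h)" for h
  have derivative: "(F has_derivative T) (at y)" unfolding T_def by (rule m.has_derivative_of_expansion[OF F])
  then have "Du F (fst y) (snd y) = (\<lambda>w. T (0, w))" by (intro Du_eq) simp
  with fredholm have "(\<lambda>w. T (0, w)) \<in> Phi0" by simp
  then obtain Q and n :: nat and l e where Q: "bounded_linear Q" "inj Q" and l: "\<forall>i<n. bounded_linear (l i)"
      and QT: "\<forall>u. Q (T (0, u)) = u - (\<Sum>i<n. l i u *\<^sub>R e i)"
    by (rule fredholm_index_zero_perturbation)
  obtain c b where c: "\<forall>i<Suc n. bounded_linear (c i)" and b: "\<forall>h. (0, Q (T h)) = h - (\<Sum>i<Suc n. c i h *\<^sub>R b i)"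
    by (rule finite_rank_correction_with_parameter[OF has_derivative_linear[OF derivative] bounded_linear.linear[OF Q(1)] l QT])
  define A where "A v = (0::real, Q v)" for v
  have A: "bounded_linear A" unfolding A_def by (intro bounded_linear_Pair bounded_linear_zero Q(1))
  obtain L where L: "multilinear_series (\<lambda>n v. A (m n v)) r L" by (rule m.compose_bounded_linear[OF A])
  have zeros: "series_sum (\<lambda>n v. A (m n v)) h = 0 \<longleftrightarrow> F (y + h) = 0" if "norm h < r" for h
  proof -
    have "F (y + h) = series_sum m h" using F that by blast
    moreover have "Q v = 0 \<longleftrightarrow> v = 0" for v using linear_inj_iff_eq_0[OF bounded_linear.linear[OF Q(1)]] Q(2) linear_0[OF bounded_linear.linear[OF Q(1)]] by auto
    ultimately show ?thesis using m.series_sum_compose_bounded_linear[OF A that] by (simp add: A_def zero_prod_def)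
  qed
  interpret finite_rank_defect "\<lambda>n v. A (m n v)" r L "Suc n" c b
  proof (intro finite_rank_defect.intro finite_rank_defect_axioms.intro L)
    show "series_sum (\<lambda>n v. A (m n v)) 0 = 0" using zeros[of 0] zero m.r by simp
  qed (use c b in \<open>auto simp: A_def T_def\<close>)
  have "arc_linked_at ({h. series_sum (\<lambda>n v. A (m n v)) h = 0} \<inter> ball 0 (min r \<epsilon>)) 0"
    by (rule arc_linked_at_zeros) (use m.r \<epsilon> in simp)
  moreover have "{h. series_sum (\<lambda>n v. A (m n v)) h = 0} \<inter> ball 0 (min r \<epsilon>) = {h. norm h < r \<and> F (y + h) = 0} \<inter> ball 0 \<epsilon>"
    using zeros by auto
  ultimately show ?thesis by simp
qed

lemma fredholm_zero_set_arc_linked: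
  fixes F :: "real \<times> 'u::banach \<Rightarrow> 'v::banach"
  assumes "analytic_map_at F y" and fredholm: "Du F (fst y) (snd y) \<in> Phi0" and y: "y \<in> zero_set F" and \<epsilon>: "0 < \<epsilon>"
  shows "arc_linked_at (zero_set F \<inter> ball y \<epsilon>) y"
proof -
  obtain m r K where m: "multilinear_series m r K" "\<forall>h. norm h < r \<longrightarrow> F (y + h) = series_sum m h"
    by (rule analytic_map_at_series[OF assms(1)])
  define Z where "Z = {h. norm h < r \<and> F (y + h) = 0} \<inter> ball 0 \<epsilon>"
  have r: "0 < r" using m(1) by (simp add: multilinear_series_def)
  have Z: "arc_linked_at Z 0" "0 \<in> Z"
    unfolding Z_def using fredholm_expansion_zeros_arc_linked[OF m fredholm _ \<epsilon>] y r \<epsilon> by (auto simp: zero_set_def)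
  have "arc_linked_at (zero_set F \<inter> ball y \<epsilon>) (y + 0)"
  proof (rule arc_linked_at_image[OF Z])
    show "continuous_on Z ((+) y)" by (intro continuous_intros)
    show "(+) y ` Z \<subseteq> zero_set F \<inter> ball y \<epsilon>" by (auto simp: Z_def zero_set_def dist_norm)
    fix M :: "(real \<times> 'u) set" assume M: "open M" "0 \<in> M"
    have "x \<in> (+) y ` (Z \<inter> M)" if x: "x \<in> zero_set F \<inter> ball y \<epsilon> \<inter> (ball y r \<inter> (+) y ` M)" for x
    proof -
      obtain z where "z \<in> M" "x = y + z" using x by blast
      moreover from this have "z \<in> Z" using x by (simp add: Z_def zero_set_def dist_norm)
      ultimately show ?thesis by blast
    qed
    moreover have "open (ball y r \<inter> (+) y ` M)" "y + 0 \<in> ball y r \<inter> (+) y ` M"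
      using M r by (auto intro: open_Int open_translation image_eqI[of _ _ 0])
    ultimately show "\<exists>N. open N \<and> y + 0 \<in> N \<and> zero_set F \<inter> ball y \<epsilon> \<inter> N \<subseteq> (+) y ` (Z \<inter> M)" by blast
  qed (simp add: inj_on_def)
  then show ?thesis by simp
qed

lemma (in multilinear_series) strict_derivative:
  obtains M where "0 \<le> M" "\<forall>\<delta> a b. \<delta> \<le> r / 4 \<longrightarrow> norm a < \<delta> \<longrightarrow> norm b < \<delta> \<longrightarrow>
    norm (series_sum m a - series_sum m b - m 1 (\<lambda>_. a - b)) \<le> M * \<delta> * norm (a - b)"
proof -
  obtain M where M: "0 \<le> M" "\<forall>x h. norm x < r / 4 \<longrightarrow> norm (series_derivative m x h - m 1 (\<lambda>_. h)) \<le> M * norm x * norm h"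
    by (rule series_derivative_near_linear_part)
  define T where "T h = m 1 (\<lambda>_. h)" for h
  have T: "bounded_linear T" unfolding T_def by (rule has_derivative_bounded_linear[OF has_derivative_linear_part])
  have "norm (series_sum m a - series_sum m b - T (a - b)) \<le> M * \<delta> * norm (a - b)"
    if \<delta>: "\<delta> \<le> r / 4" and ab: "norm a < \<delta>" "norm b < \<delta>" for \<delta> a b
  proof -
    have "norm ((series_sum m a - T a) - (series_sum m b - T b)) \<le> M * \<delta> * norm (a - b)"
    proof (rule differentiable_bound[of "ball 0 \<delta>" "\<lambda>x. series_sum m x - T x" "\<lambda>x h. series_derivative m x h - T h"])
      fix z :: 'a assume "z \<in> ball 0 \<delta>"
      then have z: "norm z < \<delta>" "norm z < r / 4" using \<delta> by auto
      show "((\<lambda>x. series_sum m x - T x) has_derivative (\<lambda>h. series_derivative m z h - T h)) (at z within ball 0 \<delta>)"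
        by (intro has_derivative_diff has_derivative_at_withinI[OF has_derivative_series_sum[OF z(2)]]
            bounded_linear_imp_has_derivative[OF T])
      have "norm (series_derivative m z h - T h) \<le> M * \<delta> * norm h" for h
      proof -
        have "M * norm z * norm h \<le> M * \<delta> * norm h" using M(1) z(1) by (intro mult_right_mono mult_left_mono) auto
        then show ?thesis using M(2)[rule_format, OF z(2), of h] unfolding T_def by linarith
      qed
      moreover have "0 \<le> \<delta>" using z(1) norm_ge_zero[of z] by linarith
      ultimately show "onorm (\<lambda>h. series_derivative m z h - T h) \<le> M * \<delta>" using M(1) by (intro onorm_bound mult_nonneg_nonneg)
    qed (use ab in auto)
    moreover have "series_sum m a - series_sum m b - T (a - b) = (series_sum m a - T a) - (series_sum m b - T b)"
      by (simp add: linear_diff[OF bounded_linear.linear[OF T], of a b])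
    ultimately show ?thesis by (simp only:)
  qed
  then show thesis using that M(1) unfolding T_def by blast
qed

lemma regular_trivial_zero_isolated:
  fixes F :: "real \<times> 'u::banach \<Rightarrow> 'v::banach"
  assumes "analytic_map_at F (l0, 0)" and F1: "\<And>l. F (l, 0) = 0" and GL: "Du F l0 0 \<in> GL"
  shows "\<exists>\<delta>>0. \<forall>x. F x = 0 \<longrightarrow> dist x (l0, 0) < \<delta> \<longrightarrow> snd x = 0"
proof -
  obtain m r K where m: "multilinear_series m r K" and F: "\<forall>h. norm h < r \<longrightarrow> F ((l0, 0) + h) = series_sum m h"
    by (rule analytic_map_at_series[OF assms(1)])
  interpret multilinear_series m r K by (rule m)
  obtain M where M: "0 \<le> M" "\<forall>\<delta> a b. \<delta> \<le> r / 4 \<longrightarrow> norm a < \<delta> \<longrightarrow> norm b < \<delta> \<longrightarrow>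
      norm (series_sum m a - series_sum m b - m 1 (\<lambda>_. a - b)) \<le> M * \<delta> * norm (a - b)"
    by (rule strict_derivative)
  define S where "S w = m 1 (\<lambda>_. (0, w))" for w
  have "Du F l0 0 = S" unfolding S_def by (rule Du_eq[OF has_derivative_of_expansion[OF F]])
  then have S: "bij S" "bounded_linear (inv_into UNIV S)" using GL by (simp_all add: GL_def)
  obtain b where b: "0 < b" "\<And>v. norm (inv_into UNIV S v) \<le> norm v * b" using bounded_linear.pos_bounded[OF S(2)] by blast
  have lower: "norm w \<le> norm (S w) * b" for w using b(2)[of "S w"] S(1) by (simp add: bij_is_inj)
  define k where "k = (M + 1) * b"
  have k: "0 < k" "M * b \<le> k" using b(1) M(1) by (simp_all add: k_def distrib_right add_nonneg_pos)
  define \<delta> where "\<delta> = min (r / 4) (1 / (2 * k))"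
  have \<delta>: "0 < \<delta>" "\<delta> \<le> r / 4" "\<delta> \<le> 1 / (2 * k)" using r k by (auto simp: \<delta>_def)
  have "snd x = 0" if x: "F x = 0" "dist x (l0, 0) < \<delta>" for x
  proof -
    define a w where "a = fst x - l0" and "w = snd x"
    have x_eq: "x = (l0, 0) + (a, w)" by (simp add: a_def w_def prod_eq_iff)
    have small: "norm (a, w) < \<delta>" using x(2) x_eq by (simp add: dist_norm)
    have small0: "norm (a, 0::'u) < \<delta>" using le_less_trans[OF norm_fst_le small] by (simp add: norm_Pair)
    have "series_sum m (a, w) = 0" "series_sum m (a, 0) = 0"
      using F[rule_format, of "(a, w)"] F[rule_format, of "(a, 0)"] small small0 \<delta>(2) r x(1) x_eq F1 by auto
    then have "norm (S w) \<le> M * \<delta> * norm w"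
      using M(2)[rule_format, OF \<delta>(2) small small0] by (simp add: S_def norm_Pair)
    then have "norm (S w) * b \<le> M * \<delta> * norm w * b" using b(1) by (intro mult_right_mono) auto
    also have "\<dots> = (M * b * \<delta>) * norm w" by (simp only: mult_ac)
    also have "\<dots> \<le> (k * (1 / (2 * k))) * norm w" using k \<delta>(1,3) by (intro mult_right_mono mult_mono) auto
    finally have "norm (S w) * b \<le> 1 / 2 * norm w" using k(1) by simp
    moreover have "0 \<le> norm w" by simp
    ultimately have "norm w = 0" using lower[of w] by linarith
    then show ?thesis by (simp add: w_def)
  qed
  then show ?thesis using \<delta>(1) by blast
qed

section \<open>Global extension of curves of zeros\<close>

lemma compact_zero_set_Int_cball:
  assumes "proper_on_closed_bounded F"
  shows "compact (zero_set F \<inter> cball 0 R)"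
proof -
  have "compact {x \<in> cball 0 R. F x \<in> {0}}"
    using assms unfolding proper_on_closed_bounded_def by (elim allE[of _ "cball 0 R"] allE[of _ "{0}"]) auto
  moreover have "zero_set F \<inter> cball 0 R = {x \<in> cball 0 R. F x \<in> {0}}" by (auto simp: zero_set_def)
  ultimately show ?thesis by simp
qed

lemma isolated_in_spectrum_regular_nearby:
  assumes "0 isolated_in spectrum_family L"
  obtains \<epsilon> where "0 < \<epsilon>" "\<forall>l. l \<noteq> 0 \<longrightarrow> \<bar>l\<bar> < \<epsilon> \<longrightarrow> L l \<in> GL"
proof -
  obtain W where W: "open W" "W \<inter> spectrum_family L = {0}" using assms unfolding isolated_in_def by blast
  then obtain \<epsilon> where \<epsilon>: "0 < \<epsilon>" "ball 0 \<epsilon> \<subseteq> W" using open_contains_ball by blast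
  have "L l \<in> GL" if "l \<noteq> 0" "\<bar>l\<bar> < \<epsilon>" for l
  proof -
    have "l \<in> W" using that(2) \<epsilon>(2) by auto
    then show ?thesis using W(2) that(1) unfolding spectrum_family_def by blast
  qed
  then show thesis using that \<epsilon>(1) by blast
qed

lemma trivial_along_connected_curve:
  fixes \<gamma> :: "real \<Rightarrow> real \<times> 'u::real_normed_vector"
  assumes cont: "continuous_on {0<..c} \<gamma>" and zeros: "\<forall>t\<in>{0<..c}. F (\<gamma> t) = 0"
    and isolated: "\<forall>t\<in>{0<..c}. snd (\<gamma> t) = 0 \<longrightarrow> (\<exists>\<delta>>0. \<forall>x. F x = 0 \<longrightarrow> dist x (\<gamma> t) < \<delta> \<longrightarrow> snd x = 0)"
  shows "(\<forall>t\<in>{0<..c}. snd (\<gamma> t) \<noteq> 0) \<or> (\<forall>t\<in>{0<..c}. snd (\<gamma> t) = 0)"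
proof -
  define J where "J = {t \<in> {0<..c}. snd (\<gamma> t) = 0}"
  have "closedin (top_of_set {0<..c}) J" unfolding J_def
    by (rule continuous_closedin_preimage_constant) (intro continuous_intros cont)
  moreover have "openin (top_of_set {0<..c}) J" unfolding openin_euclidean_subtopology_iff
  proof (intro conjI ballI)
    show "J \<subseteq> {0<..c}" by (auto simp: J_def)
    fix t assume t: "t \<in> J"
    then obtain \<delta> where \<delta>: "0 < \<delta>" "\<forall>x. F x = 0 \<longrightarrow> dist x (\<gamma> t) < \<delta> \<longrightarrow> snd x = 0" using isolated unfolding J_def by blast
    obtain \<eta> where \<eta>: "0 < \<eta>" "\<forall>s\<in>{0<..c}. dist s t < \<eta> \<longrightarrow> dist (\<gamma> s) (\<gamma> t) < \<delta>"
      using cont t \<delta>(1) unfolding continuous_on_iff J_def by blast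
    have "s \<in> J" if "s \<in> {0<..c}" "dist s t < \<eta>" for s using \<eta>(2) \<delta>(2)[rule_format, of "\<gamma> s"] zeros that by (simp add: J_def)
    then show "\<exists>\<eta>>0. \<forall>s\<in>{0<..c}. dist s t < \<eta> \<longrightarrow> s \<in> J" using \<eta>(1) by blast
  qed
  ultimately have "J = {} \<or> J = {0<..c}" using connected_clopen[of "{0<..c}"] by auto
  then show ?thesis unfolding J_def by blast
qed

lemma exists_half_line_avoiding_nonzero_function:
  fixes u :: "real \<Rightarrow> real"
  assumes "continuous_on {0<..c} u" "\<forall>t\<in>{0<..c}. u t \<noteq> 0"
  obtains \<sigma> where "\<sigma> \<noteq> 0" "\<forall>s>0. \<forall>t\<in>{0<..c}. \<sigma> * s \<noteq> u t"
proof -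
  have connected: "connected (u ` {0<..c})" by (intro connected_continuous_image assms(1)) simp
  have "0 \<notin> u ` {0<..c}" using assms(2) by auto
  then have "(\<forall>t\<in>{0<..c}. 0 < u t) \<or> (\<forall>t\<in>{0<..c}. u t < 0)"
    using connectedD_interval[OF connected, of _ _ 0] assms(2) by (meson imageI linorder_neqE_linordered_idom less_imp_le)
  then show thesis
  proof
    assume pos: "\<forall>t\<in>{0<..c}. 0 < u t"
    have "- 1 * s \<noteq> u t" if "0 < s" "t \<in> {0<..c}" for s t using bspec[OF pos that(2)] that(1) by linarith
    then show thesis using that[of "- 1"] by simp
  next
    assume neg: "\<forall>t\<in>{0<..c}. u t < 0"
    have "1 * s \<noteq> u t" if "0 < s" "t \<in> {0<..c}" for s t using bspec[OF neg that(2)] that(1) by linarith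
    then show thesis using that[of 1] by simp
  qed
qed

lemma exists_trivial_half_line_avoiding_curve:
  fixes \<gamma> :: "real \<Rightarrow> real \<times> 'u::real_normed_vector"
  assumes cont: "continuous_on {0<..c} \<gamma>" and zeros: "\<forall>t\<in>{0<..c}. F (\<gamma> t) = 0" "\<forall>t\<in>{0<..c}. \<gamma> t \<noteq> (0, 0)"
    and isolated: "\<forall>t\<in>{0<..c}. snd (\<gamma> t) = 0 \<longrightarrow> (\<exists>\<delta>>0. \<forall>x. F x = 0 \<longrightarrow> dist x (\<gamma> t) < \<delta> \<longrightarrow> snd x = 0)"
  obtains \<sigma> :: real where "\<sigma> \<noteq> 0" "\<forall>s>0. \<forall>t\<in>{0<..c}. (\<sigma> * s, 0) \<noteq> \<gamma> t"
proof (cases "\<forall>t\<in>{0<..c}. snd (\<gamma> t) \<noteq> 0")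
  case True
  then have "(1 * s, 0) \<noteq> \<gamma> t" if "t \<in> {0<..c}" for s t using that by (metis snd_conv)
  then show thesis using that[of 1] by simp
next
  case False
  then have "\<forall>t\<in>{0<..c}. snd (\<gamma> t) = 0" using trivial_along_connected_curve[OF cont zeros(1) isolated] by blast
  then have "\<forall>t\<in>{0<..c}. fst (\<gamma> t) \<noteq> 0" using zeros(2) by (metis prod.collapse)
  then obtain \<sigma> where "\<sigma> \<noteq> 0" "\<forall>s>0. \<forall>t\<in>{0<..c}. \<sigma> * s \<noteq> fst (\<gamma> t)"
    by (rule exists_half_line_avoiding_nonzero_function[OF continuous_on_fst[OF cont]])
  then show thesis using that[of \<sigma>] by (metis fst_conv)
qed

lemma analytic_curve_from_originD:
  fixes F :: "real \<times> 'u::banach \<Rightarrow> 'v::zero"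
  assumes "analytic_curve_from_origin F \<gamma>"
  shows "continuous_on {0<..<1} \<gamma>" "inj_on \<gamma> {0<..<1}" "\<gamma> ` {0<..<1} \<subseteq> zero_set F" "(\<gamma> \<longlongrightarrow> (0, 0)) (at_right 0)"
proof -
  show "inj_on \<gamma> {0<..<1}" "\<gamma> ` {0<..<1} \<subseteq> zero_set F" "(\<gamma> \<longlongrightarrow> (0, 0)) (at_right 0)"
    using assms unfolding analytic_curve_from_origin_def by blast+
  show "continuous_on {0<..<1} \<gamma>"
    using assms analytic_map_at_continuous unfolding analytic_curve_from_origin_def analytic_map_on_def
    by (intro continuous_at_imp_continuous_on) blast
qed

lemma analytic_curve_from_origin_near:
  fixes F :: "real \<times> 'u::banach \<Rightarrow> 'v::zero"
  assumes curve: "analytic_curve_from_origin F \<gamma>" and \<epsilon>: "0 < \<epsilon>"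
  obtains c where "0 < c" "c < 1" "\<forall>t\<in>{0<..c}. \<gamma> t \<noteq> (0, 0) \<and> dist (\<gamma> t) (0, 0) < \<epsilon>"
proof -
  note \<gamma> = analytic_curve_from_originD[OF curve]
  have "\<forall>\<^sub>F t in at_right 0. dist (\<gamma> t) (0, 0) < \<epsilon>" by (rule tendstoD[OF \<gamma>(4) \<epsilon>])
  moreover have "\<forall>\<^sub>F t in at_right 0. t < 1 \<and> \<gamma> t \<noteq> (0, 0)"
  proof (cases "\<exists>s\<in>{0<..<1}. \<gamma> s = (0, 0)")
    case True
    then obtain s where s: "s \<in> {0<..<1}" "\<gamma> s = (0, 0)" by blast
    have "\<gamma> t \<noteq> (0, 0)" if "t \<in> {0<..<s}" for t using inj_onD[OF \<gamma>(2), of t s] s that by auto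
    then show ?thesis using s(1) unfolding eventually_at_right_field by (intro exI[of _ s]) auto
  qed (auto simp: eventually_at_right_field intro: exI[of _ 1])
  ultimately have "\<forall>\<^sub>F t in at_right 0. t < 1 \<and> \<gamma> t \<noteq> (0, 0) \<and> dist (\<gamma> t) (0, 0) < \<epsilon>" by eventually_elim simp
  then obtain b where b: "0 < b" "\<forall>t>0. t < b \<longrightarrow> t < 1 \<and> \<gamma> t \<noteq> (0, 0) \<and> dist (\<gamma> t) (0, 0) < \<epsilon>"
    unfolding eventually_at_right_field by blast
  have "\<forall>t\<in>{0<..b/2}. t < 1 \<and> \<gamma> t \<noteq> (0, 0) \<and> dist (\<gamma> t) (0, 0) < \<epsilon>" using b by auto
  then show thesis using that[of "b / 2"] b(1) by auto
qed

definition closed_at_origin :: "(real \<Rightarrow> 'a::zero) \<Rightarrow> real \<Rightarrow> 'a" where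
  "closed_at_origin \<gamma> t = (if t \<le> 0 then 0 else \<gamma> t)"

lemma arc_closed_at_origin:
  fixes \<gamma> :: "real \<Rightarrow> 'a::real_normed_vector"
  assumes cont: "continuous_on {0<..c} \<gamma>" and inj: "inj_on \<gamma> {0<..c}" and nonzero: "0 \<notin> \<gamma> ` {0<..c}"
    and limit: "(\<gamma> \<longlongrightarrow> 0) (at_right 0)" and c: "0 < c"
  shows "continuous_on {0..c} (closed_at_origin \<gamma>)" "inj_on (closed_at_origin \<gamma>) {0..c}"
proof -
  have positive: "closed_at_origin \<gamma> t = \<gamma> t" if "0 < t" for t using that by (simp add: closed_at_origin_def)
  show "inj_on (closed_at_origin \<gamma>) {0..c}"
  proof (rule linorder_inj_onI)
    fix s t assume st: "s < t" "s \<in> {0..c}" "t \<in> {0..c}"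
    show "closed_at_origin \<gamma> s \<noteq> closed_at_origin \<gamma> t"
    proof (cases "s = 0")
      case True
      then show ?thesis using nonzero st by (force simp: closed_at_origin_def)
    next
      case False
      then show ?thesis using inj_onD[OF inj, of s t] st positive[of s] positive[of t] by auto
    qed
  qed auto
  have "continuous (at t within {0..c}) (closed_at_origin \<gamma>)" if t: "t \<in> {0..c}" for t
  proof (cases "t = 0")
    case True
    have "(closed_at_origin \<gamma> \<longlongrightarrow> 0) (at_right 0)"
      by (rule Lim_transform_eventually[OF limit]) (auto simp: eventually_at_filter positive)
    then show ?thesis using True by (simp add: continuous_within closed_at_origin_def at_within_Icc_at_right[OF c])
  next
    case False
    have "continuous_on {0<..c} (closed_at_origin \<gamma>)" by (rule continuous_on_eq[OF cont]) (simp add: positive)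
    then have "continuous (at t within {0<..c}) (closed_at_origin \<gamma>)" using t False by (simp add: continuous_on_eq_continuous_within)
    moreover have "at t within {0..c} = at t within {0<..c}" using t False by (intro at_within_nhd[of t "{0<..}"]) auto
    ultimately show ?thesis by (simp add: continuous_within)
  qed
  then show "continuous_on {0..c} (closed_at_origin \<gamma>)" by (simp add: continuous_on_eq_continuous_within)
qed

lemma analytic_curve_extension:
  fixes F :: "real \<times> 'u::banach \<Rightarrow> 'v::banach"
  assumes analytic: "analytic_map_on F UNIV" and F1: "\<And>l. F (l, 0) = 0" and F2: "\<And>l u. Du F l u \<in> Phi0"
    and isolated: "0 isolated_in spectrum_family (linearization F)" and F4: "proper_on_closed_bounded F"
    and curve: "analytic_curve_from_origin F \<gamma>"
  shows "\<exists>\<Gamma>. global_extension F \<gamma> \<Gamma>"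
proof -
  have analytic_at: "analytic_map_at F y" for y using analytic unfolding analytic_map_on_def by blast
  obtain \<epsilon> where \<epsilon>: "0 < \<epsilon>" "\<forall>l. l \<noteq> 0 \<longrightarrow> \<bar>l\<bar> < \<epsilon> \<longrightarrow> Du F l 0 \<in> GL"
    using isolated_in_spectrum_regular_nearby[OF isolated] unfolding linearization_def by blast
  note \<gamma> = analytic_curve_from_originD[OF curve]
  obtain c where c: "0 < c" "c < 1" "\<forall>t\<in>{0<..c}. \<gamma> t \<noteq> (0, 0) \<and> dist (\<gamma> t) (0, 0) < \<epsilon>"
    by (rule analytic_curve_from_origin_near[OF curve \<epsilon>(1)])
  have sub: "{0<..c} \<subseteq> {0<..<1}" using c(2) by auto
  have cont: "continuous_on {0<..c} \<gamma>" by (rule continuous_on_subset[OF \<gamma>(1) sub])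
  have nonzero: "0 \<notin> \<gamma> ` {0<..c}" using c(3) by (auto simp: zero_prod_def)
  have zeros: "\<forall>t\<in>{0<..c}. F (\<gamma> t) = 0" using \<gamma>(3) sub by (auto simp: zero_set_def)
  have "\<exists>\<delta>>0. \<forall>x. F x = 0 \<longrightarrow> dist x (\<gamma> t) < \<delta> \<longrightarrow> snd x = 0" if t: "t \<in> {0<..c}" "snd (\<gamma> t) = 0" for t
  proof -
    have trivial: "\<gamma> t = (fst (\<gamma> t), 0)" using t(2) by (simp add: prod_eq_iff)
    have "fst (\<gamma> t) \<noteq> 0" "\<bar>fst (\<gamma> t)\<bar> < \<epsilon>"
      using bspec[OF c(3) t(1)] dist_fst_le[of "\<gamma> t" "(0, 0)"] trivial by (metis, simp)
    then show ?thesis using regular_trivial_zero_isolated[OF analytic_at F1] \<epsilon>(2) trivial by metis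
  qed
  then obtain \<sigma> :: real where \<sigma>: "\<sigma> \<noteq> 0" "\<forall>s>0. \<forall>t\<in>{0<..c}. (\<sigma> * s, 0) \<noteq> \<gamma> t"
    using exists_trivial_half_line_avoiding_curve[OF cont zeros] c(3) by blast
  interpret arc_extension "zero_set F" "closed_at_origin \<gamma>" "\<lambda>s. (\<sigma> * s, 0)" c
  proof
    show "compact (zero_set F \<inter> cball 0 R)" for R by (rule compact_zero_set_Int_cball[OF F4])
    show "arc_linked_at (zero_set F \<inter> ball y \<epsilon>) y" if "y \<in> zero_set F" "0 < \<epsilon>" for y \<epsilon>
      by (rule fredholm_zero_set_arc_linked[OF analytic_at F2 that])
    show "continuous_on {0..c} (closed_at_origin \<gamma>)" "inj_on (closed_at_origin \<gamma>) {0..c}"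
      using arc_closed_at_origin[OF cont inj_on_subset[OF \<gamma>(2) sub] nonzero] \<gamma>(4) c(1) by (auto simp: zero_prod_def)
    show "closed_at_origin \<gamma> ` {0..c} \<subseteq> zero_set F"
      using zeros F1[of 0] by (auto simp: closed_at_origin_def zero_set_def zero_prod_def)
    show "inj_on (\<lambda>s. (\<sigma> * s, 0::'u)) {0..}" using \<sigma>(1) by (auto simp: inj_on_def)
    show "(\<sigma> * s, 0) \<noteq> closed_at_origin \<gamma> t" if "0 < s" "0 < t" "t \<le> c" for s t
      using \<sigma>(2) that by (simp add: closed_at_origin_def)
  qed (use F1 c(1) in \<open>auto simp: zero_set_def closed_at_origin_def zero_prod_def intro!: continuous_intros\<close>)
  obtain \<Gamma> \<delta> where "ray_in (zero_set F) \<Gamma>" "0 < \<delta>" "\<delta> \<le> c" "\<forall>t\<in>{0<..<\<delta>}. \<Gamma> t = closed_at_origin \<gamma> t"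
      "filterlim (\<lambda>t. norm (\<Gamma> t)) at_top at_top \<or> (\<exists>T>0. \<Gamma> T = closed_at_origin \<gamma> 0)"
    using extendable unfolding extendable_def by blast
  then have "global_extension F \<gamma> \<Gamma>" unfolding global_extension_def
    using c(2) by (auto simp: ray_in_def closed_at_origin_def zero_prod_def)
  then show ?thesis by blast
qed

theorem theorem7p2:
  fixes F :: "real \<times> 'u::banach \<Rightarrow> 'v::banach" and \<phi>0 :: 'u
  assumes analytic: "analytic_map_on F UNIV"
    and F1: "\<And>l. F (l, 0) = 0"
    and F2: "\<And>l u. Du F l u \<in> Phi0"
    and F3: "0 isolated_in spectrum_family (linearization F)"
      "\<phi>0 \<noteq> 0" "null_space (linearization F 0) = span {\<phi>0}"
    and F4: "proper_on_closed_bounded F"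
  shows "(\<forall>\<gamma>. analytic_curve_from_origin F \<gamma> \<and> \<gamma> ` {0<..<1} \<subseteq> zero_set F - trivial_line \<and>
              \<gamma> ` {0<..<1} \<subseteq> regular_points F \<longrightarrow>
            (\<exists>\<Gamma>. global_extension F \<gamma> \<Gamma>)) \<and>
         (\<forall>Uz d a. weierstrass_polynomial F \<phi>0 Uz d a \<and> weierstrass_irreducible Uz d a \<longrightarrow>
            (\<forall>\<gamma>. analytic_curve_from_origin F \<gamma> \<longrightarrow> (\<exists>\<Gamma>. global_extension F \<gamma> \<Gamma>)))"
proof -
  have "\<exists>\<Gamma>. global_extension F \<gamma> \<Gamma>" if "analytic_curve_from_origin F \<gamma>" for \<gamma>
    by (rule analytic_curve_extension[OF analytic F1 F2 F3(1) F4 that])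
  then show ?thesis by blast
qed

end
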